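(* Let $f$ be a continuous map and let $X$ be an isolated invariant set for $f$ with finitely many connected components. Let $F_1,\ldots,F_m$ be the (finitely many) essential quasicomponents of $W^u_\infty\setminus(\tilde X\cup\{\infty\})$, and let $\overline F_j$ denote the closure of $F_j$ in the quotient space $W^u_\infty/\tilde X$ obtained from $W^u_\infty$ by collapsing $\tilde X$ to a single point. Then for every degree $q\ge1$ such that $\check H^q(X;\mathbb K)$ is finite dimensional there is an isomorphism $$\check H^{q+1}(W^u_\infty,\tilde X;\mathbb K)\;\cong\;\bigoplus_{j=1}^m\check H^{q+1}(\overline F_j;\mathbb K)$$ that commutes with $\tilde f^*$.
   Context: Setting. $M$ is a locally compact, paracompact Hausdorff space, $f\colon D\to M$ is a continuous map defined on an open set $D\subseteq M$. $\check H^*$ denotes Čech cohomology with coefficients in the field $\mathbb K$, where $\mathbb K=\mathbb Q$ or $\mathbb C$. For $A\subseteq D$, $\mathrm{Inv}(A)$ is the set of $p\in A$ for which there is a sequence $(p_i)_{i\in\mathbb Z}$ in $A$ with $p_0=p$ and $f(p_i)=p_{i+1}$ for all $i$. A compact set $X\subseteq D$ with $f(X)=X$ is an isolated invariant set if it has a compact neighbourhood $A\subseteq D$ with $X=\mathrm{Inv}(A)$ (such $A$ is an isolating neighbourhood of $X$). Index pairs. An index pair for $f$ and $X$ is a pair of compact sets $L\subseteq N\subseteq D$ such that (i) $\overline{N\setminus L}$ is an isolating neighbourhood of $X$ and $X\cap L=\emptyset$; (ii) $f(N\setminus L)\subseteq N$; (iii) $f(L)\cap N\subseteq L$. The index map is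 the continuous map $f_\#\colon (N/L,[L])\to(N/L,[L])$ of the pointed quotient space given by $f_\#(p)=f(p)$ if $p,f(p)\in N\setminus L$ and $f_\#(p)=[L]$ otherwise (if $L=\emptyset$, $N/L$ is $N$ with a disjoint base point added). Compactified unstable manifold. $W^u_\infty$ is the inverse limit of $N/L\xleftarrow{f_\#}N/L\xleftarrow{f_\#}\cdots$, i.e. the compact Hausdorff space of sequences $\xi=(\xi_i)_{i\ge0}$ in $N/L$ with $f_\#(\xi_{i+1})=\xi_i$; the point $\infty$ is the constant sequence $([L],[L],\ldots)$. The map $\tilde f(\xi_0,\xi_1,\ldots)=(f_\#(\xi_0),\xi_0,\xi_1,\ldots)$ is a homeomorphism of $W^u_\infty$ fixing $\infty$, and $\tilde X=\{\xi\in W^u_\infty:\xi_i\in X\text{ for all }i\}$ is a compact $\tilde f$-invariant subset. (Up to homeomorphism and conjugation these objects do not depend on the index pair.) Quasicomponents. The quasicomponent of a point $z$ in a space $Z$ is the intersection of all clopen subsets of $Z$ containing $z$. A quasicomponent $F$ of $W^u_\infty\setminus(\tilde X\cup\{\infty\})$ is essential if its closure in $W^u_\infty$ contains $\infty$ and meets $\tilde X$. The homeomorphism $\tilde f$ permutes the essential quasicomponents. It also induces a homeomorphism of $W^u_\infty/\tilde X$ that permutes the sets $\overline F_j$, and hence an endomorphism $\tilde f^*$ of $\bigoplus_j\check H^{q+1}(\overline F_j)$ sending the summand of $\overline{\tilde f(F_j)}$ to the summand of $\overline F_j$. Standing assumption. $X$ has an index pair $(N,L)$ such that $\check H^q(N/L;\mathbb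 K)$ is finite dimensional in every degree (automatic if $M$ is a locally compact metrizable absolute neighbourhood retract, e.g. a topological manifold); consequently $\check H^q(W^u_\infty;\mathbb K)$ is finite dimensional in every degree $q$. *)

theory Defs
  imports
    "HOL-Analysis.Function_Topology"
    "HOL-Analysis.Abstract_Topological_Spaces"
    "HOL-Algebra.QuotRing"
    "Jordan_Normal_Form.VS_Connect"
begin

section \<open>Point-set preliminaries\<close>

definition paracompact_space :: "'a topology \<Rightarrow> bool" where
  "paracompact_space X \<longleftrightarrow>
     (\<forall>\<U>. (\<forall>U\<in>\<U>. openin X U) \<and> \<Union>\<U> = topspace X \<longrightarrow>
        (\<exists>\<V>. (\<forall>V\<in>\<V>. openin X V) \<and> \<Union>\<V> = topspace X \<and>
             (\<forall>V\<in>\<V>. \<exists>U\<in>\<U>. V \<subseteq> U) \<and> locally_finite_in X \<V>))"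

text \<open>The pointed quotient \<open>T/S\<close>. Its base point is \<open>None\<close>; the points of
  \<open>topspace T - S\<close> appear under \<open>Some\<close>. If \<open>S\<close> is empty, then \<open>None\<close> is a disjoint
  (isolated) base point.\<close>

definition collapse_proj :: "'a set \<Rightarrow> 'a \<Rightarrow> 'a option" where
  "collapse_proj S x = (if x \<in> S then None else Some x)"

definition collapse_topology :: "'a topology \<Rightarrow> 'a set \<Rightarrow> 'a option topology" where
  "collapse_topology T S = topology (\<lambda>U.
     U \<subseteq> insert None (Some ` (topspace T - S)) \<and>
     openin T {x \<in> topspace T. collapse_proj S x \<in> U})"

lemma openin_collapse_topology:
  "openin (collapse_topology T S) U \<longleftrightarrow>
     U \<subseteq> insert None (Some ` (topspace T - S)) \<and>
     openin T {x \<in> topspace T. collapse_proj S x \<in> U}"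
proof -
  have int: "{x \<in> topspace T. collapse_proj S x \<in> A \<inter> B} =
      {x \<in> topspace T. collapse_proj S x \<in> A} \<inter> {x \<in> topspace T. collapse_proj S x \<in> B}" for A B
    by blast
  have un: "{x \<in> topspace T. collapse_proj S x \<in> \<Union>\<K>} =
      (\<Union>K\<in>\<K>. {x \<in> topspace T. collapse_proj S x \<in> K})" for \<K>
    by blast
  have "istopology (\<lambda>U. U \<subseteq> insert None (Some ` (topspace T - S)) \<and>
     openin T {x \<in> topspace T. collapse_proj S x \<in> U})"
    unfolding istopology_def
  proof (intro conjI allI impI)
    fix \<K> :: "'a option set set"
    assume *: "\<forall>K\<in>\<K>. K \<subseteq> insert None (Some ` (topspace T - S)) \<and>
        openin T {x \<in> topspace T. collapse_proj S x \<in> K}"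
    show "\<Union>\<K> \<subseteq> insert None (Some ` (topspace T - S))" using * by blast
    show "openin T {x \<in> topspace T. collapse_proj S x \<in> \<Union>\<K>}"
      unfolding un using * by blast
  qed (auto simp only: int intro: openin_Int)
  then show ?thesis
    unfolding collapse_topology_def by (simp add: topology_inverse')
qed

lemma topspace_collapse_topology:
  "topspace (collapse_topology T S) = insert None (Some ` (topspace T - S))"
proof (rule subset_antisym)
  show "topspace (collapse_topology T S) \<subseteq> insert None (Some ` (topspace T - S))"
    using openin_collapse_topology openin_topspace by metis
  have "{x \<in> topspace T. collapse_proj S x \<in> insert None (Some ` (topspace T - S))} = topspace T"
    by (auto simp: collapse_proj_def)
  then have "openin (collapse_topology T S) (insert None (Some ` (topspace T - S)))"
    by (simp add: openin_collapse_topology)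
  then show "insert None (Some ` (topspace T - S)) \<subseteq> topspace (collapse_topology T S)"
    by (rule openin_subset)
qed

definition collapse_map :: "'a set \<Rightarrow> ('a \<Rightarrow> 'a) \<Rightarrow> 'a option \<Rightarrow> 'a option" where
  "collapse_map S g z = (case z of None \<Rightarrow> None | Some x \<Rightarrow> collapse_proj S (g x))"


section \<open>Cech cohomology of pairs\<close>

text \<open>A covering of the pair \<open>(X, A)\<close> is an open cover of \<open>X\<close> together with a subfamily that
  covers \<open>A\<close>. Its nerve is the pair consisting of the nerve of the cover and the
  subcomplex of those simplices of the subfamily that have a common point in \<open>A\<close>.\<close>

type_synonym 'a covering = "'a set set \<times> 'a set set"

definition coverings :: "'a topology \<Rightarrow> 'a set \<Rightarrow> 'a covering set" where
  "coverings X A = {(\<U>, \<U>').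
     (\<forall>U\<in>\<U>. openin X U) \<and> \<Union>\<U> = topspace X \<and> \<U>' \<subseteq> \<U> \<and> A \<subseteq> \<Union>\<U>'}"

text \<open>Simplices are ordered, repetitions being allowed.\<close>

definition nerve :: "'a set set \<Rightarrow> 'a set \<Rightarrow> nat \<Rightarrow> 'a set list set" where
  "nerve \<U> A q = {\<sigma>. length \<sigma> = Suc q \<and> set \<sigma> \<subseteq> \<U> \<and> A \<inter> \<Inter>(set \<sigma>) \<noteq> {}}"

definition cochains :: "'a set \<Rightarrow> 'a covering \<Rightarrow> nat \<Rightarrow> ('a set list \<Rightarrow> 'k::field) set" where
  "cochains A \<alpha> q = {c. (\<forall>\<sigma>. \<sigma> \<notin> nerve (fst \<alpha>) UNIV q \<longrightarrow> c \<sigma> = 0) \<and>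
                        (\<forall>\<sigma> \<in> nerve (snd \<alpha>) A q. c \<sigma> = 0)}"

definition coboundary ::
    "'a covering \<Rightarrow> nat \<Rightarrow> ('a set list \<Rightarrow> 'k::field) \<Rightarrow> ('a set list \<Rightarrow> 'k)" where
  "coboundary \<alpha> q c = (\<lambda>\<sigma>. if \<sigma> \<in> nerve (fst \<alpha>) UNIV (Suc q)
     then (\<Sum>i<Suc (Suc q). (- 1) ^ i * c (take i \<sigma> @ drop (Suc i) \<sigma>)) else 0)"

definition cocycles :: "'a set \<Rightarrow> 'a covering \<Rightarrow> nat \<Rightarrow> ('a set list \<Rightarrow> 'k::field) set" where
  "cocycles A \<alpha> q = {c \<in> cochains A \<alpha> q. coboundary \<alpha> q c = (\<lambda>_. 0)}"

definition coboundaries :: "'a set \<Rightarrow> 'a covering \<Rightarrow> nat \<Rightarrow> ('a set list \<Rightarrow> 'k::field) set" where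
  "coboundaries A \<alpha> q =
     (case q of 0 \<Rightarrow> {\<lambda>_. 0} | Suc p \<Rightarrow> coboundary \<alpha> p ` cochains A \<alpha> p)"

text \<open>A vertex map over \<open>g\<close> from a covering \<open>\<gamma>\<close> of \<open>(X, A)\<close> to a covering \<open>\<alpha>\<close> of \<open>(Y, B)\<close>,
  where \<open>g\<close> maps \<open>(X, A)\<close> to \<open>(Y, B)\<close>. For \<open>g = id\<close> it exhibits \<open>\<gamma>\<close> as a refinement
  of \<open>\<alpha>\<close>; in general \<open>\<gamma>\<close> refines the preimage of \<open>\<alpha>\<close> under \<open>g\<close>.\<close>

definition vertex_map ::
    "('a \<Rightarrow> 'b) \<Rightarrow> 'a covering \<Rightarrow> 'b covering \<Rightarrow> ('a set \<Rightarrow> 'b set) \<Rightarrow> bool" where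
  "vertex_map g \<gamma> \<alpha> \<phi> \<longleftrightarrow>
     (\<forall>V \<in> fst \<gamma>. \<phi> V \<in> fst \<alpha> \<and> g ` V \<subseteq> \<phi> V) \<and> (\<forall>V \<in> snd \<gamma>. \<phi> V \<in> snd \<alpha>)"

definition pull_cochain ::
    "'a covering \<Rightarrow> nat \<Rightarrow> ('a set \<Rightarrow> 'b set) \<Rightarrow> ('b set list \<Rightarrow> 'k::field) \<Rightarrow> ('a set list \<Rightarrow> 'k)" where
  "pull_cochain \<gamma> q \<phi> c = (\<lambda>\<tau>. if \<tau> \<in> nerve (fst \<gamma>) UNIV q then c (map \<phi> \<tau>) else 0)"

text \<open>Elements of the direct limit, over all coverings, of the cohomology of the nerves are
  equivalence classes of pairs of a covering and a cocycle on it: two such pairs are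
  equivalent iff the cocycles become cohomologous on some common refinement.\<close>

type_synonym ('a, 'k) cech_class = "('a covering \<times> ('a set list \<Rightarrow> 'k)) set"

definition cech_cocycles ::
    "'a topology \<Rightarrow> 'a set \<Rightarrow> nat \<Rightarrow> ('a covering \<times> ('a set list \<Rightarrow> 'k::field)) set" where
  "cech_cocycles X A q = (SIGMA \<alpha> : coverings X A. cocycles A \<alpha> q)"

definition cech_rel :: "'a topology \<Rightarrow> 'a set \<Rightarrow> nat \<Rightarrow>
    (('a covering \<times> ('a set list \<Rightarrow> 'k::field)) \<times> ('a covering \<times> ('a set list \<Rightarrow> 'k))) set" where
  "cech_rel X A q = {((\<alpha>, c), (\<beta>, d)).
     (\<alpha>, c) \<in> cech_cocycles X A q \<and> (\<beta>, d) \<in> cech_cocycles X A q \<and>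
     (\<exists>\<gamma> \<in> coverings X A. \<exists>\<phi> \<psi>. vertex_map id \<gamma> \<alpha> \<phi> \<and> vertex_map id \<gamma> \<beta> \<psi> \<and>
        (\<lambda>\<sigma>. pull_cochain \<gamma> q \<phi> c \<sigma> - pull_cochain \<gamma> q \<psi> d \<sigma>) \<in> coboundaries A \<gamma> q)}"

text \<open>The vector space \<open>H\<^sup>q(X, A; 'k)\<close>; absolute cohomology is the case \<open>A = {}\<close>. Any two
  classes have representatives on a common covering, where they are added. The ring
  components \<open>mult\<close> and \<open>one\<close> of the record play no role in a module.\<close>

definition cech :: "'a topology \<Rightarrow> 'a set \<Rightarrow> nat \<Rightarrow> ('k::field, ('a, 'k) cech_class) module" where
  "cech X A q = \<lparr>
     carrier = cech_cocycles X A q // cech_rel X A q,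
     mult = undefined,
     one = undefined,
     zero = cech_rel X A q `` {(\<alpha>, c). \<alpha> \<in> coverings X A \<and> c = (\<lambda>_. 0)},
     add = (\<lambda>S T. cech_rel X A q ``
              {(\<alpha>, e). \<exists>c d. (\<alpha>, c) \<in> S \<and> (\<alpha>, d) \<in> T \<and> e = (\<lambda>\<sigma>. c \<sigma> + d \<sigma>)}),
     smult = (\<lambda>k S. cech_rel X A q ``
              {(\<alpha>, e). \<exists>c. (\<alpha>, c) \<in> S \<and> e = (\<lambda>\<sigma>. k * c \<sigma>)}) \<rparr>"

text \<open>\<open>cech_map X A q g\<close> is the map \<open>g\<^sup>* : H\<^sup>q(Y, B) \<rightarrow> H\<^sup>q(X, A)\<close> induced by a continuous map
  \<open>g : (X, A) \<rightarrow> (Y, B)\<close>.\<close>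

definition cech_map :: "'a topology \<Rightarrow> 'a set \<Rightarrow> nat \<Rightarrow> ('a \<Rightarrow> 'b) \<Rightarrow>
    ('b, 'k::field) cech_class \<Rightarrow> ('a, 'k) cech_class" where
  "cech_map X A q g S = cech_rel X A q ``
     {(\<gamma>, e). \<gamma> \<in> coverings X A \<and>
        (\<exists>\<alpha> c \<phi>. (\<alpha>, c) \<in> S \<and> vertex_map g \<gamma> \<alpha> \<phi> \<and> e = pull_cochain \<gamma> q \<phi> c)}"

definition module_direct_sum :: "'i set \<Rightarrow> ('i \<Rightarrow> ('k, 'v) module) \<Rightarrow> ('k, 'i \<Rightarrow> 'v) module" where
  "module_direct_sum I V = \<lparr>
     carrier = {c \<in> \<Pi>\<^sub>E i\<in>I. carrier (V i). finite {i \<in> I. c i \<noteq> \<zero>\<^bsub>V i\<^esub>}},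
     mult = undefined,
     one = undefined,
     zero = (\<lambda>i\<in>I. \<zero>\<^bsub>V i\<^esub>),
     add = (\<lambda>c d. \<lambda>i\<in>I. c i \<oplus>\<^bsub>V i\<^esub> d i),
     smult = (\<lambda>k c. \<lambda>i\<in>I. k \<odot>\<^bsub>V i\<^esub> c i) \<rparr>"


section \<open>Isolated invariant sets and index pairs\<close>

definition inv_part :: "('a \<Rightarrow> 'a) \<Rightarrow> 'a set \<Rightarrow> 'a set" where
  "inv_part f A = {x. \<exists>p :: int \<Rightarrow> 'a. (\<forall>i. p i \<in> A) \<and> p 0 = x \<and> (\<forall>i. f (p i) = p (i + 1))}"

definition isolating_neighbourhood ::
    "'a topology \<Rightarrow> 'a set \<Rightarrow> ('a \<Rightarrow> 'a) \<Rightarrow> 'a set \<Rightarrow> 'a set \<Rightarrow> bool" where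
  "isolating_neighbourhood M D f X A \<longleftrightarrow>
     compactin M A \<and> A \<subseteq> D \<and> X \<subseteq> M interior_of A \<and> X = inv_part f A"

definition isolated_invariant_set ::
    "'a topology \<Rightarrow> 'a set \<Rightarrow> ('a \<Rightarrow> 'a) \<Rightarrow> 'a set \<Rightarrow> bool" where
  "isolated_invariant_set M D f X \<longleftrightarrow>
     compactin M X \<and> X \<subseteq> D \<and> f ` X = X \<and> (\<exists>A. isolating_neighbourhood M D f X A)"

definition index_pair ::
    "'a topology \<Rightarrow> 'a set \<Rightarrow> ('a \<Rightarrow> 'a) \<Rightarrow> 'a set \<Rightarrow> 'a set \<Rightarrow> 'a set \<Rightarrow> bool" where
  "index_pair M D f X N L \<longleftrightarrow>
     compactin M N \<and> compactin M L \<and> L \<subseteq> N \<and> N \<subseteq> D \<and>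
     isolating_neighbourhood M D f X (M closure_of (N - L)) \<and> X \<inter> L = {} \<and>
     f ` (N - L) \<subseteq> N \<and>
     f ` L \<inter> N \<subseteq> L"

definition index_space :: "'a topology \<Rightarrow> 'a set \<Rightarrow> 'a set \<Rightarrow> 'a option topology" where
  "index_space M N L = collapse_topology (subtopology M N) L"

definition index_map :: "('a \<Rightarrow> 'a) \<Rightarrow> 'a set \<Rightarrow> 'a set \<Rightarrow> 'a option \<Rightarrow> 'a option" where
  "index_map f N L z = (case z of None \<Rightarrow> None
     | Some p \<Rightarrow> if p \<in> N - L \<and> f p \<in> N - L then Some (f p) else None)"


section \<open>The compactified unstable manifold\<close>

definition unstable_space ::
    "'a topology \<Rightarrow> ('a \<Rightarrow> 'a) \<Rightarrow> 'a set \<Rightarrow> 'a set \<Rightarrow> (nat \<Rightarrow> 'a option) topology" where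
  "unstable_space M f N L =
     subtopology (product_topology (\<lambda>_. index_space M N L) UNIV)
       {\<xi>. \<forall>i. index_map f N L (\<xi> (Suc i)) = \<xi> i}"

definition unstable_infinity :: "nat \<Rightarrow> 'a option" where
  "unstable_infinity = (\<lambda>_. None)"

definition unstable_shift ::
    "('a \<Rightarrow> 'a) \<Rightarrow> 'a set \<Rightarrow> 'a set \<Rightarrow> (nat \<Rightarrow> 'a option) \<Rightarrow> (nat \<Rightarrow> 'a option)" where
  "unstable_shift f N L \<xi> = case_nat (index_map f N L (\<xi> 0)) \<xi>"

definition unstable_core ::
    "'a topology \<Rightarrow> ('a \<Rightarrow> 'a) \<Rightarrow> 'a set \<Rightarrow> 'a set \<Rightarrow> 'a set \<Rightarrow> (nat \<Rightarrow> 'a option) set" where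
  "unstable_core M f N L X = {\<xi> \<in> topspace (unstable_space M f N L). \<forall>i. \<xi> i \<in> Some ` X}"

definition essential_quasicomponents ::
    "'a topology \<Rightarrow> ('a \<Rightarrow> 'a) \<Rightarrow> 'a set \<Rightarrow> 'a set \<Rightarrow> 'a set \<Rightarrow> (nat \<Rightarrow> 'a option) set set" where
  "essential_quasicomponents M f N L X =
     (let W = unstable_space M f N L; X' = unstable_core M f N L X in
       {F \<in> quasi_components_of (subtopology W (topspace W - (X' \<union> {unstable_infinity}))).
          unstable_infinity \<in> W closure_of F \<and> W closure_of F \<inter> X' \<noteq> {}})"

text \<open>The closure of \<open>F\<close> in the quotient of the compactified unstable manifold by the core,
  as a space.\<close>

definition collapsed_closure :: "'a topology \<Rightarrow> ('a \<Rightarrow> 'a) \<Rightarrow> 'a set \<Rightarrow> 'a set \<Rightarrow> 'a set \<Rightarrow>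
    (nat \<Rightarrow> 'a option) set \<Rightarrow> (nat \<Rightarrow> 'a option) option topology" where
  "collapsed_closure M f N L X F =
     (let X' = unstable_core M f N L X; Q = collapse_topology (unstable_space M f N L) X' in
       subtopology Q (Q closure_of (collapse_proj X' ` F)))"

definition quasicomponent_sum ::
    "'a topology \<Rightarrow> ('a \<Rightarrow> 'a) \<Rightarrow> 'a set \<Rightarrow> 'a set \<Rightarrow> 'a set \<Rightarrow> nat \<Rightarrow>
     ('k::field, (nat \<Rightarrow> 'a option) set \<Rightarrow> ((nat \<Rightarrow> 'a option) option, 'k) cech_class) module" where
  "quasicomponent_sum M f N L X q =
     module_direct_sum (essential_quasicomponents M f N L X)
       (\<lambda>F. cech (collapsed_closure M f N L X F) {} q)"

text \<open>The shift maps the closure of \<open>F\<close> to that of its image \<open>unstable_shift f N L ` F\<close>, so the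
  induced map carries the summand indexed by the latter to the summand indexed by \<open>F\<close>.\<close>

definition quasicomponent_sum_map ::
    "'a topology \<Rightarrow> ('a \<Rightarrow> 'a) \<Rightarrow> 'a set \<Rightarrow> 'a set \<Rightarrow> 'a set \<Rightarrow> nat \<Rightarrow>
     ((nat \<Rightarrow> 'a option) set \<Rightarrow> ((nat \<Rightarrow> 'a option) option, 'k::field) cech_class) \<Rightarrow>
     ((nat \<Rightarrow> 'a option) set \<Rightarrow> ((nat \<Rightarrow> 'a option) option, 'k) cech_class)" where
  "quasicomponent_sum_map M f N L X q c =
     (\<lambda>F \<in> essential_quasicomponents M f N L X.
        cech_map (collapsed_closure M f N L X F) {} q
          (collapse_map (unstable_core M f N L X) (unstable_shift f N L))
          (c (unstable_shift f N L ` F)))"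

end

theory Submission
  imports Defs "HOL-Library.Function_Algebras"
begin

text \<open>Cech classes are represented by functions on finite lists of points, modulo functions vanishing
  on all sufficiently small lists (Alexander-Spanier cochains). By excision, the cohomology of
  \<open>(W, X')\<close> is that of the quotient \<open>Q = W/X'\<close>, in which the shift pushes every closed set missing
  the collapsed point \<open>a\<close> into any neighbourhood of \<open>b = \<infinity>\<close>, while its inverse pushes every
  closed set missing \<open>b\<close> towards \<open>a\<close>. Disjoint clopen neighbourhoods in \<open>Q - {a, b}\<close> of essential
  quasicomponents give classes of degree one with at most one linear relation, so finite dimension
  leaves finitely many essential quasicomponents \<open>F\<close>; and a clopen set disjoint from all of them splits into a part near \<open>a\<close>
  and a part near \<open>b\<close>.

  The isomorphism is restriction to the closures \<open>F \<union> {a, b}\<close>. It is onto because cocycles extend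
  to disjoint clopen neighbourhoods of the \<open>F\<close> and are glued along the two points \<open>a\<close> and \<open>b\<close>. A
  class in its kernel already vanishes on such neighbourhoods. The kernel is finite dimensional and
  invariant under the shift and its inverse, whose iterates shrink each of the two remaining parts
  to a point, so the class vanishes on these parts as well. For \<open>q \<ge> 1\<close> the vanishing on the
  pieces glues along \<open>{a, b}\<close>. Finite dimension for an arbitrary index pair follows from the given one,
  because tails of sequences identify the two spaces \<open>W\<close>.\<close>

text \<open>Lists of points replace nerves because a function that moves points only slightly,
  continuous or not, acts on cocycles up to an explicit prism homotopy; this one device yields
  extension to neighbourhoods, excision and the passage to inverse limits. The step from q to q + 1
  comes from the sequence of the pair: degree q + 1 of the quotient is controlled by degree q + 1 of
  \<open>W\<close> and degree q of the core, and the core is the inverse limit of \<open>X\<close>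
  under \<open>f\<close>. In degree 0 the finitely many components of \<open>X\<close> supply the
  finite dimension, which bounds degree 1 of the quotient. The obstacle is that a class vanishing on
  a closed set vanishes only on a neighbourhood depending on the class, while iterating the shift
  produces infinitely many classes. A finite generating set has one common neighbourhood, so a
  single iterate serves all of them. Gluing at the two points requires primitives that can be coned
  off near both ends, hence primitives of positive degree; this is where q \<ge> 1 enters.\<close>

no_notation vector_scalar_mult (infixl \<open>*s\<close> 70)

section \<open>Subspaces of finite codimension\<close>

text \<open>One ambient space of functions contains cocycles and coboundaries as subspaces, so
  dimensions are counted modulo a subspace without forming quotients.\<close>

definition fscale :: "'k::field \<Rightarrow> ('x \<Rightarrow> 'k) \<Rightarrow> 'x \<Rightarrow> 'k" where
  "fscale c f = (\<lambda>x. c * f x)"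

interpretation fvs: vector_space fscale
  by unfold_locales (auto simp: fscale_def fun_eq_iff algebra_simps)

notation fscale (infixr \<open>*s\<close> 75)

interpretation fvp: vector_space_pair fscale fscale ..

text \<open>For a subspace \<open>B\<close> of a subspace \<open>Z\<close> this is finite
  dimensionality of \<open>Z / B\<close>. The witness \<open>S\<close> may leave \<open>Z\<close>,
  which makes the notion stable under shrinking \<open>Z\<close> and enlarging
  \<open>B\<close>.\<close>

definition finite_over :: "('x \<Rightarrow> 'k::field) set \<Rightarrow> ('x \<Rightarrow> 'k::field) set \<Rightarrow> bool" where
  "finite_over B Z \<longleftrightarrow> (\<exists>S. finite S \<and> Z \<subseteq> fvs.span (S \<union> B))"

lemma finite_over_mono: "finite_over B Z \<Longrightarrow> Z' \<subseteq> Z \<Longrightarrow> B \<subseteq> B' \<Longrightarrow> finite_over B' Z'"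
  unfolding finite_over_def by (meson Un_mono order.refl order.trans fvs.span_mono)

text \<open>Induction on the given generators: as soon as some \<open>z\<close> in \<open>Z\<close>
  involves the generator \<open>s\<close>, it takes over the role of \<open>s\<close>. The point is
  to have generators inside \<open>Z\<close>, where they can be used as cocycles.\<close>

lemma finite_over_basis:
  assumes "finite_over B Z" "fvs.subspace Z"
  obtains S where "finite S" "S \<subseteq> Z" "Z \<subseteq> fvs.span (S \<union> B)"
proof -
  obtain S0 where S0: "finite S0" "Z \<subseteq> fvs.span (S0 \<union> B)"
    using assms(1) unfolding finite_over_def by blast
  have "\<exists>S. finite S \<and> S \<subseteq> Z \<and> Z \<subseteq> fvs.span (S \<union> B)" if "finite S0" "fvs.subspace Z" "Z \<subseteq> fvs.span (S0 \<union> B)" for S0 Z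
    using that
  proof (induction S0 arbitrary: Z rule: finite_induct)
    case empty
    then show ?case by (intro exI[of _ "{}"]) auto
  next
    case (insert s S0)
    define Z1 where "Z1 = Z \<inter> fvs.span (S0 \<union> B)"
    have Z1: "fvs.subspace Z1" unfolding Z1_def using insert.prems by (simp add: fvs.subspace_inter)
    obtain S1 where S1: "finite S1" "S1 \<subseteq> Z1" "Z1 \<subseteq> fvs.span (S1 \<union> B)"
      using insert.IH[OF Z1] unfolding Z1_def by blast
    show ?case
    proof (cases "Z \<subseteq> fvs.span (S0 \<union> B)")
      case True
      then have "Z1 = Z" unfolding Z1_def by blast
      then show ?thesis using S1 by blast
    next
      case False
      then obtain z where z: "z \<in> Z" "z \<notin> fvs.span (S0 \<union> B)" by blast
      have br: "\<exists>k. y - k *s s \<in> fvs.span (S0 \<union> B)" if "y \<in> Z" for y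
        using insert.prems(2) that fvs.span_breakdown_eq[of y s "S0 \<union> B"] by auto
      obtain k where k: "z - k *s s \<in> fvs.span (S0 \<union> B)" using br z(1) by blast
      have "k \<noteq> 0" using k z(2) by auto
      \<comment> \<open>Subtracting the multiple of \<open>z\<close> with the same
        \<open>s\<close>-coefficient moves any \<open>y\<close> in \<open>Z\<close> into
        \<open>Z1\<close>.\<close>
      have "Z \<subseteq> fvs.span (insert z S1 \<union> B)"
      proof
        fix y assume y: "y \<in> Z"
        obtain l where l: "y - l *s s \<in> fvs.span (S0 \<union> B)" using br y by blast
        have "y - (l / k) *s z = (y - l *s s) - (l / k) *s (z - k *s s)"
          using \<open>k \<noteq> 0\<close> by (simp add: fvs.scale_right_diff_distrib)
        also have "\<dots> \<in> fvs.span (S0 \<union> B)"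
          by (intro fvs.span_diff fvs.span_scale k l)
        finally have "y - (l / k) *s z \<in> fvs.span (S0 \<union> B)" .
        moreover have "y - (l / k) *s z \<in> Z"
          using y z insert.prems(1) by (simp add: fvs.subspace_diff fvs.subspace_scale)
        ultimately have "y - (l / k) *s z \<in> fvs.span (S1 \<union> B)" using S1 unfolding Z1_def by blast
        then show "y \<in> fvs.span (insert z S1 \<union> B)"
          using fvs.span_breakdown_eq[of y z "S1 \<union> B"] by auto
      qed
      then show ?thesis
        using S1 z by (intro exI[of _ "insert z S1"]) (auto simp: Z1_def)
    qed
  qed
  then show thesis using that S0 assms(2) by blast
qed

text \<open>Gaussian elimination modulo \<open>span B\<close>, one generator at a time. The vectors
  form an indexed family, so repetitions are allowed.\<close>

lemma finite_over_dependent: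
  assumes "finite S" "finite I" "card S < card I" "\<And>i. i \<in> I \<Longrightarrow> v i \<in> fvs.span (S \<union> B)"
  shows "\<exists>a. (\<exists>i\<in>I. a i \<noteq> 0) \<and> (\<Sum>i\<in>I. a i *s v i) \<in> fvs.span B"
  using assms
proof (induction S arbitrary: I v rule: finite_induct)
  case empty
  then obtain i where i: "i \<in> I" by fastforce
  have "(\<Sum>j\<in>I. (if j = i then 1 else 0) *s v j) = (\<Sum>j\<in>I. if j = i then v j else 0)"
    by (rule sum.cong) auto
  also have "\<dots> = v i" using i empty by simp
  finally show ?case using empty i by (intro exI[of _ "\<lambda>j. if j = i then 1 else 0"]) auto
next
  case (insert s S)
  have "\<exists>k. v i - k *s s \<in> fvs.span (S \<union> B)" if "i \<in> I" for i
    using insert.prems(3)[OF that] fvs.span_breakdown_eq[of "v i" s "S \<union> B"] by auto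
  then obtain k where k: "\<And>i. i \<in> I \<Longrightarrow> v i - k i *s s \<in> fvs.span (S \<union> B)" by metis
  show ?case
  proof (cases "\<forall>i\<in>I. k i = 0")
    case True
    have "v i \<in> fvs.span (S \<union> B)" if "i \<in> I" for i using k[OF that] True that by simp
    moreover have "card S < card I" using insert by (simp add: card_insert_if)
    ultimately show ?thesis using insert.IH[OF insert.prems(1)] by blast
  next
    case False
    then obtain j where j: "j \<in> I" "k j \<noteq> 0" by blast
    define w where "w = (\<lambda>i. v i - (k i / k j) *s v j)"
    have w: "w i \<in> fvs.span (S \<union> B)" if "i \<in> I - {j}" for i
    proof -
      have "w i = (v i - k i *s s) - (k i / k j) *s (v j - k j *s s)"
        using j(2) by (simp add: w_def fvs.scale_right_diff_distrib)
      then show ?thesis using k[of i] k[OF j(1)] that by (simp add: fvs.span_diff fvs.span_scale)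
    qed
    have "card S < card (I - {j})" using insert j by (simp add: card_insert_if)
    then obtain a where a: "\<exists>i\<in>I - {j}. a i \<noteq> 0" "(\<Sum>i\<in>I - {j}. a i *s w i) \<in> fvs.span B"
      using insert.IH[of "I - {j}" w] w insert.prems(1) by auto
    \<comment> \<open>The coefficient of the pivot \<open>v j\<close> collects the multiples of it
      that were subtracted in forming the \<open>w i\<close>.\<close>
    define a' where "a' = a(j := - (\<Sum>i\<in>I - {j}. a i * (k i / k j)))"
    have "(\<Sum>i\<in>I. a' i *s v i) = a' j *s v j + (\<Sum>i\<in>I - {j}. a' i *s v i)"
      using insert.prems(1) j(1) by (simp add: sum.remove)
    also have "(\<Sum>i\<in>I - {j}. a' i *s v i) = (\<Sum>i\<in>I - {j}. a i *s v i)"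
      by (rule sum.cong) (auto simp: a'_def)
    also have "a' j *s v j = - (\<Sum>i\<in>I - {j}. a i *s ((k i / k j) *s v j))"
      by (simp add: a'_def fvs.scale_sum_left)
    also have "\<dots> + (\<Sum>i\<in>I - {j}. a i *s v i) = (\<Sum>i\<in>I - {j}. a i *s w i)"
      by (simp add: w_def fvs.scale_right_diff_distrib sum_subtractf)
    finally have "(\<Sum>i\<in>I. a' i *s v i) \<in> fvs.span B" using a(2) by simp
    moreover have "\<exists>i\<in>I. a' i \<noteq> 0" using a(1) by (auto simp: a'_def)
    ultimately show ?thesis by blast
  qed
qed

text \<open>Otherwise vectors independent modulo \<open>B\<close> could be picked for ever, and
  \<open>Suc d\<close> of them contradict \<open>d\<close> generators. The generators may change
  with \<open>T\<close>; in an inverse limit they do, since a finite set of cocycles comes from a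
  stage of its own.\<close>

lemma finite_over_bounded:
  assumes "\<And>T. finite T \<Longrightarrow> T \<subseteq> Z \<Longrightarrow> \<exists>S. finite S \<and> card S \<le> d \<and> T \<subseteq> fvs.span (S \<union> B)"
  shows "finite_over B Z"
proof (rule ccontr)
  assume nf: "\<not> finite_over B Z"
  have indep: "\<exists>T. finite T \<and> T \<subseteq> Z \<and> card T = n \<and>
      (\<forall>a. (\<Sum>t\<in>T. a t *s t) \<in> fvs.span B \<longrightarrow> (\<forall>t\<in>T. a t = 0))" for n
  proof (induction n)
    case 0
    then show ?case by (intro exI[of _ "{}"]) auto
  next
    case (Suc n)
    then obtain T where T: "finite T" "T \<subseteq> Z" "card T = n"
      "\<forall>a. (\<Sum>t\<in>T. a t *s t) \<in> fvs.span B \<longrightarrow> (\<forall>t\<in>T. a t = 0)" by (elim exE conjE) (rule that)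
    obtain z where z: "z \<in> Z" "z \<notin> fvs.span (T \<union> B)"
      using nf T(1) unfolding finite_over_def by blast
    have "z \<notin> T" using z by (meson UnI1 fvs.span_base)
    have ind: "\<forall>t\<in>insert z T. a t = 0" if a: "(\<Sum>t\<in>insert z T. a t *s t) \<in> fvs.span B" for a
    proof -
      have e: "(\<Sum>t\<in>insert z T. a t *s t) = a z *s z + (\<Sum>t\<in>T. a t *s t)"
        using T(1) \<open>z \<notin> T\<close> by simp
      have z0: "a z = 0"
      proof (rule ccontr)
        assume "a z \<noteq> 0"
        have "(\<Sum>t\<in>T. a t *s t) \<in> fvs.span (T \<union> B)"
          by (intro fvs.span_sum fvs.span_scale fvs.span_base) auto
        moreover have "a z *s z + (\<Sum>t\<in>T. a t *s t) \<in> fvs.span (T \<union> B)"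
          using a e fvs.span_mono[of B "T \<union> B"] by auto
        ultimately have "a z *s z \<in> fvs.span (T \<union> B)" by (simp add: fvs.span_add_eq2)
        then have "inverse (a z) *s (a z *s z) \<in> fvs.span (T \<union> B)" by (rule fvs.span_scale)
        then show False using \<open>a z \<noteq> 0\<close> z by simp
      qed
      have "(\<Sum>t\<in>T. a t *s t) \<in> fvs.span B" using a unfolding e z0 by simp
      then show ?thesis using T(4)[THEN spec, of a] z0 by blast
    qed
    have "finite (insert z T)" "insert z T \<subseteq> Z" "card (insert z T) = Suc n"
      using T(1-3) z(1) \<open>z \<notin> T\<close> by auto
    then show ?case using ind by blast
  qed
  obtain T where T: "finite T" "T \<subseteq> Z" "card T = Suc d"
      and T4: "\<forall>a. (\<Sum>t\<in>T. a t *s t) \<in> fvs.span B \<longrightarrow> (\<forall>t\<in>T. a t = 0)"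
    using indep[of "Suc d"] by (elim exE conjE) (rule that)
  obtain S where S: "finite S" "card S \<le> d" "T \<subseteq> fvs.span (S \<union> B)" using assms T by blast
  have "card S < card T" using S T by simp
  moreover have "t \<in> fvs.span (S \<union> B)" if "t \<in> T" for t using S that by blast
  ultimately have "\<exists>a. (\<exists>i\<in>T. a i \<noteq> 0) \<and> (\<Sum>i\<in>T. a i *s i) \<in> fvs.span B"
    by (rule finite_over_dependent[OF S(1) T(1), of "\<lambda>t. t" B])
  then obtain a where "\<exists>i\<in>T. a i \<noteq> 0" "(\<Sum>i\<in>T. a i *s i) \<in> fvs.span B"
    by (elim exE conjE) (rule that)
  then show False using T4[THEN spec, of a] by blast
qed

lemma span_Un_subspace:
  assumes "x \<in> fvs.span (S \<union> B)" "fvs.subspace B"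
  obtains y b where "y \<in> fvs.span S" "b \<in> B" "x = y + b"
  using assms by (auto simp: fvs.span_Un fvs.span_eq_iff[THEN iffD2])

text \<open>In effect \<open>h\<close> maps \<open>Z / B\<close> to a space that contains the image
  of \<open>Z'\<close> modulo \<open>B'\<close>, so generators can be pushed forward.\<close>

lemma finite_over_image:
  fixes h :: "('x \<Rightarrow> 'k::field) \<Rightarrow> ('y \<Rightarrow> 'k)"
  assumes h: "\<And>x y. h (x + y) = h x + h y" "\<And>c x. h (c *s x) = c *s h x"
    and B: "finite_over B Z" "h ` B \<subseteq> B'" "Z' \<subseteq> fvs.span (h ` Z \<union> B')"
  shows "finite_over B' Z'"
proof -
  have lin: "Vector_Spaces.linear fscale fscale h"
    using h by unfold_locales (simp_all add: fscale_def fun_eq_iff algebra_simps)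
  obtain S where S: "finite S" "Z \<subseteq> fvs.span (S \<union> B)"
    using B(1) unfolding finite_over_def by blast
  have "h ` Z \<subseteq> fvs.span (h ` S \<union> h ` B)"
    using S(2) fvp.linear_span_image[OF lin, of "S \<union> B"] by (auto simp: image_Un)
  also have "\<dots> \<subseteq> fvs.span (h ` S \<union> B')"
    using B(2) by (intro fvs.span_mono) auto
  finally have "h ` Z \<union> B' \<subseteq> fvs.span (h ` S \<union> B')"
    using fvs.span_superset[of "h ` S \<union> B'"] by auto
  then have "fvs.span (h ` Z \<union> B') \<subseteq> fvs.span (h ` S \<union> B')"
    by (simp add: fvs.span_minimal)
  then show ?thesis unfolding finite_over_def using S(1) B(3) by blast
qed

section \<open>Cochains on lists of points\<close>

text \<open>The alternating sum over deleted entries, by recursion on the first entry so that its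
  identities become list inductions. Cochains carry no degree: degree q lives on lists of length q +
  1, and the value at \<open>[]\<close> augments the complex.\<close>

fun cob :: "('z list \<Rightarrow> 'k::field) \<Rightarrow> 'z list \<Rightarrow> 'k" where
  "cob \<phi> [] = 0"
| "cob \<phi> (x # xs) = \<phi> xs - cob (\<lambda>ys. \<phi> (x # ys)) xs"

text \<open>The alternating sum over the simplices that triangulate the prism between the
  \<open>g\<close>-image and the \<open>h\<close>-image of a simplex.\<close>

fun prism :: "('y \<Rightarrow> 'z) \<Rightarrow> ('y \<Rightarrow> 'z) \<Rightarrow> ('z list \<Rightarrow> 'k::field) \<Rightarrow> 'y list \<Rightarrow> 'k" where
  "prism g h \<phi> [] = 0"
| "prism g h \<phi> (x # xs) = \<phi> (g x # h x # map h xs) - prism g h (\<lambda>ys. \<phi> (g x # ys)) xs"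

lemma cob_sum: "cob \<phi> xs = (\<Sum>i<length xs. (- 1) ^ i * \<phi> (take i xs @ drop (Suc i) xs))"
proof (induction xs arbitrary: \<phi>)
  case (Cons x xs)
  have "(\<Sum>i<length (x # xs). (- 1) ^ i * \<phi> (take i (x # xs) @ drop (Suc i) (x # xs))) =
      \<phi> xs + (\<Sum>i<length xs. (- 1) ^ Suc i * \<phi> (x # take i xs @ drop (Suc i) xs))"
    by (simp only: length_Cons sum.lessThan_Suc_shift) simp
  also have "\<dots> = \<phi> xs - cob (\<lambda>ys. \<phi> (x # ys)) xs"
    by (simp add: Cons sum_negf)
  finally show ?case by simp
qed simp

lemma cob_plus: "cob (\<lambda>xs. \<phi> xs + \<psi> xs) xs = cob \<phi> xs + cob \<psi> xs"
  by (induction xs arbitrary: \<phi> \<psi>) (auto simp: algebra_simps)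

lemma cob_times: "cob (\<lambda>xs. c * \<phi> xs) xs = c * cob \<phi> xs"
  by (induction xs arbitrary: \<phi>) (auto simp: algebra_simps)

lemma cob_minus: "cob (\<lambda>xs. \<phi> xs - \<psi> xs) xs = cob \<phi> xs - cob \<psi> xs"
  using cob_plus[of \<phi> "\<lambda>xs. (- 1) * \<psi> xs" xs] cob_times[of "- 1" \<psi> xs] by simp

lemma cob_zero [simp]: "cob (\<lambda>xs. 0) xs = 0"
  using cob_times[of 0 "\<lambda>_. 0" xs] by simp

lemma cob_map: "cob (\<lambda>xs. \<phi> (map g xs)) xs = cob \<phi> (map g xs)"
proof (induction xs arbitrary: \<phi>)
  case (Cons x xs)
  then show ?case using Cons[of "\<lambda>ys. \<phi> (g x # ys)"] by simp
qed simp

lemma cob_cob [simp]: "cob (cob \<phi>) xs = 0"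
  by (induction xs arbitrary: \<phi>) (auto simp: cob_minus)

lemma cob_cong:
  assumes "\<And>ys. set ys \<subseteq> set xs \<Longrightarrow> length xs = Suc (length ys) \<Longrightarrow> \<phi> ys = \<psi> ys"
  shows "cob \<phi> xs = cob \<psi> xs"
  using assms
proof (induction xs arbitrary: \<phi> \<psi>)
  case (Cons x xs)
  have "cob (\<lambda>ys. \<phi> (x # ys)) xs = cob (\<lambda>ys. \<psi> (x # ys)) xs"
    by (rule Cons.IH) (rule Cons.prems, auto)
  moreover have "\<phi> xs = \<psi> xs" by (rule Cons.prems) auto
  ultimately show ?case by simp
qed simp

lemma cob_eq_0:
  assumes "\<And>ys. set ys \<subseteq> set xs \<Longrightarrow> length xs = Suc (length ys) \<Longrightarrow> \<phi> ys = 0"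
  shows "cob \<phi> xs = 0"
  using cob_cong[of xs \<phi> "\<lambda>_. 0"] assms by auto

lemma prism_cong:
  assumes "\<And>ys. set ys \<subseteq> g ` set xs \<union> h ` set xs \<Longrightarrow> length ys = Suc (length xs) \<Longrightarrow> \<phi> ys = \<psi> ys"
  shows "prism g h \<phi> xs = prism g h \<psi> xs"
  using assms
proof (induction xs arbitrary: \<phi> \<psi>)
  case (Cons x xs)
  have "prism g h (\<lambda>ys. \<phi> (g x # ys)) xs = prism g h (\<lambda>ys. \<psi> (g x # ys)) xs"
    by (rule Cons.IH) (rule Cons.prems, auto)
  moreover have "\<phi> (g x # h x # map h xs) = \<psi> (g x # h x # map h xs)"
    by (rule Cons.prems) auto
  ultimately show ?case by simp
qed simp

lemma prism_zero [simp]: "prism g h (\<lambda>_. 0) xs = 0"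
  by (induction xs) auto

lemma prism_eq_0:
  assumes "\<And>ys. set ys \<subseteq> g ` set xs \<union> h ` set xs \<Longrightarrow> length ys = Suc (length xs) \<Longrightarrow> \<phi> ys = 0"
  shows "prism g h \<phi> xs = 0"
  using prism_cong[of g xs h \<phi> "\<lambda>_. 0"] assms by auto

lemma prism_minus: "prism g h (\<lambda>xs. \<phi> xs - \<psi> xs) xs = prism g h \<phi> xs - prism g h \<psi> xs"
  by (induction xs arbitrary: \<phi> \<psi>) auto

text \<open>The chain homotopy identity is purely formal and holds for arbitrary \<open>g\<close>
  and \<open>h\<close>; closeness of the two functions matters only when the lists occurring in the
  prism have to be small.\<close>

lemma prism_homotopy:
  "cob (prism g h \<phi>) xs + prism g h (cob \<phi>) xs = \<phi> (map h xs) - \<phi> (map g xs)"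
proof (induction xs arbitrary: \<phi>)
  case (Cons x xs)
  show ?case
    using Cons[of "\<lambda>ys. \<phi> (g x # ys)"] cob_map[of "\<lambda>ys. \<phi> (g x # h x # ys)" h xs]
    by (simp add: cob_minus prism_minus algebra_simps)
qed simp

section \<open>The filter of small lists\<close>

definition open_cover :: "'z topology \<Rightarrow> 'z set set \<Rightarrow> bool" where
  "open_cover X \<U> \<longleftrightarrow> (\<forall>U\<in>\<U>. openin X U) \<and> \<Union>\<U> = topspace X"

text \<open>An Alexander-Spanier cochain is a function up to equality along this filter. Common
  refinements of open covers make the principal filters a base.\<close>

definition smalls :: "'z topology \<Rightarrow> 'z list filter" where
  "smalls X = (INF \<U>\<in>{\<U>. open_cover X \<U>}. principal {xs. xs \<noteq> [] \<and> (\<exists>U\<in>\<U>. set xs \<subseteq> U)})"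

lemma eventually_smalls:
  "eventually P (smalls X) \<longleftrightarrow>
     (\<exists>\<U>. open_cover X \<U> \<and> (\<forall>U\<in>\<U>. \<forall>xs. xs \<noteq> [] \<longrightarrow> set xs \<subseteq> U \<longrightarrow> P xs))"
proof -
  have "eventually P (smalls X) \<longleftrightarrow>
    (\<exists>\<U>\<in>{\<U>. open_cover X \<U>}. eventually P (principal {xs. xs \<noteq> [] \<and> (\<exists>U\<in>\<U>. set xs \<subseteq> U)}))"
    unfolding smalls_def
  proof (rule eventually_INF_base)
    have "open_cover X {topspace X}" by (simp add: open_cover_def)
    then show "{\<U>. open_cover X \<U>} \<noteq> {}" by blast
  next
    fix \<U> \<V> assume "\<U> \<in> {\<U>. open_cover X \<U>}" "\<V> \<in> {\<U>. open_cover X \<U>}"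
    then have UV: "\<And>U. U \<in> \<U> \<Longrightarrow> openin X U" "\<And>V. V \<in> \<V> \<Longrightarrow> openin X V"
      "\<Union>\<U> = topspace X" "\<Union>\<V> = topspace X" unfolding open_cover_def by auto
    have "\<Union>{U \<inter> V |U V. U \<in> \<U> \<and> V \<in> \<V>} = \<Union>\<U> \<inter> \<Union>\<V>" by blast
    then have "open_cover X {U \<inter> V |U V. U \<in> \<U> \<and> V \<in> \<V>}"
      unfolding open_cover_def using UV by (auto intro: openin_Int)
    then show "\<exists>\<W>\<in>{\<U>. open_cover X \<U>}. principal {xs. xs \<noteq> [] \<and> (\<exists>U\<in>\<W>. set xs \<subseteq> U)}
       \<le> inf (principal {xs. xs \<noteq> [] \<and> (\<exists>U\<in>\<U>. set xs \<subseteq> U)})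
             (principal {xs. xs \<noteq> [] \<and> (\<exists>U\<in>\<V>. set xs \<subseteq> U)})"
      by (intro bexI[of _ "{U \<inter> V |U V. U \<in> \<U> \<and> V \<in> \<V>}"]) auto
  qed
  then show ?thesis by (auto simp: eventually_principal)
qed

text \<open>Neighbourhoods chosen at the individual points already form a cover, so identities of
  cochains can be checked point by point.\<close>

lemma eventually_smalls_local:
  "eventually P (smalls X) \<longleftrightarrow>
     (\<forall>x\<in>topspace X. \<exists>U. openin X U \<and> x \<in> U \<and> (\<forall>xs. xs \<noteq> [] \<longrightarrow> set xs \<subseteq> U \<longrightarrow> P xs))"
  (is "_ \<longleftrightarrow> ?R")
proof
  assume "eventually P (smalls X)"
  then show ?R unfolding eventually_smalls open_cover_def by (metis UnionE)
next
  assume ?R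
  moreover from this have "open_cover X {U. openin X U \<and> (\<forall>xs. xs \<noteq> [] \<longrightarrow> set xs \<subseteq> U \<longrightarrow> P xs)}"
    unfolding open_cover_def by (auto dest: openin_subset)
  ultimately show "eventually P (smalls X)" unfolding eventually_smalls by blast
qed

lemma eventually_smalls_subset:
  assumes "eventually P (smalls X)"
  shows "eventually (\<lambda>xs. \<forall>ys. ys \<noteq> [] \<longrightarrow> set ys \<subseteq> set xs \<longrightarrow> P ys) (smalls X)"
  using assms unfolding eventually_smalls by (meson order.trans)

lemma eventually_smalls_topspace:
  "eventually (\<lambda>xs. xs \<noteq> [] \<and> set xs \<subseteq> topspace X) (smalls X)"
  unfolding eventually_smalls by (intro exI[of _ "{topspace X}"]) (simp add: open_cover_def)

lemma eventually_smalls_map: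
  assumes "continuous_map X Y g" "eventually P (smalls Y)"
  shows "eventually (\<lambda>xs. P (map g xs)) (smalls X)"
  unfolding eventually_smalls_local
proof
  fix x assume x: "x \<in> topspace X"
  then have "g x \<in> topspace Y" using assms(1) by (auto simp: continuous_map_def Pi_iff)
  then obtain U where U: "openin Y U" "g x \<in> U" "\<And>xs. xs \<noteq> [] \<Longrightarrow> set xs \<subseteq> U \<Longrightarrow> P xs"
    using assms(2) unfolding eventually_smalls_local by blast
  have "openin X {y \<in> topspace X. g y \<in> U}"
    using U assms(1) by (simp add: continuous_map_def)
  moreover have "P (map g xs)" if "xs \<noteq> []" "set xs \<subseteq> {y \<in> topspace X. g y \<in> U}" for xs
    using that by (intro U(3)) auto
  ultimately show "\<exists>U. openin X U \<and> x \<in> U \<and> (\<forall>xs. xs \<noteq> [] \<longrightarrow> set xs \<subseteq> U \<longrightarrow> P (map g xs))"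
    using x U(2) by (intro exI[of _ "{y \<in> topspace X. g y \<in> U}"]) auto
qed

text \<open>The open complement of \<open>A\<close> completes any cover of \<open>A\<close> by
  traces of open sets, and no nonempty list in it lies in \<open>A\<close>. Cochains on a closed
  subset can thus be treated as conditions in the ambient space.\<close>

lemma eventually_smalls_subtopology:
  assumes "closedin X A"
  shows "eventually P (smalls (subtopology X A)) \<longleftrightarrow>
     eventually (\<lambda>xs. set xs \<subseteq> A \<longrightarrow> P xs) (smalls X)"
proof
  assume P: "eventually P (smalls (subtopology X A))"
  show "eventually (\<lambda>xs. set xs \<subseteq> A \<longrightarrow> P xs) (smalls X)"
    unfolding eventually_smalls_local
  proof
    fix x assume x: "x \<in> topspace X"
    show "\<exists>U. openin X U \<and> x \<in> U \<and> (\<forall>xs. xs \<noteq> [] \<longrightarrow> set xs \<subseteq> U \<longrightarrow> set xs \<subseteq> A \<longrightarrow> P xs)"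
    proof (cases "x \<in> A")
      case True
      then obtain U where U: "openin (subtopology X A) U" "x \<in> U" "\<And>xs. xs \<noteq> [] \<Longrightarrow> set xs \<subseteq> U \<Longrightarrow> P xs"
        using P x unfolding eventually_smalls_local topspace_subtopology by blast
      then obtain T where T: "openin X T" "U = T \<inter> A" unfolding openin_subtopology by blast
      have "P xs" if "xs \<noteq> []" "set xs \<subseteq> T" "set xs \<subseteq> A" for xs
        using that U(3)[of xs] T(2) by auto
      then show ?thesis using T U(2) by (intro exI[of _ T]) auto
    next
      case False
      have "set xs \<subseteq> A \<Longrightarrow> set xs \<subseteq> topspace X - A \<Longrightarrow> xs \<noteq> [] \<Longrightarrow> P xs" for xs
        by (cases xs) auto
      then show ?thesis using x False assms by (intro exI[of _ "topspace X - A"]) auto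
    qed
  qed
next
  assume "eventually (\<lambda>xs. set xs \<subseteq> A \<longrightarrow> P xs) (smalls X)"
  moreover have "continuous_map (subtopology X A) X (\<lambda>x. x)"
    by (simp add: continuous_map_from_subtopology)
  ultimately have "eventually (\<lambda>xs. set xs \<subseteq> A \<longrightarrow> P xs) (smalls (subtopology X A))"
    using eventually_smalls_map[of "subtopology X A" X "\<lambda>x. x"] by fastforce
  with eventually_smalls_topspace show "eventually P (smalls (subtopology X A))"
    by (rule eventually_elim2) auto
qed

text \<open>\<open>N x\<close> records, for each of finitely many closed shrinkings
  \<open>K i\<close>, whether \<open>x\<close> lies in it. If \<open>y\<close> in \<open>K i\<close>
  belongs to \<open>N x\<close>, then \<open>x\<close> is in \<open>K i\<close> as well, so that
  \<open>N x\<close> stays inside \<open>U i\<close>.\<close>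

lemma barycentric_refinement:
  assumes X: "compact_space X" "Hausdorff_space X" and \<U>: "open_cover X \<U>"
  obtains \<V> where "open_cover X \<V>"
    "\<And>x. x \<in> topspace X \<Longrightarrow> \<exists>U\<in>\<U>. \<Union>{V \<in> \<V>. x \<in> V} \<subseteq> U"
proof -
  have reg: "regular_space X" using X by (simp add: compact_Hausdorff_or_regular_imp_normal_space
        normal_t1_imp_regular_space Hausdorff_imp_t1_space)
  have "\<exists>G K. openin X G \<and> x \<in> G \<and> G \<subseteq> K \<and> closedin X K \<and>
      (\<exists>U\<in>\<U>. openin X U \<and> K \<subseteq> U)"
    if x: "x \<in> topspace X" for x
  proof -
    obtain U where U: "openin X U" "x \<in> U" "U \<in> \<U>"
      using \<U> x unfolding open_cover_def by blast
    then obtain G K where "openin X G" "closedin X K" "x \<in> G" "G \<subseteq> K" "K \<subseteq> U"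
      using reg x unfolding neighbourhood_base_of_closedin[symmetric] neighbourhood_base_of by meson
    then show ?thesis using U by blast
  qed
  then obtain G K U where GKU: "\<And>x. x \<in> topspace X \<Longrightarrow> openin X (G x) \<and> x \<in> G x \<and> G x \<subseteq> K x \<and>
      closedin X (K x) \<and> openin X (U x) \<and> K x \<subseteq> U x \<and> U x \<in> \<U>"
    by metis
  have "\<exists>\<F>. finite \<F> \<and> \<F> \<subseteq> G ` topspace X \<and> topspace X \<subseteq> \<Union>\<F>"
    using X(1) unfolding compact_space_alt by (rule allE[of _ "G ` topspace X"]) (use GKU in blast)
  then obtain I where I: "finite I" "I \<subseteq> topspace X" "topspace X \<subseteq> (\<Union>i\<in>I. G i)"
    by (metis finite_subset_image)
  define N where "N = (\<lambda>x. topspace X \<inter> (\<Inter>i\<in>I. if x \<in> K i then U i else topspace X - K i))"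
  have N: "openin X (N x)" if "x \<in> topspace X" for x
  proof (cases "I = {}")
    case False
    have "openin X (\<Inter>i\<in>I. if x \<in> K i then U i else topspace X - K i)"
      using I False GKU by (intro openin_INT2) (auto simp: subset_iff)
    then show ?thesis unfolding N_def by (simp add: openin_Int)
  qed (simp add: N_def)
  have xN: "x \<in> N x" if "x \<in> topspace X" for x
    using that I(2) GKU unfolding N_def by auto
  have "open_cover X (N ` topspace X)"
    unfolding open_cover_def using N xN openin_subset by fastforce
  moreover have "\<exists>U\<in>\<U>. \<Union>{V \<in> N ` topspace X. y \<in> V} \<subseteq> U" if y: "y \<in> topspace X" for y
  proof -
    obtain i where i: "i \<in> I" "y \<in> G i" using I(3) y by blast
    then have yK: "y \<in> K i" using GKU I(2) by blast
    have "N x \<subseteq> U i" if "x \<in> topspace X" "y \<in> N x" for x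
    proof -
      have "x \<in> K i"
      proof (rule ccontr)
        assume "x \<notin> K i"
        then have "N x \<subseteq> topspace X - K i" unfolding N_def using i(1) by auto
        then show False using that yK by auto
      qed
      then show ?thesis unfolding N_def using i(1) by auto
    qed
    then have "\<Union>{V \<in> N ` topspace X. y \<in> V} \<subseteq> U i" by blast
    then show ?thesis using GKU i(1) I(2) by blast
  qed
  ultimately show thesis using that by blast
qed

lemma smalls_barycentric:
  assumes X: "compact_space X" "Hausdorff_space X" and P: "eventually P (smalls X)"
  obtains \<V> where "open_cover X \<V>"
    "\<And>x ys. x \<in> topspace X \<Longrightarrow> ys \<noteq> [] \<Longrightarrow> set ys \<subseteq> \<Union>{V \<in> \<V>. x \<in> V} \<Longrightarrow> P ys"
proof -
  obtain \<U> where U: "open_cover X \<U>" "\<And>U xs. U \<in> \<U> \<Longrightarrow> xs \<noteq> [] \<Longrightarrow> set xs \<subseteq> U \<Longrightarrow> P xs"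
    using P unfolding eventually_smalls by blast
  obtain \<V> where V: "open_cover X \<V>" "\<And>x. x \<in> topspace X \<Longrightarrow> \<exists>U\<in>\<U>. \<Union>{V \<in> \<V>. x \<in> V} \<subseteq> U"
    by (rule barycentric_refinement[OF X U(1)]) (rule that)
  have "P ys" if h: "x \<in> topspace X" "ys \<noteq> []" "set ys \<subseteq> \<Union>{V \<in> \<V>. x \<in> V}" for x ys
  proof -
    obtain W where W: "W \<in> \<U>" "\<Union>{V \<in> \<V>. x \<in> V} \<subseteq> W" using V(2)[OF h(1)] by (elim bexE) (rule that)
    show ?thesis by (rule U(2)[OF W(1) h(2) order.trans[OF h(3) W(2)]])
  qed
  then show thesis by (rule that[OF V(1)])
qed

text \<open>Two barycentric refinements in succession give a star refinement: every point of the
  star of \<open>U\<close> shares a member of the coarser cover with a fixed point of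
  \<open>U\<close>.\<close>

lemma smalls_star:
  assumes X: "compact_space X" "Hausdorff_space X" and P: "eventually P (smalls X)"
  obtains \<V> where "open_cover X \<V>"
    "\<And>U ys. U \<in> \<V> \<Longrightarrow> U \<noteq> {} \<Longrightarrow> ys \<noteq> [] \<Longrightarrow> set ys \<subseteq> \<Union>{V \<in> \<V>. U \<inter> V \<noteq> {}} \<Longrightarrow> P ys"
proof -
  obtain \<V> where V: "open_cover X \<V>"
    "\<And>x ys. x \<in> topspace X \<Longrightarrow> ys \<noteq> [] \<Longrightarrow> set ys \<subseteq> \<Union>{V \<in> \<V>. x \<in> V} \<Longrightarrow> P ys"
    using smalls_barycentric[OF assms] by blast
  have ev: "eventually (\<lambda>xs. \<exists>V\<in>\<V>. set xs \<subseteq> V) (smalls X)"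
    unfolding eventually_smalls using V(1) by blast
  obtain \<W> where W: "open_cover X \<W>"
    "\<And>x ys. x \<in> topspace X \<Longrightarrow> ys \<noteq> [] \<Longrightarrow> set ys \<subseteq> \<Union>{V \<in> \<W>. x \<in> V} \<Longrightarrow> \<exists>V\<in>\<V>. set ys \<subseteq> V"
    by (rule smalls_barycentric[OF X ev]) (rule that)
  have "P ys" if U: "U \<in> \<W>" "U \<noteq> {}" "ys \<noteq> []" "set ys \<subseteq> \<Union>{V \<in> \<W>. U \<inter> V \<noteq> {}}" for U ys
  proof -
    obtain x where x: "x \<in> U" using U by blast
    have xX: "x \<in> topspace X" using x U W(1) unfolding open_cover_def by blast
    have "y \<in> \<Union>{V \<in> \<V>. x \<in> V}" if y: "y \<in> set ys" for y
    proof -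
      obtain V where V: "V \<in> \<W>" "y \<in> V" "U \<inter> V \<noteq> {}" using U(4) y by blast
      then obtain u where u: "u \<in> U" "u \<in> V" by blast
      have "u \<in> topspace X" using u U W(1) unfolding open_cover_def by blast
      moreover have "set [x, y] \<subseteq> \<Union>{V \<in> \<W>. u \<in> V}" using x u V U(1) by auto
      ultimately obtain V' where "V' \<in> \<V>" "set [x, y] \<subseteq> V'" using W(2)[of u "[x, y]"] by auto
      then show ?thesis by auto
    qed
    then have "set ys \<subseteq> \<Union>{V \<in> \<V>. x \<in> V}" by (rule subsetI)
    then show ?thesis by (rule V(2)[OF xX U(3)])
  qed
  then show thesis using that W(1) by blast
qed

text \<open>A discontinuous retraction of a neighbourhood of \<open>A\<close> onto \<open>A\<close> that moves points as little as desired.\<close>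

lemma small_retraction:
  assumes X: "compact_space X" "Hausdorff_space X" and A: "closedin X A" and P: "eventually P (smalls X)"
  obtains r V where "openin X V" "A \<subseteq> V" "\<And>x. x \<in> V \<Longrightarrow> r x \<in> A" "\<And>x. x \<in> A \<Longrightarrow> r x = x"
    "eventually (\<lambda>xs. set xs \<subseteq> V \<longrightarrow> (\<forall>ys. ys \<noteq> [] \<longrightarrow> set ys \<subseteq> set xs \<union> r ` set xs \<longrightarrow> P ys)) (smalls X)"
proof -
  \<comment> \<open>A small list lies in some \<open>U\<close>, and each image under the retraction
    shares a member of the cover with its point, hence lies in the star of \<open>U\<close>. A star
    refinement is exactly what bounds the mixed lists.\<close>
  obtain \<V> where V: "open_cover X \<V>"
    "\<And>U ys. U \<in> \<V> \<Longrightarrow> U \<noteq> {} \<Longrightarrow> ys \<noteq> [] \<Longrightarrow> set ys \<subseteq> \<Union>{V \<in> \<V>. U \<inter> V \<noteq> {}} \<Longrightarrow> P ys"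
    using smalls_star[OF X P] by blast
  define S where "S = \<Union>{V \<in> \<V>. V \<inter> A \<noteq> {}}"
  define r where "r = (\<lambda>x. if x \<in> A then x else SOME a. a \<in> A \<and> (\<exists>V\<in>\<V>. x \<in> V \<and> a \<in> V))"
  have r: "r x \<in> A \<and> (\<exists>V\<in>\<V>. x \<in> V \<and> r x \<in> V)" if "x \<in> S" for x
  proof (cases "x \<in> A")
    case False
    have "\<exists>a. a \<in> A \<and> (\<exists>V\<in>\<V>. x \<in> V \<and> a \<in> V)" using that unfolding S_def by blast
    from someI_ex[OF this] show ?thesis using False by (simp add: r_def)
  qed (use that in \<open>auto simp: r_def S_def\<close>)
  show thesis
  proof
    show "openin X S" unfolding S_def using V(1) by (auto simp: open_cover_def)
    show "A \<subseteq> S" using V(1) closedin_subset[OF A] unfolding S_def open_cover_def by blast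
    show "\<And>x. x \<in> S \<Longrightarrow> r x \<in> A" using r by blast
    show "\<And>x. x \<in> A \<Longrightarrow> r x = x" by (simp add: r_def)
    have "P ys" if h: "U \<in> \<V>" "xs \<noteq> []" "set xs \<subseteq> U" "set xs \<subseteq> S" "ys \<noteq> []" "set ys \<subseteq> set xs \<union> r ` set xs"
      for U xs ys
    proof (rule V(2)[OF h(1) _ h(5)])
      show "U \<noteq> {}" using h(2,3) by (cases xs) auto
      show "set ys \<subseteq> \<Union>{V \<in> \<V>. U \<inter> V \<noteq> {}}"
      proof
        fix y assume "y \<in> set ys"
        then consider "y \<in> set xs" | x where "x \<in> set xs" "y = r x" using h(6) by blast
        then show "y \<in> \<Union>{V \<in> \<V>. U \<inter> V \<noteq> {}}"
        proof cases
          case 1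
          then show ?thesis using h by blast
        next
          case 2
          then show ?thesis using r[of x] h(3,4) by blast
        qed
      qed
    qed
    then show "eventually (\<lambda>xs. set xs \<subseteq> S \<longrightarrow> (\<forall>ys. ys \<noteq> [] \<longrightarrow> set ys \<subseteq> set xs \<union> r ` set xs \<longrightarrow> P ys)) (smalls X)"
      unfolding eventually_smalls using V(1) by blast
  qed
qed

section \<open>Alexander-Spanier cocycles\<close>

text \<open>Relative cocycles are kept as functions rather than germs: both conditions concern small
  lists only, and all other values are arbitrary.\<close>

definition Zc :: "'z topology \<Rightarrow> 'z set \<Rightarrow> nat \<Rightarrow> ('z list \<Rightarrow> 'k::field) set" where
  "Zc X A q = {\<phi>. eventually (\<lambda>xs. length xs = Suc (Suc q) \<longrightarrow> cob \<phi> xs = 0) (smalls X) \<and>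
     eventually (\<lambda>xs. length xs = Suc q \<longrightarrow> set xs \<subseteq> A \<longrightarrow> \<phi> xs = 0) (smalls X)}"

text \<open>In degree 0 the primitive is forced to be zero: a value at \<open>[]\<close> would make
  the constants coboundaries and produce reduced cohomology.\<close>

definition Bd :: "'z topology \<Rightarrow> 'z set \<Rightarrow> nat \<Rightarrow> ('z list \<Rightarrow> 'k::field) set" where
  "Bd X A q = {\<phi>. \<exists>\<psi>. (q = 0 \<longrightarrow> \<psi> = (\<lambda>_. 0)) \<and>
     eventually (\<lambda>xs. length xs = q \<longrightarrow> set xs \<subseteq> A \<longrightarrow> \<psi> xs = 0) (smalls X) \<and>
     eventually (\<lambda>xs. length xs = Suc q \<longrightarrow> \<phi> xs = cob \<psi> xs) (smalls X)}"

lemma ZcI: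
  assumes "eventually (\<lambda>xs. length xs = Suc (Suc q) \<longrightarrow> cob \<phi> xs = 0) (smalls X)"
    "eventually (\<lambda>xs. length xs = Suc q \<longrightarrow> set xs \<subseteq> A \<longrightarrow> \<phi> xs = 0) (smalls X)"
  shows "\<phi> \<in> Zc X A q"
  using assms by (simp add: Zc_def)

lemma BdI:
  assumes "q = 0 \<Longrightarrow> \<psi> = (\<lambda>_. 0)"
    "eventually (\<lambda>xs. length xs = q \<longrightarrow> set xs \<subseteq> A \<longrightarrow> \<psi> xs = 0) (smalls X)"
    "eventually (\<lambda>xs. length xs = Suc q \<longrightarrow> \<phi> xs = cob \<psi> xs) (smalls X)"
  shows "\<phi> \<in> Bd X A q"
  using assms by (auto simp: Bd_def)

lemma BdE:
  assumes "\<phi> \<in> Bd X A q"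
  obtains \<psi> where "q = 0 \<longrightarrow> \<psi> = (\<lambda>_. 0)"
    "eventually (\<lambda>xs. length xs = q \<longrightarrow> set xs \<subseteq> A \<longrightarrow> \<psi> xs = 0) (smalls X)"
    "eventually (\<lambda>xs. length xs = Suc q \<longrightarrow> \<phi> xs = cob \<psi> xs) (smalls X)"
  using assms by (auto simp: Bd_def)

lemma subspace_Zc: "fvs.subspace (Zc X A q :: ('z list \<Rightarrow> 'k::field) set)"
proof (rule fvs.subspaceI)
  show "0 \<in> Zc X A q" by (simp add: Zc_def zero_fun_def)
next
  fix \<phi> \<psi> :: "'z list \<Rightarrow> 'k" assume a: "\<phi> \<in> Zc X A q" "\<psi> \<in> Zc X A q"
  show "\<phi> + \<psi> \<in> Zc X A q"
  proof (rule ZcI)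
    from a have "eventually (\<lambda>xs. (length xs = Suc (Suc q) \<longrightarrow> cob \<phi> xs = 0) \<and> (length xs = Suc (Suc q) \<longrightarrow> cob \<psi> xs = 0)) (smalls X)"
      by (auto simp: Zc_def intro: eventually_conj)
    then show "eventually (\<lambda>xs. length xs = Suc (Suc q) \<longrightarrow> cob (\<phi> + \<psi>) xs = 0) (smalls X)"
      by (rule eventually_mono) (auto simp: plus_fun_def cob_plus)
    from a have "eventually (\<lambda>xs. (length xs = Suc q \<longrightarrow> set xs \<subseteq> A \<longrightarrow> \<phi> xs = 0) \<and> (length xs = Suc q \<longrightarrow> set xs \<subseteq> A \<longrightarrow> \<psi> xs = 0)) (smalls X)"
      by (auto simp: Zc_def intro: eventually_conj)
    then show "eventually (\<lambda>xs. length xs = Suc q \<longrightarrow> set xs \<subseteq> A \<longrightarrow> (\<phi> + \<psi>) xs = 0) (smalls X)"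
      by (rule eventually_mono) auto
  qed
next
  fix c :: 'k and \<phi> :: "'z list \<Rightarrow> 'k" assume a: "\<phi> \<in> Zc X A q"
  then show "c *s \<phi> \<in> Zc X A q"
    by (auto simp: Zc_def fscale_def cob_times elim: eventually_mono)
qed

lemma subspace_Bd: "fvs.subspace (Bd X A q :: ('z list \<Rightarrow> 'k::field) set)"
proof (rule fvs.subspaceI)
  show "0 \<in> Bd X A q" by (rule BdI[of _ "\<lambda>_. 0"]) (auto simp: zero_fun_def)
next
  fix \<phi> \<phi>' :: "'z list \<Rightarrow> 'k" assume a: "\<phi> \<in> Bd X A q" "\<phi>' \<in> Bd X A q"
  obtain \<psi> where p: "q = 0 \<longrightarrow> \<psi> = (\<lambda>_. 0)"
    "eventually (\<lambda>xs. length xs = q \<longrightarrow> set xs \<subseteq> A \<longrightarrow> \<psi> xs = 0) (smalls X)"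
    "eventually (\<lambda>xs. length xs = Suc q \<longrightarrow> \<phi> xs = cob \<psi> xs) (smalls X)"
    using a(1) by (rule BdE)
  obtain \<psi>' where p': "q = 0 \<longrightarrow> \<psi>' = (\<lambda>_. 0)"
    "eventually (\<lambda>xs. length xs = q \<longrightarrow> set xs \<subseteq> A \<longrightarrow> \<psi>' xs = 0) (smalls X)"
    "eventually (\<lambda>xs. length xs = Suc q \<longrightarrow> \<phi>' xs = cob \<psi>' xs) (smalls X)"
    using a(2) by (rule BdE)
  show "\<phi> + \<phi>' \<in> Bd X A q"
  proof (rule BdI[of _ "\<lambda>xs. \<psi> xs + \<psi>' xs"])
    show "q = 0 \<Longrightarrow> (\<lambda>xs. \<psi> xs + \<psi>' xs) = (\<lambda>_. 0)" using p(1) p'(1) by simp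
    show "eventually (\<lambda>xs. length xs = q \<longrightarrow> set xs \<subseteq> A \<longrightarrow> \<psi> xs + \<psi>' xs = 0) (smalls X)"
      using p(2) p'(2) by (rule eventually_elim2) auto
    show "eventually (\<lambda>xs. length xs = Suc q \<longrightarrow> (\<phi> + \<phi>') xs = cob (\<lambda>xs. \<psi> xs + \<psi>' xs) xs) (smalls X)"
      using p(3) p'(3) by (rule eventually_elim2) (auto simp: cob_plus)
  qed
next
  fix c :: 'k and \<phi> :: "'z list \<Rightarrow> 'k" assume a: "\<phi> \<in> Bd X A q"
  obtain \<psi> where p: "q = 0 \<longrightarrow> \<psi> = (\<lambda>_. 0)"
    "eventually (\<lambda>xs. length xs = q \<longrightarrow> set xs \<subseteq> A \<longrightarrow> \<psi> xs = 0) (smalls X)"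
    "eventually (\<lambda>xs. length xs = Suc q \<longrightarrow> \<phi> xs = cob \<psi> xs) (smalls X)"
    using a by (rule BdE)
  show "c *s \<phi> \<in> Bd X A q"
  proof (rule BdI[of _ "\<lambda>xs. c * \<psi> xs"])
    show "q = 0 \<Longrightarrow> (\<lambda>xs. c * \<psi> xs) = (\<lambda>_. 0)" using p(1) by simp
    show "eventually (\<lambda>xs. length xs = q \<longrightarrow> set xs \<subseteq> A \<longrightarrow> c * \<psi> xs = 0) (smalls X)"
      using p(2) by (rule eventually_mono) auto
    show "eventually (\<lambda>xs. length xs = Suc q \<longrightarrow> (c *s \<phi>) xs = cob (\<lambda>xs. c * \<psi> xs) xs) (smalls X)"
      using p(3) by (rule eventually_mono) (auto simp: cob_times fscale_def)
  qed
qed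

lemma eventually_cob:
  assumes "eventually (\<lambda>xs. length xs = Suc q \<longrightarrow> \<phi> xs = \<psi> xs) (smalls X)"
  shows "eventually (\<lambda>xs. length xs = Suc (Suc q) \<longrightarrow> cob \<phi> xs = cob \<psi> xs) (smalls X)"
  using eventually_smalls_subset[OF assms]
proof (rule eventually_mono, intro impI)
  fix xs assume *: "\<forall>ys. ys \<noteq> [] \<longrightarrow> set ys \<subseteq> set xs \<longrightarrow> length ys = Suc q \<longrightarrow> \<phi> ys = \<psi> ys"
    and l: "length xs = Suc (Suc q)"
  show "cob \<phi> xs = cob \<psi> xs"
  proof (rule cob_cong)
    fix ys assume "set ys \<subseteq> set xs" "length xs = Suc (length ys)"
    moreover from this have "ys \<noteq> []" using l by auto
    ultimately show "\<phi> ys = \<psi> ys" using * l by simp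
  qed
qed

lemma eventually_cob_on:
  assumes "eventually (\<lambda>xs. length xs = q \<longrightarrow> set xs \<subseteq> A \<longrightarrow> \<phi> xs = \<psi> xs) (smalls X)" "q = 0 \<Longrightarrow> \<phi> = \<psi>"
  shows "eventually (\<lambda>xs. length xs = Suc q \<longrightarrow> set xs \<subseteq> A \<longrightarrow> cob \<phi> xs = cob \<psi> xs) (smalls X)"
proof (cases q)
  case (Suc p)
  show ?thesis
    using eventually_smalls_subset[OF assms(1)]
  proof (rule eventually_mono, intro impI)
    fix xs assume *: "\<forall>ys. ys \<noteq> [] \<longrightarrow> set ys \<subseteq> set xs \<longrightarrow> length ys = q \<longrightarrow> set ys \<subseteq> A \<longrightarrow> \<phi> ys = \<psi> ys"
      and l: "length xs = Suc q" "set xs \<subseteq> A"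
    show "cob \<phi> xs = cob \<psi> xs"
    proof (rule cob_cong)
      fix ys assume "set ys \<subseteq> set xs" "length xs = Suc (length ys)"
      moreover from this have "ys \<noteq> []" using l Suc by auto
      ultimately show "\<phi> ys = \<psi> ys" using * l by simp
    qed
  qed
qed (use assms(2) in auto)

lemma small_eq_imp_Bd:
  assumes "eventually (\<lambda>xs. length xs = Suc q \<longrightarrow> \<phi> xs = \<psi> xs) (smalls X)"
  shows "\<phi> - \<psi> \<in> Bd X A q"
  using assms by (intro BdI[of _ "\<lambda>_. 0"]) (auto elim: eventually_mono)

lemma cob_in_Bd:
  assumes "eventually (\<lambda>xs. length xs = q \<longrightarrow> set xs \<subseteq> A \<longrightarrow> \<psi> xs = 0) (smalls X)" "0 < q"
  shows "cob \<psi> \<in> Bd X A q"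
  using assms by (intro BdI[of _ \<psi>]) auto

lemma eventually_smalls_map_on:
  assumes g: "continuous_map X Y g" "g ` (A \<inter> topspace X) \<subseteq> B"
    and P: "eventually (\<lambda>xs. length xs = n \<longrightarrow> set xs \<subseteq> B \<longrightarrow> P xs) (smalls Y)"
  shows "eventually (\<lambda>xs. length xs = n \<longrightarrow> set xs \<subseteq> A \<longrightarrow> P (map g xs)) (smalls X)"
  using eventually_smalls_map[OF g(1) P] eventually_smalls_topspace
  by (rule eventually_elim2) (use g(2) in fastforce)

lemma Zc_map:
  assumes g: "continuous_map X Y g" "g ` (A \<inter> topspace X) \<subseteq> B" and \<phi>: "\<phi> \<in> Zc Y B q"
  shows "(\<lambda>xs. \<phi> (map g xs)) \<in> Zc X A q"
proof (rule ZcI)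
  show "eventually (\<lambda>xs. length xs = Suc (Suc q) \<longrightarrow> cob (\<lambda>xs. \<phi> (map g xs)) xs = 0) (smalls X)"
    using eventually_smalls_map[OF g(1), of "\<lambda>xs. length xs = Suc (Suc q) \<longrightarrow> cob \<phi> xs = 0"] \<phi>
    by (simp add: Zc_def cob_map)
  show "eventually (\<lambda>xs. length xs = Suc q \<longrightarrow> set xs \<subseteq> A \<longrightarrow> \<phi> (map g xs) = 0) (smalls X)"
    using \<phi> by (intro eventually_smalls_map_on[OF g, of _ "\<lambda>xs. \<phi> xs = 0"]) (simp add: Zc_def)
qed

lemma Bd_map:
  assumes g: "continuous_map X Y g" "g ` (A \<inter> topspace X) \<subseteq> B" and \<phi>: "\<phi> \<in> Bd Y B q"
  shows "(\<lambda>xs. \<phi> (map g xs)) \<in> Bd X A q"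
proof -
  obtain \<psi> where p: "q = 0 \<longrightarrow> \<psi> = (\<lambda>_. 0)"
    "eventually (\<lambda>xs. length xs = q \<longrightarrow> set xs \<subseteq> B \<longrightarrow> \<psi> xs = 0) (smalls Y)"
    "eventually (\<lambda>xs. length xs = Suc q \<longrightarrow> \<phi> xs = cob \<psi> xs) (smalls Y)"
    using \<phi> by (rule BdE)
  show ?thesis
  proof (rule BdI[of _ "\<lambda>xs. \<psi> (map g xs)"])
    show "q = 0 \<Longrightarrow> (\<lambda>xs. \<psi> (map g xs)) = (\<lambda>_. 0)" using p(1) by simp
    show "eventually (\<lambda>xs. length xs = q \<longrightarrow> set xs \<subseteq> A \<longrightarrow> \<psi> (map g xs) = 0) (smalls X)"
      using p(2) by (rule eventually_smalls_map_on[OF g])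
    show "eventually (\<lambda>xs. length xs = Suc q \<longrightarrow> \<phi> (map g xs) = cob (\<lambda>xs. \<psi> (map g xs)) xs) (smalls X)"
      using eventually_smalls_map[OF g(1) p(3)] by (simp add: cob_map)
  qed
qed

text \<open>The prism of \<open>\<phi>\<close> is the primitive. The hypotheses say that
  \<open>g\<close> and \<open>h\<close> are close as far as \<open>\<phi>\<close> can see: lists
  mixing values of both still satisfy the cocycle conditions.\<close>

lemma homotopic_Bd:
  assumes c: "eventually (\<lambda>xs. \<forall>ys. length ys = Suc (Suc q) \<longrightarrow> set ys \<subseteq> g ` set xs \<union> h ` set xs \<longrightarrow> cob \<phi> ys = 0) (smalls X)"
    and A: "eventually (\<lambda>xs. set xs \<subseteq> A \<longrightarrow> (\<forall>ys. length ys = Suc q \<longrightarrow> set ys \<subseteq> g ` set xs \<union> h ` set xs \<longrightarrow> \<phi> ys = 0)) (smalls X)"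
  shows "(\<lambda>xs. \<phi> (map h xs) - \<phi> (map g xs)) \<in> Bd X A q"
\<comment> \<open>In degree 0 the primitive must be literally zero; the prism vanishes on
  \<open>[]\<close>, so nothing is lost.\<close>
proof (rule BdI[of _ "if q = 0 then \<lambda>_. 0 else prism g h \<phi>"])
  show "eventually (\<lambda>xs. length xs = q \<longrightarrow> set xs \<subseteq> A \<longrightarrow> (if q = 0 then \<lambda>_. 0 else prism g h \<phi>) xs = 0) (smalls X)"
    using A by (rule eventually_mono) (auto intro!: prism_eq_0)
  show "eventually (\<lambda>xs. length xs = Suc q \<longrightarrow> \<phi> (map h xs) - \<phi> (map g xs) =
      cob (if q = 0 then \<lambda>_. 0 else prism g h \<phi>) xs) (smalls X)"
    using c
  proof (rule eventually_mono, intro impI)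
    fix xs assume *: "\<forall>ys. length ys = Suc (Suc q) \<longrightarrow> set ys \<subseteq> g ` set xs \<union> h ` set xs \<longrightarrow> cob \<phi> ys = 0"
      and l: "length xs = Suc q"
    have "prism g h (cob \<phi>) xs = 0" using * l by (intro prism_eq_0) auto
    then have e: "cob (prism g h \<phi>) xs = \<phi> (map h xs) - \<phi> (map g xs)"
      using prism_homotopy[of g h \<phi> xs] by simp
    show "\<phi> (map h xs) - \<phi> (map g xs) = cob (if q = 0 then \<lambda>_. 0 else prism g h \<phi>) xs"
    proof (cases "q = 0")
      case True
      then obtain x where "xs = [x]" using l by (cases xs) auto
      then show ?thesis using e True by simp
    qed (simp add: e)
  qed
qed auto

lemma Zc_subtopology:
  assumes "closedin X A"
  shows "\<phi> \<in> Zc (subtopology X A) B q \<longleftrightarrow>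
     eventually (\<lambda>xs. set xs \<subseteq> A \<longrightarrow> length xs = Suc (Suc q) \<longrightarrow> cob \<phi> xs = 0) (smalls X) \<and>
     eventually (\<lambda>xs. set xs \<subseteq> A \<longrightarrow> length xs = Suc q \<longrightarrow> set xs \<subseteq> B \<longrightarrow> \<phi> xs = 0) (smalls X)"
  by (simp add: Zc_def eventually_smalls_subtopology[OF assms])

lemma Bd_subtopology:
  assumes "closedin X A"
  shows "\<phi> \<in> Bd (subtopology X A) B q \<longleftrightarrow>
     (\<exists>\<psi>. (q = 0 \<longrightarrow> \<psi> = (\<lambda>_. 0)) \<and>
     eventually (\<lambda>xs. set xs \<subseteq> A \<longrightarrow> length xs = q \<longrightarrow> set xs \<subseteq> B \<longrightarrow> \<psi> xs = 0) (smalls X) \<and>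
     eventually (\<lambda>xs. set xs \<subseteq> A \<longrightarrow> length xs = Suc q \<longrightarrow> \<phi> xs = cob \<psi> xs) (smalls X))"
  by (simp add: Bd_def eventually_smalls_subtopology[OF assms])

lemma Zc_absolute: "eventually (\<lambda>xs. length xs = Suc (Suc q) \<longrightarrow> cob \<phi> xs = 0) (smalls X) \<Longrightarrow> \<phi> \<in> Zc X {} q"
  using eventually_smalls_topspace[of X] by (auto simp: Zc_def elim: eventually_mono)

lemma Zc_mono: "B \<subseteq> A \<Longrightarrow> Zc X A q \<subseteq> Zc X B q"
proof
  fix \<phi> assume BA: "B \<subseteq> A" and \<phi>: "\<phi> \<in> Zc X A q"
  have "eventually (\<lambda>xs. length xs = Suc q \<longrightarrow> set xs \<subseteq> A \<longrightarrow> \<phi> xs = 0) (smalls X)"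
    using \<phi> by (simp add: Zc_def)
  then have "eventually (\<lambda>xs. length xs = Suc q \<longrightarrow> set xs \<subseteq> B \<longrightarrow> \<phi> xs = 0) (smalls X)"
    by (rule eventually_mono) (use BA in blast)
  with \<phi> show "\<phi> \<in> Zc X B q" by (simp add: Zc_def)
qed

lemma Zc_restrict: "\<phi> \<in> Zc X B q \<Longrightarrow> B' \<subseteq> B \<Longrightarrow> \<phi> \<in> Zc (subtopology X A) B' q"
  using Zc_map[of "subtopology X A" X "\<lambda>x. x" B' B] by (auto simp: continuous_map_from_subtopology)

lemma Bd_restrict: "\<phi> \<in> Bd X B q \<Longrightarrow> B' \<subseteq> B \<Longrightarrow> \<phi> \<in> Bd (subtopology X A) B' q"
  using Bd_map[of "subtopology X A" X "\<lambda>x. x" B' B] by (auto simp: continuous_map_from_subtopology)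

text \<open>A relative cocycle on a neighbourhood of \<open>A\<close> bounds near \<open>A\<close>, because it is homotopic to its
  pull-back under a small retraction onto \<open>A\<close>, where it vanishes.\<close>

lemma bounds_near:
  fixes \<phi> :: "'z list \<Rightarrow> 'k::field"
  assumes X: "compact_space X" "Hausdorff_space X" and A: "closedin X A"
    and U: "openin X U" "A \<subseteq> U"
    and c: "eventually (\<lambda>xs. set xs \<subseteq> U \<longrightarrow> length xs = Suc (Suc q) \<longrightarrow> cob \<phi> xs = 0) (smalls X)"
    and z: "eventually (\<lambda>xs. set xs \<subseteq> A \<longrightarrow> length xs = Suc q \<longrightarrow> \<phi> xs = 0) (smalls X)"
  obtains \<psi> V where "openin X V" "A \<subseteq> V" "q = 0 \<Longrightarrow> \<psi> = (\<lambda>_. 0)"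
    "eventually (\<lambda>xs. set xs \<subseteq> A \<longrightarrow> length xs = q \<longrightarrow> \<psi> xs = 0) (smalls X)"
    "eventually (\<lambda>xs. set xs \<subseteq> V \<longrightarrow> length xs = Suc q \<longrightarrow> \<phi> xs = cob \<psi> xs) (smalls X)"
proof -
  define P where "P = (\<lambda>xs. (set xs \<subseteq> U \<longrightarrow> length xs = Suc (Suc q) \<longrightarrow> cob \<phi> xs = 0) \<and>
     (set xs \<subseteq> A \<longrightarrow> length xs = Suc q \<longrightarrow> \<phi> xs = 0))"
  have P: "eventually P (smalls X)" unfolding P_def using c z by (rule eventually_conj)
  obtain r V where rV: "openin X V" "A \<subseteq> V" "\<And>x. x \<in> V \<Longrightarrow> r x \<in> A" "\<And>x. x \<in> A \<Longrightarrow> r x = x"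
    "eventually (\<lambda>xs. set xs \<subseteq> V \<longrightarrow> (\<forall>ys. ys \<noteq> [] \<longrightarrow> set ys \<subseteq> set xs \<union> r ` set xs \<longrightarrow> P ys)) (smalls X)"
    by (rule small_retraction[OF X A P]) (rule that)
  define \<psi> where "\<psi> = (if q = 0 then \<lambda>_. 0 else (\<lambda>xs. prism r (\<lambda>x. x) \<phi> xs))"
  show thesis
  proof
    show "openin X (U \<inter> V)" using U(1) rV(1) by (rule openin_Int)
    show "A \<subseteq> U \<inter> V" using U(2) rV(2) by blast
    show "q = 0 \<Longrightarrow> \<psi> = (\<lambda>_. 0)" by (simp add: \<psi>_def)
    show "eventually (\<lambda>xs. set xs \<subseteq> A \<longrightarrow> length xs = q \<longrightarrow> \<psi> xs = 0) (smalls X)"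
      using rV(5)
    proof (rule eventually_mono, intro impI)
      fix xs assume *: "set xs \<subseteq> V \<longrightarrow> (\<forall>ys. ys \<noteq> [] \<longrightarrow> set ys \<subseteq> set xs \<union> r ` set xs \<longrightarrow> P ys)"
        and xs: "set xs \<subseteq> A" "length xs = q"
      have "prism r (\<lambda>x. x) \<phi> xs = 0"
      proof (rule prism_eq_0)
        fix ys assume ys: "set ys \<subseteq> r ` set xs \<union> (\<lambda>x. x) ` set xs" "length ys = Suc (length xs)"
        have "P ys" using *[rule_format, of ys] ys xs(1) rV(2) by (cases ys) auto
        moreover have "r ` set xs \<subseteq> A" using xs(1) rV(2,3) by blast
        then have "set ys \<subseteq> A" using ys(1) xs(1) by blast
        ultimately show "\<phi> ys = 0" unfolding P_def using ys xs by simp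
      qed
      then show "\<psi> xs = 0" by (simp add: \<psi>_def)
    qed
    show "eventually (\<lambda>xs. set xs \<subseteq> U \<inter> V \<longrightarrow> length xs = Suc q \<longrightarrow> \<phi> xs = cob \<psi> xs) (smalls X)"
      using rV(5)
    proof (rule eventually_mono, intro impI)
      fix xs assume *: "set xs \<subseteq> V \<longrightarrow> (\<forall>ys. ys \<noteq> [] \<longrightarrow> set ys \<subseteq> set xs \<union> r ` set xs \<longrightarrow> P ys)"
        and xs: "set xs \<subseteq> U \<inter> V" "length xs = Suc q"
      have sub: "P ys" if "ys \<noteq> []" "set ys \<subseteq> set xs \<union> r ` set xs" for ys using * xs(1) that by auto
      have rA: "r ` set xs \<subseteq> A" using xs(1) rV(3) by auto
      have "P (map r xs)" using sub[of "map r xs"] xs(2) by (cases xs) auto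
      then have "\<phi> (map r xs) = 0" using rA xs(2) by (simp add: P_def)
      moreover have "prism r (\<lambda>x. x) (cob \<phi>) xs = 0"
      proof (rule prism_eq_0)
        fix ys assume ys: "set ys \<subseteq> r ` set xs \<union> (\<lambda>x. x) ` set xs" "length ys = Suc (length xs)"
        have "ys \<noteq> []" "set ys \<subseteq> set xs \<union> r ` set xs" using ys by auto
        then have "P ys" by (rule sub)
        moreover have "set ys \<subseteq> U" using ys(1) xs(1) rA U(2) by auto
        ultimately show "cob \<phi> ys = 0" unfolding P_def using ys xs by simp
      qed
      ultimately have e: "\<phi> xs = cob (prism r (\<lambda>x. x) \<phi>) xs"
        using prism_homotopy[of r "\<lambda>x. x" \<phi> xs] by simp
      show "\<phi> xs = cob \<psi> xs"
      proof (cases "q = 0")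
        case True
        then obtain x where "xs = [x]" using xs(2) by (cases xs) auto
        then show ?thesis using e True by (simp add: \<psi>_def)
      qed (simp add: e \<psi>_def)
    qed
  qed
qed

text \<open>The injective half of tautness: after subtracting a primitive on \<open>A\<close>, the
  cocycle vanishes on \<open>A\<close> and so bounds near \<open>A\<close>. The neighbourhood
  depends on the class.\<close>

lemma Bd_near:
  fixes \<phi> :: "'z list \<Rightarrow> 'k::field"
  assumes X: "compact_space X" "Hausdorff_space X" and A: "closedin X A"
    and \<phi>: "\<phi> \<in> Zc X {} q" "\<phi> \<in> Bd (subtopology X A) {} q"
  obtains V where "openin X V" "A \<subseteq> V" "\<And>C. closedin X C \<Longrightarrow> C \<subseteq> V \<Longrightarrow> \<phi> \<in> Bd (subtopology X C) {} q"
proof -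
  obtain \<psi> where p: "q = 0 \<longrightarrow> \<psi> = (\<lambda>_. 0)"
     "eventually (\<lambda>xs. set xs \<subseteq> A \<longrightarrow> length xs = Suc q \<longrightarrow> \<phi> xs = cob \<psi> xs) (smalls X)"
    using \<phi>(2) unfolding Bd_subtopology[OF A] by blast
  have c: "eventually (\<lambda>xs. set xs \<subseteq> topspace X \<longrightarrow> length xs = Suc (Suc q) \<longrightarrow> cob (\<lambda>xs. \<phi> xs - cob \<psi> xs) xs = 0) (smalls X)"
    using \<phi>(1) by (auto simp: Zc_def cob_minus elim: eventually_mono)
  have z: "eventually (\<lambda>xs. set xs \<subseteq> A \<longrightarrow> length xs = Suc q \<longrightarrow> \<phi> xs - cob \<psi> xs = 0) (smalls X)"
    using p(2) by (auto elim: eventually_mono)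
  obtain \<eta> V where V: "openin X V" "A \<subseteq> V" "q = 0 \<Longrightarrow> \<eta> = (\<lambda>_. 0)"
    "eventually (\<lambda>xs. set xs \<subseteq> A \<longrightarrow> length xs = q \<longrightarrow> \<eta> xs = 0) (smalls X)"
    "eventually (\<lambda>xs. set xs \<subseteq> V \<longrightarrow> length xs = Suc q \<longrightarrow> \<phi> xs - cob \<psi> xs = cob \<eta> xs) (smalls X)"
    by (rule bounds_near[OF X A openin_topspace closedin_subset[OF A] c z]) (rule that)
  show thesis
  proof
    fix C assume C: "closedin X C" "C \<subseteq> V"
    show "\<phi> \<in> Bd (subtopology X C) {} q"
      unfolding Bd_subtopology[OF C(1)]
    proof (intro exI[of _ "\<lambda>xs. \<psi> xs + \<eta> xs"] conjI impI)
      show "q = 0 \<Longrightarrow> (\<lambda>xs. \<psi> xs + \<eta> xs) = (\<lambda>_. 0)" using p(1) V(3) by simp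
      show "eventually (\<lambda>xs. set xs \<subseteq> C \<longrightarrow> length xs = q \<longrightarrow> set xs \<subseteq> {} \<longrightarrow> \<psi> xs + \<eta> xs = 0) (smalls X)"
        using eventually_smalls_topspace[of X] by (rule eventually_mono) auto
      show "eventually (\<lambda>xs. set xs \<subseteq> C \<longrightarrow> length xs = Suc q \<longrightarrow> \<phi> xs = cob (\<lambda>xs. \<psi> xs + \<eta> xs) xs) (smalls X)"
        using V(5) by (rule eventually_mono) (use C(2) in \<open>auto simp: cob_plus algebra_simps\<close>)
    qed
  qed (use V in auto)
qed

text \<open>The surjective half of tautness: pull back along a small retraction, which fixes
  \<open>A\<close> and turns small lists near \<open>A\<close> into lists in \<open>A\<close> still
  small enough for the cocycle identity.\<close>

lemma Zc_extend:
  fixes \<phi> :: "'z list \<Rightarrow> 'k::field"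
  assumes X: "compact_space X" "Hausdorff_space X" and A: "closedin X A"
    and \<phi>: "\<phi> \<in> Zc (subtopology X A) {} q"
  obtains V \<psi> where "openin X V" "A \<subseteq> V" "\<And>xs. set xs \<subseteq> A \<Longrightarrow> \<psi> xs = \<phi> xs"
    "\<And>C. closedin X C \<Longrightarrow> C \<subseteq> V \<Longrightarrow> \<psi> \<in> Zc (subtopology X C) {} q"
proof -
  have P: "eventually (\<lambda>xs. set xs \<subseteq> A \<longrightarrow> length xs = Suc (Suc q) \<longrightarrow> cob \<phi> xs = 0) (smalls X)"
    using \<phi> unfolding Zc_subtopology[OF A] by blast
  obtain r V where rV: "openin X V" "A \<subseteq> V" "\<And>x. x \<in> V \<Longrightarrow> r x \<in> A" "\<And>x. x \<in> A \<Longrightarrow> r x = x"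
    "eventually (\<lambda>xs. set xs \<subseteq> V \<longrightarrow> (\<forall>ys. ys \<noteq> [] \<longrightarrow> set ys \<subseteq> set xs \<union> r ` set xs \<longrightarrow>
       set ys \<subseteq> A \<longrightarrow> length ys = Suc (Suc q) \<longrightarrow> cob \<phi> ys = 0)) (smalls X)"
    by (rule small_retraction[OF X A P]) (rule that)
  show thesis
  proof
    show "openin X V" "A \<subseteq> V" by fact+
    show "\<phi> (map r xs) = \<phi> xs" if "set xs \<subseteq> A" for xs
      using that rV(4) by (metis map_idI subsetD)
    fix C assume C: "closedin X C" "C \<subseteq> V"
    have "eventually (\<lambda>xs. set xs \<subseteq> C \<longrightarrow> length xs = Suc (Suc q) \<longrightarrow> cob (\<lambda>xs. \<phi> (map r xs)) xs = 0) (smalls X)"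
      using rV(5)
    proof (rule eventually_mono, intro impI)
      fix xs assume *: "set xs \<subseteq> V \<longrightarrow> (\<forall>ys. ys \<noteq> [] \<longrightarrow> set ys \<subseteq> set xs \<union> r ` set xs \<longrightarrow>
         set ys \<subseteq> A \<longrightarrow> length ys = Suc (Suc q) \<longrightarrow> cob \<phi> ys = 0)"
        and xs: "set xs \<subseteq> C" "length xs = Suc (Suc q)"
      have "set xs \<subseteq> V" using xs C by blast
      then have "cob \<phi> (map r xs) = 0"
        using *[rule_format, of "map r xs"] xs rV(3) by (cases xs) auto
      then show "cob (\<lambda>xs. \<phi> (map r xs)) xs = 0" by (simp add: cob_map)
    qed
    then show "(\<lambda>xs. \<phi> (map r xs)) \<in> Zc (subtopology X C) {} q"
      by (intro Zc_absolute) (simp add: eventually_smalls_subtopology[OF C(1)])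
  qed
qed

text \<open>The cone from \<open>a\<close> contracts all cochains on lists near \<open>a\<close>.\<close>

lemma cone_at_point:
  assumes \<phi>: "eventually (\<lambda>xs. length xs = Suc (Suc q) \<longrightarrow> cob \<phi> xs = 0) (smalls X)" and a: "a \<in> topspace X"
  obtains V where "openin X V" "a \<in> V"
    "\<And>xs. set xs \<subseteq> V \<Longrightarrow> length xs = Suc q \<Longrightarrow> \<phi> xs = cob (\<lambda>ys. \<phi> (a # ys)) xs"
proof -
  obtain V where V: "openin X V" "a \<in> V"
      "\<And>xs. xs \<noteq> [] \<Longrightarrow> set xs \<subseteq> V \<Longrightarrow> length xs = Suc (Suc q) \<Longrightarrow> cob \<phi> xs = 0"
    using \<phi> a unfolding eventually_smalls_local by blast
  show thesis
  proof
    fix xs assume "set xs \<subseteq> V" "length xs = Suc q"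
    then show "\<phi> xs = cob (\<lambda>ys. \<phi> (a # ys)) xs"
      using V(3)[of "a # xs"] V(2) by auto
  qed (use V in auto)
qed

section \<open>Comparison of Cech and Alexander-Spanier cohomology\<close>

text \<open>An assignment of members of \<open>\<alpha>\<close> to points under which small lists of points become simplices of the nerve.\<close>

definition star_choice :: "'z topology \<Rightarrow> 'z set \<Rightarrow> ('z \<Rightarrow> 'w) \<Rightarrow> 'w covering \<Rightarrow> ('z \<Rightarrow> 'w set) \<Rightarrow> bool" where
  "star_choice X A g \<alpha> l \<longleftrightarrow> (\<forall>x\<in>topspace X. l x \<in> fst \<alpha>) \<and> (\<forall>x\<in>A \<inter> topspace X. l x \<in> snd \<alpha>) \<and>
     eventually (\<lambda>xs. \<forall>x\<in>set xs. \<forall>y\<in>set xs. g y \<in> l x) (smalls X)"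

lemma star_choice_vertex_map:
  assumes "star_choice X A (\<lambda>x. x) \<gamma> l" "vertex_map g \<gamma> \<alpha> \<phi>"
  shows "star_choice X A g \<alpha> (\<lambda>x. \<phi> (l x))"
  unfolding star_choice_def
proof (intro conjI ballI)
  fix x assume "x \<in> topspace X"
  then show "\<phi> (l x) \<in> fst \<alpha>" using assms unfolding star_choice_def vertex_map_def by blast
next
  fix x assume "x \<in> A \<inter> topspace X"
  then show "\<phi> (l x) \<in> snd \<alpha>" using assms unfolding star_choice_def vertex_map_def by blast
next
  have "eventually (\<lambda>xs. \<forall>x\<in>set xs. \<forall>y\<in>set xs. y \<in> l x) (smalls X)"
    using assms(1) by (simp add: star_choice_def)
  with eventually_smalls_topspace[of X] show "eventually (\<lambda>xs. \<forall>x\<in>set xs. \<forall>y\<in>set xs. g y \<in> \<phi> (l x)) (smalls X)"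
  proof (rule eventually_elim2, intro ballI)
    fix xs x y assume "xs \<noteq> [] \<and> set xs \<subseteq> topspace X" "\<forall>x\<in>set xs. \<forall>y\<in>set xs. y \<in> l x" "x \<in> set xs" "y \<in> set xs"
    then have "y \<in> l x" "l x \<in> fst \<gamma>" using assms(1) by (auto simp: star_choice_def)
    then show "g y \<in> \<phi> (l x)" using assms(2) by (auto simp: vertex_map_def)
  qed
qed

lemma star_choice_compose:
  assumes "star_choice Y B (\<lambda>x. x) \<alpha> l" "continuous_map X Y g" "g ` (A \<inter> topspace X) \<subseteq> B"
  shows "star_choice X A g \<alpha> (\<lambda>x. l (g x))"
proof -
  have gX: "g x \<in> topspace Y" if "x \<in> topspace X" for x
    using assms(2) that by (auto simp: continuous_map_def Pi_iff)
  have "eventually (\<lambda>xs. \<forall>x\<in>set xs. \<forall>y\<in>set xs. y \<in> l x) (smalls Y)"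
    using assms(1) by (simp add: star_choice_def)
  from eventually_smalls_map[OF assms(2) this]
  have "eventually (\<lambda>xs. \<forall>x\<in>set xs. \<forall>y\<in>set xs. g y \<in> l (g x)) (smalls X)" by simp
  then show ?thesis using assms(1,3) gX unfolding star_choice_def by blast
qed

lemma nerve_mono: "\<U>' \<subseteq> \<U> \<Longrightarrow> nerve \<U>' A q \<subseteq> nerve \<U> UNIV q"
  by (auto simp: nerve_def)

lemma nerve_face: "\<sigma> \<in> nerve \<U> A (Suc q) \<Longrightarrow> set \<tau> \<subseteq> set \<sigma> \<Longrightarrow> length \<tau> = Suc q \<Longrightarrow> \<tau> \<in> nerve \<U> A q"
  unfolding nerve_def by blast

lemma coboundary_nerve:
  assumes "\<sigma> \<in> nerve (fst \<alpha>) UNIV (Suc q)"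
  shows "coboundary \<alpha> q c \<sigma> = cob c \<sigma>"
proof -
  have "length \<sigma> = Suc (Suc q)" using assms by (simp add: nerve_def)
  then show ?thesis using assms by (simp add: coboundary_def cob_sum)
qed

lemma cocycles_iff:
  "c \<in> cocycles A \<alpha> q \<longleftrightarrow> c \<in> cochains A \<alpha> q \<and> (\<forall>\<sigma> \<in> nerve (fst \<alpha>) UNIV (Suc q). cob c \<sigma> = 0)"
proof -
  have "coboundary \<alpha> q c = (\<lambda>_. 0) \<longleftrightarrow> (\<forall>\<sigma> \<in> nerve (fst \<alpha>) UNIV (Suc q). cob c \<sigma> = 0)"
    using coboundary_nerve[of _ \<alpha> q c] by (auto simp: fun_eq_iff) (auto simp: coboundary_def)
  then show ?thesis by (simp add: cocycles_def)
qed

lemma star_choice_nerve: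
  assumes "star_choice X A g \<alpha> l" "star_choice X A g \<alpha> m"
  shows "eventually (\<lambda>xs. \<forall>ys. length ys = Suc q \<longrightarrow> set ys \<subseteq> l ` set xs \<union> m ` set xs \<longrightarrow>
           ys \<in> nerve (fst \<alpha>) UNIV q) (smalls X)"
    and "g ` (A \<inter> topspace X) \<subseteq> B \<Longrightarrow>
       eventually (\<lambda>xs. set xs \<subseteq> A \<longrightarrow> (\<forall>ys. length ys = Suc q \<longrightarrow> set ys \<subseteq> l ` set xs \<union> m ` set xs \<longrightarrow>
           ys \<in> nerve (snd \<alpha>) B q)) (smalls X)"
proof -
  have l: "\<And>x. x \<in> topspace X \<Longrightarrow> l x \<in> fst \<alpha>" "\<And>x. x \<in> topspace X \<Longrightarrow> m x \<in> fst \<alpha>"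
    "\<And>x. x \<in> topspace X \<Longrightarrow> x \<in> A \<Longrightarrow> l x \<in> snd \<alpha>" "\<And>x. x \<in> topspace X \<Longrightarrow> x \<in> A \<Longrightarrow> m x \<in> snd \<alpha>"
    using assms by (auto simp: star_choice_def)
  have "eventually (\<lambda>xs. (\<forall>x\<in>set xs. \<forall>y\<in>set xs. g y \<in> l x) \<and> (\<forall>x\<in>set xs. \<forall>y\<in>set xs. g y \<in> m x)) (smalls X)"
    using assms unfolding star_choice_def by (intro eventually_conj) auto
  from eventually_conj[OF eventually_smalls_topspace this]
  have ev: "eventually (\<lambda>xs. xs \<noteq> [] \<and> set xs \<subseteq> topspace X \<and> (\<forall>x\<in>set xs. \<forall>y\<in>set xs. g y \<in> l x \<and> g y \<in> m x)) (smalls X)"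
    by (rule eventually_mono) blast
  have hd: "g (hd xs) \<in> \<Inter>(set ys)"
    if "xs \<noteq> []" "\<forall>x\<in>set xs. \<forall>y\<in>set xs. g y \<in> l x \<and> g y \<in> m x" "set ys \<subseteq> l ` set xs \<union> m ` set xs" for xs ys
    using that hd_in_set[OF that(1)] by blast
  show "eventually (\<lambda>xs. \<forall>ys. length ys = Suc q \<longrightarrow> set ys \<subseteq> l ` set xs \<union> m ` set xs \<longrightarrow>
           ys \<in> nerve (fst \<alpha>) UNIV q) (smalls X)"
    using ev
  proof (rule eventually_mono, intro allI impI)
    fix xs ys assume xs: "xs \<noteq> [] \<and> set xs \<subseteq> topspace X \<and> (\<forall>x\<in>set xs. \<forall>y\<in>set xs. g y \<in> l x \<and> g y \<in> m x)"
      and ys: "length ys = Suc q" "set ys \<subseteq> l ` set xs \<union> m ` set xs"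
    have "set ys \<subseteq> fst \<alpha>" using ys(2) xs l by blast
    then show "ys \<in> nerve (fst \<alpha>) UNIV q" using hd[of xs ys] xs ys unfolding nerve_def by blast
  qed
  assume gB: "g ` (A \<inter> topspace X) \<subseteq> B"
  show "eventually (\<lambda>xs. set xs \<subseteq> A \<longrightarrow> (\<forall>ys. length ys = Suc q \<longrightarrow> set ys \<subseteq> l ` set xs \<union> m ` set xs \<longrightarrow>
           ys \<in> nerve (snd \<alpha>) B q)) (smalls X)"
    using ev
  proof (rule eventually_mono, intro allI impI)
    fix xs ys assume xs: "xs \<noteq> [] \<and> set xs \<subseteq> topspace X \<and> (\<forall>x\<in>set xs. \<forall>y\<in>set xs. g y \<in> l x \<and> g y \<in> m x)"
      and A: "set xs \<subseteq> A" and ys: "length ys = Suc q" "set ys \<subseteq> l ` set xs \<union> m ` set xs"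
    have 1: "set ys \<subseteq> snd \<alpha>" using ys(2) xs l A by blast
    have "hd xs \<in> A \<inter> topspace X" using A xs hd_in_set[of xs] by blast
    then have "g (hd xs) \<in> B" using gB by blast
    moreover have "g (hd xs) \<in> \<Inter>(set ys)" using hd[of xs ys] xs ys(2) by blast
    ultimately show "ys \<in> nerve (snd \<alpha>) B q" using 1 ys(1) unfolding nerve_def by blast
  qed
qed

text \<open>Over a small list the members chosen by \<open>l\<close> and by \<open>m\<close> have a
  common point, so together they span a simplex: the two choices are contiguous and the prism
  applies.\<close>

lemma star_choices_cohomologous:
  assumes l: "star_choice X A g \<alpha> l" "star_choice X A g \<alpha> m" and gB: "g ` (A \<inter> topspace X) \<subseteq> B"
    and c: "c \<in> cocycles B \<alpha> q"
  shows "(\<lambda>xs. c (map m xs) - c (map l xs)) \<in> Bd X A q"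
proof (rule homotopic_Bd)
  show "eventually (\<lambda>xs. \<forall>ys. length ys = Suc (Suc q) \<longrightarrow> set ys \<subseteq> l ` set xs \<union> m ` set xs \<longrightarrow> cob c ys = 0) (smalls X)"
    using star_choice_nerve(1)[OF l, of "Suc q"] by (rule eventually_mono) (use c in \<open>auto simp: cocycles_iff\<close>)
  show "eventually (\<lambda>xs. set xs \<subseteq> A \<longrightarrow> (\<forall>ys. length ys = Suc q \<longrightarrow> set ys \<subseteq> l ` set xs \<union> m ` set xs \<longrightarrow> c ys = 0)) (smalls X)"
    using star_choice_nerve(2)[OF l gB, of q] by (rule eventually_mono) (use c in \<open>auto simp: cocycles_iff cochains_def\<close>)
qed

lemma cocycle_pulled_to_points:
  assumes l: "star_choice X A g \<alpha> l" and gB: "g ` (A \<inter> topspace X) \<subseteq> B" and c: "c \<in> cocycles B \<alpha> q"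
  shows "(\<lambda>xs. c (map l xs)) \<in> Zc X A q"
proof (rule ZcI)
  show "eventually (\<lambda>xs. length xs = Suc (Suc q) \<longrightarrow> cob (\<lambda>xs. c (map l xs)) xs = 0) (smalls X)"
    unfolding cob_map
    using star_choice_nerve(1)[OF l l, of "Suc q"] by (rule eventually_mono) (use c in \<open>auto simp: cocycles_iff\<close>)
  show "eventually (\<lambda>xs. length xs = Suc q \<longrightarrow> set xs \<subseteq> A \<longrightarrow> c (map l xs) = 0) (smalls X)"
    using star_choice_nerve(2)[OF l l gB, of q] by (rule eventually_mono) (use c in \<open>auto simp: cocycles_iff cochains_def\<close>)
qed

lemma coboundary_pulled_to_points:
  assumes l: "star_choice X A (\<lambda>x. x) \<gamma> l" and e: "e \<in> coboundaries A \<gamma> q"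
  shows "(\<lambda>xs. e (map l xs)) \<in> Bd X A q"
proof (cases q)
  case 0
  then have "e = (\<lambda>_. 0)" using e by (simp add: coboundaries_def)
  then show ?thesis using fvs.subspace_0[OF subspace_Bd[of X A q]] by (simp add: zero_fun_def)
next
  case (Suc p)
  then obtain b where b: "b \<in> cochains A \<gamma> p" "e = coboundary \<gamma> p b"
    using e by (auto simp: coboundaries_def)
  show ?thesis
  proof (rule BdI[of _ "\<lambda>xs. b (map l xs)"])
    have "eventually (\<lambda>xs. set xs \<subseteq> A \<longrightarrow> (\<forall>ys. length ys = Suc p \<longrightarrow> set ys \<subseteq> l ` set xs \<union> l ` set xs \<longrightarrow>
           ys \<in> nerve (snd \<gamma>) A p)) (smalls X)" by (rule star_choice_nerve(2)[OF l l]) auto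
    then show "eventually (\<lambda>xs. length xs = q \<longrightarrow> set xs \<subseteq> A \<longrightarrow> b (map l xs) = 0) (smalls X)"
      by (rule eventually_mono) (use b Suc in \<open>auto simp: cochains_def\<close>)
    show "eventually (\<lambda>xs. length xs = Suc q \<longrightarrow> e (map l xs) = cob (\<lambda>xs. b (map l xs)) xs) (smalls X)"
      unfolding cob_map
      using star_choice_nerve(1)[OF l l, of q] by (rule eventually_mono) (use b Suc coboundary_nerve[of _ \<gamma> p b] in auto)
  qed (use Suc in simp)
qed

lemma pull_cocycle:
  assumes "vertex_map g \<gamma> \<alpha> \<phi>" "g ` A \<subseteq> B" "c \<in> cocycles B \<alpha> q" "snd \<gamma> \<subseteq> fst \<gamma>"
  shows "pull_cochain \<gamma> q \<phi> c \<in> cocycles A \<gamma> q"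
  unfolding cocycles_iff
proof (intro conjI ballI)
  have n1: "map \<phi> \<tau> \<in> nerve (fst \<alpha>) UNIV m" if "\<tau> \<in> nerve (fst \<gamma>) UNIV m" for \<tau> m
  proof -
    have "\<Inter>(set \<tau>) \<noteq> {}" using that by (auto simp: nerve_def)
    then obtain y where "y \<in> \<Inter>(set \<tau>)" by blast
    then have "g y \<in> \<Inter>(set (map \<phi> \<tau>))" "set (map \<phi> \<tau>) \<subseteq> fst \<alpha>"
      using that assms(1) by (fastforce simp: nerve_def vertex_map_def)+
    then show ?thesis using that unfolding nerve_def by auto
  qed
  have n2: "map \<phi> \<tau> \<in> nerve (snd \<alpha>) B m" if "\<tau> \<in> nerve (snd \<gamma>) A m" for \<tau> m
  proof -
    have "A \<inter> \<Inter>(set \<tau>) \<noteq> {}" using that by (auto simp: nerve_def)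
    then obtain y where "y \<in> A" "y \<in> \<Inter>(set \<tau>)" by blast
    then have "g y \<in> B" "g y \<in> \<Inter>(set (map \<phi> \<tau>))" "set (map \<phi> \<tau>) \<subseteq> snd \<alpha>"
      using that assms(1,2,4) by (fastforce simp: nerve_def vertex_map_def)+
    then show ?thesis using that unfolding nerve_def by auto
  qed
  show "pull_cochain \<gamma> q \<phi> c \<in> cochains A \<gamma> q"
    using n2 assms(3) by (auto simp: cochains_def pull_cochain_def cocycles_iff)
  fix \<sigma> assume s: "\<sigma> \<in> nerve (fst \<gamma>) UNIV (Suc q)"
  have "cob (pull_cochain \<gamma> q \<phi> c) \<sigma> = cob (\<lambda>\<tau>. c (map \<phi> \<tau>)) \<sigma>"
  proof (rule cob_cong)
    fix ys assume "set ys \<subseteq> set \<sigma>" "length \<sigma> = Suc (length ys)"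
    then have "ys \<in> nerve (fst \<gamma>) UNIV q" using nerve_face[OF s, of ys] s by (auto simp: nerve_def)
    then show "pull_cochain \<gamma> q \<phi> c ys = c (map \<phi> ys)" by (simp add: pull_cochain_def)
  qed
  then show "cob (pull_cochain \<gamma> q \<phi> c) \<sigma> = 0"
    using n1[OF s] assms(3) by (simp add: cob_map cocycles_iff)
qed

text \<open>The dictionary between the two theories: a nerve cocycle and a point cocycle correspond
  if evaluating the former on chosen members of the covering gives the latter up to a coboundary.
  One star choice suffices, as all of them are cohomologous.\<close>

definition represents :: "'z topology \<Rightarrow> 'z set \<Rightarrow> nat \<Rightarrow> 'z covering \<times> ('z set list \<Rightarrow> 'k::field) \<Rightarrow>
    ('z list \<Rightarrow> 'k) \<Rightarrow> bool" where
  "represents X A q p \<phi> \<longleftrightarrow> p \<in> cech_cocycles X A q \<and> \<phi> \<in> Zc X A q \<and>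
     (\<exists>l. star_choice X A (\<lambda>x. x) (fst p) l \<and> (\<lambda>xs. snd p (map l xs)) - \<phi> \<in> Bd X A q)"

locale compact_pair =
  fixes X :: "'z topology" and A :: "'z set"
  assumes compact: "compact_space X" and Hausdorff: "Hausdorff_space X" and closed: "closedin X A"
begin

lemma A_subset: "A \<subseteq> topspace X" using closed by (rule closedin_subset)

text \<open>Members outside the subfamily are first cut down to the complement of \<open>A\<close>.
  A star around a point of \<open>A\<close> can then only fit into a member of the
  subfamily.\<close>

lemma star_choice_exists:
  assumes "\<alpha> \<in> coverings X A"
  obtains l where "star_choice X A (\<lambda>x. x) \<alpha> l"
proof -
  have a: "\<And>U. U \<in> fst \<alpha> \<Longrightarrow> openin X U" "\<Union>(fst \<alpha>) = topspace X" "snd \<alpha> \<subseteq> fst \<alpha>" "A \<subseteq> \<Union>(snd \<alpha>)"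
    using assms by (simp_all add: coverings_def case_prod_unfold)
  have "open_cover X (snd \<alpha> \<union> (\<lambda>U. U - A) ` fst \<alpha>)"
    unfolding open_cover_def
  proof
    show "\<forall>U\<in>snd \<alpha> \<union> (\<lambda>U. U - A) ` fst \<alpha>. openin X U"
      using a closed by (auto intro: openin_diff)
    have "\<Union>(snd \<alpha> \<union> (\<lambda>U. U - A) ` fst \<alpha>) = \<Union>(snd \<alpha>) \<union> (\<Union>(fst \<alpha>) - A)" by blast
    also have "\<dots> = topspace X"
      using Union_mono[OF a(3)] unfolding a(2) using a(4) A_subset by blast
    finally show "\<Union>(snd \<alpha> \<union> (\<lambda>U. U - A) ` fst \<alpha>) = topspace X" .
  qed
  then obtain \<V> where V: "open_cover X \<V>"
    "\<And>x. x \<in> topspace X \<Longrightarrow> \<exists>U\<in>snd \<alpha> \<union> (\<lambda>U. U - A) ` fst \<alpha>. \<Union>{V \<in> \<V>. x \<in> V} \<subseteq> U"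
    by (rule barycentric_refinement[OF compact Hausdorff]) (rule that)
  have "\<exists>U\<in>fst \<alpha>. \<Union>{V \<in> \<V>. x \<in> V} \<subseteq> U \<and> (x \<in> A \<longrightarrow> U \<in> snd \<alpha>)" if x: "x \<in> topspace X" for x
  proof -
    obtain U where U: "U \<in> snd \<alpha> \<union> (\<lambda>U. U - A) ` fst \<alpha>" "\<Union>{V \<in> \<V>. x \<in> V} \<subseteq> U"
      using V(2)[OF x] by (elim bexE) (rule that)
    have "x \<in> \<Union>{V \<in> \<V>. x \<in> V}" using V(1) x unfolding open_cover_def by blast
    then have "x \<in> U" using U(2) by (rule subsetD[rotated])
    then have "U \<in> fst \<alpha> \<and> (x \<in> A \<longrightarrow> U \<in> snd \<alpha>) \<or> (\<exists>U'\<in>fst \<alpha>. U = U' - A \<and> x \<notin> A)"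
      using U(1) a(3) by blast
    then show ?thesis
    proof
      assume "\<exists>U'\<in>fst \<alpha>. U = U' - A \<and> x \<notin> A"
      then obtain U' where "U' \<in> fst \<alpha>" "U \<subseteq> U'" "x \<notin> A" by blast
      then show ?thesis using order.trans[OF U(2)] by (intro bexI[of _ U']) simp_all
    qed (use U(2) in \<open>intro bexI[of _ U], simp_all\<close>)
  qed
  then obtain l where l: "\<And>x. x \<in> topspace X \<Longrightarrow> l x \<in> fst \<alpha> \<and> \<Union>{V \<in> \<V>. x \<in> V} \<subseteq> l x \<and> (x \<in> A \<longrightarrow> l x \<in> snd \<alpha>)"
    by metis
  have "eventually (\<lambda>xs. \<forall>x\<in>set xs. \<forall>y\<in>set xs. y \<in> l x) (smalls X)"
    unfolding eventually_smalls
  proof (intro exI[of _ \<V>] conjI V(1) ballI allI impI)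
    fix V xs x y assume *: "V \<in> \<V>" "xs \<noteq> []" "set xs \<subseteq> V" "x \<in> set xs" "y \<in> set xs"
    then have "x \<in> topspace X" using V(1) unfolding open_cover_def by blast
    then show "y \<in> l x" using l * by blast
  qed
  then have "star_choice X A (\<lambda>x. x) \<alpha> l" using l by (auto simp: star_choice_def)
  then show thesis by (rule that)
qed

text \<open>Conversely, base points in the members of a fine covering turn simplices into small lists of points.\<close>

lemma base_points_exist:
  assumes "eventually P (smalls X)"
  obtains \<gamma> b where "\<gamma> \<in> coverings X A" "\<And>V. V \<in> fst \<gamma> \<Longrightarrow> b V \<in> V" "\<And>V. V \<in> snd \<gamma> \<Longrightarrow> b V \<in> A"
    "\<And>\<sigma> Y ys. \<sigma> \<noteq> [] \<Longrightarrow> set \<sigma> \<subseteq> fst \<gamma> \<Longrightarrow> Y \<subseteq> \<Inter>(set \<sigma>) \<Longrightarrow> Y \<noteq> {} \<Longrightarrow> ys \<noteq> [] \<Longrightarrow>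
       set ys \<subseteq> Y \<union> b ` set \<sigma> \<Longrightarrow> P ys"
proof -
  obtain \<V> where V: "open_cover X \<V>"
    "\<And>x ys. x \<in> topspace X \<Longrightarrow> ys \<noteq> [] \<Longrightarrow> set ys \<subseteq> \<Union>{V \<in> \<V>. x \<in> V} \<Longrightarrow> P ys"
    by (rule smalls_barycentric[OF compact Hausdorff assms]) (rule that)
  \<comment> \<open>The empty set has no base point and is removed; the members meeting
    \<open>A\<close> form the subfamily and receive base points in \<open>A\<close>.\<close>
  define \<gamma> where "\<gamma> = (\<V> - {{}}, {V \<in> \<V>. V \<inter> A \<noteq> {}})"
  define b where "b = (\<lambda>V. if V \<inter> A \<noteq> {} then SOME x. x \<in> V \<inter> A else SOME x. x \<in> V)"
  have b1: "b V \<in> V \<inter> A" if "V \<inter> A \<noteq> {}" for V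
    using that someI_ex[of "\<lambda>x. x \<in> V \<inter> A"] unfolding b_def by auto
  have b2: "b V \<in> V" if "V \<noteq> {}" for V
    using b1[of V] that someI_ex[of "\<lambda>x. x \<in> V"] unfolding b_def by (cases "V \<inter> A = {}") auto
  show thesis
  proof (rule that)
    show "\<gamma> \<in> coverings X A"
    proof -
      have "A \<subseteq> \<Union>{V \<in> \<V>. V \<inter> A \<noteq> {}}"
      proof
        fix a assume "a \<in> A"
        moreover from this obtain V where "V \<in> \<V>" "a \<in> V"
          using V(1) A_subset unfolding open_cover_def by blast
        ultimately show "a \<in> \<Union>{V \<in> \<V>. V \<inter> A \<noteq> {}}" by blast
      qed
      then show ?thesis using V(1) unfolding \<gamma>_def coverings_def open_cover_def by auto
    qed
    show "b V \<in> V" if "V \<in> fst \<gamma>" for V using that b2 by (simp add: \<gamma>_def)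
    show "b V \<in> A" if "V \<in> snd \<gamma>" for V using that b1[of V] by (auto simp: \<gamma>_def)
    show "P ys" if s: "\<sigma> \<noteq> []" "set \<sigma> \<subseteq> fst \<gamma>" "Y \<subseteq> \<Inter>(set \<sigma>)" "Y \<noteq> {}" "ys \<noteq> []" "set ys \<subseteq> Y \<union> b ` set \<sigma>" for \<sigma> Y ys
    proof -
      obtain y where y: "y \<in> Y" using s(4) by blast
      have mem: "V \<in> \<V>" "y \<in> V" "b V \<in> V" "Y \<subseteq> V" if "V \<in> set \<sigma>" for V
        using that s y b2[of V] by (auto simp: \<gamma>_def)
      obtain V0 where V0: "V0 \<in> set \<sigma>" using s(1) by (cases \<sigma>) auto
      have yX: "y \<in> topspace X" using mem[OF V0] V(1) unfolding open_cover_def by blast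
      have "Y \<subseteq> \<Union>{V \<in> \<V>. y \<in> V}" using mem[OF V0] by blast
      moreover have "b ` set \<sigma> \<subseteq> \<Union>{V \<in> \<V>. y \<in> V}"
      proof (rule image_subsetI)
        fix V assume "V \<in> set \<sigma>"
        from mem[OF this] show "b V \<in> \<Union>{V \<in> \<V>. y \<in> V}" by blast
      qed
      ultimately have "Y \<union> b ` set \<sigma> \<subseteq> \<Union>{V \<in> \<V>. y \<in> V}" by (rule Un_least)
      with s(6) have "set ys \<subseteq> \<Union>{V \<in> \<V>. y \<in> V}" by (rule order.trans)
      then show "P ys" by (rule V(2)[OF yX s(5)])
    qed
  qed
qed

lemma Bd_diff_trans: "\<phi> - \<psi> \<in> Bd X A q \<Longrightarrow> \<psi> - \<eta> \<in> Bd X A q \<Longrightarrow> \<phi> - \<eta> \<in> Bd X A q"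
  using fvs.subspace_add[OF subspace_Bd, of "\<phi> - \<psi>" X A q "\<psi> - \<eta>"] by simp

lemma Bd_diff_sym: "\<phi> - \<psi> \<in> Bd X A q \<Longrightarrow> \<psi> - \<phi> \<in> Bd X A q"
  using fvs.subspace_neg[OF subspace_Bd, of "\<phi> - \<psi>" X A q] by simp

lemma representsD:
  assumes "represents X A q p \<phi>" "star_choice X A (\<lambda>x. x) (fst p) m"
  shows "(\<lambda>xs. snd p (map m xs)) - \<phi> \<in> Bd X A q"
proof -
  obtain l where l: "star_choice X A (\<lambda>x. x) (fst p) l" "(\<lambda>xs. snd p (map l xs)) - \<phi> \<in> Bd X A q"
    using assms(1) by (auto simp: represents_def)
  have "snd p \<in> cocycles A (fst p) q"
    using assms(1) by (auto simp: represents_def cech_cocycles_def)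
  then have "(\<lambda>xs. snd p (map m xs)) - (\<lambda>xs. snd p (map l xs)) \<in> Bd X A q"
    using star_choices_cohomologous[OF l(1) assms(2), of A] by (simp add: fun_diff_def)
  then show ?thesis using l(2) by (rule Bd_diff_trans)
qed

lemma represents_unique:
  assumes "represents X A q p \<phi>" "represents X A q p \<psi>"
  shows "\<phi> - \<psi> \<in> Bd X A q"
proof -
  obtain l where l: "star_choice X A (\<lambda>x. x) (fst p) l" "(\<lambda>xs. snd p (map l xs)) - \<phi> \<in> Bd X A q"
    using assms(1) by (auto simp: represents_def)
  show ?thesis using Bd_diff_trans[OF Bd_diff_sym[OF l(2)] representsD[OF assms(2) l(1)]] .
qed

lemma represents_cong:
  assumes "represents X A q p \<phi>" "\<psi> \<in> Zc X A q" "\<phi> - \<psi> \<in> Bd X A q"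
  shows "represents X A q p \<psi>"
  using assms Bd_diff_trans unfolding represents_def by blast

lemma represents_exists:
  assumes "p \<in> cech_cocycles X A q"
  obtains \<phi> where "represents X A q p \<phi>"
proof -
  have p: "fst p \<in> coverings X A" "snd p \<in> cocycles A (fst p) q"
    using assms by (auto simp: cech_cocycles_def)
  obtain l where l: "star_choice X A (\<lambda>x. x) (fst p) l" by (rule star_choice_exists[OF p(1)])
  have "(\<lambda>xs. snd p (map l xs)) \<in> Zc X A q" by (rule cocycle_pulled_to_points[OF l _ p(2)]) auto
  moreover have "(\<lambda>xs. snd p (map l xs)) - (\<lambda>xs. snd p (map l xs)) \<in> Bd X A q"
    using fvs.subspace_0[OF subspace_Bd[of X A q]] by simp
  ultimately have "represents X A q p (\<lambda>xs. snd p (map l xs))"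
    using assms l unfolding represents_def by blast
  then show thesis by (rule that)
qed

lemma coverings_snd: "\<alpha> \<in> coverings X A \<Longrightarrow> snd \<alpha> \<subseteq> fst \<alpha>" by (auto simp: coverings_def)

end

text \<open>Choosing a member upstairs and applying the vertex map, or applying \<open>g\<close> and
  choosing downstairs, are two star choices over \<open>g\<close>, hence cohomologous.\<close>

lemma represents_map:
  assumes XA: "compact_pair X A" and YB: "compact_pair Y B"
    and g: "continuous_map X Y g" "g ` A \<subseteq> B"
    and r: "represents Y B q (\<alpha>, c) \<phi>" and \<gamma>: "\<gamma> \<in> coverings X A" "vertex_map g \<gamma> \<alpha> \<theta>"
  shows "represents X A q (\<gamma>, pull_cochain \<gamma> q \<theta> c) (\<lambda>xs. \<phi> (map g xs))"
proof -
  interpret X: compact_pair X A by fact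
  interpret Y: compact_pair Y B by fact
  have g': "g ` (A \<inter> topspace X) \<subseteq> B" using g(2) by blast
  have \<alpha>: "\<alpha> \<in> coverings Y B" "c \<in> cocycles B \<alpha> q" "\<phi> \<in> Zc Y B q"
    using r by (auto simp: represents_def cech_cocycles_def)
  obtain l where l: "star_choice X A (\<lambda>x. x) \<gamma> l" by (rule X.star_choice_exists[OF \<gamma>(1)])
  obtain m where m: "star_choice Y B (\<lambda>x. x) \<alpha> m" by (rule Y.star_choice_exists[OF \<alpha>(1)])
  have pc: "pull_cochain \<gamma> q \<theta> c \<in> cocycles A \<gamma> q"
    by (rule pull_cocycle[OF \<gamma>(2) g(2) \<alpha>(2) X.coverings_snd[OF \<gamma>(1)]])
  have 1: "(\<lambda>xs. c (map m (map g xs))) - (\<lambda>xs. \<phi> (map g xs)) \<in> Bd X A q"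
    using Bd_map[OF g(1) g' Y.representsD[OF r, of m]] m by (simp add: fun_diff_def)
  have "(\<lambda>xs. c (map (\<lambda>x. \<theta> (l x)) xs) - c (map (\<lambda>x. m (g x)) xs)) \<in> Bd X A q"
    by (rule star_choices_cohomologous[OF star_choice_compose[OF m g(1) g'] star_choice_vertex_map[OF l \<gamma>(2)] g' \<alpha>(2)])
  then have 2: "(\<lambda>xs. c (map (\<lambda>x. \<theta> (l x)) xs)) - (\<lambda>xs. c (map m (map g xs))) \<in> Bd X A q"
    by (simp add: fun_diff_def comp_def)
  have "eventually (\<lambda>xs. \<forall>ys. length ys = Suc q \<longrightarrow> set ys \<subseteq> l ` set xs \<union> l ` set xs \<longrightarrow>
           ys \<in> nerve (fst \<gamma>) UNIV q) (smalls X)" by (rule star_choice_nerve(1)[OF l l])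
  then have "eventually (\<lambda>xs. length xs = Suc q \<longrightarrow> pull_cochain \<gamma> q \<theta> c (map l xs) = c (map (\<lambda>x. \<theta> (l x)) xs)) (smalls X)"
    by (rule eventually_mono) (auto simp: pull_cochain_def comp_def)
  then have 3: "(\<lambda>xs. pull_cochain \<gamma> q \<theta> c (map l xs)) - (\<lambda>xs. c (map (\<lambda>x. \<theta> (l x)) xs)) \<in> Bd X A q"
    by (rule small_eq_imp_Bd)
  have "(\<lambda>xs. pull_cochain \<gamma> q \<theta> c (map l xs)) - (\<lambda>xs. \<phi> (map g xs)) \<in> Bd X A q"
    using X.Bd_diff_trans[OF 3 X.Bd_diff_trans[OF 2 1]] .
  moreover have "(\<lambda>xs. \<phi> (map g xs)) \<in> Zc X A q" by (rule Zc_map[OF g(1) g' \<alpha>(3)])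
  ultimately show ?thesis using l pc \<gamma>(1) by (auto simp: represents_def cech_cocycles_def)
qed

context compact_pair
begin

text \<open>On the refinement witnessing the relation the two cocycles differ by a coboundary of the
  nerve, which becomes a coboundary on points.\<close>

lemma cech_rel_imp:
  assumes "(p, p') \<in> cech_rel X A q" "represents X A q p \<phi>"
  shows "represents X A q p' \<phi>"
proof -
  obtain \<alpha> c \<beta> d where p: "p = (\<alpha>, c)" "p' = (\<beta>, d)" by (cases p, cases p')
  obtain \<gamma> \<theta> \<rho> where \<gamma>: "\<gamma> \<in> coverings X A" "vertex_map id \<gamma> \<alpha> \<theta>" "vertex_map id \<gamma> \<beta> \<rho>"
    "(\<lambda>\<sigma>. pull_cochain \<gamma> q \<theta> c \<sigma> - pull_cochain \<gamma> q \<rho> d \<sigma>) \<in> coboundaries A \<gamma> q" and p': "p' \<in> cech_cocycles X A q"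
    using assms(1) unfolding cech_rel_def p by auto
  obtain \<psi> where \<psi>: "represents X A q p' \<psi>" by (rule represents_exists[OF p'])
  have id: "continuous_map X X id" "id ` A \<subseteq> A" by auto
  have 1: "represents X A q (\<gamma>, pull_cochain \<gamma> q \<theta> c) \<phi>"
    using represents_map[OF compact_pair_axioms compact_pair_axioms id assms(2)[unfolded p] \<gamma>(1,2)] by simp
  have 2: "represents X A q (\<gamma>, pull_cochain \<gamma> q \<rho> d) \<psi>"
    using represents_map[OF compact_pair_axioms compact_pair_axioms id \<psi>[unfolded p] \<gamma>(1,3)] by simp
  obtain l where l: "star_choice X A (\<lambda>x. x) \<gamma> l" by (rule star_choice_exists[OF \<gamma>(1)])
  have 3: "(\<lambda>xs. pull_cochain \<gamma> q \<theta> c (map l xs)) - (\<lambda>xs. pull_cochain \<gamma> q \<rho> d (map l xs)) \<in> Bd X A q"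
    using coboundary_pulled_to_points[OF l \<gamma>(4)] by (simp add: fun_diff_def)
  have "(\<lambda>xs. pull_cochain \<gamma> q \<theta> c (map l xs)) - \<phi> \<in> Bd X A q"
    "(\<lambda>xs. pull_cochain \<gamma> q \<rho> d (map l xs)) - \<psi> \<in> Bd X A q"
    using representsD[OF 1, of l] representsD[OF 2, of l] l by simp_all
  then have "\<psi> - \<phi> \<in> Bd X A q"
    using Bd_diff_trans Bd_diff_sym 3 by metis
  moreover have "\<phi> \<in> Zc X A q" using assms(2) by (simp add: represents_def)
  ultimately show ?thesis using represents_cong \<psi> by blast
qed

text \<open>Composing base points with the star choices \<open>l\<close> and \<open>m\<close>
  exhibits a fine covering as a refinement of both coverings. The primitive on points, evaluated at
  base points, is then a primitive on its nerve.\<close>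

lemma represents_imp_cech_rel:
  fixes \<phi> :: "'z list \<Rightarrow> 'k::field"
  assumes "represents X A q p \<phi>" "represents X A q p' \<phi>"
  shows "(p, p') \<in> cech_rel X A q"
proof -
  obtain \<alpha> c \<beta> d where p: "p = (\<alpha>, c)" "p' = (\<beta>, d)" by (cases p, cases p')
  have pc: "p \<in> cech_cocycles X A q" "p' \<in> cech_cocycles X A q" using assms by (auto simp: represents_def)
  obtain l where l: "star_choice X A (\<lambda>x. x) \<alpha> l" "(\<lambda>xs. c (map l xs)) - \<phi> \<in> Bd X A q"
    using assms(1) by (auto simp: represents_def p)
  obtain m where m: "star_choice X A (\<lambda>x. x) \<beta> m" "(\<lambda>xs. d (map m xs)) - \<phi> \<in> Bd X A q"
    using assms(2) by (auto simp: represents_def p)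
  obtain \<psi> where \<psi>: "q = 0 \<longrightarrow> \<psi> = (\<lambda>_. 0)"
    "eventually (\<lambda>xs. length xs = q \<longrightarrow> set xs \<subseteq> A \<longrightarrow> \<psi> xs = 0) (smalls X)"
    "eventually (\<lambda>xs. length xs = Suc q \<longrightarrow> ((\<lambda>xs. c (map l xs)) - (\<lambda>xs. d (map m xs))) xs = cob \<psi> xs) (smalls X)"
    using Bd_diff_trans[OF l(2) Bd_diff_sym[OF m(2)]] by (rule BdE)
  define P where "P = (\<lambda>xs. (length xs = q \<longrightarrow> set xs \<subseteq> A \<longrightarrow> \<psi> xs = 0) \<and>
     (length xs = Suc q \<longrightarrow> c (map l xs) - d (map m xs) = cob \<psi> xs) \<and>
     (\<forall>x\<in>set xs. \<forall>y\<in>set xs. y \<in> l x) \<and> (\<forall>x\<in>set xs. \<forall>y\<in>set xs. y \<in> m x))"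
  have P: "eventually P (smalls X)"
    unfolding P_def using \<psi>(2,3) l(1) m(1) by (intro eventually_conj) (auto simp: star_choice_def)
  obtain \<gamma> b where \<gamma>: "\<gamma> \<in> coverings X A" "\<And>V. V \<in> fst \<gamma> \<Longrightarrow> b V \<in> V" "\<And>V. V \<in> snd \<gamma> \<Longrightarrow> b V \<in> A"
    "\<And>\<sigma> Y ys. \<sigma> \<noteq> [] \<Longrightarrow> set \<sigma> \<subseteq> fst \<gamma> \<Longrightarrow> Y \<subseteq> \<Inter>(set \<sigma>) \<Longrightarrow> Y \<noteq> {} \<Longrightarrow> ys \<noteq> [] \<Longrightarrow>
       set ys \<subseteq> Y \<union> b ` set \<sigma> \<Longrightarrow> P ys"
    by (rule base_points_exist[OF P]) (rule that)
  have VX: "V \<subseteq> topspace X" if "V \<in> fst \<gamma>" for V using \<gamma>(1) that by (auto simp: coverings_def)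
  have Pb: "P (map b \<sigma>)" if "\<sigma> \<in> nerve (fst \<gamma>) B n" for \<sigma> B n
  proof -
    have "\<sigma> \<noteq> []" "set \<sigma> \<subseteq> fst \<gamma>" "\<Inter>(set \<sigma>) \<noteq> {}" using that by (auto simp: nerve_def)
    then show ?thesis using \<gamma>(4)[of \<sigma> "\<Inter>(set \<sigma>)" "map b \<sigma>"] by auto
  qed
  \<comment> \<open>The pair of the base point and any other point of \<open>V\<close> is small, so
    the star choice at the base point contains that other point.\<close>
  have sub: "V \<subseteq> l (b V) \<and> V \<subseteq> m (b V)" if V: "V \<in> fst \<gamma>" for V
  proof -
    have "P [b V, y]" if "y \<in> V" for y
      using \<gamma>(4)[of "[V]" V "[b V, y]"] V that by auto
    then show ?thesis by (auto simp: P_def)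
  qed
  have lv: "vertex_map id \<gamma> \<alpha> (\<lambda>V. l (b V))"
    unfolding vertex_map_def using sub \<gamma>(2,3) VX coverings_snd[OF \<gamma>(1)] l(1) A_subset
    by (auto simp: star_choice_def subset_iff)
  have mv: "vertex_map id \<gamma> \<beta> (\<lambda>V. m (b V))"
    unfolding vertex_map_def using sub \<gamma>(2,3) VX coverings_snd[OF \<gamma>(1)] m(1) A_subset
    by (auto simp: star_choice_def subset_iff)
  have "(\<lambda>\<sigma>. pull_cochain \<gamma> q (\<lambda>V. l (b V)) c \<sigma> - pull_cochain \<gamma> q (\<lambda>V. m (b V)) d \<sigma>) \<in> coboundaries A \<gamma> q"
  proof -
    have e: "pull_cochain \<gamma> q (\<lambda>V. l (b V)) c \<sigma> - pull_cochain \<gamma> q (\<lambda>V. m (b V)) d \<sigma> =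
        (if \<sigma> \<in> nerve (fst \<gamma>) UNIV q then cob \<psi> (map b \<sigma>) else 0)" for \<sigma>
    proof (cases "\<sigma> \<in> nerve (fst \<gamma>) UNIV q")
      case True
      then have "length (map b \<sigma>) = Suc q" by (simp add: nerve_def)
      then have "c (map l (map b \<sigma>)) - d (map m (map b \<sigma>)) = cob \<psi> (map b \<sigma>)"
        using Pb[OF True] by (simp add: P_def)
      then show ?thesis using True by (simp add: pull_cochain_def comp_def)
    qed (simp add: pull_cochain_def)
    show ?thesis
    proof (cases q)
      case 0
      then show ?thesis using \<psi>(1) cob_zero unfolding e by (simp add: coboundaries_def cong: if_cong)
    next
      case (Suc n)
      \<comment> \<open>Nerve cochains must vanish off the nerve, hence the cut-off.\<close>
      define b' where "b' = (\<lambda>\<sigma>. if \<sigma> \<in> nerve (fst \<gamma>) UNIV n then \<psi> (map b \<sigma>) else 0)"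
      have "b' \<in> cochains A \<gamma> n"
        unfolding cochains_def b'_def
      proof (intro CollectI conjI ballI allI impI)
        fix \<sigma> assume s: "\<sigma> \<in> nerve (snd \<gamma>) A n"
        have "\<sigma> \<in> nerve (fst \<gamma>) UNIV n" using s nerve_mono[OF coverings_snd[OF \<gamma>(1)]] by blast
        then have "P (map b \<sigma>)" by (rule Pb)
        moreover have "set (map b \<sigma>) \<subseteq> A" "length (map b \<sigma>) = q" using s \<gamma>(3) Suc by (auto simp: nerve_def)
        ultimately show "(if \<sigma> \<in> nerve (fst \<gamma>) UNIV n then \<psi> (map b \<sigma>) else 0) = 0" by (auto simp: P_def)
      qed simp
      moreover have "(if \<sigma> \<in> nerve (fst \<gamma>) UNIV q then cob \<psi> (map b \<sigma>) else 0) = coboundary \<gamma> n b' \<sigma>" for \<sigma>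
      proof (cases "\<sigma> \<in> nerve (fst \<gamma>) UNIV q")
        case True
        have "cob b' \<sigma> = cob (\<lambda>\<tau>. \<psi> (map b \<tau>)) \<sigma>"
        proof (rule cob_cong)
          fix ys assume "set ys \<subseteq> set \<sigma>" "length \<sigma> = Suc (length ys)"
          then have "ys \<in> nerve (fst \<gamma>) UNIV n"
            using nerve_face[of \<sigma> "fst \<gamma>" UNIV n ys] True Suc by (auto simp: nerve_def)
          then show "b' ys = \<psi> (map b ys)" by (simp add: b'_def)
        qed
        then show ?thesis using True Suc coboundary_nerve[of \<sigma> \<gamma> n b'] by (simp add: cob_map)
      qed (simp add: coboundary_def Suc)
      ultimately show ?thesis unfolding e using Suc by (auto simp: coboundaries_def)
    qed
  qed
  then show ?thesis
    using pc \<gamma>(1) lv mv unfolding cech_rel_def p by blast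
qed

text \<open>Evaluation at base points turns point cocycles into nerve cocycles. Two are treated at
  once because addition of Cech classes needs representatives on a common covering.\<close>

lemma represented_pair:
  fixes \<phi> \<psi> :: "'z list \<Rightarrow> 'k::field"
  assumes "\<phi> \<in> Zc X A q" "\<psi> \<in> Zc X A q"
  obtains \<alpha> c d where "represents X A q (\<alpha>, c) \<phi>" "represents X A q (\<alpha>, d) \<psi>"
proof -
  define P where "P = (\<lambda>xs. (length xs = Suc (Suc q) \<longrightarrow> cob \<phi> xs = 0 \<and> cob \<psi> xs = 0) \<and>
     (length xs = Suc q \<longrightarrow> set xs \<subseteq> A \<longrightarrow> \<phi> xs = 0 \<and> \<psi> xs = 0))"
  have P: "eventually P (smalls X)"
    unfolding P_def using assms unfolding Zc_def
    by (auto simp: eventually_conj_iff imp_conjR)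
  obtain \<gamma> b where \<gamma>: "\<gamma> \<in> coverings X A" "\<And>V. V \<in> fst \<gamma> \<Longrightarrow> b V \<in> V" "\<And>V. V \<in> snd \<gamma> \<Longrightarrow> b V \<in> A"
    "\<And>\<sigma> Y ys. \<sigma> \<noteq> [] \<Longrightarrow> set \<sigma> \<subseteq> fst \<gamma> \<Longrightarrow> Y \<subseteq> \<Inter>(set \<sigma>) \<Longrightarrow> Y \<noteq> {} \<Longrightarrow> ys \<noteq> [] \<Longrightarrow>
       set ys \<subseteq> Y \<union> b ` set \<sigma> \<Longrightarrow> P ys"
    by (rule base_points_exist[OF P]) (rule that)
  have Pb: "P (map b \<sigma>)" if "\<sigma> \<in> nerve (fst \<gamma>) B n" for \<sigma> B n
  proof -
    have "\<sigma> \<noteq> []" "set \<sigma> \<subseteq> fst \<gamma>" "\<Inter>(set \<sigma>) \<noteq> {}" using that by (auto simp: nerve_def)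
    then show ?thesis using \<gamma>(4)[of \<sigma> "\<Inter>(set \<sigma>)" "map b \<sigma>"] by auto
  qed
  obtain l where l: "star_choice X A (\<lambda>x. x) \<gamma> l" by (rule star_choice_exists[OF \<gamma>(1)])
  have main: "represents X A q (\<gamma>, \<lambda>\<sigma>. if \<sigma> \<in> nerve (fst \<gamma>) UNIV q then \<eta> (map b \<sigma>) else 0) \<eta>"
    (is "represents _ _ _ (_, ?c) _")
    if \<eta>: "\<eta> \<in> Zc X A q" and P\<eta>: "\<And>xs. P xs \<Longrightarrow> (length xs = Suc (Suc q) \<longrightarrow> cob \<eta> xs = 0) \<and>
       (length xs = Suc q \<longrightarrow> set xs \<subseteq> A \<longrightarrow> \<eta> xs = 0)" for \<eta> :: "'z list \<Rightarrow> 'k"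
  proof -
    have "?c \<in> cocycles A \<gamma> q"
      unfolding cocycles_iff
    proof (intro conjI ballI)
      show "?c \<in> cochains A \<gamma> q"
        unfolding cochains_def
      proof (intro CollectI conjI ballI allI impI)
        fix \<sigma> assume s: "\<sigma> \<in> nerve (snd \<gamma>) A q"
        have "\<sigma> \<in> nerve (fst \<gamma>) UNIV q" using s nerve_mono[OF coverings_snd[OF \<gamma>(1)]] by blast
        then have "P (map b \<sigma>)" by (rule Pb)
        moreover have "set (map b \<sigma>) \<subseteq> A" "length (map b \<sigma>) = Suc q" using s \<gamma>(3) by (auto simp: nerve_def)
        ultimately show "?c \<sigma> = 0" using P\<eta> by auto
      qed simp
      fix \<sigma> assume s: "\<sigma> \<in> nerve (fst \<gamma>) UNIV (Suc q)"
      have "cob ?c \<sigma> = cob (\<lambda>\<tau>. \<eta> (map b \<tau>)) \<sigma>"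
      proof (rule cob_cong)
        fix ys assume "set ys \<subseteq> set \<sigma>" "length \<sigma> = Suc (length ys)"
        then have "ys \<in> nerve (fst \<gamma>) UNIV q" using nerve_face[OF s, of ys] s by (auto simp: nerve_def)
        then show "?c ys = \<eta> (map b ys)" by simp
      qed
      also have "\<dots> = 0" using P\<eta>[OF Pb[OF s]] s by (simp add: cob_map nerve_def)
      finally show "cob ?c \<sigma> = 0" .
    qed
    moreover have "(\<lambda>xs. ?c (map l xs)) - \<eta> \<in> Bd X A q"
    proof -
      have "eventually (\<lambda>xs. \<forall>ys. length ys = Suc q \<longrightarrow> set ys \<subseteq> l ` set xs \<union> l ` set xs \<longrightarrow>
           ys \<in> nerve (fst \<gamma>) UNIV q) (smalls X)" by (rule star_choice_nerve(1)[OF l l])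
      then have "eventually (\<lambda>xs. length xs = Suc q \<longrightarrow> ?c (map l xs) = \<eta> (map (\<lambda>x. b (l x)) xs)) (smalls X)"
        by (rule eventually_mono) (auto simp: comp_def)
      then have 1: "(\<lambda>xs. ?c (map l xs)) - (\<lambda>xs. \<eta> (map (\<lambda>x. b (l x)) xs)) \<in> Bd X A q"
        by (rule small_eq_imp_Bd)
      have "eventually (\<lambda>xs. \<forall>x\<in>set xs. \<forall>y\<in>set xs. y \<in> l x) (smalls X)"
        using l by (simp add: star_choice_def)
      with eventually_smalls_topspace[of X]
      have ev: "eventually (\<lambda>xs. set xs \<subseteq> topspace X \<and> (\<forall>ys. ys \<noteq> [] \<longrightarrow> set ys \<subseteq> (\<lambda>x. b (l x)) ` set xs \<union> (\<lambda>x. x) ` set xs \<longrightarrow> P ys)) (smalls X)"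
      proof (rule eventually_elim2, intro conjI allI impI)
        fix xs ys assume xs: "xs \<noteq> [] \<and> set xs \<subseteq> topspace X" "\<forall>x\<in>set xs. \<forall>y\<in>set xs. y \<in> l x"
          and ys: "ys \<noteq> []" "set ys \<subseteq> (\<lambda>x. b (l x)) ` set xs \<union> (\<lambda>x. x) ` set xs"
        show "P ys"
        proof (rule \<gamma>(4)[of "map l xs" "set xs"])
          show "set (map l xs) \<subseteq> fst \<gamma>" using xs(1) l by (auto simp: star_choice_def)
        qed (use xs ys in auto)
      qed simp
      \<comment> \<open>Going from a point to its chosen member and on to the base point of that
        member moves it little, so the round trip is homotopic to the identity.\<close>
      have "(\<lambda>xs. \<eta> (map (\<lambda>x. x) xs) - \<eta> (map (\<lambda>x. b (l x)) xs)) \<in> Bd X A q"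
      proof (rule homotopic_Bd)
        show "eventually (\<lambda>xs. \<forall>ys. length ys = Suc (Suc q) \<longrightarrow> set ys \<subseteq> (\<lambda>x. b (l x)) ` set xs \<union> (\<lambda>x. x) ` set xs \<longrightarrow> cob \<eta> ys = 0) (smalls X)"
          using ev
        proof (rule eventually_mono, intro allI impI)
          fix xs ys assume xs: "set xs \<subseteq> topspace X \<and> (\<forall>ys. ys \<noteq> [] \<longrightarrow> set ys \<subseteq> (\<lambda>x. b (l x)) ` set xs \<union> (\<lambda>x. x) ` set xs \<longrightarrow> P ys)"
            and ys: "length ys = Suc (Suc q)" "set ys \<subseteq> (\<lambda>x. b (l x)) ` set xs \<union> (\<lambda>x. x) ` set xs"
          have "ys \<noteq> []" using ys(1) by auto
          then show "cob \<eta> ys = 0" using P\<eta>[of ys] xs ys by blast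
        qed
        show "eventually (\<lambda>xs. set xs \<subseteq> A \<longrightarrow> (\<forall>ys. length ys = Suc q \<longrightarrow> set ys \<subseteq> (\<lambda>x. b (l x)) ` set xs \<union> (\<lambda>x. x) ` set xs \<longrightarrow> \<eta> ys = 0)) (smalls X)"
          using ev
        proof (rule eventually_mono, intro allI impI)
          fix xs ys assume xs: "set xs \<subseteq> topspace X \<and> (\<forall>ys. ys \<noteq> [] \<longrightarrow> set ys \<subseteq> (\<lambda>x. b (l x)) ` set xs \<union> (\<lambda>x. x) ` set xs \<longrightarrow> P ys)"
            and A: "set xs \<subseteq> A"
            and ys: "length ys = Suc q" "set ys \<subseteq> (\<lambda>x. b (l x)) ` set xs \<union> (\<lambda>x. x) ` set xs"
          have "ys \<noteq> []" using ys(1) by auto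
          moreover have "b (l x) \<in> A" if "x \<in> set xs" for x
          proof -
            have "x \<in> A \<inter> topspace X" using that A xs by blast
            then have "l x \<in> snd \<gamma>" using l unfolding star_choice_def by blast
            then show ?thesis by (rule \<gamma>(3))
          qed
          then have "set ys \<subseteq> A" using ys(2) A by auto
          ultimately show "\<eta> ys = 0" using P\<eta>[of ys] xs ys by blast
        qed
      qed
      then have 2: "\<eta> - (\<lambda>xs. \<eta> (map (\<lambda>x. b (l x)) xs)) \<in> Bd X A q" by (simp add: fun_diff_def)
      show ?thesis using Bd_diff_trans[OF 1 Bd_diff_sym[OF 2]] .
    qed
    ultimately show ?thesis using \<eta> l \<gamma>(1) by (auto simp: represents_def cech_cocycles_def)
  qed
  show thesis
    by (rule that; rule main) (use assms in \<open>auto simp: P_def\<close>)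
qed

section \<open>The Cech vector space in terms of point cocycles\<close>

definition cclass :: "nat \<Rightarrow> ('z list \<Rightarrow> 'k::field) \<Rightarrow> ('z, 'k) cech_class" where
  "cclass q \<phi> = {p. represents X A q p \<phi>}"

text \<open>Any nonempty part of a class generates the whole class. Each operation of
  \<open>cech\<close> is the saturation of a set of representatives, so it suffices to find one
  representative and to see that all of them represent the same cocycle.\<close>

lemma cech_rel_Image:
  assumes "S \<subseteq> cclass q \<phi>" "S \<noteq> {}"
  shows "cech_rel X A q `` S = cclass q \<phi>"
  using assms cech_rel_imp represents_imp_cech_rel unfolding cclass_def by blast

lemma cclass_nonempty: "\<phi> \<in> Zc X A q \<Longrightarrow> cclass q \<phi> \<noteq> {}"
  using represented_pair[of \<phi> q \<phi>] unfolding cclass_def by blast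

lemma cclass_eq_iff:
  assumes "\<phi> \<in> Zc X A q" "\<psi> \<in> Zc X A q"
  shows "cclass q \<phi> = cclass q \<psi> \<longleftrightarrow> \<phi> - \<psi> \<in> Bd X A q"
proof
  assume "cclass q \<phi> = cclass q \<psi>"
  then show "\<phi> - \<psi> \<in> Bd X A q"
    using cclass_nonempty[OF assms(1)] represents_unique unfolding cclass_def by blast
next
  assume "\<phi> - \<psi> \<in> Bd X A q"
  then show "cclass q \<phi> = cclass q \<psi>"
    using represents_cong assms Bd_diff_sym unfolding cclass_def by blast
qed

lemma carrier_cech:
  "carrier (cech X A q :: ('k::field, ('z, 'k) cech_class) module) = cclass q ` Zc X A q"
proof -
  have "(cech_cocycles X A q // cech_rel X A q :: ('z, 'k) cech_class set) = cclass q ` Zc X A q"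
  proof
    show "(cech_cocycles X A q // cech_rel X A q :: ('z, 'k) cech_class set) \<subseteq> cclass q ` Zc X A q"
    proof
      fix S :: "('z, 'k) cech_class" assume "S \<in> cech_cocycles X A q // cech_rel X A q"
      then obtain p where p: "p \<in> cech_cocycles X A q" "S = cech_rel X A q `` {p}" by (rule quotientE)
      obtain \<phi> where \<phi>: "represents X A q p \<phi>" by (rule represents_exists[OF p(1)])
      have "S = cclass q \<phi>" unfolding p(2) using \<phi> by (intro cech_rel_Image) (auto simp: cclass_def)
      then show "S \<in> cclass q ` Zc X A q" using \<phi> by (auto simp: represents_def)
    qed
    show "cclass q ` Zc X A q \<subseteq> (cech_cocycles X A q // cech_rel X A q :: ('z, 'k) cech_class set)"
    proof
      fix S :: "('z, 'k) cech_class" assume "S \<in> cclass q ` Zc X A q"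
      then obtain \<phi> where \<phi>: "\<phi> \<in> Zc X A q" "S = cclass q \<phi>" by blast
      obtain p where p: "represents X A q p \<phi>" using cclass_nonempty[OF \<phi>(1)] by (auto simp: cclass_def)
      have "S = cech_rel X A q `` {p}"
        unfolding \<phi>(2) using p by (intro cech_rel_Image[symmetric]) (auto simp: cclass_def)
      then show "S \<in> cech_cocycles X A q // cech_rel X A q"
        using p by (auto simp: represents_def intro: quotientI)
    qed
  qed
  then show ?thesis by (simp add: cech_def)
qed

lemma cclass_carrier: "\<phi> \<in> Zc X A q \<Longrightarrow> cclass q \<phi> \<in> carrier (cech X A q)"
  by (simp add: carrier_cech)

lemma represents_plus:
  assumes "represents X A q (\<alpha>, c) \<phi>" "represents X A q (\<alpha>, d) \<psi>"
  shows "represents X A q (\<alpha>, \<lambda>\<sigma>. c \<sigma> + d \<sigma>) (\<phi> + \<psi>)"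
proof -
  have a: "\<alpha> \<in> coverings X A" "c \<in> cocycles A \<alpha> q" "d \<in> cocycles A \<alpha> q" "\<phi> \<in> Zc X A q" "\<psi> \<in> Zc X A q"
    using assms by (auto simp: represents_def cech_cocycles_def)
  obtain l where l: "star_choice X A (\<lambda>x. x) \<alpha> l" by (rule star_choice_exists[OF a(1)])
  have "(\<lambda>xs. c (map l xs)) - \<phi> \<in> Bd X A q" "(\<lambda>xs. d (map l xs)) - \<psi> \<in> Bd X A q"
    using representsD[OF assms(1), of l] representsD[OF assms(2), of l] l by auto
  from fvs.subspace_add[OF subspace_Bd this]
  have "(\<lambda>xs. c (map l xs) + d (map l xs)) - (\<phi> + \<psi>) \<in> Bd X A q"
    by (simp add: fun_diff_def plus_fun_def algebra_simps)
  moreover have "(\<lambda>\<sigma>. c \<sigma> + d \<sigma>) \<in> cocycles A \<alpha> q"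
    using a(2,3) by (auto simp: cocycles_iff cochains_def cob_plus)
  ultimately show ?thesis
    using a l fvs.subspace_add[OF subspace_Zc a(4,5)] by (auto simp: represents_def cech_cocycles_def)
qed

lemma represents_scale:
  assumes "represents X A q (\<alpha>, c) \<phi>"
  shows "represents X A q (\<alpha>, \<lambda>\<sigma>. k * c \<sigma>) (k *s \<phi>)"
proof -
  have a: "\<alpha> \<in> coverings X A" "c \<in> cocycles A \<alpha> q" "\<phi> \<in> Zc X A q"
    using assms by (auto simp: represents_def cech_cocycles_def)
  obtain l where l: "star_choice X A (\<lambda>x. x) \<alpha> l" by (rule star_choice_exists[OF a(1)])
  have "(\<lambda>xs. c (map l xs)) - \<phi> \<in> Bd X A q"
    using representsD[OF assms(1), of l] l by auto
  from fvs.subspace_scale[OF subspace_Bd this, of k]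
  have "(\<lambda>xs. k * c (map l xs)) - (k *s \<phi>) \<in> Bd X A q"
    by (simp add: fun_diff_def fscale_def algebra_simps)
  moreover have "(\<lambda>\<sigma>. k * c \<sigma>) \<in> cocycles A \<alpha> q"
    using a(2) by (auto simp: cocycles_iff cochains_def cob_times)
  ultimately show ?thesis
    using a l fvs.subspace_scale[OF subspace_Zc a(3)] by (auto simp: represents_def cech_cocycles_def)
qed

lemma cech_add:
  assumes "\<phi> \<in> Zc X A q" "\<psi> \<in> Zc X A q"
  shows "cclass q \<phi> \<oplus>\<^bsub>cech X A q\<^esub> cclass q \<psi> = cclass q (\<phi> + \<psi>)"
proof -
  obtain \<alpha> c d where *: "represents X A q (\<alpha>, c) \<phi>" "represents X A q (\<alpha>, d) \<psi>"
    by (rule represented_pair[OF assms])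
  have "cech_rel X A q `` {(\<alpha>, e). \<exists>c d. (\<alpha>, c) \<in> cclass q \<phi> \<and> (\<alpha>, d) \<in> cclass q \<psi> \<and> e = (\<lambda>\<sigma>. c \<sigma> + d \<sigma>)}
      = cclass q (\<phi> + \<psi>)"
  proof (rule cech_rel_Image)
    show "{(\<alpha>, e). \<exists>c d. (\<alpha>, c) \<in> cclass q \<phi> \<and> (\<alpha>, d) \<in> cclass q \<psi> \<and> e = (\<lambda>\<sigma>. c \<sigma> + d \<sigma>)} \<subseteq> cclass q (\<phi> + \<psi>)"
      using represents_plus by (auto simp: cclass_def)
    have "(\<alpha>, \<lambda>\<sigma>. c \<sigma> + d \<sigma>) \<in> {(\<alpha>, e). \<exists>c d. (\<alpha>, c) \<in> cclass q \<phi> \<and> (\<alpha>, d) \<in> cclass q \<psi> \<and> e = (\<lambda>\<sigma>. c \<sigma> + d \<sigma>)}"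
      using * by (auto simp: cclass_def)
    then show "{(\<alpha>, e). \<exists>c d. (\<alpha>, c) \<in> cclass q \<phi> \<and> (\<alpha>, d) \<in> cclass q \<psi> \<and> e = (\<lambda>\<sigma>. c \<sigma> + d \<sigma>)} \<noteq> {}" by blast
  qed
  then show ?thesis by (simp add: cech_def)
qed

lemma cech_smult:
  assumes "\<phi> \<in> Zc X A q"
  shows "k \<odot>\<^bsub>cech X A q\<^esub> cclass q \<phi> = cclass q (k *s \<phi>)"
proof -
  obtain p where p: "represents X A q p \<phi>" using cclass_nonempty[OF assms] by (auto simp: cclass_def)
  obtain \<alpha> c where c: "p = (\<alpha>, c)" by (cases p)
  have "cech_rel X A q `` {(\<alpha>, e). \<exists>c. (\<alpha>, c) \<in> cclass q \<phi> \<and> e = (\<lambda>\<sigma>. k * c \<sigma>)} = cclass q (k *s \<phi>)"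
  proof (rule cech_rel_Image)
    show "{(\<alpha>, e). \<exists>c. (\<alpha>, c) \<in> cclass q \<phi> \<and> e = (\<lambda>\<sigma>. k * c \<sigma>)} \<subseteq> cclass q (k *s \<phi>)"
      using represents_scale by (auto simp: cclass_def)
    have "(\<alpha>, \<lambda>\<sigma>. k * c \<sigma>) \<in> {(\<alpha>, e). \<exists>c. (\<alpha>, c) \<in> cclass q \<phi> \<and> e = (\<lambda>\<sigma>. k * c \<sigma>)}"
      using p c by (auto simp: cclass_def)
    then show "{(\<alpha>, e). \<exists>c. (\<alpha>, c) \<in> cclass q \<phi> \<and> e = (\<lambda>\<sigma>. k * c \<sigma>)} \<noteq> {}" by blast
  qed
  then show ?thesis by (simp add: cech_def)
qed

lemma cech_zero: "\<zero>\<^bsub>cech X A q\<^esub> = cclass q 0"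
proof -
  have z: "represents X A q (\<alpha>, \<lambda>_. 0) 0" if a: "\<alpha> \<in> coverings X A" for \<alpha>
  proof -
    obtain l where l: "star_choice X A (\<lambda>x. x) \<alpha> l" by (rule star_choice_exists[OF a(1)])
    have "(\<lambda>_. 0) \<in> cocycles A \<alpha> q" by (auto simp: cocycles_iff cochains_def)
    moreover have "(\<lambda>_. 0) - 0 \<in> Bd X A q"
      using fvs.subspace_0[OF subspace_Bd[of X A q]] by (simp add: zero_fun_def fun_diff_def)
    ultimately show ?thesis using a l fvs.subspace_0[OF subspace_Zc[of X A q]]
      by (auto simp: represents_def cech_cocycles_def)
  qed
  have "cech_rel X A q `` {(\<alpha>, c). \<alpha> \<in> coverings X A \<and> c = (\<lambda>_. 0)} = cclass q 0"
  proof (rule cech_rel_Image)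
    show "{(\<alpha>, c). \<alpha> \<in> coverings X A \<and> c = (\<lambda>_. 0)} \<subseteq> cclass q 0"
      using z by (auto simp: cclass_def)
    have "({topspace X}, {topspace X}) \<in> coverings X A" using A_subset by (simp add: coverings_def)
    then show "{(\<alpha>, c). \<alpha> \<in> coverings X A \<and> c = (\<lambda>_. 0)} \<noteq> {}" by blast
  qed
  then show ?thesis by (simp add: cech_def)
qed

end

lemma cech_map_cclass:
  assumes XA: "compact_pair X A" and YB: "compact_pair Y B"
    and g: "continuous_map X Y g" "g ` A \<subseteq> B" and \<phi>: "\<phi> \<in> Zc Y B q"
  shows "cech_map X A q g (compact_pair.cclass Y B q \<phi>) = compact_pair.cclass X A q (\<lambda>xs. \<phi> (map g xs))"
proof -
  interpret X: compact_pair X A by fact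
  interpret Y: compact_pair Y B by fact
  obtain p where p: "represents Y B q p \<phi>" using Y.cclass_nonempty[OF \<phi>] by (auto simp: Y.cclass_def)
  obtain \<alpha> c where c: "p = (\<alpha>, c)" by (cases p)
  have \<alpha>: "\<alpha> \<in> coverings Y B" using p c by (auto simp: represents_def cech_cocycles_def)
  define pre where "pre = (\<lambda>U. {x \<in> topspace X. g x \<in> U})"
  define \<gamma> where "\<gamma> = (pre ` fst \<alpha>, pre ` snd \<alpha>)"
  have a: "\<And>U. U \<in> fst \<alpha> \<Longrightarrow> openin Y U" "\<Union>(fst \<alpha>) = topspace Y" "snd \<alpha> \<subseteq> fst \<alpha>" "B \<subseteq> \<Union>(snd \<alpha>)"
    using \<alpha> by (simp_all add: coverings_def case_prod_unfold)
  have \<gamma>: "\<gamma> \<in> coverings X A"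
    unfolding \<gamma>_def coverings_def
  proof (simp, intro conjI ballI)
    show "openin X (pre U)" if "U \<in> fst \<alpha>" for U
      using a(1)[OF that] g(1) by (simp add: pre_def continuous_map_def)
    have "g x \<in> \<Union>(fst \<alpha>)" if "x \<in> topspace X" for x
      using that g(1) a(2) by (auto simp: continuous_map_def Pi_iff)
    then show "(\<Union>x\<in>fst \<alpha>. pre x) = topspace X" unfolding pre_def by blast
    show "pre ` snd \<alpha> \<subseteq> pre ` fst \<alpha>" using a(3) by blast
    show "A \<subseteq> (\<Union>x\<in>snd \<alpha>. pre x)" unfolding pre_def using a(4) g(2) X.A_subset by blast
  qed
  \<comment> \<open>One preimage may arise from several members of \<open>\<alpha>\<close>; for sets
    of the subfamily the choice must be made inside \<open>snd \<alpha>\<close>.\<close>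
  define \<theta> where "\<theta> = (\<lambda>V. if V \<in> pre ` snd \<alpha> then SOME U. U \<in> snd \<alpha> \<and> V = pre U else SOME U. U \<in> fst \<alpha> \<and> V = pre U)"
  have 1: "\<theta> V \<in> snd \<alpha> \<and> V = pre (\<theta> V)" if "V \<in> pre ` snd \<alpha>" for V
  proof -
    have "\<exists>U. U \<in> snd \<alpha> \<and> V = pre U" using that by blast
    from someI_ex[OF this] show ?thesis using that by (simp add: \<theta>_def)
  qed
  have 2: "\<theta> V \<in> fst \<alpha> \<and> V = pre (\<theta> V)" if "V \<in> pre ` fst \<alpha>" for V
  proof (cases "V \<in> pre ` snd \<alpha>")
    case True
    then show ?thesis using 1 Y.coverings_snd[OF \<alpha>] by blast
  next
    case False
    have "\<exists>U. U \<in> fst \<alpha> \<and> V = pre U" using that by blast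
    from someI_ex[OF this] show ?thesis using False by (simp add: \<theta>_def)
  qed
  have v: "vertex_map g \<gamma> \<alpha> \<theta>"
    unfolding vertex_map_def
  proof (intro conjI ballI)
    fix V assume V: "V \<in> fst \<gamma>"
    then show "\<theta> V \<in> fst \<alpha>" using 2 by (simp add: \<gamma>_def)
    have "V = pre (\<theta> V)" using V 2 by (simp add: \<gamma>_def)
    then show "g ` V \<subseteq> \<theta> V" unfolding pre_def by auto
  next
    fix V assume "V \<in> snd \<gamma>"
    then show "\<theta> V \<in> snd \<alpha>" using 1 by (simp add: \<gamma>_def)
  qed
  show ?thesis
    unfolding cech_map_def
  proof (rule X.cech_rel_Image)
    let ?S = "{(\<gamma>, e). \<gamma> \<in> coverings X A \<and>
        (\<exists>\<alpha> c \<phi>'. (\<alpha>, c) \<in> Y.cclass q \<phi> \<and> vertex_map g \<gamma> \<alpha> \<phi>' \<and> e = pull_cochain \<gamma> q \<phi>' c)}"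
    show "?S \<subseteq> X.cclass q (\<lambda>xs. \<phi> (map g xs))"
      using represents_map[OF XA YB g] by (auto simp: X.cclass_def Y.cclass_def)
    have "(\<gamma>, pull_cochain \<gamma> q \<theta> c) \<in> ?S"
    proof -
      have "(\<alpha>, c) \<in> Y.cclass q \<phi>" using p c by (simp add: Y.cclass_def)
      then show ?thesis using \<gamma> v by blast
    qed
    then show "?S \<noteq> {}" by blast
  qed
qed

text \<open>\<open>h\<close> is injective from \<open>Z'\<close> modulo \<open>B'\<close> into
  \<open>Z\<close> modulo \<open>B\<close>. Generators of the image are first moved into the image
  of \<open>Z'\<close>, so that they can be lifted.\<close>

lemma finite_over_preimage:
  fixes h :: "('x \<Rightarrow> 'k::field) \<Rightarrow> ('y \<Rightarrow> 'k)"
  assumes h: "\<And>x y. h (x + y) = h x + h y" "\<And>c x. h (c *s x) = c *s h x"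
    and Z: "fvs.subspace Z'" "fvs.subspace B" "finite_over B Z" "h ` Z' \<subseteq> Z"
    and inj: "\<And>z. z \<in> Z' \<Longrightarrow> h z \<in> B \<Longrightarrow> z \<in> B'"
  shows "finite_over B' Z'"
proof -
  have lin: "Vector_Spaces.linear fscale fscale h"
    using h by unfold_locales (simp_all add: fscale_def fun_eq_iff algebra_simps)
  have "finite_over B (h ` Z')" using finite_over_mono[OF Z(3,4)] by blast
  moreover have "fvs.subspace (h ` Z')" by (rule fvp.linear_subspace_image[OF lin Z(1)])
  ultimately obtain S where S: "finite S" "S \<subseteq> h ` Z'" "h ` Z' \<subseteq> fvs.span (S \<union> B)"
    by (rule finite_over_basis)
  obtain S' where S': "S' \<subseteq> Z'" "finite S'" "S = h ` S'"
    using finite_subset_image[OF S(1,2)] by blast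
  have "Z' \<subseteq> fvs.span (S' \<union> B')"
  proof
    fix z assume z: "z \<in> Z'"
    have "h z \<in> fvs.span (h ` S' \<union> B)" using S(3) S'(3) z by blast
    then obtain y b where y: "y \<in> fvs.span (h ` S')" "b \<in> B" "h z = y + b"
      using Z(2) by (rule span_Un_subspace)
    obtain y' where y': "y' \<in> fvs.span S'" "y = h y'"
      using y(1) unfolding fvp.linear_span_image[OF lin] by blast
    have "y' \<in> Z'" using y'(1) S'(1) Z(1) fvs.span_minimal by blast
    then have d: "z - y' \<in> Z'" using z Z(1) by (simp add: fvs.subspace_diff)
    have "h (z - y') = b" using y(3) y'(2) h(1)[of "z - y'" y'] by (simp add: algebra_simps)
    then have "z - y' \<in> B'" using inj[OF d] y(2) by simp
    then have "z - y' \<in> fvs.span (S' \<union> B')" by (simp add: fvs.span_base)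
    moreover have "y' \<in> fvs.span (S' \<union> B')" using y'(1) fvs.span_mono[of S' "S' \<union> B'"] by blast
    ultimately show "z \<in> fvs.span (S' \<union> B')" using fvs.span_add by fastforce
  qed
  then show ?thesis unfolding finite_over_def using S'(2) by blast
qed

context compact_pair
begin

lemma cech_vectorspace:
  "vectorspace class_ring (cech X A q :: ('k::field, ('z, 'k) cech_class) module)"
proof -
  let ?H = "cech X A q :: ('k, ('z, 'k) cech_class) module"
  have sZ: "fvs.subspace (Zc X A q :: ('z list \<Rightarrow> 'k) set)" by (rule subspace_Zc)
  have car: "\<And>S. S \<in> carrier ?H \<Longrightarrow> \<exists>\<phi>\<in>Zc X A q. S = cclass q \<phi>" by (auto simp: carrier_cech)
  have "abelian_group ?H"
  proof (rule abelian_groupI)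
    show "\<zero>\<^bsub>?H\<^esub> \<in> carrier ?H" using fvs.subspace_0[OF sZ] by (simp add: cech_zero cclass_carrier)
    fix S T U assume "S \<in> carrier ?H" "T \<in> carrier ?H" "U \<in> carrier ?H"
    then obtain \<phi> \<psi> \<eta> where *: "\<phi> \<in> Zc X A q" "\<psi> \<in> Zc X A q" "\<eta> \<in> Zc X A q"
      "S = cclass q \<phi>" "T = cclass q \<psi>" "U = cclass q \<eta>" using car by metis
    note [simp] = *(4-6) cech_add cech_zero fvs.subspace_add[OF sZ] fvs.subspace_0[OF sZ] *(1-3)
    show "S \<oplus>\<^bsub>?H\<^esub> T \<in> carrier ?H" by (simp add: cclass_carrier)
    show "S \<oplus>\<^bsub>?H\<^esub> T \<oplus>\<^bsub>?H\<^esub> U = S \<oplus>\<^bsub>?H\<^esub> (T \<oplus>\<^bsub>?H\<^esub> U)" by (simp add: add.assoc)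
    show "S \<oplus>\<^bsub>?H\<^esub> T = T \<oplus>\<^bsub>?H\<^esub> S" by (simp add: add.commute)
    show "\<zero>\<^bsub>?H\<^esub> \<oplus>\<^bsub>?H\<^esub> S = S" by simp
    have "cclass q (- \<phi>) \<oplus>\<^bsub>?H\<^esub> S = \<zero>\<^bsub>?H\<^esub>" using fvs.subspace_neg[OF sZ *(1)] by simp
    then show "\<exists>y\<in>carrier ?H. y \<oplus>\<^bsub>?H\<^esub> S = \<zero>\<^bsub>?H\<^esub>"
      using fvs.subspace_neg[OF sZ *(1)] cclass_carrier by blast
  qed
  moreover have "Module.module class_ring ?H"
  proof (rule Module.moduleI)
    show "cring (class_ring :: 'k ring)" by (rule class_cring.cring_axioms)
    show "abelian_group ?H" by fact
    fix a :: 'k and S assume ab: "a \<in> carrier (class_ring :: 'k ring)" "S \<in> carrier ?H"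
    then obtain \<phi> where *: "\<phi> \<in> Zc X A q" "S = cclass q \<phi>" using car by metis
    note [simp] = *(2) cech_add cech_smult fvs.subspace_add[OF sZ] fvs.subspace_scale[OF sZ] *(1)
    show "a \<odot>\<^bsub>?H\<^esub> S \<in> carrier ?H" by (simp add: cclass_carrier)
  next
    fix a b :: 'k and S assume ab: "a \<in> carrier (class_ring :: 'k ring)" "b \<in> carrier (class_ring :: 'k ring)" "S \<in> carrier ?H"
    then obtain \<phi> where *: "\<phi> \<in> Zc X A q" "S = cclass q \<phi>" using car by metis
    note [simp] = *(2) cech_add cech_smult fvs.subspace_add[OF sZ] fvs.subspace_scale[OF sZ] *(1)
    show "(a \<oplus>\<^bsub>class_ring\<^esub> b) \<odot>\<^bsub>?H\<^esub> S = a \<odot>\<^bsub>?H\<^esub> S \<oplus>\<^bsub>?H\<^esub> b \<odot>\<^bsub>?H\<^esub> S"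
      by (simp add: fvs.scale_left_distrib)
  next
    fix a b :: 'k and S assume ab: "a \<in> carrier (class_ring :: 'k ring)" "b \<in> carrier (class_ring :: 'k ring)" "S \<in> carrier ?H"
    then obtain \<phi> where *: "\<phi> \<in> Zc X A q" "S = cclass q \<phi>" using car by metis
    note [simp] = *(2) cech_add cech_smult fvs.subspace_add[OF sZ] fvs.subspace_scale[OF sZ] *(1)
    show "(a \<otimes>\<^bsub>class_ring\<^esub> b) \<odot>\<^bsub>?H\<^esub> S = a \<odot>\<^bsub>?H\<^esub> (b \<odot>\<^bsub>?H\<^esub> S)" by simp
  next
    fix S assume "S \<in> carrier ?H"
    then obtain \<phi> where "\<phi> \<in> Zc X A q" "S = cclass q \<phi>" using car by metis
    then show "\<one>\<^bsub>class_ring\<^esub> \<odot>\<^bsub>?H\<^esub> S = S" by (simp add: cech_smult)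
  next
    fix a :: 'k and S T assume a: "a \<in> carrier (class_ring :: 'k ring)" "S \<in> carrier ?H" "T \<in> carrier ?H"
    then obtain \<phi> \<psi> where "\<phi> \<in> Zc X A q" "\<psi> \<in> Zc X A q" "S = cclass q \<phi>" "T = cclass q \<psi>" using car by metis
    then show "a \<odot>\<^bsub>?H\<^esub> (S \<oplus>\<^bsub>?H\<^esub> T) = a \<odot>\<^bsub>?H\<^esub> S \<oplus>\<^bsub>?H\<^esub> a \<odot>\<^bsub>?H\<^esub> T"
      by (simp add: cech_add cech_smult fvs.subspace_add[OF sZ] fvs.subspace_scale[OF sZ] fvs.scale_right_distrib)
  qed
  ultimately show ?thesis by (intro vectorspace.intro class_field.field_axioms)
qed

text \<open>The classes with a representative in the span of finitely many lifted generators and the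
  coboundaries form a submodule containing the generators, hence everything.\<close>

lemma fin_dim_imp_finite_over:
  assumes "vectorspace.fin_dim class_ring (cech X A q :: ('k::field, ('z, 'k) cech_class) module)"
  shows "finite_over (Bd X A q) (Zc X A q :: ('z list \<Rightarrow> 'k) set)"
proof -
  let ?H = "cech X A q :: ('k, ('z, 'k) cech_class) module"
  interpret H: vectorspace class_ring ?H by (rule cech_vectorspace)
  obtain G where G: "finite G" "G \<subseteq> carrier ?H" "H.span G = carrier ?H"
    using assms by (auto simp: H.fin_dim_def)
  obtain S where S: "S \<subseteq> Zc X A q" "finite S" "G = cclass q ` S"
    using finite_subset_image[OF G(1) G(2)[unfolded carrier_cech]] by blast
  define N where "N = cclass q ` (fvs.span (S \<union> Bd X A q) \<inter> Zc X A q)"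
  have sub: "fvs.subspace (fvs.span (S \<union> Bd X A q) \<inter> Zc X A q)"
    by (intro fvs.subspace_inter fvs.subspace_span subspace_Zc)
  have "submodule class_ring N ?H"
  proof (rule submodule.intro)
    show "Module.module class_ring ?H" by (rule H.module_axioms)
    show "N \<subseteq> carrier ?H" unfolding N_def using cclass_carrier by blast
    show "\<zero>\<^bsub>?H\<^esub> \<in> N" unfolding N_def cech_zero using fvs.subspace_0[OF sub] by blast
    show "v \<oplus>\<^bsub>?H\<^esub> w \<in> N" if vw: "v \<in> N" "w \<in> N" for v w
    proof -
      obtain \<phi> \<psi> where *: "\<phi> \<in> fvs.span (S \<union> Bd X A q) \<inter> Zc X A q" "\<psi> \<in> fvs.span (S \<union> Bd X A q) \<inter> Zc X A q"
        "v = cclass q \<phi>" "w = cclass q \<psi>" using vw unfolding N_def by blast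
      then have "v \<oplus>\<^bsub>?H\<^esub> w = cclass q (\<phi> + \<psi>)" by (simp add: cech_add)
      then show ?thesis unfolding N_def using fvs.subspace_add[OF sub *(1,2)] by blast
    qed
    show "c \<odot>\<^bsub>?H\<^esub> v \<in> N" if v: "v \<in> N" for c v
    proof -
      obtain \<phi> where *: "\<phi> \<in> fvs.span (S \<union> Bd X A q) \<inter> Zc X A q" "v = cclass q \<phi>"
        using v unfolding N_def by blast
      then have "c \<odot>\<^bsub>?H\<^esub> v = cclass q (c *s \<phi>)" by (simp add: cech_smult)
      then show ?thesis unfolding N_def using fvs.subspace_scale[OF sub *(1)] by blast
    qed
  qed
  moreover have "G \<subseteq> N" unfolding N_def S(3) using S(1) by (auto intro: fvs.span_base)
  ultimately have "carrier ?H \<subseteq> N" using H.span_is_subset G(3) by blast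
  have "Zc X A q \<subseteq> fvs.span (S \<union> Bd X A q)"
  proof
    fix \<phi> :: "'z list \<Rightarrow> 'k" assume \<phi>: "\<phi> \<in> Zc X A q"
    then have "cclass q \<phi> \<in> N" using \<open>carrier ?H \<subseteq> N\<close> cclass_carrier by blast
    then obtain \<psi> where \<psi>: "\<psi> \<in> fvs.span (S \<union> Bd X A q)" "\<psi> \<in> Zc X A q" "cclass q \<phi> = cclass q \<psi>"
      unfolding N_def by blast
    then have "\<phi> - \<psi> \<in> Bd X A q" using cclass_eq_iff[OF \<phi>] by blast
    then have "\<phi> - \<psi> \<in> fvs.span (S \<union> Bd X A q)" by (simp add: fvs.span_base)
    then show "\<phi> \<in> fvs.span (S \<union> Bd X A q)" using fvs.span_add[OF _ \<psi>(1)] by fastforce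
  qed
  then show ?thesis unfolding finite_over_def using S(2) by blast
qed

end

section \<open>The exact sequence of a pair\<close>

lemma cob_fun_plus: "cob (\<phi> + \<psi>) = cob \<phi> + cob \<psi>"
  by (simp add: plus_fun_def cob_plus fun_eq_iff)

lemma cob_fun_scale: "cob (c *s \<phi>) = c *s cob \<phi>"
  by (simp add: fscale_def cob_times fun_eq_iff)

text \<open>The middle term of the exact piece from degree p of \<open>A\<close> through degree p +
  1 of the pair to degree p + 1 of \<open>X\<close>. A cocycle on \<open>A\<close> is already a
  function on all lists, so \<open>cob\<close> itself is the connecting map.\<close>

lemma finite_over_relative:
  fixes X :: "'z topology"
  assumes A: "closedin X A"
    and X: "finite_over (Bd X {} (Suc p)) (Zc X {} (Suc p) :: ('z list \<Rightarrow> 'k::field) set)"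
    and Ap: "finite_over (Bd (subtopology X A) {} p) (Zc (subtopology X A) {} p :: ('z list \<Rightarrow> 'k) set)"
  shows "finite_over (Bd X A (Suc p)) (Zc X A (Suc p) :: ('z list \<Rightarrow> 'k) set)"
proof -
  \<comment> \<open>The cocycles that die in the absolute cohomology of \<open>X\<close>; by
    exactness they come from \<open>A\<close>.\<close>
  let ?T = "Zc X A (Suc p) \<inter> Bd X {} (Suc p) :: ('z list \<Rightarrow> 'k) set"
  have "finite_over (Bd X A (Suc p)) ?T"
  proof (rule finite_over_image[of cob, OF cob_fun_plus cob_fun_scale Ap])
    show "cob ` Bd (subtopology X A) {} p \<subseteq> (Bd X A (Suc p) :: ('z list \<Rightarrow> 'k) set)"
    proof (rule image_subsetI)
      fix \<phi> :: "'z list \<Rightarrow> 'k" assume "\<phi> \<in> Bd (subtopology X A) {} p"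
      then obtain \<psi> where \<psi>: "eventually (\<lambda>xs. set xs \<subseteq> A \<longrightarrow> length xs = Suc p \<longrightarrow> \<phi> xs = cob \<psi> xs) (smalls X)"
        unfolding Bd_subtopology[OF A] by blast
      \<comment> \<open>Replacing \<open>\<phi>\<close> by its difference with
        \<open>cob \<psi>\<close> leaves the coboundary unchanged and makes the primitive vanish on
        \<open>A\<close>.\<close>
      show "cob \<phi> \<in> Bd X A (Suc p)"
      proof (rule BdI[of _ "\<lambda>xs. \<phi> xs - cob \<psi> xs"])
        show "eventually (\<lambda>xs. length xs = Suc p \<longrightarrow> set xs \<subseteq> A \<longrightarrow> \<phi> xs - cob \<psi> xs = 0) (smalls X)"
          using \<psi> by (rule eventually_mono) simp
      qed (simp_all add: cob_minus)
    qed
    show "?T \<subseteq> fvs.span (cob ` Zc (subtopology X A) {} p \<union> Bd X A (Suc p))"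
    proof
      fix u :: "'z list \<Rightarrow> 'k" assume u: "u \<in> ?T"
      then obtain w where w: "eventually (\<lambda>xs. length xs = Suc (Suc p) \<longrightarrow> u xs = cob w xs) (smalls X)"
        unfolding Bd_def by blast
      have "eventually (\<lambda>xs. length xs = Suc (Suc p) \<longrightarrow> set xs \<subseteq> A \<longrightarrow> u xs = 0) (smalls X)"
        using u by (simp add: Zc_def)
      with w have "eventually (\<lambda>xs. set xs \<subseteq> A \<longrightarrow> length xs = Suc (Suc p) \<longrightarrow> cob w xs = 0) (smalls X)"
        by (rule eventually_elim2) auto
      then have "w \<in> Zc (subtopology X A) {} p"
        by (intro Zc_absolute) (simp add: eventually_smalls_subtopology[OF A])
      then have "cob w \<in> fvs.span (cob ` Zc (subtopology X A) {} p \<union> Bd X A (Suc p))"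
        by (intro fvs.span_base) blast
      moreover have "u - cob w \<in> Bd X A (Suc p)" using w by (rule small_eq_imp_Bd)
      then have "u - cob w \<in> fvs.span (cob ` Zc (subtopology X A) {} p \<union> Bd X A (Suc p))"
        by (intro fvs.span_base) blast
      ultimately show "u \<in> fvs.span (cob ` Zc (subtopology X A) {} p \<union> Bd X A (Suc p))"
        using fvs.span_add by fastforce
    qed
  qed
  then obtain S2 where S2: "finite S2" "?T \<subseteq> fvs.span (S2 \<union> Bd X A (Suc p))"
    unfolding finite_over_def by blast
  have "finite_over (Bd X {} (Suc p)) (Zc X A (Suc p) :: ('z list \<Rightarrow> 'k) set)"
    using X by (rule finite_over_mono) (auto intro: Zc_mono[THEN subsetD])
  then obtain S1 where S1: "finite S1" "S1 \<subseteq> Zc X A (Suc p)" "Zc X A (Suc p) \<subseteq> fvs.span (S1 \<union> Bd X {} (Suc p) :: ('z list \<Rightarrow> 'k) set)"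
    by (rule finite_over_basis[OF _ subspace_Zc])
  have "Zc X A (Suc p) \<subseteq> fvs.span ((S1 \<union> S2) \<union> Bd X A (Suc p))"
  proof
    fix u :: "'z list \<Rightarrow> 'k" assume u: "u \<in> Zc X A (Suc p)"
    then have "u \<in> fvs.span (S1 \<union> Bd X {} (Suc p))" using S1(3) by blast
    then obtain y b where y: "y \<in> fvs.span S1" "b \<in> Bd X {} (Suc p)" "u = y + b"
      by (rule span_Un_subspace[OF _ subspace_Bd])
    have "y \<in> Zc X A (Suc p)" using y(1) fvs.span_minimal[OF S1(2) subspace_Zc] by blast
    then have "u - y \<in> Zc X A (Suc p)" using u by (simp add: fvs.subspace_diff[OF subspace_Zc])
    then have "b \<in> ?T" using y by simp
    then have "b \<in> fvs.span ((S1 \<union> S2) \<union> Bd X A (Suc p))"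
      using S2(2) fvs.span_mono[of "S2 \<union> Bd X A (Suc p)" "(S1 \<union> S2) \<union> Bd X A (Suc p)"] by blast
    moreover have "y \<in> fvs.span ((S1 \<union> S2) \<union> Bd X A (Suc p))"
      using y(1) fvs.span_mono[of S1 "(S1 \<union> S2) \<union> Bd X A (Suc p)"] by blast
    ultimately show "u \<in> fvs.span ((S1 \<union> S2) \<union> Bd X A (Suc p))"
      unfolding y(3) by (intro fvs.span_add)
  qed
  then show ?thesis unfolding finite_over_def using S1(1) S2(1) by blast
qed

section \<open>Collapsing a closed set\<close>

lemma openin_collapse_off:
  assumes "openin T U" "closedin T S"
  shows "openin (collapse_topology T S) (Some ` (U - S))"
proof -
  have "{x \<in> topspace T. collapse_proj S x \<in> Some ` (U - S)} = U - S"
    using openin_subset[OF assms(1)] by (auto simp: collapse_proj_def)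
  then show ?thesis
    using assms openin_subset[OF assms(1)] by (auto simp: openin_collapse_topology openin_diff)
qed

lemma openin_collapse_around:
  assumes "openin T U" "S \<inter> topspace T \<subseteq> U"
  shows "openin (collapse_topology T S) (insert None (Some ` (U - S)))"
proof -
  have "{x \<in> topspace T. collapse_proj S x \<in> insert None (Some ` (U - S))} = U"
    using openin_subset[OF assms(1)] assms(2) by (auto simp: collapse_proj_def)
  then show ?thesis
    using assms openin_subset[OF assms(1)] by (auto simp: openin_collapse_topology)
qed

lemma continuous_collapse_proj: "continuous_map T (collapse_topology T S) (collapse_proj S)"
  unfolding continuous_map_def
  by (auto simp: topspace_collapse_topology openin_collapse_topology) (auto simp: collapse_proj_def)

text \<open>The value at \<open>None\<close> is a separate condition because \<open>None\<close> is
  a disjoint point when \<open>S\<close> misses the space.\<close>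

lemma continuous_from_collapse:
  assumes "h None \<in> topspace Y" "continuous_map T Y (\<lambda>x. h (collapse_proj S x))"
  shows "continuous_map (collapse_topology T S) Y h"
  unfolding continuous_map_def
proof (intro conjI allI impI)
  show "h \<in> topspace (collapse_topology T S) \<rightarrow> topspace Y"
  proof
    fix z assume z: "z \<in> topspace (collapse_topology T S)"
    show "h z \<in> topspace Y"
    proof (cases z)
      case (Some x)
      then have "x \<in> topspace T" "collapse_proj S x = z"
        using z by (auto simp: topspace_collapse_topology collapse_proj_def)
      then show ?thesis using assms(2) by (auto simp: continuous_map_def Pi_iff)
    qed (simp add: assms)
  qed
  fix U assume U: "openin Y U"
  have "collapse_proj S x \<in> topspace (collapse_topology T S)" if "x \<in> topspace T" for x
    using that by (auto simp: topspace_collapse_topology collapse_proj_def)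
  then have "{x \<in> topspace T. collapse_proj S x \<in> {z \<in> topspace (collapse_topology T S). h z \<in> U}} =
      {x \<in> topspace T. h (collapse_proj S x) \<in> U}" by blast
  moreover have "openin T {x \<in> topspace T. h (collapse_proj S x) \<in> U}"
    using assms(2) U by (simp add: continuous_map_def)
  moreover have "{z \<in> topspace (collapse_topology T S). h z \<in> U} \<subseteq> insert None (Some ` (topspace T - S))"
    by (auto simp: topspace_collapse_topology)
  ultimately show "openin (collapse_topology T S) {z \<in> topspace (collapse_topology T S). h z \<in> U}"
    unfolding openin_collapse_topology by presburger
qed

lemma compact_space_collapse:
  assumes "compact_space T"
  shows "compact_space (collapse_topology T S)"
proof -
  have "compactin (collapse_topology T S) (collapse_proj S ` topspace T)"
    using image_compactin[OF _ continuous_collapse_proj] assms by (auto simp: compact_space_def)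
  moreover have "compactin (collapse_topology T S) {None}"
    by (simp add: topspace_collapse_topology)
  ultimately have "compactin (collapse_topology T S) (collapse_proj S ` topspace T \<union> {None})"
    by (rule compactin_Un)
  moreover have "collapse_proj S ` topspace T \<union> {None} = topspace (collapse_topology T S)"
    by (auto simp: topspace_collapse_topology collapse_proj_def image_iff)
  ultimately show ?thesis by (simp add: compact_space_def)
qed

lemma Hausdorff_space_collapse:
  assumes T: "compact_space T" "Hausdorff_space T" and S: "closedin T S"
  shows "Hausdorff_space (collapse_topology T S)"
proof -
  let ?Q = "collapse_topology T S"
  have reg: "regular_space T" using T by (simp add: compact_Hausdorff_or_regular_imp_normal_space
        normal_t1_imp_regular_space Hausdorff_imp_t1_space)
  have N: "\<exists>U V. openin ?Q U \<and> openin ?Q V \<and> None \<in> U \<and> Some y \<in> V \<and> disjnt U V"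
    if y: "y \<in> topspace T - S" for y
  proof -
    obtain U V where UV: "openin T U" "openin T V" "S \<subseteq> U" "y \<in> V" "disjnt U V"
      using reg S y unfolding regular_space_def by (metis disjnt_sym)
    show ?thesis
      using openin_collapse_around[OF UV(1)] openin_collapse_off[OF UV(2) S] UV y
      by (intro exI[of _ "insert None (Some ` (U - S))"] exI[of _ "Some ` (V - S)"]) (auto simp: disjnt_def)
  qed
  have S2: "\<exists>U V. openin ?Q U \<and> openin ?Q V \<and> Some x \<in> U \<and> Some y \<in> V \<and> disjnt U V"
    if xy: "x \<in> topspace T - S" "y \<in> topspace T - S" "x \<noteq> y" for x y
  proof -
    obtain U V where UV: "openin T U" "openin T V" "x \<in> U" "y \<in> V" "disjnt U V"
      using T(2) xy unfolding Hausdorff_space_def by blast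
    show ?thesis
      using openin_collapse_off[OF UV(1) S] openin_collapse_off[OF UV(2) S] UV xy
      by (intro exI[of _ "Some ` (U - S)"] exI[of _ "Some ` (V - S)"]) (auto simp: disjnt_def)
  qed
  show ?thesis
    unfolding Hausdorff_space_def
  proof (intro allI impI)
    fix x y assume xy: "x \<in> topspace ?Q \<and> y \<in> topspace ?Q \<and> x \<noteq> y"
    show "\<exists>U V. openin ?Q U \<and> openin ?Q V \<and> x \<in> U \<and> y \<in> V \<and> disjnt U V"
    proof (cases x)
      case None
      with xy obtain y' where "y = Some y'" "y' \<in> topspace T - S" by (auto simp: topspace_collapse_topology)
      then show ?thesis using N[of y'] None by blast
    next
      case x: (Some x')
      with xy have x': "x' \<in> topspace T - S" by (auto simp: topspace_collapse_topology)
      show ?thesis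
      proof (cases y)
        case None
        then show ?thesis using N[OF x'] x by (metis disjnt_sym)
      next
        case y: (Some y')
        with xy have "y' \<in> topspace T - S" by (auto simp: topspace_collapse_topology)
        then show ?thesis using S2[OF x', of y'] x y xy by blast
      qed
    qed
  qed
qed

text \<open>Around \<open>None\<close> the neighbourhood given by \<open>V\<close> is used, around
  any other point one that misses \<open>S\<close>; lists in the latter lift to small lists of
  \<open>T\<close>.\<close>

lemma eventually_smalls_collapse:
  assumes R: "eventually R (smalls T)" and S: "closedin T S" and V: "openin T V" "S \<subseteq> V"
  shows "eventually (\<lambda>ys. set ys \<subseteq> insert None (Some ` V) \<or>
     (\<exists>xs. ys = map Some xs \<and> set xs \<inter> S = {} \<and> R xs)) (smalls (collapse_topology T S))"
  unfolding eventually_smalls_local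
proof
  fix z assume z: "z \<in> topspace (collapse_topology T S)"
  show "\<exists>U. openin (collapse_topology T S) U \<and> z \<in> U \<and> (\<forall>ys. ys \<noteq> [] \<longrightarrow> set ys \<subseteq> U \<longrightarrow>
      set ys \<subseteq> insert None (Some ` V) \<or> (\<exists>xs. ys = map Some xs \<and> set xs \<inter> S = {} \<and> R xs))"
  proof (cases z)
    case None
    then show ?thesis
      using openin_collapse_around[OF V(1), of S] V(2)
      by (intro exI[of _ "insert None (Some ` (V - S))"]) blast
  next
    case (Some x)
    with z have x: "x \<in> topspace T" "x \<notin> S" by (auto simp: topspace_collapse_topology)
    then obtain U where U: "openin T U" "x \<in> U" "\<And>xs. xs \<noteq> [] \<Longrightarrow> set xs \<subseteq> U \<Longrightarrow> R xs"
      using R unfolding eventually_smalls_local by blast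
    have "\<exists>xs. ys = map Some xs \<and> set xs \<inter> S = {} \<and> R xs" if ys: "ys \<noteq> []" "set ys \<subseteq> Some ` (U - S)" for ys
    proof (intro exI[of _ "map the ys"] conjI)
      have "map Some (map the ys) = map id ys" unfolding map_map
        by (rule map_cong) (use ys(2) in auto)
      then show "ys = map Some (map the ys)" by simp
      have "set (map the ys) \<subseteq> U - S" using ys(2) by auto
      then show "set (map the ys) \<inter> S = {}" "R (map the ys)" using U(3)[of "map the ys"] ys(1) by auto
    qed
    then show ?thesis
      using openin_collapse_off[OF U(1) S] Some x U(2)
      by (intro exI[of _ "Some ` (U - S)"]) blast
  qed
qed

text \<open>Meant for \<open>u\<close> that vanishes on small lists in \<open>V\<close>, so that the
  value zero near the collapsed point is consistent. Lists that contain \<open>None\<close> and also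
  leave \<open>V\<close> get a junk value through \<open>the None\<close>; they are not
  small.\<close>

definition descend :: "'a set \<Rightarrow> ('a list \<Rightarrow> 'k::field) \<Rightarrow> 'a option list \<Rightarrow> 'k" where
  "descend V u ys = (if set ys \<subseteq> insert None (Some ` V) then 0 else u (map the ys))"

lemma descend_map_Some: "descend V u (map Some xs) = (if set xs \<subseteq> V then 0 else u xs)"
  by (auto simp: descend_def comp_def)

lemma descend_proj:
  assumes S: "closedin T S" and V: "openin T V" "S \<subseteq> V"
    and z: "eventually (\<lambda>xs. set xs \<subseteq> V \<longrightarrow> length xs = n \<longrightarrow> u xs = 0) (smalls T)"
  shows "eventually (\<lambda>xs. length xs = n \<longrightarrow> descend V u (map (collapse_proj S) xs) = u xs) (smalls T)"
proof -
  have "open_cover T {V, topspace T - S}"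
    using V S closedin_subset[OF S] openin_subset[OF V(1)] by (auto simp: open_cover_def)
  then have "eventually (\<lambda>xs. set xs \<subseteq> V \<or> set xs \<inter> S = {}) (smalls T)"
    unfolding eventually_smalls by (intro exI[of _ "{V, topspace T - S}"]) auto
  with z show ?thesis
  proof (rule eventually_elim2, intro impI)
    fix xs assume xs: "set xs \<subseteq> V \<longrightarrow> length xs = n \<longrightarrow> u xs = 0" "set xs \<subseteq> V \<or> set xs \<inter> S = {}" "length xs = n"
    show "descend V u (map (collapse_proj S) xs) = u xs"
    proof (cases "set xs \<subseteq> V")
      case True
      then have "set (map (collapse_proj S) xs) \<subseteq> insert None (Some ` V)"
        by (auto simp: collapse_proj_def)
      then show ?thesis using xs True by (simp add: descend_def)
    next
      case False
      then have "map (collapse_proj S) xs = map Some xs"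
        using xs(2) by (intro map_cong) (auto simp: collapse_proj_def)
      then show ?thesis using False by (simp only: descend_map_Some) simp
    qed
  qed
qed

text \<open>A list may leave \<open>V\<close> while one of its faces stays inside. There
  \<open>descend\<close> puts zero, and \<open>u\<close> is zero as well.\<close>

lemma cob_descend:
  fixes T :: "'a topology"
  assumes S: "closedin T S" and V: "openin T V" "S \<subseteq> V"
    and z: "eventually (\<lambda>xs. set xs \<subseteq> V \<longrightarrow> length xs = Suc n \<longrightarrow> u xs = 0) (smalls T)"
  shows "eventually (\<lambda>ys. length ys = Suc (Suc n) \<longrightarrow> cob (descend V u) ys = descend V (cob u) ys)
     (smalls (collapse_topology T S))"
  using eventually_smalls_collapse[OF eventually_smalls_subset[OF z] S V]
proof (rule eventually_mono, intro impI)
  fix ys :: "'a option list" assume l: "length ys = Suc (Suc n)"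
  assume "set ys \<subseteq> insert None (Some ` V) \<or> (\<exists>xs. ys = map Some xs \<and> set xs \<inter> S = {} \<and>
      (\<forall>zs. zs \<noteq> [] \<longrightarrow> set zs \<subseteq> set xs \<longrightarrow> set zs \<subseteq> V \<longrightarrow> length zs = Suc n \<longrightarrow> u zs = 0))"
  then show "cob (descend V u) ys = descend V (cob u) ys"
  proof (elim disjE exE conjE)
    assume ys: "set ys \<subseteq> insert None (Some ` V)"
    have "cob (descend V u) ys = 0" by (rule cob_eq_0) (use ys in \<open>auto simp: descend_def\<close>)
    then show ?thesis using ys by (simp add: descend_def)
  next
    fix xs assume xs: "ys = map Some xs" and
      z: "\<forall>zs. zs \<noteq> [] \<longrightarrow> set zs \<subseteq> set xs \<longrightarrow> set zs \<subseteq> V \<longrightarrow> length zs = Suc n \<longrightarrow> u zs = 0"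
    have face: "u zs = 0" if "set zs \<subseteq> set xs" "length xs = Suc (length zs)" "set zs \<subseteq> V" for zs
    proof -
      have "zs \<noteq> []" "length zs = Suc n" using that l xs by auto
      then show ?thesis using z that by blast
    qed
    have "cob (descend V u) ys = cob (\<lambda>zs. descend V u (map Some zs)) xs" by (simp add: xs cob_map)
    also have "\<dots> = cob u xs" by (rule cob_cong) (use face in \<open>auto simp: descend_map_Some\<close>)
    also have "\<dots> = descend V (cob u) ys"
    proof (cases "set xs \<subseteq> V")
      case True
      then have "cob u xs = 0" using face by (intro cob_eq_0) auto
      then show ?thesis using True by (simp add: xs descend_map_Some)
    qed (simp add: xs descend_map_Some)
    finally show ?thesis .
  qed
qed

section \<open>Excision for the collapsed pair\<close>

locale collapsed_pair = compact_pair X A for X :: "'z topology" and A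
begin

definition "Q = collapse_topology X A"

abbreviation "proj \<equiv> collapse_proj A"

lemma compact_Q: "compact_space Q" and Hausdorff_Q: "Hausdorff_space Q"
  unfolding Q_def using compact_space_collapse[OF compact] Hausdorff_space_collapse[OF compact Hausdorff closed] by auto

lemma None_Q: "None \<in> topspace Q" by (simp add: Q_def topspace_collapse_topology)

lemma proj_Q: "continuous_map X Q proj" by (simp add: Q_def continuous_collapse_proj)

lemma proj_A: "proj ` (A \<inter> topspace X) \<subseteq> {None}" by (auto simp: collapse_proj_def)

text \<open>A relative cocycle bounds near \<open>A\<close> with a primitive vanishing on
  \<open>A\<close>. Subtracting the coboundary of that primitive makes it zero on a whole
  neighbourhood of \<open>A\<close>, and then it descends.\<close>

lemma excision_surj:
  fixes u :: "'z list \<Rightarrow> 'k::field"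
  assumes u: "u \<in> Zc X A q"
  obtains \<phi> where "\<phi> \<in> Zc Q {None} q" "u - (\<lambda>xs. \<phi> (map proj xs)) \<in> Bd X A q"
proof -
  have c: "eventually (\<lambda>xs. set xs \<subseteq> topspace X \<longrightarrow> length xs = Suc (Suc q) \<longrightarrow> cob u xs = 0) (smalls X)"
    and z: "eventually (\<lambda>xs. set xs \<subseteq> A \<longrightarrow> length xs = Suc q \<longrightarrow> u xs = 0) (smalls X)"
    using u by (auto simp: Zc_def elim: eventually_mono)
  obtain \<psi> V where V: "openin X V" "A \<subseteq> V" "q = 0 \<Longrightarrow> \<psi> = (\<lambda>_. 0)"
    "eventually (\<lambda>xs. set xs \<subseteq> A \<longrightarrow> length xs = q \<longrightarrow> \<psi> xs = 0) (smalls X)"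
    "eventually (\<lambda>xs. set xs \<subseteq> V \<longrightarrow> length xs = Suc q \<longrightarrow> u xs = cob \<psi> xs) (smalls X)"
    by (rule bounds_near[OF compact Hausdorff closed openin_topspace A_subset c z]) (rule that)
  define u1 where "u1 = (\<lambda>xs. u xs - cob \<psi> xs)"
  have z1: "eventually (\<lambda>xs. set xs \<subseteq> V \<longrightarrow> length xs = Suc q \<longrightarrow> u1 xs = 0) (smalls X)"
    using V(5) by (rule eventually_mono) (simp add: u1_def)
  have c1: "eventually (\<lambda>xs. length xs = Suc (Suc q) \<longrightarrow> cob u1 xs = 0) (smalls X)"
    using u by (simp add: u1_def cob_minus Zc_def)
  show thesis
  proof (rule that)
    have "eventually (\<lambda>ys. length ys = Suc (Suc q) \<longrightarrow> descend V (cob u1) ys = 0) (smalls Q)"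
      using eventually_smalls_collapse[OF c1 closed V(1,2)] unfolding Q_def
      by (rule eventually_mono) (auto simp: descend_map_Some, simp add: descend_def)
    with cob_descend[OF closed V(1,2) z1]
    have "eventually (\<lambda>ys. length ys = Suc (Suc q) \<longrightarrow> cob (descend V u1) ys = 0) (smalls Q)"
      unfolding Q_def by (rule eventually_elim2) simp
    then show "descend V u1 \<in> Zc Q {None} q"
      by (rule ZcI) (rule always_eventually, auto simp: descend_def)
    show "u - (\<lambda>xs. descend V u1 (map proj xs)) \<in> Bd X A q"
    proof (rule BdI[OF V(3)])
      show "eventually (\<lambda>xs. length xs = q \<longrightarrow> set xs \<subseteq> A \<longrightarrow> \<psi> xs = 0) (smalls X)"
        using V(4) by (rule eventually_mono) simp
      show "eventually (\<lambda>xs. length xs = Suc q \<longrightarrow> (u - (\<lambda>xs. descend V u1 (map proj xs))) xs = cob \<psi> xs) (smalls X)"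
        using descend_proj[OF closed V(1,2) z1] by (rule eventually_mono) (simp add: u1_def)
    qed
  qed
qed

lemma cone_at_None:
  fixes \<phi> :: "'z option list \<Rightarrow> 'k::field"
  assumes "\<phi> \<in> Zc Q B q"
  obtains V where "openin Q V" "None \<in> V"
    "\<And>ys. set ys \<subseteq> V \<Longrightarrow> length ys = Suc q \<Longrightarrow> \<phi> ys = cob (\<lambda>zs. \<phi> (None # zs)) ys"
  using assms None_Q unfolding Zc_def
  by (auto intro: cone_at_point[of q \<phi> Q None])

text \<open>A list of copies of one point is small for every cover, so a condition on small lists
  holds exactly there.\<close>

lemma Zc_None_replicate:
  assumes "\<phi> \<in> Zc Q {None} q" "set ys \<subseteq> {None}" "length ys = Suc q"
  shows "\<phi> ys = 0"
proof -
  have "eventually (\<lambda>xs. length xs = Suc q \<longrightarrow> set xs \<subseteq> {None} \<longrightarrow> \<phi> xs = 0) (smalls Q)"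
    using assms(1) by (simp add: Zc_def)
  then obtain U where "None \<in> U" "\<And>xs. xs \<noteq> [] \<Longrightarrow> set xs \<subseteq> U \<Longrightarrow> length xs = Suc q \<longrightarrow> set xs \<subseteq> {None} \<longrightarrow> \<phi> xs = 0"
    using None_Q unfolding eventually_smalls_local by blast
  then show ?thesis using assms(2,3) by (metis empty_subsetI insert_subset length_0_conv nat.distinct(1) order.trans)
qed

text \<open>A primitive on \<open>X\<close> need not be constant near \<open>A\<close>. The cone
  \<open>\<kappa>\<close> from \<open>None\<close> is a primitive near the collapsed point;
  subtracting its pull-back leaves a cochain that is a cocycle near \<open>A\<close> and zero on
  \<open>A\<close>. A second correction by \<open>bounds_near\<close> makes it zero near
  \<open>A\<close>, so it descends.\<close>

lemma excision_inj:
  fixes \<phi> :: "'z option list \<Rightarrow> 'k::field"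
  assumes \<phi>: "\<phi> \<in> Zc Q {None} (Suc p)" and b: "(\<lambda>xs. \<phi> (map proj xs)) \<in> Bd X A (Suc p)"
  shows "\<phi> \<in> Bd Q {} (Suc p)"
proof -
  obtain w where w: "eventually (\<lambda>xs. length xs = Suc p \<longrightarrow> set xs \<subseteq> A \<longrightarrow> w xs = 0) (smalls X)"
    "eventually (\<lambda>xs. length xs = Suc (Suc p) \<longrightarrow> \<phi> (map proj xs) = cob w xs) (smalls X)"
    using b by (elim BdE) (rule that)
  obtain G where G: "openin Q G" "None \<in> G"
    "\<And>ys. set ys \<subseteq> G \<Longrightarrow> length ys = Suc (Suc p) \<Longrightarrow> \<phi> ys = cob (\<lambda>zs. \<phi> (None # zs)) ys"
    by (rule cone_at_None[OF \<phi>]) (rule that)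
  define \<kappa> where "\<kappa> = (\<lambda>zs. \<phi> (None # zs))"
  define U where "U = {x \<in> topspace X. proj x \<in> G}"
  have U: "openin X U" "A \<subseteq> U"
    using proj_Q G(1,2) A_subset unfolding U_def continuous_map_def by (auto simp: collapse_proj_def)
  define w1 where "w1 = (\<lambda>xs. w xs - \<kappa> (map proj xs))"
  have cw1: "eventually (\<lambda>xs. length xs = Suc (Suc p) \<longrightarrow> cob w1 xs = \<phi> (map proj xs) - cob \<kappa> (map proj xs)) (smalls X)"
    using w(2) by (rule eventually_mono) (simp add: w1_def cob_minus cob_map)
  have c: "eventually (\<lambda>xs. set xs \<subseteq> U \<longrightarrow> length xs = Suc (Suc p) \<longrightarrow> cob w1 xs = 0) (smalls X)"
    using cw1
  proof (rule eventually_mono, intro impI)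
    fix xs assume "length xs = Suc (Suc p) \<longrightarrow> cob w1 xs = \<phi> (map proj xs) - cob \<kappa> (map proj xs)"
      "set xs \<subseteq> U" "length xs = Suc (Suc p)"
    moreover from this have "\<phi> (map proj xs) = cob \<kappa> (map proj xs)"
      unfolding \<kappa>_def by (intro G(3)) (auto simp: U_def)
    ultimately show "cob w1 xs = 0" by simp
  qed
  have z: "eventually (\<lambda>xs. set xs \<subseteq> A \<longrightarrow> length xs = Suc p \<longrightarrow> w1 xs = 0) (smalls X)"
    using w(1)
  proof (rule eventually_mono, intro impI)
    fix xs assume *: "length xs = Suc p \<longrightarrow> set xs \<subseteq> A \<longrightarrow> w xs = 0" "set xs \<subseteq> A" "length xs = Suc p"
    have "\<kappa> (map proj xs) = 0"
      unfolding \<kappa>_def using * by (intro Zc_None_replicate[OF \<phi>]) (auto simp: collapse_proj_def)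
    then show "w1 xs = 0" using * by (simp add: w1_def)
  qed
  obtain \<eta> V where V: "openin X V" "A \<subseteq> V" "p = 0 \<Longrightarrow> \<eta> = (\<lambda>_. 0)"
    "eventually (\<lambda>xs. set xs \<subseteq> A \<longrightarrow> length xs = p \<longrightarrow> \<eta> xs = 0) (smalls X)"
    "eventually (\<lambda>xs. set xs \<subseteq> V \<longrightarrow> length xs = Suc p \<longrightarrow> w1 xs = cob \<eta> xs) (smalls X)"
    by (rule bounds_near[OF compact Hausdorff closed U c z]) (rule that)
  define w2 where "w2 = (\<lambda>xs. w1 xs - cob \<eta> xs)"
  define V2 where "V2 = U \<inter> V"
  have V2: "openin X V2" "A \<subseteq> V2" unfolding V2_def using U V by (auto intro: openin_Int)
  have z2: "eventually (\<lambda>xs. set xs \<subseteq> V2 \<longrightarrow> length xs = Suc p \<longrightarrow> w2 xs = 0) (smalls X)"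
    using V(5) by (rule eventually_mono) (simp add: w2_def V2_def)
  have cw2: "eventually (\<lambda>xs. length xs = Suc (Suc p) \<longrightarrow> cob w2 xs = \<phi> (map proj xs) - cob \<kappa> (map proj xs)) (smalls X)"
    using cw1 by (rule eventually_mono) (simp add: w2_def cob_minus)
  \<comment> \<open>Near \<open>None\<close> both sides vanish by the cone identity; a small list
    elsewhere lifts to \<open>X\<close>, where the identity is known.\<close>
  have "eventually (\<lambda>ys. length ys = Suc (Suc p) \<longrightarrow> descend V2 (cob w2) ys = \<phi> ys - cob \<kappa> ys) (smalls Q)"
    using eventually_conj[OF eventually_smalls_collapse[OF cw2 closed V2, folded Q_def] eventually_smalls_topspace]
  proof (rule eventually_mono, intro impI, elim conjE disjE exE)
    fix ys assume ys: "set ys \<subseteq> insert None (Some ` V2)" "length ys = Suc (Suc p)" "set ys \<subseteq> topspace Q"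
    have "set ys \<subseteq> G"
    proof
      fix y assume y: "y \<in> set ys"
      show "y \<in> G"
      proof (cases y)
        case (Some x)
        then have "x \<in> U" "x \<notin> A" using y ys by (auto simp: V2_def Q_def topspace_collapse_topology)
        then show ?thesis using Some by (auto simp: U_def collapse_proj_def)
      qed (use G(2) in simp)
    qed
    then have "\<phi> ys = cob \<kappa> ys" unfolding \<kappa>_def using ys(2) by (intro G(3))
    then show "descend V2 (cob w2) ys = \<phi> ys - cob \<kappa> ys" using ys by (simp add: descend_def)
  next
    fix ys xs assume l: "length ys = Suc (Suc p)" and ys: "ys = map Some xs" "set xs \<inter> A = {}"
      and e: "length xs = Suc (Suc p) \<longrightarrow> cob w2 xs = \<phi> (map proj xs) - cob \<kappa> (map proj xs)"
      and t: "set ys \<subseteq> topspace Q"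
    have m: "map proj xs = ys" unfolding ys(1) by (intro map_cong) (use ys(2) in \<open>auto simp: collapse_proj_def\<close>)
    show "descend V2 (cob w2) ys = \<phi> ys - cob \<kappa> ys"
    proof (cases "set xs \<subseteq> V2")
      case True
      have "set ys \<subseteq> G" using True m by (auto simp: V2_def U_def)
      then have "\<phi> ys = cob \<kappa> ys" unfolding \<kappa>_def using l by (intro G(3))
      then show ?thesis using True ys(1) by (simp add: descend_map_Some)
    next
      case False
      then show ?thesis using e m l ys(1) by (simp add: descend_map_Some)
    qed
  qed
  with cob_descend[OF closed V2 z2, folded Q_def]
  have "eventually (\<lambda>ys. length ys = Suc (Suc p) \<longrightarrow> \<phi> ys = cob (\<lambda>zs. descend V2 w2 zs + \<kappa> zs) ys) (smalls Q)"
    by (rule eventually_elim2) (simp add: cob_plus)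
  then show ?thesis
    using eventually_smalls_topspace[of Q]
    by (intro BdI[of _ "\<lambda>zs. descend V2 w2 zs + \<kappa> zs"]) (auto elim: eventually_mono)
qed

lemma cob_const: "cob (\<lambda>_. c) xs = (if even (length xs) then 0 else c)"
  by (induction xs) auto

text \<open>An absolute primitive takes some value \<open>c\<close> on the constant list at
  \<open>None\<close>. Subtracting this constant makes its pull-back vanish on \<open>A\<close>,
  provided that the constant cochain is a cocycle or zero, which the parity of p decides.\<close>

lemma excision_Bd:
  fixes \<phi> :: "'z option list \<Rightarrow> 'k::field"
  assumes \<phi>: "\<phi> \<in> Zc Q {None} (Suc p)" and b: "\<phi> \<in> Bd Q {} (Suc p)"
  shows "(\<lambda>xs. \<phi> (map proj xs)) \<in> Bd X A (Suc p)"
proof -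
  obtain \<psi> where \<psi>: "eventually (\<lambda>ys. length ys = Suc (Suc p) \<longrightarrow> \<phi> ys = cob \<psi> ys) (smalls Q)"
    using b by (elim BdE) (rule that)
  define c where "c = \<psi> (replicate (Suc p) None)"
  have rep: "ys = replicate (Suc p) None" if "set ys \<subseteq> {None}" "length ys = Suc p" for ys :: "'z option list"
    using that by (metis replicate_eqI singletonD subsetD)
  \<comment> \<open>For even p the constant is a cocycle. For odd p its coboundary is
    \<open>c\<close> again, and on the constant list that equals a value of the relative cocycle
    \<open>\<phi>\<close>, which is zero.\<close>
  have "odd p \<Longrightarrow> c = 0"
  proof -
    assume "odd p"
    obtain U where "None \<in> U" "\<And>xs. xs \<noteq> [] \<Longrightarrow> set xs \<subseteq> U \<Longrightarrow> length xs = Suc (Suc p) \<longrightarrow> \<phi> xs = cob \<psi> xs"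
      using None_Q \<psi> unfolding eventually_smalls_local by blast
    then have "\<phi> (replicate (Suc (Suc p)) None) = cob \<psi> (replicate (Suc (Suc p)) None)"
      by (metis empty_subsetI insert_subset length_0_conv length_replicate nat.distinct(1) set_replicate_Suc)
    moreover have "\<phi> (replicate (Suc (Suc p)) None) = 0" by (rule Zc_None_replicate[OF \<phi>]) auto
    moreover have "cob \<psi> (replicate (Suc (Suc p)) None) = cob (\<lambda>_. c) (replicate (Suc (Suc p)) (None :: 'z option))"
    proof (rule cob_cong)
      fix ys :: "'z option list"
      assume ys: "set ys \<subseteq> set (replicate (Suc (Suc p)) None)" "length (replicate (Suc (Suc p)) (None :: 'z option)) = Suc (length ys)"
      then show "\<psi> ys = c" unfolding c_def by (subst rep[of ys]) (auto split: if_splits)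
    qed
    ultimately show "c = 0" using \<open>odd p\<close> by (simp add: cob_const del: replicate.simps)
  qed
  then have cc: "cob (\<lambda>_. c) xs = 0" if "length xs = Suc (Suc p)" for xs :: "'z option list"
    using that by (auto simp: cob_const)
  show ?thesis
  proof (rule BdI[of _ "\<lambda>xs. \<psi> (map proj xs) - c"])
    show "eventually (\<lambda>xs. length xs = Suc p \<longrightarrow> set xs \<subseteq> A \<longrightarrow> \<psi> (map proj xs) - c = 0) (smalls X)"
    proof (rule always_eventually, intro allI impI)
      fix xs assume "length xs = Suc p" "set xs \<subseteq> A"
      then have "map proj xs = replicate (Suc p) None" by (intro rep) (auto simp: collapse_proj_def)
      then show "\<psi> (map proj xs) - c = 0" by (simp add: c_def)
    qed
    have "cob (\<lambda>xs. \<psi> (map proj xs) - c) xs = cob (\<lambda>ys. \<psi> ys - c) (map proj xs)" for xs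
      by (simp add: cob_map[of "\<lambda>ys. \<psi> ys - c", symmetric])
    then show "eventually (\<lambda>xs. length xs = Suc (Suc p) \<longrightarrow> \<phi> (map proj xs) = cob (\<lambda>xs. \<psi> (map proj xs) - c) xs) (smalls X)"
      using eventually_smalls_map[OF proj_Q \<psi>] by (auto simp: cob_minus cc elim: eventually_mono)
  qed simp
qed

text \<open>In positive degree the absolute cohomology and that relative to a point agree:
  subtracting the coboundary of the cone from \<open>None\<close> kills the cocycle near
  \<open>None\<close>.\<close>

lemma Zc_normalize:
  fixes \<phi> :: "'z option list \<Rightarrow> 'k::field"
  assumes \<phi>: "\<phi> \<in> Zc Q {} (Suc p)"
  obtains \<phi>' where "\<phi>' \<in> Zc Q {None} (Suc p)" "\<phi> - \<phi>' \<in> Bd Q {} (Suc p)"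
proof -
  obtain G where G: "openin Q G" "None \<in> G"
    "\<And>ys. set ys \<subseteq> G \<Longrightarrow> length ys = Suc (Suc p) \<Longrightarrow> \<phi> ys = cob (\<lambda>zs. \<phi> (None # zs)) ys"
    by (rule cone_at_None[OF \<phi>]) (rule that)
  show thesis
  proof (rule that)
    show "(\<lambda>ys. \<phi> ys - cob (\<lambda>zs. \<phi> (None # zs)) ys) \<in> Zc Q {None} (Suc p)"
    proof (rule ZcI)
      show "eventually (\<lambda>xs. length xs = Suc (Suc (Suc p)) \<longrightarrow> cob (\<lambda>ys. \<phi> ys - cob (\<lambda>zs. \<phi> (None # zs)) ys) xs = 0) (smalls Q)"
        using \<phi> by (simp add: Zc_def cob_minus)
      show "eventually (\<lambda>xs. length xs = Suc (Suc p) \<longrightarrow> set xs \<subseteq> {None} \<longrightarrow> \<phi> xs - cob (\<lambda>zs. \<phi> (None # zs)) xs = 0) (smalls Q)"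
        using G(2,3) by (intro always_eventually) auto
    qed
    have "cob (\<lambda>zs. \<phi> (None # zs)) \<in> Bd Q {} (Suc p)"
      using eventually_smalls_topspace[of Q] by (intro cob_in_Bd) (auto elim: eventually_mono)
    then show "\<phi> - (\<lambda>ys. \<phi> ys - cob (\<lambda>zs. \<phi> (None # zs)) ys) \<in> Bd Q {} (Suc p)"
      by (simp add: fun_diff_def)
  qed
qed

lemma finite_over_quotient:
  assumes "finite_over (Bd X A (Suc p)) (Zc X A (Suc p) :: ('z list \<Rightarrow> 'k::field) set)"
  shows "finite_over (Bd Q {} (Suc p)) (Zc Q {} (Suc p) :: ('z option list \<Rightarrow> 'k) set)"
proof -
  have "finite_over (Bd Q {} (Suc p)) (Zc Q {None} (Suc p) :: ('z option list \<Rightarrow> 'k) set)"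
  proof (rule finite_over_preimage[of "\<lambda>\<phi> xs. \<phi> (map proj xs)", OF _ _ subspace_Zc subspace_Bd assms])
    show "(\<lambda>\<phi> xs. \<phi> (map proj xs)) ` Zc Q {None} (Suc p) \<subseteq> (Zc X A (Suc p) :: ('z list \<Rightarrow> 'k) set)"
      using Zc_map[OF proj_Q proj_A] by blast
  qed (auto simp: plus_fun_def fscale_def excision_inj)
  then show ?thesis
  proof (rule finite_over_image[of "\<lambda>\<phi>. \<phi>", rotated 2])
    show "Zc Q {} (Suc p) \<subseteq> fvs.span ((\<lambda>\<phi>. \<phi>) ` Zc Q {None} (Suc p) \<union> Bd Q {} (Suc p) :: ('z option list \<Rightarrow> 'k) set)"
    proof
      fix \<phi> :: "'z option list \<Rightarrow> 'k" assume "\<phi> \<in> Zc Q {} (Suc p)"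
      then obtain \<phi>' where *: "\<phi>' \<in> Zc Q {None} (Suc p)" "\<phi> - \<phi>' \<in> Bd Q {} (Suc p)" by (rule Zc_normalize)
      then have "\<phi>' + (\<phi> - \<phi>') \<in> fvs.span ((\<lambda>\<phi>. \<phi>) ` Zc Q {None} (Suc p) \<union> Bd Q {} (Suc p))"
        by (intro fvs.span_add fvs.span_base) auto
      then show "\<phi> \<in> fvs.span ((\<lambda>\<phi>. \<phi>) ` Zc Q {None} (Suc p) \<union> Bd Q {} (Suc p))" by simp
    qed
  qed auto
qed

end

section \<open>Continuity for inverse sequences\<close>

text \<open>\<open>W\<close> is the limit of a single map iterated. The abstract form covers both
  the unstable manifold over the index space and its core over \<open>X\<close>, where the
  coordinates have to be freed from the option type.\<close>

locale inverse_sequence =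
  fixes W :: "'w topology" and Y :: "'y topology" and g :: "'y \<Rightarrow> 'y" and \<pi> :: "nat \<Rightarrow> 'w \<Rightarrow> 'y"
  assumes W: "compact_space W" "Hausdorff_space W" and Y: "compact_space Y" "Hausdorff_space Y"
    and g: "continuous_map Y Y g" and \<pi>: "\<And>i. continuous_map W Y (\<pi> i)"
    and bond: "\<And>i x. x \<in> topspace W \<Longrightarrow> g (\<pi> (Suc i) x) = \<pi> i x"
    and separating: "\<And>x y. x \<in> topspace W \<Longrightarrow> y \<in> topspace W \<Longrightarrow> (\<And>i. \<pi> i x = \<pi> i y) \<Longrightarrow> x = y"
    and realize: "\<And>y. (\<And>i. y i \<in> topspace Y) \<Longrightarrow> (\<And>i. g (y (Suc i)) = y i) \<Longrightarrow>
      \<exists>x\<in>topspace W. \<forall>i. \<pi> i x = y i"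
begin

lemma bond_power: "x \<in> topspace W \<Longrightarrow> (g ^^ m) (\<pi> (i + m) x) = \<pi> i x"
  by (induction m) (simp_all add: bond funpow_swap1)

lemma continuous_power: "continuous_map Y Y (g ^^ m)"
  by (induction m) (auto intro: continuous_map_compose[OF _ g, unfolded comp_def])

text \<open>Two points with the same image at a late stage are close, since the diagonal is the intersection
  of the decreasing closed relations \<open>\<pi> i x = \<pi> i y\<close>.\<close>

lemma late_stage_fine:
  assumes P: "eventually P (smalls W)"
  obtains i where "eventually (\<lambda>ys. \<forall>xs. xs \<noteq> [] \<longrightarrow> set xs \<subseteq> topspace W \<longrightarrow> \<pi> i ` set xs \<subseteq> set ys \<longrightarrow> P xs) (smalls Y)"
proof -
  obtain \<V> where V: "open_cover W \<V>"
    "\<And>x ys. x \<in> topspace W \<Longrightarrow> ys \<noteq> [] \<Longrightarrow> set ys \<subseteq> \<Union>{V \<in> \<V>. x \<in> V} \<Longrightarrow> P ys"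
    by (rule smalls_barycentric[OF W P]) (rule that)
  \<comment> \<open>Pairs with equal \<open>i\<close>-th coordinate that no member of the cover
    contains. Finally none are left.\<close>
  define D where "D = (\<lambda>i. {z \<in> topspace (prod_topology W W). \<pi> i (fst z) = \<pi> i (snd z)} - (\<Union>V\<in>\<V>. V \<times> V))"
  have cl: "closedin (prod_topology W W) (D i)" for i
  proof -
    have 1: "closedin (prod_topology W W) {z \<in> topspace (prod_topology W W). \<pi> i (fst z) = \<pi> i (snd z)}"
      by (rule closedin_continuous_maps_eq[OF Y(2)])
        (auto intro!: continuous_map_compose[OF continuous_map_fst \<pi>, unfolded comp_def]
          continuous_map_compose[OF continuous_map_snd \<pi>, unfolded comp_def])
    have "openin (prod_topology W W) (\<Union>V\<in>\<V>. V \<times> V)"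
      using V(1) unfolding open_cover_def by (intro openin_Union) (auto simp: openin_prod_Times_iff)
    then show ?thesis unfolding D_def using 1 by (rule closedin_diff[rotated])
  qed
  have dec: "decseq D"
    unfolding decseq_Suc_iff
  proof
    fix i
    show "D (Suc i) \<subseteq> D i"
    proof
      fix z assume z: "z \<in> D (Suc i)"
      then have z': "z \<in> topspace (prod_topology W W)" "\<pi> (Suc i) (fst z) = \<pi> (Suc i) (snd z)"
        "z \<notin> (\<Union>V\<in>\<V>. V \<times> V)" unfolding D_def by blast+
      then have "fst z \<in> topspace W" "snd z \<in> topspace W" by (simp_all add: mem_Times_iff)
      then have "\<pi> i (fst z) = \<pi> i (snd z)" using z'(2) bond by metis
      then show "z \<in> D i" using z' unfolding D_def by blast
    qed
  qed
  have "\<exists>i. D i = {}"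
  proof (rule ccontr)
    assume "\<nexists>i. D i = {}"
    then have "(\<Inter>i. D i) \<noteq> {}"
      using compact_space_imp_nest[of "prod_topology W W" D] cl dec W(1) by (auto simp: compact_space_prod_topology)
    then obtain z where z: "\<And>i. z \<in> D i" by blast
    have zi: "z \<in> topspace (prod_topology W W) \<and> \<pi> i (fst z) = \<pi> i (snd z)" for i
      using z[of i] unfolding D_def by blast
    have zW: "fst z \<in> topspace W" "snd z \<in> topspace W" using zi[of 0] by (auto simp: mem_Times_iff)
    have "fst z = snd z" by (rule separating[OF zW]) (use zi in blast)
    then obtain V0 where "V0 \<in> \<V>" "z \<in> V0 \<times> V0"
      using V(1) zW unfolding open_cover_def mem_Times_iff by (metis UnionE)
    then have "z \<in> (\<Union>V\<in>\<V>. V \<times> V)" by blast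
    then show False using z[of 0] unfolding D_def by blast
  qed
  then obtain i where i: "D i = {}" by blast
  have fibre: "y \<in> \<Union>{V \<in> \<V>. x \<in> V}" if h: "x \<in> topspace W" "y \<in> topspace W" "\<pi> i x = \<pi> i y" for x y
  proof -
    have "(x, y) \<notin> D i" using i by blast
    then have "(x, y) \<in> (\<Union>V\<in>\<V>. V \<times> V)" unfolding D_def using h by simp
    then show ?thesis by blast
  qed
  \<comment> \<open>For a closed map, a neighbourhood of a fibre contains the preimage of a
    neighbourhood of the point below it.\<close>
  have closed_map: "closed_map W Y (\<pi> i)" by (rule continuous_imp_closed_map[OF \<pi> W(1) Y(2)])
  show thesis
  proof (rule that[of i], unfold eventually_smalls_local, intro ballI)
    fix y assume y: "y \<in> topspace Y"
    show "\<exists>U. openin Y U \<and> y \<in> U \<and> (\<forall>ys. ys \<noteq> [] \<longrightarrow> set ys \<subseteq> U \<longrightarrow>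
       (\<forall>xs. xs \<noteq> [] \<longrightarrow> set xs \<subseteq> topspace W \<longrightarrow> \<pi> i ` set xs \<subseteq> set ys \<longrightarrow> P xs))"
    proof (cases "\<exists>x\<in>topspace W. \<pi> i x = y")
      case True
      then obtain x where x: "x \<in> topspace W" "\<pi> i x = y" by blast
      define S where "S = \<Union>{V \<in> \<V>. x \<in> V}"
      have "openin W S" unfolding S_def using V(1) by (auto simp: open_cover_def)
      then have "closedin Y (\<pi> i ` (topspace W - S))"
        using closed_map by (auto simp: closed_map_def)
      then have o: "openin Y (topspace Y - \<pi> i ` (topspace W - S))" by blast
      have "y \<notin> \<pi> i ` (topspace W - S)" using fibre[OF x(1)] x(2) unfolding S_def by auto
      moreover have "P xs" if h: "xs \<noteq> []" "set xs \<subseteq> topspace W" "\<pi> i ` set xs \<subseteq> set ys"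
        "set ys \<subseteq> topspace Y - \<pi> i ` (topspace W - S)" for xs ys
      proof (rule V(2)[OF x(1) h(1)])
        have "set xs \<subseteq> S" using h by blast
        then show "set xs \<subseteq> \<Union>{V \<in> \<V>. x \<in> V}" by (simp add: S_def)
      qed
      ultimately show ?thesis using o y by (intro exI[of _ "topspace Y - \<pi> i ` (topspace W - S)"]) auto
    next
      case False
      have "closedin Y (\<pi> i ` topspace W)" using closed_map by (auto simp: closed_map_def)
      then have o: "openin Y (topspace Y - \<pi> i ` topspace W)" by blast
      have "False" if h: "xs \<noteq> []" "set xs \<subseteq> topspace W" "\<pi> i ` set xs \<subseteq> set ys"
        "set ys \<subseteq> topspace Y - \<pi> i ` topspace W" for xs ys
        using h by (cases xs) auto
      then show ?thesis using o y False by (intro exI[of _ "topspace Y - \<pi> i ` topspace W"]) blast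
    qed
  qed
qed

text \<open>If every power of \<open>g\<close> left \<open>V\<close>, finite backward orbits that
  start outside \<open>V\<close> would accumulate at an infinite one. It is realized by a point of
  \<open>W\<close> whose \<open>i\<close>-th coordinate lies outside \<open>V\<close>.\<close>

lemma image_in_neighbourhood:
  assumes V: "openin Y V" "\<pi> i ` topspace W \<subseteq> V"
  obtains m where "(g ^^ m) ` topspace Y \<subseteq> V"
proof -
  let ?P = "product_topology (\<lambda>_::nat. Y) UNIV"
  \<comment> \<open>Only the first \<open>m\<close> bonding equations are imposed; this makes the
    sets closed, decreasing and nonempty.\<close>
  define C where "C = (\<lambda>m. {y \<in> topspace ?P. y 0 \<in> topspace Y - V} \<inter> {y. \<forall>k<m. g (y (Suc k)) = y k})"
  have cP: "compact_space ?P" using Y(1) by (simp add: compact_space_product_topology)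
  have pr: "continuous_map ?P Y (\<lambda>y. y k)" for k by (rule continuous_map_product_projection) simp
  have cl: "closedin ?P (C m)" for m
  proof (induction m)
    case 0
    have "closedin ?P {y \<in> topspace ?P. y 0 \<in> topspace Y - V}"
      by (rule closedin_continuous_map_preimage[OF pr]) (use V(1) in blast)
    then show ?case by (simp add: C_def)
  next
    case (Suc m)
    have "C (Suc m) = C m \<inter> {y \<in> topspace ?P. g (y (Suc m)) = y m}"
      by (auto simp: C_def less_Suc_eq)
    moreover have "closedin ?P {y \<in> topspace ?P. g (y (Suc m)) = y m}"
      by (rule closedin_continuous_maps_eq[OF Y(2) continuous_map_compose[OF pr g, unfolded comp_def] pr])
    ultimately show ?case using Suc by (simp add: closedin_Int)
  qed
  have "\<exists>m. (g ^^ m) ` topspace Y \<subseteq> V"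
  proof (rule ccontr)
    assume no: "\<nexists>m. (g ^^ m) ` topspace Y \<subseteq> V"
    have "C m \<noteq> {}" for m
    proof -
      obtain z where z: "z \<in> topspace Y" "(g ^^ m) z \<notin> V" using no by blast
      have gz: "(g ^^ k) z \<in> topspace Y" for k
        using continuous_power[of k] z(1) by (auto simp: continuous_map_def Pi_iff)
      have "g ((g ^^ (m - Suc k)) z) = (g ^^ (m - k)) z" if "k < m" for k
      proof -
        have "m - k = Suc (m - Suc k)" using that by simp
        then show ?thesis by simp
      qed
      then have "(\<lambda>k. (g ^^ (m - k)) z) \<in> C m" using z gz by (auto simp: C_def)
      then show ?thesis by blast
    qed
    moreover have "decseq C" by (auto simp: decseq_def C_def)
    ultimately have "(\<Inter>m. C m) \<noteq> {}" using compact_space_imp_nest[OF cP] cl by blast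
    then obtain y where y: "\<And>m. y \<in> C m" by blast
    have yY: "y k \<in> topspace Y" for k using y[of 0] by (auto simp: C_def PiE_iff)
    have yg: "g (y (Suc k)) = y k" for k using y[of "Suc k"] by (auto simp: C_def)
    \<comment> \<open>The infinite backward orbit starts at stage \<open>i\<close>; the earlier
      stages are filled in by applying \<open>g\<close> to \<open>y 0\<close>.\<close>
    define z where "z = (\<lambda>j. if j \<le> i then (g ^^ (i - j)) (y 0) else y (j - i))"
    have "\<exists>x\<in>topspace W. \<forall>j. \<pi> j x = z j"
    proof (rule realize)
      show "z j \<in> topspace Y" for j
        using yY continuous_power[of "i - j"] by (auto simp: z_def continuous_map_def Pi_iff)
      show "g (z (Suc j)) = z j" for j
      proof (cases "j < i")
        case True
        then have "i - j = Suc (i - Suc j)" by simp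
        then show ?thesis using True by (simp add: z_def)
      next
        case False
        then show ?thesis using yg[of "j - i"] by (cases "j = i") (auto simp: z_def Suc_diff_le)
      qed
    qed
    then obtain x where "x \<in> topspace W" "\<pi> i x = y 0" by (auto simp: z_def)
    then show False using V(2) y[of 0] by (auto simp: C_def)
  qed
  then show thesis using that by blast
qed

text \<open>When the fibres of the \<open>i\<close>-th projection are small for \<open>u\<close>, a
  discontinuous section of it does no harm. It exists only over the image of \<open>W\<close>, so
  \<open>Y\<close> is first pushed near that image by \<open>g ^^ m\<close> and then retracted onto
  it. The cocycle therefore belongs to stage i + m.\<close>

lemma cocycle_from_stage:
  fixes u :: "'w list \<Rightarrow> 'k::field"
  assumes u: "u \<in> Zc W {} q"
  obtains i \<eta> where "\<eta> \<in> Zc Y {} q" "u - (\<lambda>xs. \<eta> (map (\<pi> i) xs)) \<in> Bd W {} q"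
proof -
  have P: "eventually (\<lambda>xs. length xs = Suc (Suc q) \<longrightarrow> cob u xs = 0) (smalls W)"
    using u by (simp add: Zc_def)
  obtain i where i: "eventually (\<lambda>ys. \<forall>xs. xs \<noteq> [] \<longrightarrow> set xs \<subseteq> topspace W \<longrightarrow> \<pi> i ` set xs \<subseteq> set ys \<longrightarrow>
      length xs = Suc (Suc q) \<longrightarrow> cob u xs = 0) (smalls Y)"
    by (rule late_stage_fine[OF P])
  define A where "A = \<pi> i ` topspace W"
  have A: "closedin Y A"
    unfolding A_def using continuous_imp_closed_map[OF \<pi> W(1) Y(2), of i] by (auto simp: closed_map_def)
  obtain r V where rV: "openin Y V" "A \<subseteq> V" "\<And>x. x \<in> V \<Longrightarrow> r x \<in> A" "\<And>x. x \<in> A \<Longrightarrow> r x = x"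
    "eventually (\<lambda>xs. set xs \<subseteq> V \<longrightarrow> (\<forall>ys. ys \<noteq> [] \<longrightarrow> set ys \<subseteq> set xs \<union> r ` set xs \<longrightarrow>
       (\<forall>xs. xs \<noteq> [] \<longrightarrow> set xs \<subseteq> topspace W \<longrightarrow> \<pi> i ` set xs \<subseteq> set ys \<longrightarrow>
      length xs = Suc (Suc q) \<longrightarrow> cob u xs = 0))) (smalls Y)"
    by (rule small_retraction[OF Y A i]) (rule that)
  obtain m where m: "(g ^^ m) ` topspace Y \<subseteq> V"
    using image_in_neighbourhood[OF rV(1)] rV(2) unfolding A_def by blast
  have "\<forall>a\<in>A. \<exists>x\<in>topspace W. \<pi> i x = a" by (auto simp: A_def)
  then obtain s where s: "\<And>a. a \<in> A \<Longrightarrow> s a \<in> topspace W" "\<And>a. a \<in> A \<Longrightarrow> \<pi> i (s a) = a" by metis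
  have key: "eventually (\<lambda>zs. set zs \<subseteq> V \<longrightarrow> (\<forall>ys. length ys = Suc (Suc q) \<longrightarrow> set ys \<subseteq> topspace W \<longrightarrow>
      \<pi> i ` set ys \<subseteq> set zs \<union> r ` set zs \<longrightarrow> cob u ys = 0)) (smalls Y)"
    using rV(5)
  proof (rule eventually_mono, intro impI allI)
    fix zs ys assume *: "set zs \<subseteq> V \<longrightarrow> (\<forall>ys. ys \<noteq> [] \<longrightarrow> set ys \<subseteq> set zs \<union> r ` set zs \<longrightarrow>
       (\<forall>xs. xs \<noteq> [] \<longrightarrow> set xs \<subseteq> topspace W \<longrightarrow> \<pi> i ` set xs \<subseteq> set ys \<longrightarrow>
      length xs = Suc (Suc q) \<longrightarrow> cob u xs = 0))"
      and h: "set zs \<subseteq> V" "length ys = Suc (Suc q)" "set ys \<subseteq> topspace W" "\<pi> i ` set ys \<subseteq> set zs \<union> r ` set zs"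
    have "ys \<noteq> []" "map (\<pi> i) ys \<noteq> []" using h(2) by auto
    then show "cob u ys = 0" using *[rule_format, of "map (\<pi> i) ys" ys] h by simp
  qed
  define \<eta> where "\<eta> = (\<lambda>ys. u (map (\<lambda>y. s (r ((g ^^ m) y))) ys))"
  show thesis
  proof (rule that)
    show "\<eta> \<in> Zc Y {} q"
    proof (rule Zc_absolute)
      show "eventually (\<lambda>xs. length xs = Suc (Suc q) \<longrightarrow> cob \<eta> xs = 0) (smalls Y)"
        using eventually_conj[OF eventually_smalls_map[OF continuous_power[of m] key] eventually_smalls_topspace]
      proof (rule eventually_mono, intro impI, elim conjE)
        fix xs assume *: "set (map (g ^^ m) xs) \<subseteq> V \<longrightarrow> (\<forall>ys. length ys = Suc (Suc q) \<longrightarrow> set ys \<subseteq> topspace W \<longrightarrow>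
          \<pi> i ` set ys \<subseteq> set (map (g ^^ m) xs) \<union> r ` set (map (g ^^ m) xs) \<longrightarrow> cob u ys = 0)"
          and l: "length xs = Suc (Suc q)" and t: "set xs \<subseteq> topspace Y"
        have V: "set (map (g ^^ m) xs) \<subseteq> V" using m t by auto
        let ?ys = "map (\<lambda>y. s (r ((g ^^ m) y))) xs"
        have rA: "r ((g ^^ m) y) \<in> A" if "y \<in> set xs" for y using V that rV(3) by auto
        have "set ?ys \<subseteq> topspace W" using rA s(1) by auto
        moreover have "\<pi> i ` set ?ys \<subseteq> r ` set (map (g ^^ m) xs)" using rA s(2) by auto
        ultimately have "cob u ?ys = 0" using * V l by (metis length_map sup.coboundedI2)
        then show "cob \<eta> xs = 0" unfolding \<eta>_def by (simp add: cob_map)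
      qed
    qed
    have "(\<lambda>xs. u (map (\<lambda>x. x) xs) - u (map (\<lambda>x. s (r (\<pi> i x))) xs)) \<in> Bd W {} q"
    proof (rule homotopic_Bd)
      show "eventually (\<lambda>xs. \<forall>ys. length ys = Suc (Suc q) \<longrightarrow>
          set ys \<subseteq> (\<lambda>x. s (r (\<pi> i x))) ` set xs \<union> (\<lambda>x. x) ` set xs \<longrightarrow> cob u ys = 0) (smalls W)"
        using eventually_conj[OF eventually_smalls_map[OF \<pi>[of i] key] eventually_smalls_topspace]
      proof (rule eventually_mono, intro impI allI, elim conjE)
        fix xs ys assume *: "set (map (\<pi> i) xs) \<subseteq> V \<longrightarrow> (\<forall>ys. length ys = Suc (Suc q) \<longrightarrow> set ys \<subseteq> topspace W \<longrightarrow>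
          \<pi> i ` set ys \<subseteq> set (map (\<pi> i) xs) \<union> r ` set (map (\<pi> i) xs) \<longrightarrow> cob u ys = 0)"
          and l: "length ys = Suc (Suc q)" and t: "set xs \<subseteq> topspace W"
          and ys: "set ys \<subseteq> (\<lambda>x. s (r (\<pi> i x))) ` set xs \<union> (\<lambda>x. x) ` set xs"
        have A': "\<pi> i x \<in> A" if "x \<in> set xs" for x using t that by (auto simp: A_def)
        then have V: "set (map (\<pi> i) xs) \<subseteq> V" using rV(2) by auto
        have rA: "r (\<pi> i x) \<in> A" if "x \<in> set xs" for x using A'[OF that] rV(4) by simp
        have "set ys \<subseteq> topspace W" using ys rA s(1) t by auto
        moreover have "\<pi> i ` set ys \<subseteq> set (map (\<pi> i) xs) \<union> r ` set (map (\<pi> i) xs)"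
        proof
          fix z assume "z \<in> \<pi> i ` set ys"
          then obtain y where y: "y \<in> set ys" "z = \<pi> i y" by blast
          then consider "y \<in> set xs" | x where "x \<in> set xs" "y = s (r (\<pi> i x))" using ys by blast
          then show "z \<in> set (map (\<pi> i) xs) \<union> r ` set (map (\<pi> i) xs)"
            using y(2) s(2) rA by cases auto
        qed
        ultimately show "cob u ys = 0" using * V l by blast
      qed
      show "eventually (\<lambda>xs. set xs \<subseteq> {} \<longrightarrow> (\<forall>ys. length ys = Suc q \<longrightarrow>
          set ys \<subseteq> (\<lambda>x. s (r (\<pi> i x))) ` set xs \<union> (\<lambda>x. x) ` set xs \<longrightarrow> u ys = 0)) (smalls W)"
        using eventually_smalls_topspace[of W] by (rule eventually_mono) auto
    qed
    then have 1: "u - (\<lambda>xs. u (map (\<lambda>x. s (r (\<pi> i x))) xs)) \<in> Bd W {} q" by (simp add: fun_diff_def)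
    have "eventually (\<lambda>xs. length xs = Suc q \<longrightarrow> u (map (\<lambda>x. s (r (\<pi> i x))) xs) = \<eta> (map (\<pi> (i + m)) xs)) (smalls W)"
      using eventually_smalls_topspace
    proof (rule eventually_mono, intro impI)
      fix xs assume "xs \<noteq> [] \<and> set xs \<subseteq> topspace W"
      then have "map (\<lambda>x. s (r (\<pi> i x))) xs = map (\<lambda>x. s (r ((g ^^ m) (\<pi> (i + m) x)))) xs"
        using bond_power by (intro map_cong) auto
      then show "u (map (\<lambda>x. s (r (\<pi> i x))) xs) = \<eta> (map (\<pi> (i + m)) xs)"
        by (simp only: \<eta>_def map_map comp_def)
    qed
    then have 2: "(\<lambda>xs. u (map (\<lambda>x. s (r (\<pi> i x))) xs)) - (\<lambda>xs. \<eta> (map (\<pi> (i + m)) xs)) \<in> Bd W {} q"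
      by (rule small_eq_imp_Bd)
    show "u - (\<lambda>xs. \<eta> (map (\<pi> (i + m)) xs)) \<in> Bd W {} q"
      using fvs.subspace_add[OF subspace_Bd 1 2] by simp
  qed
qed

lemma cocycle_from_later_stage:
  fixes u :: "'w list \<Rightarrow> 'k::field"
  assumes "\<eta> \<in> Zc Y {} q" "u - (\<lambda>xs. \<eta> (map (\<pi> i) xs)) \<in> Bd W {} q" "i \<le> j"
  obtains \<eta>' where "\<eta>' \<in> Zc Y {} q" "u - (\<lambda>xs. \<eta>' (map (\<pi> j) xs)) \<in> Bd W {} q"
proof (rule that)
  show "(\<lambda>xs. \<eta> (map (g ^^ (j - i)) xs)) \<in> Zc Y {} q"
    by (rule Zc_map[OF continuous_power _ assms(1)]) auto
  have "eventually (\<lambda>xs. length xs = Suc q \<longrightarrow> \<eta> (map (\<pi> i) xs) = \<eta> (map (g ^^ (j - i)) (map (\<pi> j) xs))) (smalls W)"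
    using eventually_smalls_topspace
  proof (rule eventually_mono, intro impI)
    fix xs assume t: "xs \<noteq> [] \<and> set xs \<subseteq> topspace W"
    have "map (\<pi> i) xs = map (\<lambda>x. (g ^^ (j - i)) (\<pi> j x)) xs"
      by (rule map_cong) (use t bond_power[of _ "j - i" i] assms(3) in auto)
    then show "\<eta> (map (\<pi> i) xs) = \<eta> (map (g ^^ (j - i)) (map (\<pi> j) xs))" by (simp only: map_map comp_def)
  qed
  then have "(\<lambda>xs. \<eta> (map (\<pi> i) xs)) - (\<lambda>xs. \<eta> (map (g ^^ (j - i)) (map (\<pi> j) xs))) \<in> Bd W {} q"
    by (rule small_eq_imp_Bd)
  from fvs.subspace_add[OF subspace_Bd assms(2) this]
  show "u - (\<lambda>xs. \<eta> (map (g ^^ (j - i)) (map (\<pi> j) xs))) \<in> Bd W {} q" by simp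
qed

text \<open>A finite family of cocycles comes from one common stage, and there the images of
  \<open>S\<close> generate. The stage varies with the family, the bound \<open>card S\<close> does
  not.\<close>

lemma finite_over_limit:
  assumes "finite_over (Bd Y {} q) (Zc Y {} q :: ('y list \<Rightarrow> 'k::field) set)"
  shows "finite_over (Bd W {} q) (Zc W {} q :: ('w list \<Rightarrow> 'k) set)"
proof -
  obtain S where S: "finite S" "Zc Y {} q \<subseteq> fvs.span (S \<union> Bd Y {} q :: ('y list \<Rightarrow> 'k) set)"
    using assms unfolding finite_over_def by blast
  show ?thesis
  proof (rule finite_over_bounded[where d = "card S"])
    fix T :: "('w list \<Rightarrow> 'k) set" assume T: "finite T" "T \<subseteq> Zc W {} q"
    have "\<exists>i. \<exists>\<eta>\<in>Zc Y {} q. t - (\<lambda>xs. \<eta> (map (\<pi> i) xs)) \<in> Bd W {} q" if "t \<in> T" for t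
    proof -
      have "t \<in> Zc W {} q" using T(2) that by blast
      then show ?thesis by (rule cocycle_from_stage) blast
    qed
    then obtain i \<eta> where i: "\<And>t. t \<in> T \<Longrightarrow> \<eta> t \<in> Zc Y {} q \<and> t - (\<lambda>xs. \<eta> t (map (\<pi> (i t)) xs)) \<in> Bd W {} q"
      by metis
    define j where "j = Max (insert 0 (i ` T))"
    have ij: "i t \<le> j" if "t \<in> T" for t unfolding j_def using T(1) that by simp
    define h where "h = (\<lambda>\<phi>::'y list \<Rightarrow> 'k. \<lambda>xs. \<phi> (map (\<pi> j) xs))"
    have lin: "Vector_Spaces.linear fscale fscale h"
      by unfold_locales (simp_all add: h_def fscale_def fun_eq_iff algebra_simps)
    have hB: "h ` Bd Y {} q \<subseteq> Bd W {} q"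
      unfolding h_def by (rule image_subsetI, rule Bd_map[OF \<pi>]) auto
    have "h ` fvs.span (S \<union> Bd Y {} q) \<subseteq> fvs.span (h ` S \<union> Bd W {} q)"
      unfolding fvp.linear_span_image[OF lin, symmetric] image_Un using hB by (intro fvs.span_mono) auto
    then have hZ: "h \<phi> \<in> fvs.span (h ` S \<union> Bd W {} q)" if "\<phi> \<in> Zc Y {} q" for \<phi>
      using S(2) that by blast
    have "T \<subseteq> fvs.span (h ` S \<union> Bd W {} q)"
    proof
      fix t assume t: "t \<in> T"
      obtain \<eta>' where e: "\<eta>' \<in> Zc Y {} q" "t - (\<lambda>xs. \<eta>' (map (\<pi> j) xs)) \<in> Bd W {} q"
        by (rule cocycle_from_later_stage[of "\<eta> t" q t "i t" j]) (use i[OF t] ij[OF t] in auto)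
      have "t - h \<eta>' \<in> fvs.span (h ` S \<union> Bd W {} q)" using e(2) by (intro fvs.span_base) (simp add: h_def)
      from fvs.span_add[OF this hZ[OF e(1)]] show "t \<in> fvs.span (h ` S \<union> Bd W {} q)" by simp
    qed
    then show "\<exists>S'. finite S' \<and> card S' \<le> card S \<and> T \<subseteq> fvs.span (S' \<union> Bd W {} q)"
      using S(1) card_image_le by (intro exI[of _ "h ` S"]) auto
  qed
qed

end

text \<open>A cocycle of degree 0 is a locally constant function, hence constant on components, and
  the indicators of the components span.\<close>

lemma finite_over_components:
  fixes X :: "'z topology"
  assumes "finite (connected_components_of X)"
  shows "finite_over (Bd X {} 0) (Zc X {} 0 :: ('z list \<Rightarrow> 'k::field) set)"
proof -
  define e :: "'z set \<Rightarrow> 'z list \<Rightarrow> 'k" where "e = (\<lambda>C xs. if hd xs \<in> C then 1 else 0)"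
  let ?S = "e ` connected_components_of X"
  have "Zc X {} 0 \<subseteq> fvs.span (?S \<union> Bd X {} 0)"
  proof
    fix \<phi> :: "'z list \<Rightarrow> 'k" assume \<phi>: "\<phi> \<in> Zc X {} 0"
    have loc: "eventually (\<lambda>xs. length xs = Suc (Suc 0) \<longrightarrow> cob \<phi> xs = 0) (smalls X)"
      using \<phi> by (simp add: Zc_def)
    have const: "\<phi> [x] = \<phi> [y]" if C: "C \<in> connected_components_of X" "x \<in> C" "y \<in> C" for C x y
    proof -
      have CX: "C \<subseteq> topspace X" by (rule connected_components_of_subset[OF C(1)])
      have op: "openin X {z \<in> topspace X. Q (\<phi> [z])}" for Q
      proof (subst openin_subopen, intro ballI)
        fix z assume z: "z \<in> {z \<in> topspace X. Q (\<phi> [z])}"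
        then obtain U where U: "openin X U" "z \<in> U" "\<And>xs. xs \<noteq> [] \<Longrightarrow> set xs \<subseteq> U \<Longrightarrow> length xs = Suc (Suc 0) \<longrightarrow> cob \<phi> xs = 0"
          using loc unfolding eventually_smalls_local by blast
        have "U \<subseteq> {z \<in> topspace X. Q (\<phi> [z])}"
        proof
          fix z' assume z': "z' \<in> U"
          have "cob \<phi> [z, z'] = 0" using U(3)[of "[z, z']"] U(2) z' by (simp del: cob.simps)
          then have "\<phi> [z'] = \<phi> [z]" by simp
          moreover have "z' \<in> topspace X" using openin_subset[OF U(1)] z' by blast
          ultimately show "z' \<in> {z \<in> topspace X. Q (\<phi> [z])}" using z by simp
        qed
        with U(1,2) show "\<exists>T. openin X T \<and> z \<in> T \<and> T \<subseteq> {z \<in> topspace X. Q (\<phi> [z])}" by (intro exI[of _ U] conjI)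
      qed
      have "{z \<in> topspace X. \<phi> [z] = \<phi> [x]} = topspace X - {z \<in> topspace X. \<phi> [z] \<noteq> \<phi> [x]}" by blast
      then have "closedin X {z \<in> topspace X. \<phi> [z] = \<phi> [x]}" using closedin_diff[OF closedin_topspace op[of "\<lambda>c. c \<noteq> \<phi> [x]"]] by simp
      then have "C \<subseteq> {z \<in> topspace X. \<phi> [z] = \<phi> [x]} \<or> disjnt C {z \<in> topspace X. \<phi> [z] = \<phi> [x]}"
        using connectedin_clopen_cases[OF connectedin_connected_components_of[OF C(1)] _ op[of "\<lambda>c. c = \<phi> [x]"]] by simp
      moreover have "x \<in> topspace X" using C(2) CX by blast
      then have "\<not> disjnt C {z \<in> topspace X. \<phi> [z] = \<phi> [x]}" using C(2) by (auto simp: disjnt_iff)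
      ultimately have "y \<in> {z \<in> topspace X. \<phi> [z] = \<phi> [x]}" using C(3) by (meson subsetD)
      then show ?thesis by simp
    qed
    define a where "a = (\<lambda>C. \<phi> [SOME x. x \<in> C])"
    have a: "\<phi> [x] = a C" if C: "C \<in> connected_components_of X" "x \<in> C" for C x
      unfolding a_def using C someI[of "\<lambda>x. x \<in> C" x] by (intro const[OF C(1)]) auto
    have "eventually (\<lambda>xs. length xs = Suc 0 \<longrightarrow> \<phi> xs = (\<Sum>C\<in>connected_components_of X. a C *s e C) xs) (smalls X)"
      using eventually_smalls_topspace
    proof (rule eventually_mono, intro impI)
      fix xs assume "xs \<noteq> [] \<and> set xs \<subseteq> topspace X" "length xs = Suc 0"
      then obtain x where x: "xs = [x]" "x \<in> topspace X" by (cases xs) auto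
      then obtain C where C: "C \<in> connected_components_of X" "x \<in> C"
        using Union_connected_components_of[of X] by blast
      have sm: "(\<Sum>C\<in>I. F C) xs = (\<Sum>C\<in>I. F C xs)" for I and F :: "'z set \<Rightarrow> 'z list \<Rightarrow> 'k"
        by (induction I rule: infinite_finite_induct) auto
      have "(\<Sum>D\<in>connected_components_of X. a D *s e D) xs = (\<Sum>D\<in>connected_components_of X. if D = C then a C else 0)"
        unfolding sm
      proof (rule sum.cong[OF refl])
        fix D assume D: "D \<in> connected_components_of X"
        have "x \<in> D \<longleftrightarrow> D = C"
          using C D pairwise_disjoint_connected_components_of[of X] unfolding pairwise_def disjnt_def by blast
        then show "(a D *s e D) xs = (if D = C then a C else 0)" by (auto simp: fscale_def e_def x)
      qed
      also have "\<dots> = a C" using assms C by simp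
      finally show "\<phi> xs = (\<Sum>D\<in>connected_components_of X. a D *s e D) xs" using a[OF C] x by simp
    qed
    then have "\<phi> - (\<Sum>C\<in>connected_components_of X. a C *s e C) \<in> Bd X {} 0" by (rule small_eq_imp_Bd)
    then have 1: "\<phi> - (\<Sum>C\<in>connected_components_of X. a C *s e C) \<in> fvs.span (?S \<union> Bd X {} 0)"
      by (intro fvs.span_base) blast
    have 2: "(\<Sum>C\<in>connected_components_of X. a C *s e C) \<in> fvs.span (?S \<union> Bd X {} 0)"
      by (intro fvs.span_sum fvs.span_scale fvs.span_base) blast
    show "\<phi> \<in> fvs.span (?S \<union> Bd X {} 0)" using fvs.span_add[OF 1 2] by simp
  qed
  then show ?thesis unfolding finite_over_def using assms by blast
qed

section \<open>Quasicomponents joining two points\<close>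

text \<open>The cones from \<open>a\<close> and from \<open>b\<close> are combined by cases. The
  lists have at least two entries, so faces are nonempty and the disjoint neighbourhoods tell the
  cases apart.\<close>

lemma cone_at_two_points:
  fixes \<psi> :: "'z list \<Rightarrow> 'k::field"
  assumes ab: "a \<in> Va" "b \<in> Vb" "Va \<inter> Vb = {}"
    and c: "\<And>xs. set xs \<subseteq> Va \<or> set xs \<subseteq> Vb \<Longrightarrow> length xs = Suc (Suc (Suc p)) \<Longrightarrow> cob \<psi> xs = 0"
  obtains \<kappa> where "\<And>xs. set xs \<subseteq> Va \<or> set xs \<subseteq> Vb \<Longrightarrow> length xs = Suc (Suc p) \<Longrightarrow> \<psi> xs = cob \<kappa> xs"
proof -
  define \<kappa> where "\<kappa> = (\<lambda>xs. if set xs \<subseteq> Va then \<psi> (a # xs) else if set xs \<subseteq> Vb then \<psi> (b # xs) else 0)"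
  show thesis
  proof (rule that)
    fix xs assume xs: "set xs \<subseteq> Va \<or> set xs \<subseteq> Vb" "length xs = Suc (Suc p)"
    show "\<psi> xs = cob \<kappa> xs"
    proof (cases "set xs \<subseteq> Va")
      case True
      have "\<psi> xs = cob (\<lambda>ys. \<psi> (a # ys)) xs" using c[of "a # xs"] True ab(1) xs(2) by simp
      also have "\<dots> = cob \<kappa> xs" by (rule cob_cong) (use True in \<open>auto simp: \<kappa>_def\<close>)
      finally show ?thesis .
    next
      case False
      then have b: "set xs \<subseteq> Vb" using xs(1) by blast
      have "\<psi> xs = cob (\<lambda>ys. \<psi> (b # ys)) xs" using c[of "b # xs"] b ab(2) xs(2) by simp
      also have "\<dots> = cob \<kappa> xs"
      proof (rule cob_cong)
        fix ys assume ys: "set ys \<subseteq> set xs" "length xs = Suc (length ys)"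
        then have "ys \<noteq> []" using xs(2) by auto
        then have "\<not> set ys \<subseteq> Va" using ys(1) b ab(3) by (cases ys) auto
        then show "\<psi> (b # ys) = \<kappa> ys" using ys(1) b by (auto simp: \<kappa>_def)
      qed
      finally show ?thesis .
    qed
  qed
qed

text \<open>In the application \<open>a\<close> is the collapsed core and \<open>b\<close> is
  infinity.\<close>

locale two_ends =
  fixes Q :: "'z topology" and a b :: 'z
  assumes compact: "compact_space Q" and Hausdorff: "Hausdorff_space Q"
    and a: "a \<in> topspace Q" and b: "b \<in> topspace Q" and ab: "a \<noteq> b"
begin

definition "E = topspace Q - {a, b}"

definition clop :: "'z set \<Rightarrow> bool" where
  "clop C \<longleftrightarrow> C \<subseteq> E \<and> openin Q C \<and> openin Q (E - C)"

definition essential :: "'z set set" where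
  "essential = {F \<in> quasi_components_of (subtopology Q E). a \<in> Q closure_of F \<and> b \<in> Q closure_of F}"

lemma closedin_point: "x \<in> topspace Q \<Longrightarrow> closedin Q {x}"
  using Hausdorff by (simp add: closedin_Hausdorff_sing_eq)

lemma openin_E: "openin Q E"
proof -
  have "closedin Q {a, b}" using closedin_Un[OF closedin_point[OF a] closedin_point[OF b]] by (simp add: insert_commute)
  then show ?thesis unfolding E_def by (intro openin_diff) auto
qed

lemma E_top: "topspace (subtopology Q E) = E" by (auto simp: E_def)

lemma clop_iff: "clop C \<longleftrightarrow> openin (subtopology Q E) C \<and> closedin (subtopology Q E) C"
  using openin_E openin_trans_full openin_subset_topspace_eq
  unfolding clop_def closedin_def E_top by (auto simp: openin_open_subtopology)

lemma clop_E: "clop E" using openin_E by (simp add: clop_def)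

lemma clop_empty: "clop {}" using openin_E by (simp add: clop_def)

lemma clop_Diff: "clop C \<Longrightarrow> clop D \<Longrightarrow> clop (C - D)"
proof -
  assume *: "clop C" "clop D"
  then have "C - D = C \<inter> (E - D)" "E - (C - D) = (E - C) \<union> D" by (auto simp: clop_def)
  then show ?thesis using * unfolding clop_def by (auto intro: openin_Int openin_Un)
qed

lemma clop_Un: "clop C \<Longrightarrow> clop D \<Longrightarrow> clop (C \<union> D)"
proof -
  assume *: "clop C" "clop D"
  then have "E - (C \<union> D) = (E - C) \<inter> (E - D)" by (auto simp: clop_def)
  then show ?thesis using * unfolding clop_def by (auto intro: openin_Int openin_Un)
qed

lemma clop_Int: "clop C \<Longrightarrow> clop D \<Longrightarrow> clop (C \<inter> D)"
  using clop_Diff[of C "C - D"] clop_Diff[of C D] by (simp add: Diff_Diff_Int)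

lemma clop_UN: "finite I \<Longrightarrow> (\<And>i. i \<in> I \<Longrightarrow> clop (C i)) \<Longrightarrow> clop (\<Union>i\<in>I. C i)"
  by (induction I rule: finite_induct) (auto simp: clop_empty clop_Un)

lemma clop_closure: "clop C \<Longrightarrow> closedin Q (C \<union> {a, b})"
proof -
  assume *: "clop C"
  then have "topspace Q - (E - C) = C \<union> {a, b}" using a b by (auto simp: clop_def E_def)
  moreover have "closedin Q (topspace Q - (E - C))" using * by (simp add: clop_def closedin_def openin_subset double_diff)
  ultimately show ?thesis by simp
qed

context
  fixes F assumes F: "F \<in> quasi_components_of (subtopology Q E)"
begin

lemma quasi_sub: "F \<subseteq> E" using quasi_components_of_subset[OF F] E_top by simp

lemma quasi_clop: "clop C \<Longrightarrow> F \<subseteq> C \<or> F \<inter> C = {}"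
  using F unfolding quasi_components_of_def clop_iff quasi_component_of_def by blast

lemma quasi_separated:
  assumes "y \<in> E" "y \<notin> F"
  obtains C where "clop C" "F \<subseteq> C" "y \<notin> C"
proof -
  obtain x where x: "x \<in> E" "F = quasi_component_of_set (subtopology Q E) x"
    using F unfolding quasi_components_of_def E_top by blast
  obtain T where T: "clop T" "(x \<in> T) \<noteq> (y \<in> T)"
    using assms x unfolding clop_iff quasi_component_of_def E_top by blast
  have "x \<in> F" using x by (auto simp: E_def)
  show thesis
  proof (cases "x \<in> T")
    case True
    then show ?thesis using that[OF T(1)] T quasi_clop[OF T(1)] \<open>x \<in> F\<close> by blast
  next
    case False
    have "clop (E - T)" using clop_Diff[OF clop_E T(1)] .
    then show ?thesis using that[of "E - T"] T False quasi_clop[of "E - T"] \<open>x \<in> F\<close> x(1) by blast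
  qed
qed

lemma quasi_closed: "closedin Q (F \<union> {a, b})"
proof -
  have "openin Q (E - F)"
  proof (subst openin_subopen, intro ballI)
    fix y assume y: "y \<in> E - F"
    then obtain C where C: "clop C" "F \<subseteq> C" "y \<notin> C" using quasi_separated by blast
    then show "\<exists>T. openin Q T \<and> y \<in> T \<and> T \<subseteq> E - F"
      using y by (intro exI[of _ "E - C"]) (auto simp: clop_def)
  qed
  moreover have "topspace Q - (E - F) = F \<union> {a, b}" using quasi_sub a b by (auto simp: E_def)
  ultimately show ?thesis by (metis closedin_diff closedin_topspace)
qed

text \<open>Since \<open>V\<close> contains both ends, every point outside it lies in
  \<open>E\<close> and is separated from \<open>F\<close> by a clopen set. Finitely many of these
  cover the compact complement of \<open>V\<close>.\<close>

lemma quasi_clop_nbhd: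
  assumes V: "openin Q V" "F \<union> {a, b} \<subseteq> V"
  obtains C where "clop C" "F \<subseteq> C" "C \<subseteq> V"
proof -
  have "\<exists>D. clop D \<and> y \<in> D \<and> D \<inter> F = {}" if y: "y \<in> topspace Q - V" for y
  proof -
    have "y \<in> E" "y \<notin> F" using y V by (auto simp: E_def)
    then obtain C where C: "clop C" "F \<subseteq> C" "y \<notin> C" by (rule quasi_separated)
    have "clop (E - C)" by (rule clop_Diff[OF clop_E C(1)])
    then show ?thesis using C \<open>y \<in> E\<close> by (intro exI[of _ "E - C"]) auto
  qed
  then obtain D where D: "\<And>y. y \<in> topspace Q - V \<Longrightarrow> clop (D y) \<and> y \<in> D y \<and> D y \<inter> F = {}" by metis
  have "compactin Q (topspace Q - V)"
    using closedin_compact_space[OF compact] V(1) by blast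
  moreover have "\<And>U. U \<in> D ` (topspace Q - V) \<Longrightarrow> openin Q U" using D by (auto simp: clop_def)
  moreover have "topspace Q - V \<subseteq> \<Union>(D ` (topspace Q - V))" using D by blast
  ultimately obtain \<F> where "finite \<F>" "\<F> \<subseteq> D ` (topspace Q - V)" "topspace Q - V \<subseteq> \<Union>\<F>"
    unfolding compactin_def by meson
  then obtain I where I: "finite I" "I \<subseteq> topspace Q - V" "topspace Q - V \<subseteq> (\<Union>y\<in>I. D y)"
    by (metis finite_subset_image)
  show thesis
  proof (rule that)
    show "clop (E - (\<Union>y\<in>I. D y))" using I D by (intro clop_Diff clop_E clop_UN) auto
    show "F \<subseteq> E - (\<Union>y\<in>I. D y)" using quasi_sub D I(2) by blast
    show "E - (\<Union>y\<in>I. D y) \<subseteq> V" using I(3) by (auto simp: E_def)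
  qed
qed

end

lemma essential_quasi: "F \<in> essential \<Longrightarrow> F \<in> quasi_components_of (subtopology Q E)"
  by (simp add: essential_def)

lemma essential_closure:
  assumes "F \<in> essential"
  shows "Q closure_of F = F \<union> {a, b}"
proof
  show "Q closure_of F \<subseteq> F \<union> {a, b}"
    by (rule closure_of_minimal[OF _ quasi_closed[OF essential_quasi[OF assms]]]) blast
  have "F \<subseteq> topspace Q" using quasi_sub[OF essential_quasi[OF assms]] by (auto simp: E_def)
  then show "F \<union> {a, b} \<subseteq> Q closure_of F"
    using closure_of_subset[of F Q] assms by (auto simp: essential_def)
qed

lemma disjoint_clop_nbhds:
  assumes I: "finite I" "I \<subseteq> essential" and V: "\<And>F. F \<in> I \<Longrightarrow> openin Q (V F) \<and> F \<union> {a, b} \<subseteq> V F"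
  obtains C where "\<And>F. F \<in> I \<Longrightarrow> clop (C F)" "\<And>F. F \<in> I \<Longrightarrow> F \<subseteq> C F" "\<And>F. F \<in> I \<Longrightarrow> C F \<subseteq> V F"
    "\<And>F F'. F \<in> I \<Longrightarrow> F' \<in> I \<Longrightarrow> F \<noteq> F' \<Longrightarrow> C F \<inter> C F' = {}"
proof -
  have q: "F \<in> quasi_components_of (subtopology Q E)" if "F \<in> I" for F
    using that I(2) essential_quasi by blast
  have "\<exists>C. clop C \<and> F \<subseteq> C \<and> F' \<inter> C = {}" if h: "F \<in> I" "F' \<in> I" "F \<noteq> F'" for F F'
  proof -
    have "disjnt F F'" by (rule pairwiseD[OF pairwise_disjoint_quasi_components_of q[OF h(1)] q[OF h(2)] h(3)])
    moreover obtain y where y: "y \<in> F'" using nonempty_quasi_components_of[OF q[OF h(2)]] by blast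
    ultimately have "y \<in> E" "y \<notin> F" using quasi_sub[OF q[OF h(2)]] by (auto simp: disjnt_iff)
    then obtain C where "clop C" "F \<subseteq> C" "y \<notin> C" by (rule quasi_separated[OF q[OF h(1)]])
    then show ?thesis using quasi_clop[OF q[OF h(2)]] y by blast
  qed
  then obtain S where S: "\<And>F F'. F \<in> I \<Longrightarrow> F' \<in> I \<Longrightarrow> F \<noteq> F' \<Longrightarrow> clop (S F F') \<and> F \<subseteq> S F F' \<and> F' \<inter> S F F' = {}"
    by metis
  have "\<exists>C. clop C \<and> F \<subseteq> C \<and> C \<subseteq> V F" if "F \<in> I" for F
    by (rule quasi_clop_nbhd[OF q[OF that], of "V F"]) (use V[OF that] in auto)
  then obtain C0 where C0: "\<And>F. F \<in> I \<Longrightarrow> clop (C0 F) \<and> F \<subseteq> C0 F \<and> C0 F \<subseteq> V F" by metis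
  \<comment> \<open>\<open>S F F'\<close> separates \<open>F\<close> from \<open>F'\<close> but is
    not symmetric. Staying inside each \<open>S F F'\<close> and avoiding each \<open>S F' F\<close>
    makes the results disjoint.\<close>
  define C where "C = (\<lambda>F. (C0 F - (\<Union>F'\<in>I - {F}. E - S F F')) - (\<Union>F'\<in>I - {F}. S F' F))"
  show thesis
  proof (rule that)
    fix F assume F: "F \<in> I"
    have "clop (\<Union>F'\<in>I - {F}. E - S F F')" using S[OF F] I(1) by (intro clop_UN clop_Diff clop_E) auto
    moreover have "clop (\<Union>F'\<in>I - {F}. S F' F)" using S[OF _ F] I(1) by (intro clop_UN) auto
    ultimately show "clop (C F)" unfolding C_def using C0[OF F] by (intro clop_Diff) auto
    show "F \<subseteq> C F"
    proof
      fix x assume x: "x \<in> F"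
      have "x \<in> S F F'" "x \<notin> S F' F" if "F' \<in> I - {F}" for F'
        using S[OF F, of F'] S[OF _ F, of F'] that x by auto
      then show "x \<in> C F" unfolding C_def using C0[OF F] x by auto
    qed
    show "C F \<subseteq> V F" unfolding C_def using C0[OF F] by auto
  next
    fix F F' assume h: "F \<in> I" "F' \<in> I" "F \<noteq> F'"
    have "C F \<subseteq> S F F'"
    proof
      fix x assume x: "x \<in> C F"
      then have "x \<in> E" using C0[OF h(1)] by (auto simp: C_def clop_def)
      moreover have "x \<notin> E - S F F'" using x h by (auto simp: C_def)
      ultimately show "x \<in> S F F'" by blast
    qed
    moreover have "C F' \<inter> S F F' = {}" using h by (auto simp: C_def)
    ultimately show "C F \<inter> C F' = {}" by blast
  qed
qed

lemma separate_ends: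
  obtains Va Vb where "openin Q Va" "openin Q Vb" "a \<in> Va" "b \<in> Vb" "Va \<inter> Vb = {}"
proof -
  have "\<exists>U V. openin Q U \<and> openin Q V \<and> a \<in> U \<and> b \<in> V \<and> disjnt U V"
    using Hausdorff a b ab unfolding Hausdorff_space_def by blast
  then obtain U V where "openin Q U" "openin Q V" "a \<in> U" "b \<in> V" "U \<inter> V = {}" unfolding disjnt_def by blast
  then show thesis by (rule that)
qed

lemma cover_cases:
  assumes "x \<in> topspace Q"
  obtains "x = a" | "x = b" | "x \<in> E"
  using assms by (auto simp: E_def)

text \<open>The cocycle \<open>u F\<close> is the coboundary of the indicator of \<open>C F\<close>
  near \<open>b\<close> and zero elsewhere; it detects a passage from \<open>a\<close> to
  \<open>b\<close> along \<open>F\<close>. If a combination of them is \<open>cob w\<close>, then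
  comparing \<open>w\<close> at the two ends along \<open>F\<close> gives
  \<open>w [a] = w [b] + \<alpha> F\<close>. Along the omitted \<open>F0\<close> it gives
  \<open>w [a] = w [b]\<close>, so all coefficients vanish.\<close>

lemma finite_essential:
  assumes fd: "finite_over (Bd Q {} 1) (Zc Q {} 1 :: ('z list \<Rightarrow> 'k::field) set)"
  shows "finite essential"
proof (rule ccontr)
  assume inf: "infinite essential"
  obtain S where S: "finite S" "Zc Q {} 1 \<subseteq> fvs.span (S \<union> Bd Q {} 1 :: ('z list \<Rightarrow> 'k) set)"
    using fd unfolding finite_over_def by blast
  \<comment> \<open>One member is set aside as the reference \<open>F0\<close>, and the remaining
    ones must still outnumber \<open>S\<close>.\<close>
  obtain I where I: "finite I" "card I = Suc (Suc (card S))" "I \<subseteq> essential"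
    using infinite_arbitrarily_large[OF inf] by blast
  obtain F0 where F0: "F0 \<in> I" using I(2) by fastforce
  obtain C where C: "\<And>F. F \<in> I \<Longrightarrow> clop (C F)" "\<And>F. F \<in> I \<Longrightarrow> F \<subseteq> C F"
    "\<And>F F'. F \<in> I \<Longrightarrow> F' \<in> I \<Longrightarrow> F \<noteq> F' \<Longrightarrow> C F \<inter> C F' = {}"
    by (rule disjoint_clop_nbhds[OF I(1,3), of "\<lambda>_. topspace Q"])
      (use I(3) quasi_sub[OF essential_quasi] a b in \<open>auto simp: E_def\<close>)
  obtain Va Vb where V: "openin Q Va" "openin Q Vb" "a \<in> Va" "b \<in> Vb" "Va \<inter> Vb = {}"
    by (rule separate_ends)
  define ch where "ch = (\<lambda>F xs. if hd xs \<in> C F then 1 else 0 :: 'k)"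
  define u where "u = (\<lambda>F xs. if set xs \<subseteq> Vb then cob (ch F) xs else 0)"
  have loc: "\<exists>U. openin Q U \<and> z \<in> U \<and> U \<subseteq> E \<and> (\<forall>F\<in>I. U \<subseteq> C F \<or> U \<inter> C F = {})" if z: "z \<in> E" for z
  proof (cases "\<exists>F\<in>I. z \<in> C F")
    case True
    then obtain F where F: "F \<in> I" "z \<in> C F" by blast
    have "\<forall>F'\<in>I. C F \<subseteq> C F' \<or> C F \<inter> C F' = {}" using C(3)[OF F(1)] by blast
    then show ?thesis using C(1)[OF F(1)] F by (intro exI[of _ "C F"]) (auto simp: clop_def)
  next
    case False
    have "clop (E - (\<Union>F\<in>I. C F))" using I(1) C(1) by (intro clop_Diff clop_E clop_UN) auto
    then show ?thesis using False z by (intro exI[of _ "E - (\<Union>F\<in>I. C F)"]) (auto simp: clop_def)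
  qed
  have pair0: "u F [x, y] = 0" if "F \<in> I" "U \<subseteq> C F \<or> U \<inter> C F = {}" "x \<in> U" "y \<in> U" for F U x y
    using that by (auto simp: u_def ch_def)
  have uZ: "u F \<in> Zc Q {} 1" if F: "F \<in> I" for F
  proof (rule Zc_absolute, unfold eventually_smalls_local, intro ballI)
    fix z assume z: "z \<in> topspace Q"
    show "\<exists>U. openin Q U \<and> z \<in> U \<and> (\<forall>xs. xs \<noteq> [] \<longrightarrow> set xs \<subseteq> U \<longrightarrow> length xs = Suc (Suc 1) \<longrightarrow> cob (u F) xs = 0)"
      using z
    proof (cases rule: cover_cases)
      case 1
      have "cob (u F) xs = 0" if "set xs \<subseteq> Va" "length xs = Suc (Suc 1)" for xs
      proof (rule cob_eq_0)
        fix ys assume ys: "set ys \<subseteq> set xs" "length xs = Suc (length ys)"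
        then have "ys \<noteq> []" using that by auto
        then have "\<not> set ys \<subseteq> Vb" using ys(1) that(1) V(5) by (cases ys) auto
        then show "u F ys = 0" by (simp add: u_def)
      qed
      then show ?thesis using V 1 by blast
    next
      case 2
      have "cob (u F) xs = 0" if "set xs \<subseteq> Vb" for xs
      proof -
        have "cob (u F) xs = cob (cob (ch F)) xs" by (rule cob_cong) (use that in \<open>auto simp: u_def\<close>)
        then show ?thesis by simp
      qed
      then show ?thesis using V 2 by blast
    next
      case 3
      obtain U where U: "openin Q U" "z \<in> U" "U \<subseteq> C F \<or> U \<inter> C F = {}" using loc[OF 3] F by blast
      have "cob (u F) xs = 0" if h: "set xs \<subseteq> U" "length xs = Suc (Suc 1)" for xs
      proof (rule cob_eq_0)
        fix ys assume ys: "set ys \<subseteq> set xs" "length xs = Suc (length ys)"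
        then have "length ys = Suc (Suc 0)" using h(2) by simp
        then obtain x y where "ys = [x, y]" by (auto simp: length_Suc_conv)
        then show "u F ys = 0" using pair0[OF F U(3), of x y] ys(1) h(1) by auto
      qed
      then show ?thesis using U by blast
    qed
  qed
  have "card S < card (I - {F0})" using I F0 by simp
  moreover have "u F \<in> fvs.span (S \<union> Bd Q {} 1)" if "F \<in> I - {F0}" for F using uZ that S(2) by blast
  ultimately have "\<exists>\<alpha>. (\<exists>F\<in>I - {F0}. \<alpha> F \<noteq> 0) \<and> (\<Sum>F\<in>I - {F0}. \<alpha> F *s u F) \<in> fvs.span (Bd Q {} 1)"
    using finite_over_dependent[OF S(1), of "I - {F0}" u "Bd Q {} 1"] I(1) by blast
  then obtain \<alpha> where \<alpha>: "\<exists>F\<in>I - {F0}. \<alpha> F \<noteq> 0" "(\<Sum>F\<in>I - {F0}. \<alpha> F *s u F) \<in> Bd Q {} 1"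
    using fvs.span_eq_iff[THEN iffD2, OF subspace_Bd[of Q "{}" 1]] by metis
  have sm: "(\<Sum>F\<in>J. \<alpha> F *s u F) xs = (\<Sum>F\<in>J. \<alpha> F * u F xs)" for J xs
    by (induction J rule: infinite_finite_induct) (auto simp: fscale_def)
  obtain w where wev: "eventually (\<lambda>xs. length xs = Suc 1 \<longrightarrow> (\<Sum>F\<in>I - {F0}. \<alpha> F *s u F) xs = cob w xs) (smalls Q)"
    using \<alpha>(2) by (elim BdE) (rule that)
  have w: "\<exists>U. openin Q U \<and> z \<in> U \<and> (\<forall>x\<in>U. \<forall>y\<in>U. w [y] - w [x] = (\<Sum>F\<in>I - {F0}. \<alpha> F * u F [x, y]))"
    if z: "z \<in> topspace Q" for z
  proof -
    obtain U where U: "openin Q U" "z \<in> U" "\<And>xs. xs \<noteq> [] \<Longrightarrow> set xs \<subseteq> U \<Longrightarrow>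
        length xs = Suc 1 \<longrightarrow> (\<Sum>F\<in>I - {F0}. \<alpha> F *s u F) xs = cob w xs"
      using wev z unfolding eventually_smalls_local by blast
    have "w [y] - w [x] = (\<Sum>F\<in>I - {F0}. \<alpha> F * u F [x, y])" if "x \<in> U" "y \<in> U" for x y
      using U(3)[of "[x, y]"] that unfolding sm by simp
    then show ?thesis using U(1,2) by blast
  qed
  obtain Oa where Oa: "openin Q Oa" "a \<in> Oa" "\<And>y. y \<in> Oa \<Longrightarrow> w [y] - w [a] = (\<Sum>F\<in>I - {F0}. \<alpha> F * u F [a, y])"
    using w[OF a] by blast
  obtain Ob where Ob: "openin Q Ob" "b \<in> Ob" "\<And>y. y \<in> Ob \<Longrightarrow> w [y] - w [b] = (\<Sum>F\<in>I - {F0}. \<alpha> F * u F [b, y])"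
    using w[OF b] by blast
  have "a \<notin> Vb" using V by blast
  then have wa: "w [y] = w [a]" if "y \<in> Oa" for y using Oa(3)[OF that] by (simp add: u_def)
  have bC: "b \<notin> C F" if "F \<in> I" for F using C(1)[OF that] by (auto simp: clop_def E_def)
  \<comment> \<open>Off the ends \<open>w\<close> is locally constant, so this level set is clopen
    in \<open>E\<close>. Each \<open>F\<close> meets it near \<open>a\<close> and is therefore
    contained in it.\<close>
  define T where "T = {z \<in> E. w [z] = w [a]}"
  have open_w: "openin Q {z \<in> E. R (w [z])}" for R
  proof (subst openin_subopen, intro ballI)
    fix z assume "z \<in> {z \<in> E. R (w [z])}"
    then have z: "z \<in> E" "R (w [z])" by auto
    obtain U where U: "openin Q U" "z \<in> U" "U \<subseteq> E" "\<forall>F\<in>I. U \<subseteq> C F \<or> U \<inter> C F = {}" using loc[OF z(1)] by blast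
    have "z \<in> topspace Q" using z(1) by (simp add: E_def)
    then obtain U' where U': "openin Q U'" "z \<in> U'"
      "\<forall>x\<in>U'. \<forall>y\<in>U'. w [y] - w [x] = (\<Sum>F\<in>I - {F0}. \<alpha> F * u F [x, y])" using w by blast
    have "w [y] = w [z]" if "y \<in> U \<inter> U'" for y
    proof -
      have "w [y] - w [z] = (\<Sum>F\<in>I - {F0}. \<alpha> F * u F [z, y])" using U'(2,3) that by blast
      also have "\<dots> = 0" using pair0[of _ U z y] U(2,4) that by (intro sum.neutral) auto
      finally show ?thesis by simp
    qed
    then have "U \<inter> U' \<subseteq> {z \<in> E. R (w [z])}" using U(3) z(2) by auto
    with U U' show "\<exists>T. openin Q T \<and> z \<in> T \<and> T \<subseteq> {z \<in> E. R (w [z])}"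
      by (intro exI[of _ "U \<inter> U'"]) (auto intro: openin_Int)
  qed
  have "E - T = {z \<in> E. w [z] \<noteq> w [a]}" by (auto simp: T_def)
  then have T: "clop T" using open_w[of "\<lambda>c. c = w [a]"] open_w[of "\<lambda>c. c \<noteq> w [a]"]
    by (auto simp: clop_def T_def)
  have key: "w [a] = w [b] + (if F = F0 then 0 else \<alpha> F)" if F: "F \<in> I" for F
  proof -
    have Fe: "F \<in> essential" "F \<in> quasi_components_of (subtopology Q E)" using F I(3) essential_quasi by auto
    obtain y where "y \<in> F" "y \<in> Oa" using Fe(1) Oa(1,2) unfolding essential_def in_closure_of by blast
    then have "y \<in> F \<inter> T" using quasi_sub[OF Fe(2)] wa by (auto simp: T_def)
    then have FT: "F \<subseteq> T" using quasi_clop[OF Fe(2) T] by blast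
    have "openin Q (Ob \<inter> Vb)" using Ob(1) V(2) by (rule openin_Int)
    then obtain z where z: "z \<in> F" "z \<in> Ob" "z \<in> Vb"
      using Fe(1) Ob(2) V(4) unfolding essential_def in_closure_of by blast
    have "w [a] = w [z]" using FT z(1) by (auto simp: T_def)
    also have "\<dots> = w [b] + (\<Sum>F\<in>I - {F0}. \<alpha> F * u F [b, z])" using Ob(3)[OF z(2)] by (simp add: algebra_simps)
    also have "(\<Sum>F\<in>I - {F0}. \<alpha> F * u F [b, z]) = (\<Sum>F'\<in>I - {F0}. if F' = F then \<alpha> F else 0)"
    proof (rule sum.cong[OF refl])
      fix F' assume F': "F' \<in> I - {F0}"
      have "z \<in> C F' \<longleftrightarrow> F' = F" using C(2)[OF F] C(3)[OF F, of F'] F' z(1) by blast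
      then show "\<alpha> F' * u F' [b, z] = (if F' = F then \<alpha> F else 0)"
        using V(4) z(3) bC[of F'] F' by (auto simp: u_def ch_def)
    qed
    also have "\<dots> = (if F = F0 then 0 else \<alpha> F)" using I(1) F by simp
    finally show ?thesis .
  qed
  have "w [a] = w [b]" using key[OF F0] by simp
  then have "\<alpha> F = 0" if "F \<in> I - {F0}" for F using key[of F] that by simp
  then show False using \<alpha>(1) by blast
qed

text \<open>The pieces meet only in \<open>a\<close> and \<open>b\<close>. Primitives on them that
  vanish near both ends can be extended by zero and added; the degree of \<open>u\<close> is at
  least 2 so that the primitives have positive degree and can be coned off at the ends.\<close>

lemma Bd_glue:
  fixes u :: "'z list \<Rightarrow> 'k::field"
  assumes u: "u \<in> Zc Q {} (Suc (Suc p))" and I: "finite I"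
    and C: "\<And>i. i \<in> I \<Longrightarrow> clop (C i)" "\<And>i j. i \<in> I \<Longrightarrow> j \<in> I \<Longrightarrow> i \<noteq> j \<Longrightarrow> C i \<inter> C j = {}" "(\<Union>i\<in>I. C i) = E"
    and bd: "\<And>i. i \<in> I \<Longrightarrow> u \<in> Bd (subtopology Q (C i \<union> {a, b})) {} (Suc (Suc p))"
  shows "u \<in> Bd Q {} (Suc (Suc p))"
proof -
  obtain Va Vb where V: "openin Q Va" "openin Q Vb" "a \<in> Va" "b \<in> Vb" "Va \<inter> Vb = {}"
    by (rule separate_ends)
  have ev: "eventually (\<lambda>xs. length xs = Suc (Suc (Suc (Suc p))) \<longrightarrow> cob u xs = 0) (smalls Q)"
    using u by (simp add: Zc_def)
  obtain Ga where Ga: "openin Q Ga" "a \<in> Ga" "\<And>xs. xs \<noteq> [] \<Longrightarrow> set xs \<subseteq> Ga \<Longrightarrow> length xs = Suc (Suc (Suc (Suc p))) \<longrightarrow> cob u xs = 0"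
    using ev a unfolding eventually_smalls_local by blast
  obtain Gb where Gb: "openin Q Gb" "b \<in> Gb" "\<And>xs. xs \<noteq> [] \<Longrightarrow> set xs \<subseteq> Gb \<Longrightarrow> length xs = Suc (Suc (Suc (Suc p))) \<longrightarrow> cob u xs = 0"
    using ev b unfolding eventually_smalls_local by blast
  define Wa where "Wa = Va \<inter> Ga"
  define Wb where "Wb = Vb \<inter> Gb"
  have W: "openin Q Wa" "openin Q Wb" "a \<in> Wa" "b \<in> Wb" "Wa \<inter> Wb = {}"
    unfolding Wa_def Wb_def using V Ga Gb by (auto intro: openin_Int)
  have cu: "cob u xs = 0" if "set xs \<subseteq> Wa \<or> set xs \<subseteq> Wb" "length xs = Suc (Suc (Suc (Suc p)))" for xs
  proof -
    have "xs \<noteq> []" using that(2) by auto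
    then show ?thesis using Ga(3)[of xs] Gb(3)[of xs] that unfolding Wa_def Wb_def by auto
  qed
  obtain \<kappa> where \<kappa>: "\<And>xs. set xs \<subseteq> Wa \<or> set xs \<subseteq> Wb \<Longrightarrow> length xs = Suc (Suc (Suc p)) \<Longrightarrow> u xs = cob \<kappa> xs"
    by (rule cone_at_two_points[OF W(3-5), of "Suc p" u, OF cu]) (assumption+, rule that)
  \<comment> \<open>Now the cocycle vanishes near both ends, so a primitive of it on any piece is
    itself a cocycle there, to which the cones apply again.\<close>
  define v where "v = (\<lambda>xs. u xs - cob \<kappa> xs)"
  have v0: "v xs = 0" if "set xs \<subseteq> Wa \<or> set xs \<subseteq> Wb" "length xs = Suc (Suc (Suc p))" for xs
    using \<kappa>[OF that] by (simp add: v_def)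
  define good where "good = (\<lambda>i \<psi> Ua Ub. openin Q Ua \<and> openin Q Ub \<and> a \<in> Ua \<and> b \<in> Ub \<and>
      eventually (\<lambda>xs. set xs \<subseteq> C i \<longrightarrow> length xs = Suc (Suc (Suc p)) \<longrightarrow> v xs = cob \<psi> xs) (smalls Q) \<and>
      (\<forall>xs. set xs \<subseteq> Ua \<inter> (C i \<union> {a, b}) \<or> set xs \<subseteq> Ub \<inter> (C i \<union> {a, b}) \<longrightarrow> length xs = Suc (Suc p) \<longrightarrow> \<psi> xs = 0))"
  have "\<exists>\<psi> Ua Ub. good i \<psi> Ua Ub"
    if i: "i \<in> I" for i
  proof -
    let ?C = "C i \<union> {a, b}"
    have cl: "closedin Q ?C" by (rule clop_closure[OF C(1)[OF i]])
    obtain \<psi>0 where "eventually (\<lambda>xs. set xs \<subseteq> ?C \<longrightarrow> length xs = Suc (Suc (Suc p)) \<longrightarrow> u xs = cob \<psi>0 xs) (smalls Q)"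
      using bd[OF i] unfolding Bd_subtopology[OF cl] by blast
    then have \<psi>1: "eventually (\<lambda>xs. set xs \<subseteq> ?C \<longrightarrow> length xs = Suc (Suc (Suc p)) \<longrightarrow> v xs = cob (\<lambda>xs. \<psi>0 xs - \<kappa> xs) xs) (smalls Q)"
      by (rule eventually_mono) (simp add: v_def cob_minus)
    define \<psi>1 where "\<psi>1 = (\<lambda>xs. \<psi>0 xs - \<kappa> xs)"
    obtain Ha where Ha: "openin Q Ha" "a \<in> Ha" "\<And>xs. xs \<noteq> [] \<Longrightarrow> set xs \<subseteq> Ha \<Longrightarrow> set xs \<subseteq> ?C \<longrightarrow> length xs = Suc (Suc (Suc p)) \<longrightarrow> v xs = cob \<psi>1 xs"
      using \<psi>1 a unfolding eventually_smalls_local \<psi>1_def by blast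
    obtain Hb where Hb: "openin Q Hb" "b \<in> Hb" "\<And>xs. xs \<noteq> [] \<Longrightarrow> set xs \<subseteq> Hb \<Longrightarrow> set xs \<subseteq> ?C \<longrightarrow> length xs = Suc (Suc (Suc p)) \<longrightarrow> v xs = cob \<psi>1 xs"
      using \<psi>1 b unfolding eventually_smalls_local \<psi>1_def by blast
    have c: "cob \<psi>1 xs = 0" if h: "set xs \<subseteq> Ha \<inter> Wa \<inter> ?C \<or> set xs \<subseteq> Hb \<inter> Wb \<inter> ?C" "length xs = Suc (Suc (Suc p))" for xs
    proof -
      have "xs \<noteq> []" using h(2) by auto
      then show ?thesis using Ha(3)[of xs] Hb(3)[of xs] v0[of xs] h by auto
    qed
    have ha: "a \<in> Ha \<inter> Wa \<inter> ?C" and hb: "b \<in> Hb \<inter> Wb \<inter> ?C" and hd: "(Ha \<inter> Wa \<inter> ?C) \<inter> (Hb \<inter> Wb \<inter> ?C) = {}"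
      using Ha(2) Hb(2) W(3-5) by auto
    obtain \<mu> where \<mu>: "\<And>xs. set xs \<subseteq> Ha \<inter> Wa \<inter> ?C \<or> set xs \<subseteq> Hb \<inter> Wb \<inter> ?C \<Longrightarrow> length xs = Suc (Suc p) \<Longrightarrow> \<psi>1 xs = cob \<mu> xs"
      by (rule cone_at_two_points[OF ha hb hd, of p \<psi>1, OF c]) (assumption+, rule that)
    show ?thesis
      unfolding good_def
    proof (rule exI[of _ "\<lambda>xs. \<psi>1 xs - cob \<mu> xs"], rule exI[of _ "Ha \<inter> Wa"], rule exI[of _ "Hb \<inter> Wb"], intro conjI allI impI)
      show "openin Q (Ha \<inter> Wa)" "openin Q (Hb \<inter> Wb)" "a \<in> Ha \<inter> Wa" "b \<in> Hb \<inter> Wb"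
        using Ha Hb W by (auto intro: openin_Int)
      show "eventually (\<lambda>xs. set xs \<subseteq> C i \<longrightarrow> length xs = Suc (Suc (Suc p)) \<longrightarrow> v xs = cob (\<lambda>xs. \<psi>1 xs - cob \<mu> xs) xs) (smalls Q)"
        using \<psi>1 unfolding \<psi>1_def by (rule eventually_mono) (auto simp: cob_minus)
      show "\<psi>1 xs - cob \<mu> xs = 0" if "set xs \<subseteq> Ha \<inter> Wa \<inter> ?C \<or> set xs \<subseteq> Hb \<inter> Wb \<inter> ?C" "length xs = Suc (Suc p)" for xs
        using \<mu>[OF that] by simp
    qed
  qed
  then obtain \<psi> Ua Ub where "\<And>i. i \<in> I \<Longrightarrow> good i (\<psi> i) (Ua i) (Ub i)" by metis
  then have \<psi>: "\<And>i. i \<in> I \<Longrightarrow> openin Q (Ua i) \<and> openin Q (Ub i) \<and> a \<in> Ua i \<and> b \<in> Ub i"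
    "\<And>i. i \<in> I \<Longrightarrow> eventually (\<lambda>xs. set xs \<subseteq> C i \<longrightarrow> length xs = Suc (Suc (Suc p)) \<longrightarrow> v xs = cob (\<psi> i) xs) (smalls Q)"
    "\<And>i xs. i \<in> I \<Longrightarrow> set xs \<subseteq> Ua i \<inter> (C i \<union> {a, b}) \<or> set xs \<subseteq> Ub i \<inter> (C i \<union> {a, b}) \<Longrightarrow> length xs = Suc (Suc p) \<Longrightarrow> \<psi> i xs = 0"
    unfolding good_def by blast+
  \<comment> \<open>Near an end every summand vanishes. A list containing a point other than
    \<open>a\<close> and \<open>b\<close> fits into at most one piece, so elsewhere only one summand
    survives.\<close>
  define \<eta> where "\<eta> = (\<lambda>xs. \<Sum>i\<in>I. if set xs \<subseteq> C i \<union> {a, b} then \<psi> i xs else 0)"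
  have near: "\<exists>U. openin Q U \<and> z \<in> U \<and> (\<forall>xs. xs \<noteq> [] \<longrightarrow> set xs \<subseteq> U \<longrightarrow> length xs = Suc (Suc (Suc p)) \<longrightarrow> v xs = cob \<eta> xs)"
    if z: "z \<in> topspace Q" for z
  proof -
    have at_end: ?thesis if h: "openin Q G" "z \<in> G" "\<And>i. i \<in> I \<Longrightarrow> openin Q (U i) \<and> z \<in> U i"
        "\<And>xs. set xs \<subseteq> G \<Longrightarrow> length xs = Suc (Suc (Suc p)) \<Longrightarrow> v xs = 0"
        "\<And>i xs. i \<in> I \<Longrightarrow> set xs \<subseteq> U i \<Longrightarrow> set xs \<subseteq> C i \<union> {a, b} \<Longrightarrow> length xs = Suc (Suc p) \<Longrightarrow> \<psi> i xs = 0" for G U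
    proof -
      \<comment> \<open>The intersection with the whole space covers an empty index set.\<close>
      let ?U = "G \<inter> (topspace Q \<inter> (\<Inter>i\<in>I. U i))"
      have "openin Q (topspace Q \<inter> (\<Inter>i\<in>I. U i))"
        using I h(3) by (cases "I = {}") (auto intro!: openin_Int openin_INT2)
      then have "openin Q ?U" using h(1) by blast
      moreover have "z \<in> ?U" using h z by blast
      moreover have "v xs = cob \<eta> xs" if xs: "set xs \<subseteq> ?U" "length xs = Suc (Suc (Suc p))" for xs
      proof -
        have "cob \<eta> xs = 0"
        proof (rule cob_eq_0)
          fix ys assume ys: "set ys \<subseteq> set xs" "length xs = Suc (length ys)"
          have "\<psi> i ys = 0" if "i \<in> I" "set ys \<subseteq> C i \<union> {a, b}" for i
            using xs ys that by (intro h(5)[OF that(1) _ that(2)]) auto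
          then show "\<eta> ys = 0" unfolding \<eta>_def by (intro sum.neutral) auto
        qed
        then show ?thesis using h(4)[of xs] xs by auto
      qed
      ultimately show ?thesis by blast
    qed
    show ?thesis using z
    proof (cases rule: cover_cases)
      case 1
      show ?thesis
      proof (rule at_end[of Wa Ua])
        show "openin Q Wa" "z \<in> Wa" using 1 W by auto
        show "openin Q (Ua i) \<and> z \<in> Ua i" if "i \<in> I" for i using 1 \<psi>(1)[OF that] by simp
        show "v xs = 0" if "set xs \<subseteq> Wa" "length xs = Suc (Suc (Suc p))" for xs using that by (intro v0) simp
        show "\<psi> i xs = 0" if "i \<in> I" "set xs \<subseteq> Ua i" "set xs \<subseteq> C i \<union> {a, b}" "length xs = Suc (Suc p)" for i xs
          using that by (intro \<psi>(3)[OF that(1)]) simp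
      qed
    next
      case 2
      show ?thesis
      proof (rule at_end[of Wb Ub])
        show "openin Q Wb" "z \<in> Wb" using 2 W by auto
        show "openin Q (Ub i) \<and> z \<in> Ub i" if "i \<in> I" for i using 2 \<psi>(1)[OF that] by simp
        show "v xs = 0" if "set xs \<subseteq> Wb" "length xs = Suc (Suc (Suc p))" for xs using that by (intro v0) simp
        show "\<psi> i xs = 0" if "i \<in> I" "set xs \<subseteq> Ub i" "set xs \<subseteq> C i \<union> {a, b}" "length xs = Suc (Suc p)" for i xs
          using that by (intro \<psi>(3)[OF that(1)]) simp
      qed
    next
      case 3
      then obtain i where i: "i \<in> I" "z \<in> C i" using C(3) by blast
      obtain U where U: "openin Q U" "z \<in> U" "\<And>xs. xs \<noteq> [] \<Longrightarrow> set xs \<subseteq> U \<Longrightarrow> set xs \<subseteq> C i \<longrightarrow> length xs = Suc (Suc (Suc p)) \<longrightarrow> v xs = cob (\<psi> i) xs"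
        using \<psi>(2)[OF i(1)] z unfolding eventually_smalls_local by blast
      have "v xs = cob \<eta> xs" if xs: "xs \<noteq> []" "set xs \<subseteq> U \<inter> C i" "length xs = Suc (Suc (Suc p))" for xs
      proof -
        have "cob \<eta> xs = cob (\<psi> i) xs"
        proof (rule cob_cong)
          fix ys assume ys: "set ys \<subseteq> set xs" "length xs = Suc (length ys)"
          then obtain y where y: "y \<in> set ys" using xs(3) by (cases ys) auto
          have yC: "y \<in> C i" using y ys xs by blast
          then have "y \<noteq> a" "y \<noteq> b" using C(1)[OF i(1)] by (auto simp: clop_def E_def)
          then have "\<not> set ys \<subseteq> C j \<union> {a, b}" if "j \<in> I" "j \<noteq> i" for j
            using C(2)[OF i(1) that(1)] that(2) yC y by blast
          then have "\<eta> ys = (\<Sum>j\<in>I. if j = i then \<psi> i ys else 0)"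
            unfolding \<eta>_def by (intro sum.cong) (use ys xs in auto)
          then show "\<eta> ys = \<psi> i ys" using I i(1) by simp
        qed
        then show ?thesis using U(3)[of xs] xs by auto
      qed
      then show ?thesis using U i C(1)[OF i(1)] by (intro exI[of _ "U \<inter> C i"]) (auto simp: clop_def intro: openin_Int)
    qed
  qed
  have "eventually (\<lambda>xs. length xs = Suc (Suc (Suc p)) \<longrightarrow> v xs = cob \<eta> xs) (smalls Q)"
    unfolding eventually_smalls_local using near by blast
  then have "eventually (\<lambda>xs. length xs = Suc (Suc (Suc p)) \<longrightarrow> u xs = cob (\<lambda>xs. \<eta> xs + \<kappa> xs) xs) (smalls Q)"
    by (rule eventually_mono) (auto simp: v_def cob_plus algebra_simps)
  then show ?thesis
    using eventually_smalls_topspace[of Q]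
    by (intro BdI[of _ "\<lambda>xs. \<eta> xs + \<kappa> xs"]) (auto elim: eventually_mono)
qed

text \<open>Cocycles extend to disjoint clopen neighbourhoods by tautness. Their domains still share
  the ends, where they need not agree; the cones make each of them zero near both ends, and then
  they add up, with zero on the rest of the space.\<close>

lemma extend_from_essential:
  fixes \<phi> :: "'z set \<Rightarrow> 'z list \<Rightarrow> 'k::field"
  assumes fin: "finite essential" and \<phi>: "\<And>F. F \<in> essential \<Longrightarrow> \<phi> F \<in> Zc (subtopology Q (F \<union> {a, b})) {} (Suc p)"
  obtains \<eta> where "\<eta> \<in> Zc Q {} (Suc p)"
    "\<And>F. F \<in> essential \<Longrightarrow> \<eta> - \<phi> F \<in> Bd (subtopology Q (F \<union> {a, b})) {} (Suc p)"
proof -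
  have Fcl: "closedin Q (F \<union> {a, b})" if "F \<in> essential" for F using quasi_closed[OF essential_quasi[OF that]] .
  have "\<exists>V \<psi>. openin Q V \<and> F \<union> {a, b} \<subseteq> V \<and> (\<forall>xs. set xs \<subseteq> F \<union> {a, b} \<longrightarrow> \<psi> xs = \<phi> F xs) \<and>
      (\<forall>C. closedin Q C \<longrightarrow> C \<subseteq> V \<longrightarrow> \<psi> \<in> Zc (subtopology Q C) {} (Suc p))" if F: "F \<in> essential" for F
    by (rule Zc_extend[OF compact Hausdorff Fcl[OF F] \<phi>[OF F]]) blast
  then obtain V \<psi> where V: "\<And>F. F \<in> essential \<Longrightarrow> openin Q (V F) \<and> F \<union> {a, b} \<subseteq> V F"
    and \<psi>: "\<And>F xs. F \<in> essential \<Longrightarrow> set xs \<subseteq> F \<union> {a, b} \<Longrightarrow> \<psi> F xs = \<phi> F xs"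
      "\<And>F C. F \<in> essential \<Longrightarrow> closedin Q C \<Longrightarrow> C \<subseteq> V F \<Longrightarrow> \<psi> F \<in> Zc (subtopology Q C) {} (Suc p)"
    by metis
  obtain C where C: "\<And>F. F \<in> essential \<Longrightarrow> clop (C F)" "\<And>F. F \<in> essential \<Longrightarrow> F \<subseteq> C F"
    "\<And>F. F \<in> essential \<Longrightarrow> C F \<subseteq> V F"
    "\<And>F F'. F \<in> essential \<Longrightarrow> F' \<in> essential \<Longrightarrow> F \<noteq> F' \<Longrightarrow> C F \<inter> C F' = {}"
    by (rule disjoint_clop_nbhds[OF fin order.refl, of V]) (use V in auto)
  obtain Va Vb where Vab: "openin Q Va" "openin Q Vb" "a \<in> Va" "b \<in> Vb" "Va \<inter> Vb = {}"
    by (rule separate_ends)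
  define good where "good = (\<lambda>F \<theta> Ua Ub. openin Q Ua \<and> openin Q Ub \<and> a \<in> Ua \<and> b \<in> Ub \<and>
      eventually (\<lambda>xs. set xs \<subseteq> C F \<union> {a, b} \<longrightarrow> length xs = Suc (Suc (Suc p)) \<longrightarrow> cob \<theta> xs = 0) (smalls Q) \<and>
      (\<forall>xs. set xs \<subseteq> Ua \<inter> (C F \<union> {a, b}) \<or> set xs \<subseteq> Ub \<inter> (C F \<union> {a, b}) \<longrightarrow> length xs = Suc (Suc p) \<longrightarrow> \<theta> xs = 0) \<and>
      (\<exists>\<kappa>. \<forall>xs. \<theta> xs = \<psi> F xs - cob \<kappa> xs))"
  have "\<exists>\<theta> Ua Ub. good F \<theta> Ua Ub"
    if F: "F \<in> essential" for F
  proof -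
    let ?C = "C F \<union> {a, b}"
    have cl: "closedin Q ?C" by (rule clop_closure[OF C(1)[OF F]])
    have "?C \<subseteq> V F" using C(3)[OF F] V[OF F] by blast
    then have ev: "eventually (\<lambda>xs. set xs \<subseteq> ?C \<longrightarrow> length xs = Suc (Suc (Suc p)) \<longrightarrow> cob (\<psi> F) xs = 0) (smalls Q)"
      using \<psi>(2)[OF F cl] unfolding Zc_subtopology[OF cl] by blast
    obtain Ha where Ha: "openin Q Ha" "a \<in> Ha" "\<And>xs. xs \<noteq> [] \<Longrightarrow> set xs \<subseteq> Ha \<Longrightarrow> set xs \<subseteq> ?C \<longrightarrow> length xs = Suc (Suc (Suc p)) \<longrightarrow> cob (\<psi> F) xs = 0"
      using ev a unfolding eventually_smalls_local by blast
    obtain Hb where Hb: "openin Q Hb" "b \<in> Hb" "\<And>xs. xs \<noteq> [] \<Longrightarrow> set xs \<subseteq> Hb \<Longrightarrow> set xs \<subseteq> ?C \<longrightarrow> length xs = Suc (Suc (Suc p)) \<longrightarrow> cob (\<psi> F) xs = 0"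
      using ev b unfolding eventually_smalls_local by blast
    have c: "cob (\<psi> F) xs = 0" if h: "set xs \<subseteq> Ha \<inter> Va \<inter> ?C \<or> set xs \<subseteq> Hb \<inter> Vb \<inter> ?C" "length xs = Suc (Suc (Suc p))" for xs
    proof -
      have "xs \<noteq> []" using h(2) by auto
      then show ?thesis using Ha(3)[of xs] Hb(3)[of xs] h by auto
    qed
    have ha: "a \<in> Ha \<inter> Va \<inter> ?C" and hb: "b \<in> Hb \<inter> Vb \<inter> ?C" and hd: "(Ha \<inter> Va \<inter> ?C) \<inter> (Hb \<inter> Vb \<inter> ?C) = {}"
      using Ha(2) Hb(2) Vab(3-5) by auto
    obtain \<kappa> where \<kappa>: "\<And>xs. set xs \<subseteq> Ha \<inter> Va \<inter> ?C \<or> set xs \<subseteq> Hb \<inter> Vb \<inter> ?C \<Longrightarrow> length xs = Suc (Suc p) \<Longrightarrow> \<psi> F xs = cob \<kappa> xs"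
      by (rule cone_at_two_points[OF ha hb hd, of p "\<psi> F", OF c]) (assumption+, rule that)
    show ?thesis
      unfolding good_def
    proof (rule exI[of _ "\<lambda>xs. \<psi> F xs - cob \<kappa> xs"], rule exI[of _ "Ha \<inter> Va"], rule exI[of _ "Hb \<inter> Vb"], intro conjI allI impI)
      show "openin Q (Ha \<inter> Va)" "openin Q (Hb \<inter> Vb)" "a \<in> Ha \<inter> Va" "b \<in> Hb \<inter> Vb"
        using Ha Hb Vab by (auto intro: openin_Int)
      show "eventually (\<lambda>xs. set xs \<subseteq> ?C \<longrightarrow> length xs = Suc (Suc (Suc p)) \<longrightarrow> cob (\<lambda>xs. \<psi> F xs - cob \<kappa> xs) xs = 0) (smalls Q)"
        using ev by (rule eventually_mono) (auto simp: cob_minus)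
      show "\<psi> F xs - cob \<kappa> xs = 0" if "set xs \<subseteq> Ha \<inter> Va \<inter> ?C \<or> set xs \<subseteq> Hb \<inter> Vb \<inter> ?C" "length xs = Suc (Suc p)" for xs
        using \<kappa>[OF that] by simp
      show "\<exists>\<kappa>'. \<forall>xs. \<psi> F xs - cob \<kappa> xs = \<psi> F xs - cob \<kappa>' xs" by blast
    qed
  qed
  then obtain \<theta> Ua Ub where "\<And>F. F \<in> essential \<Longrightarrow> good F (\<theta> F) (Ua F) (Ub F)" by metis
  then have \<theta>: "\<And>F. F \<in> essential \<Longrightarrow> openin Q (Ua F) \<and> openin Q (Ub F) \<and> a \<in> Ua F \<and> b \<in> Ub F"
    "\<And>F. F \<in> essential \<Longrightarrow> eventually (\<lambda>xs. set xs \<subseteq> C F \<union> {a, b} \<longrightarrow> length xs = Suc (Suc (Suc p)) \<longrightarrow> cob (\<theta> F) xs = 0) (smalls Q)"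
    "\<And>F xs. F \<in> essential \<Longrightarrow> set xs \<subseteq> Ua F \<inter> (C F \<union> {a, b}) \<or> set xs \<subseteq> Ub F \<inter> (C F \<union> {a, b}) \<Longrightarrow> length xs = Suc (Suc p) \<Longrightarrow> \<theta> F xs = 0"
    "\<And>F. F \<in> essential \<Longrightarrow> \<exists>\<kappa>. \<forall>xs. \<theta> F xs = \<psi> F xs - cob \<kappa> xs"
    unfolding good_def by blast+
  \<comment> \<open>Lists inside \<open>{a, b}\<close> fit all pieces at once; small ones among them
    lie near one end, where every summand is zero.\<close>
  define \<eta> where "\<eta> = (\<lambda>xs. \<Sum>F\<in>essential. if set xs \<subseteq> C F \<union> {a, b} then \<theta> F xs else 0)"
  have zero: "\<exists>G. openin Q G \<and> z \<in> G \<and> (\<forall>xs. set xs \<subseteq> G \<longrightarrow> length xs = Suc (Suc p) \<longrightarrow> \<eta> xs = 0 \<and>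
      (\<forall>F\<in>essential. set xs \<subseteq> C F \<union> {a, b} \<longrightarrow> \<theta> F xs = 0))" if z: "z = a \<or> z = b" for z
  proof -
    define U where "U = (\<lambda>F. if z = a then Ua F else Ub F)"
    let ?G = "topspace Q \<inter> (\<Inter>F\<in>essential. U F)"
    have U: "openin Q (U F) \<and> z \<in> U F" if "F \<in> essential" for F using \<theta>(1)[OF that] z by (auto simp: U_def)
    have 1: "openin Q ?G" using fin U by (cases "essential = {}") (auto intro!: openin_Int openin_INT2)
    have 2: "z \<in> ?G" using U z a b by auto
    have *: "\<theta> F xs = 0" if "set xs \<subseteq> ?G" "length xs = Suc (Suc p)" "F \<in> essential" "set xs \<subseteq> C F \<union> {a, b}" for xs F
    proof -
      have "set xs \<subseteq> U F" using that by blast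
      then show ?thesis using that by (intro \<theta>(3)[OF that(3)]) (auto simp: U_def split: if_splits)
    qed
    have 3: "\<eta> xs = 0" if "set xs \<subseteq> ?G" "length xs = Suc (Suc p)" for xs
      unfolding \<eta>_def using *[OF that] by (intro sum.neutral) auto
    show ?thesis
      by (rule exI[of _ ?G], intro conjI allI impI ballI) (fact 1, fact 2, erule (1) 3, rule *, assumption+)
  qed
  have piece: "\<eta> xs = \<theta> F xs" if h: "F \<in> essential" "xs \<noteq> []" "set xs \<subseteq> C F \<union> {a, b}" "\<not> set xs \<subseteq> {a, b}" for xs F
  proof -
    obtain y where y: "y \<in> set xs" "y \<noteq> a" "y \<noteq> b" using h(4) by blast
    have yC: "y \<in> C F" using y h(3) by blast
    have "\<not> set xs \<subseteq> C F' \<union> {a, b}" if "F' \<in> essential" "F' \<noteq> F" for F'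
      using C(4)[OF h(1) that(1)] that(2) yC y by blast
    then have "\<eta> xs = (\<Sum>F'\<in>essential. if F' = F then \<theta> F xs else 0)"
      unfolding \<eta>_def by (intro sum.cong) (use h in auto)
    then show ?thesis using fin h(1) by simp
  qed
  have \<eta>Z: "\<eta> \<in> Zc Q {} (Suc p)"
  proof (rule Zc_absolute, unfold eventually_smalls_local, intro ballI)
    fix z assume z: "z \<in> topspace Q"
    show "\<exists>U. openin Q U \<and> z \<in> U \<and> (\<forall>xs. xs \<noteq> [] \<longrightarrow> set xs \<subseteq> U \<longrightarrow> length xs = Suc (Suc (Suc p)) \<longrightarrow> cob \<eta> xs = 0)"
    proof (cases "z = a \<or> z = b")
      case True
      obtain G where G: "openin Q G" "z \<in> G" "\<And>xs. set xs \<subseteq> G \<Longrightarrow> length xs = Suc (Suc p) \<Longrightarrow> \<eta> xs = 0"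
        using zero[OF True] by blast
      have "cob \<eta> xs = 0" if "set xs \<subseteq> G" "length xs = Suc (Suc (Suc p))" for xs
        by (rule cob_eq_0, rule G(3)) (use that in auto)
      then show ?thesis using G(1,2) by blast
    next
      case False
      then have zE: "z \<in> E" using z by (simp add: E_def)
      show ?thesis
      proof (cases "\<exists>F\<in>essential. z \<in> C F")
        case True
        then obtain F where F: "F \<in> essential" "z \<in> C F" by blast
        obtain U where U: "openin Q U" "z \<in> U" "\<And>xs. xs \<noteq> [] \<Longrightarrow> set xs \<subseteq> U \<Longrightarrow> set xs \<subseteq> C F \<union> {a, b} \<longrightarrow> length xs = Suc (Suc (Suc p)) \<longrightarrow> cob (\<theta> F) xs = 0"
          using \<theta>(2)[OF F(1)] z unfolding eventually_smalls_local by blast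
        have "cob \<eta> xs = 0" if xs: "xs \<noteq> []" "set xs \<subseteq> U \<inter> C F" "length xs = Suc (Suc (Suc p))" for xs
        proof -
          have "cob \<eta> xs = cob (\<theta> F) xs"
          proof (rule cob_cong)
            fix ys assume ys: "set ys \<subseteq> set xs" "length xs = Suc (length ys)"
            then obtain y where y: "y \<in> set ys" "ys \<noteq> []" using xs(3) by (cases ys) auto
            have "y \<in> C F" using y ys xs by blast
            then have "y \<noteq> a" "y \<noteq> b" using C(1)[OF F(1)] by (auto simp: clop_def E_def)
            then show "\<eta> ys = \<theta> F ys" using y ys xs by (intro piece[OF F(1)]) auto
          qed
          then show ?thesis using U(3)[of xs] xs by auto
        qed
        then show ?thesis using U F C(1)[OF F(1)] by (intro exI[of _ "U \<inter> C F"]) (auto simp: clop_def intro: openin_Int)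
      next
        case False
        have cl: "clop (E - (\<Union>F\<in>essential. C F))" using fin C(1) by (intro clop_Diff clop_E clop_UN) auto
        have "cob \<eta> xs = 0" if xs: "set xs \<subseteq> E - (\<Union>F\<in>essential. C F)" "length xs = Suc (Suc (Suc p))" for xs
        proof (rule cob_eq_0)
          fix ys assume ys: "set ys \<subseteq> set xs" "length xs = Suc (length ys)"
          then obtain y where y: "y \<in> set ys" using xs(2) by (cases ys) auto
          then have "y \<in> E - (\<Union>F\<in>essential. C F)" using ys xs by blast
          then have "\<not> set ys \<subseteq> C F \<union> {a, b}" if "F \<in> essential" for F using y that by (auto simp: E_def)
          then show "\<eta> ys = 0" unfolding \<eta>_def by (intro sum.neutral) auto
        qed
        then show ?thesis using cl zE False by (intro exI[of _ "E - (\<Union>F\<in>essential. C F)"]) (auto simp: clop_def)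
      qed
    qed
  qed
  have "\<eta> - \<phi> F \<in> Bd (subtopology Q (F \<union> {a, b})) {} (Suc p)" if F: "F \<in> essential" for F
  proof -
    let ?F = "F \<union> {a, b}"
    obtain \<kappa> where \<kappa>: "\<And>xs. \<theta> F xs = \<psi> F xs - cob \<kappa> xs" using \<theta>(4)[OF F] by blast
    have FC: "?F \<subseteq> C F \<union> {a, b}" using C(2)[OF F] by blast
    have "\<exists>U. openin Q U \<and> z \<in> U \<and> (\<forall>xs. xs \<noteq> [] \<longrightarrow> set xs \<subseteq> U \<longrightarrow> set xs \<subseteq> ?F \<longrightarrow> length xs = Suc (Suc p) \<longrightarrow> \<eta> xs = \<theta> F xs)"
      if z: "z \<in> topspace Q" for z
    proof (cases "z = a \<or> z = b")
      case True
      obtain G where "openin Q G" "z \<in> G" "\<And>xs. set xs \<subseteq> G \<Longrightarrow> length xs = Suc (Suc p) \<Longrightarrow> \<eta> xs = 0 \<and>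
        (\<forall>F\<in>essential. set xs \<subseteq> C F \<union> {a, b} \<longrightarrow> \<theta> F xs = 0)" using zero[OF True] by blast
      then show ?thesis using F FC by (intro exI[of _ G]) (metis order.trans)
    next
      case False
      have "\<eta> xs = \<theta> F xs" if "xs \<noteq> []" "set xs \<subseteq> E" "set xs \<subseteq> ?F" for xs
      proof (rule piece[OF F that(1)])
        show "set xs \<subseteq> C F \<union> {a, b}" using that(3) FC by blast
        show "\<not> set xs \<subseteq> {a, b}" using that(1,2) by (cases xs) (auto simp: E_def)
      qed
      then show ?thesis using False z openin_E by (intro exI[of _ E]) (auto simp: E_def)
    qed
    then have "eventually (\<lambda>xs. set xs \<subseteq> ?F \<longrightarrow> length xs = Suc (Suc p) \<longrightarrow> \<eta> xs = \<theta> F xs) (smalls Q)"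
      unfolding eventually_smalls_local by blast
    then have "eventually (\<lambda>xs. set xs \<subseteq> ?F \<longrightarrow> length xs = Suc (Suc p) \<longrightarrow> (\<eta> - \<phi> F) xs = cob (\<lambda>xs. - 1 * \<kappa> xs) xs) (smalls Q)"
    proof (rule eventually_mono, intro impI)
      fix xs assume *: "set xs \<subseteq> ?F \<longrightarrow> length xs = Suc (Suc p) \<longrightarrow> \<eta> xs = \<theta> F xs" "set xs \<subseteq> ?F" "length xs = Suc (Suc p)"
      then show "(\<eta> - \<phi> F) xs = cob (\<lambda>xs. - 1 * \<kappa> xs) xs"
        using \<kappa>[of xs] \<psi>(1)[OF F *(2)] by (simp only: cob_times) simp
    qed
    moreover have "eventually (\<lambda>xs. set xs \<subseteq> ?F \<longrightarrow> length xs = Suc p \<longrightarrow> set xs \<subseteq> {} \<longrightarrow> - 1 * \<kappa> xs = 0) (smalls Q)"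
      using eventually_smalls_topspace[of Q] by (rule eventually_mono) auto
    ultimately show ?thesis
      unfolding Bd_subtopology[OF Fcl[OF F]] by (intro exI[of _ "\<lambda>xs. - 1 * \<kappa> xs"]) simp
  qed
  with \<eta>Z show thesis by (rule that)
qed

text \<open>The closure of each quasicomponent in \<open>D\<close> misses one of the ends, and this
  persists on a clopen neighbourhood in \<open>D\<close>. Finitely many such neighbourhoods exhaust
  the part of \<open>D\<close> away from both ends; what remains lies close to an end and is
  assigned to it.\<close>

lemma split_inessential:
  assumes D: "clop D" and no: "\<And>F. F \<in> essential \<Longrightarrow> F \<inter> D = {}"
  obtains Da Db where "D = Da \<union> Db" "Da \<inter> Db = {}" "closedin Q (Da \<union> {a})" "closedin Q (Db \<union> {b})"
proof -
  obtain Oa Ob where O: "openin Q Oa" "openin Q Ob" "a \<in> Oa" "b \<in> Ob" "Oa \<inter> Ob = {}"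
    by (rule separate_ends)
  have reg: "regular_space Q" using compact Hausdorff by (simp add: compact_Hausdorff_or_regular_imp_normal_space
        normal_t1_imp_regular_space Hausdorff_imp_t1_space)
  have cut: "\<exists>C U. clop C \<and> z \<in> C \<and> C \<subseteq> D \<and> openin Q U \<and> e \<in> U \<and> C \<inter> U = {}"
    if F: "F \<in> quasi_components_of (subtopology Q E)" "z \<in> F" "z \<in> D" and e: "e \<in> topspace Q" "e \<notin> Q closure_of F"
      and ee: "{e, e'} = {a, b}" "e \<noteq> e'" for F z e e'
  proof -
    have "e \<notin> F" using F(1) quasi_sub[OF F(1)] ee by (auto simp: E_def)
    have 1: "e \<in> topspace Q - (Q closure_of F \<union> {e'})" using e ee(2) by blast
    have "e' \<in> topspace Q" using ee(1) a b by auto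
    then have "openin Q (topspace Q - (Q closure_of F \<union> {e'}))"
      using closedin_point by (intro openin_diff closedin_Un) auto
    then obtain U K where UK: "openin Q U" "closedin Q K" "e \<in> U" "U \<subseteq> K" "K \<subseteq> topspace Q - (Q closure_of F \<union> {e'})"
      using reg 1 unfolding neighbourhood_base_of_closedin[symmetric] neighbourhood_base_of by meson
    have "openin Q (topspace Q - (K - U))" using UK(1,2) by (intro openin_diff closedin_diff) auto
    moreover have FK: "F \<inter> K = {}"
    proof -
      have "F \<subseteq> topspace Q" using quasi_sub[OF F(1)] by (auto simp: E_def)
      then show ?thesis using closure_of_subset[of F Q] UK(5) by blast
    qed
    then have "F \<union> {a, b} \<subseteq> topspace Q - (K - U)"
      using quasi_sub[OF F(1)] a b UK(3,5) ee by (auto simp: E_def)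
    ultimately obtain C where C: "clop C" "F \<subseteq> C" "C \<subseteq> topspace Q - (K - U)"
      by (rule quasi_clop_nbhd[OF F(1)])
    have CD: "clop (C \<inter> D)" by (rule clop_Int[OF C(1) D])
    \<comment> \<open>\<open>C\<close> avoids \<open>K - U\<close>, so removing the closed
      \<open>K\<close> is the same as removing the open \<open>U\<close>.\<close>
    have "clop (C \<inter> D - K)"
      unfolding clop_def
    proof (intro conjI)
      show "C \<inter> D - K \<subseteq> E" using CD by (auto simp: clop_def)
      show "openin Q (C \<inter> D - K)" using CD UK(2) by (auto simp: clop_def)
      have "E - (C \<inter> D - K) = (E - C \<inter> D) \<union> (E \<inter> U)" using C(3) UK(4) CD by (auto simp: clop_def)
      then show "openin Q (E - (C \<inter> D - K))" using CD openin_E UK(1) by (auto simp: clop_def)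
    qed
    moreover have "z \<in> C \<inter> D - K" using F(2,3) C(2) FK by blast
    moreover have "C \<inter> D - K \<subseteq> D" "(C \<inter> D - K) \<inter> U = {}" using UK(4) by blast+
    ultimately show ?thesis using UK(1,3) by (intro exI[of _ "C \<inter> D - K"] exI[of _ U] conjI)
  qed
  define side where "side = (\<lambda>e C. \<exists>U. openin Q U \<and> e \<in> U \<and> C \<inter> U = {})"
  have "\<exists>C. clop C \<and> z \<in> C \<and> C \<subseteq> D \<and> (side a C \<or> side b C)" if z: "z \<in> D" for z
  proof -
    have zE: "z \<in> E" using z D by (auto simp: clop_def)
    obtain F where F: "F \<in> quasi_components_of (subtopology Q E)" "z \<in> F"
      by (rule topspace_imp_quasi_components_of[of z "subtopology Q E"]) (use zE E_top in auto)
    have "F \<notin> essential" using no F(2) z by blast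
    then have "a \<notin> Q closure_of F \<or> b \<notin> Q closure_of F" using F(1) by (auto simp: essential_def)
    then show ?thesis
    proof
      assume "a \<notin> Q closure_of F"
      from cut[OF F z a this, of b] show ?thesis using ab unfolding side_def by blast
    next
      assume "b \<notin> Q closure_of F"
      from cut[OF F z b this, of a] show ?thesis using ab unfolding side_def by (metis insert_commute)
    qed
  qed
  then obtain C where C: "\<And>z. z \<in> D \<Longrightarrow> clop (C z) \<and> z \<in> C z \<and> C z \<subseteq> D \<and> (side a (C z) \<or> side b (C z))" by metis
  \<comment> \<open>The part of \<open>D\<close> outside the chosen neighbourhoods of the two ends,
    which is compact.\<close>
  define B where "B = topspace Q - (Oa \<union> Ob \<union> (E - D))"
  have BD: "B \<subseteq> D" using O by (auto simp: B_def E_def)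
  have "closedin Q B" unfolding B_def using O D by (intro closedin_diff openin_Un) (auto simp: clop_def)
  then have "compactin Q B" by (rule closedin_compact_space[OF compact])
  moreover have "\<And>U. U \<in> C ` B \<Longrightarrow> openin Q U" using C BD by (auto simp: clop_def)
  moreover have "B \<subseteq> \<Union>(C ` B)" using C BD by blast
  ultimately obtain \<F> where "finite \<F>" "\<F> \<subseteq> C ` B" "B \<subseteq> \<Union>\<F>"
    unfolding compactin_def by meson
  then obtain J where J: "finite J" "J \<subseteq> B" "B \<subseteq> (\<Union>y\<in>J. C y)"
    by (metis finite_subset_image)
  define G where "G = (\<Union>y\<in>{y \<in> J. side b (C y)}. C y)"
  define G' where "G' = (\<Union>y\<in>{y \<in> J. side a (C y)}. C y)"
  have side_UN: "side e (\<Union>y\<in>K. C y)" if "finite K" "\<And>y. y \<in> K \<Longrightarrow> side e (C y)" "e \<in> topspace Q" for K e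
    using that
  proof (induction K rule: finite_induct)
    case empty
    then show ?case unfolding side_def by (intro exI[of _ "topspace Q"]) auto
  next
    case (insert y K)
    obtain U U' where "openin Q U" "e \<in> U" "C y \<inter> U = {}" "openin Q U'" "e \<in> U'" "(\<Union>y\<in>K. C y) \<inter> U' = {}"
      using insert unfolding side_def by (metis insertI1 insertI2)
    then show ?case unfolding side_def by (intro exI[of _ "U \<inter> U'"]) (auto intro: openin_Int)
  qed
  have "side b G" unfolding G_def using J(1) b by (intro side_UN) auto
  then obtain Hb where Hb: "openin Q Hb" "b \<in> Hb" "G \<inter> Hb = {}" unfolding side_def by blast
  have "side a G'" unfolding G'_def using J(1) a by (intro side_UN) auto
  then obtain Ha where Ha: "openin Q Ha" "a \<in> Ha" "G' \<inter> Ha = {}" unfolding side_def by blast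
  have JD: "J \<subseteq> D" using J(2) BD by blast
  have G: "clop G" "clop G'" "G \<subseteq> D" "G' \<subseteq> D"
    unfolding G_def G'_def using J(1) JD C by (auto intro!: clop_UN)
  have "(\<Union>y\<in>J. C y) \<subseteq> G \<union> G'" unfolding G_def G'_def using C JD by blast
  then have BG: "B \<subseteq> G \<union> G'" using J(3) by blast
  have R: "D - G - G' \<subseteq> Oa \<union> Ob"
  proof
    fix x assume x: "x \<in> D - G - G'"
    show "x \<in> Oa \<union> Ob"
    proof (rule ccontr)
      assume "x \<notin> Oa \<union> Ob"
      then have "x \<in> B" using x D by (auto simp: B_def clop_def E_def)
      then show False using BG x by blast
    qed
  qed
  have Rc: "clop (D - G - G')" "clop (G' - G)" using G D by (auto intro: clop_Diff)
  \<comment> \<open>\<open>G\<close> stays away from \<open>b\<close>, and so does anything in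
    \<open>Oa\<close>; hence adding \<open>a\<close> alone closes \<open>Da\<close>. Symmetrically
    \<open>b\<close> alone closes \<open>Db\<close>, where the overlap with \<open>G\<close> has
    been removed.\<close>
  define Da where "Da = G \<union> ((D - G - G') \<inter> Oa)"
  define Db where "Db = (G' - G) \<union> ((D - G - G') \<inter> Ob)"
  have opens: "openin Q Da" "openin Q Db" "openin Q (E - D)"
    unfolding Da_def Db_def using G Rc O D by (auto simp: clop_def)
  have DE: "D \<subseteq> E" using D by (simp add: clop_def)
  have un: "D = Da \<union> Db" unfolding Da_def Db_def using R G(3,4) by blast
  have dis: "Da \<inter> Db = {}" unfolding Da_def Db_def using O(5) by blast
  show thesis
  proof (rule that[OF un dis])
    have "topspace Q - (Da \<union> {a}) = Db \<union> (E - D) \<union> (Ob \<inter> Hb)"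
    proof
      show "topspace Q - (Da \<union> {a}) \<subseteq> Db \<union> (E - D) \<union> (Ob \<inter> Hb)" using un Hb(2) O(4) by (auto simp: E_def)
      have "Ob \<inter> Hb \<inter> Da = {}" unfolding Da_def using Hb(3) O(5) by blast
      moreover have "Ob \<inter> Hb \<subseteq> topspace Q" using openin_subset[OF O(2)] by blast
      moreover have "a \<notin> Ob" using O by blast
      moreover have "Db \<subseteq> E" "Da \<subseteq> D" using un DE by auto
      ultimately show "Db \<union> (E - D) \<union> (Ob \<inter> Hb) \<subseteq> topspace Q - (Da \<union> {a})" using dis by (auto simp: E_def)
    qed
    then have "openin Q (topspace Q - (Da \<union> {a}))" using opens O(2) Hb(1) by (auto intro: openin_Un openin_Int)
    then show "closedin Q (Da \<union> {a})" using un DE a by (auto simp: closedin_def E_def)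
    have "topspace Q - (Db \<union> {b}) = Da \<union> (E - D) \<union> (Oa \<inter> Ha)"
    proof
      show "topspace Q - (Db \<union> {b}) \<subseteq> Da \<union> (E - D) \<union> (Oa \<inter> Ha)" using un Ha(2) O(3) by (auto simp: E_def)
      have "Oa \<inter> Ha \<inter> Db = {}" unfolding Db_def using Ha(3) O(5) by blast
      moreover have "Oa \<inter> Ha \<subseteq> topspace Q" using openin_subset[OF O(1)] by blast
      moreover have "b \<notin> Oa" using O by blast
      moreover have "Da \<subseteq> E" "Db \<subseteq> D" using un DE by auto
      ultimately show "Da \<union> (E - D) \<union> (Oa \<inter> Ha) \<subseteq> topspace Q - (Db \<union> {b})" using dis by (auto simp: E_def)
    qed
    then have "openin Q (topspace Q - (Db \<union> {b}))" using opens O(1) Ha(1) by (auto intro: openin_Un openin_Int)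
    then show "closedin Q (Db \<union> {b})" using un DE b by (auto simp: closedin_def E_def)
  qed
qed

end

lemma funpow_inverse:
  assumes "\<And>x. x \<in> A \<Longrightarrow> h' x \<in> A" "\<And>x. x \<in> A \<Longrightarrow> h (h' x) = x" "x \<in> A"
  shows "(h ^^ n) ((h' ^^ n) x) = x" "(h' ^^ n) x \<in> A"
proof -
  have "(h' ^^ n) x \<in> A \<and> (h ^^ n) ((h' ^^ n) x) = x"
  proof (induction n)
    case (Suc n)
    have "(h ^^ Suc n) ((h' ^^ Suc n) x) = (h ^^ n) (h (h' ((h' ^^ n) x)))"
      by (simp only: funpow_Suc_right funpow.simps comp_def) (simp add: funpow_swap1)
    then show ?case using Suc assms by simp
  qed (simp add: assms)
  then show "(h ^^ n) ((h' ^^ n) x) = x" "(h' ^^ n) x \<in> A" by auto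
qed

section \<open>Homeomorphisms fixing the two ends\<close>

context two_ends
begin

text \<open>The inverse is explicit data, so that forward and backward iteration can be
  exchanged.\<close>

definition end_homeo :: "('z \<Rightarrow> 'z) \<Rightarrow> ('z \<Rightarrow> 'z) \<Rightarrow> bool" where
  "end_homeo h h' \<longleftrightarrow> continuous_map Q Q h \<and> continuous_map Q Q h' \<and>
     (\<forall>x\<in>topspace Q. h' (h x) = x \<and> h (h' x) = x) \<and> h a = a \<and> h b = b"

lemma end_homeo_sym: "end_homeo h h' \<Longrightarrow> end_homeo h' h"
  using a b unfolding end_homeo_def by metis

context
  fixes h h' assumes h: "end_homeo h h'"
begin

lemma end_homeo_top: "x \<in> topspace Q \<Longrightarrow> h x \<in> topspace Q"
  using h by (auto simp: end_homeo_def continuous_map_def Pi_iff)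

lemma end_homeo_inv: "x \<in> topspace Q \<Longrightarrow> h' (h x) = x" "x \<in> topspace Q \<Longrightarrow> h (h' x) = x"
  using h by (auto simp: end_homeo_def)

lemma end_homeo_ends: "h a = a" "h b = b" "h' a = a" "h' b = b"
  using h a b unfolding end_homeo_def by metis+

lemma end_homeo_E: "x \<in> E \<Longrightarrow> h x \<in> E"
  using end_homeo_top[of x] end_homeo_inv[of x] end_homeo_ends by (auto simp: E_def)

lemma end_homeo_continuous: "continuous_map Q Q h"
  using h by (simp add: end_homeo_def)

lemma clop_preimage:
  assumes "clop T"
  shows "clop {x \<in> E. h x \<in> T}"
proof -
  have *: "openin Q {x \<in> topspace Q. h x \<in> U}" if "openin Q U" for U
    using that h by (auto simp: end_homeo_def continuous_map_def)
  have "{x \<in> E. h x \<in> T} = E \<inter> {x \<in> topspace Q. h x \<in> T}" by (auto simp: E_def)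
  moreover have "E - {x \<in> E. h x \<in> T} = E \<inter> {x \<in> topspace Q. h x \<in> E - T}"
    using end_homeo_E by (auto simp: E_def)
  ultimately show ?thesis
    using *[of T] *[of "E - T"] assms openin_E unfolding clop_def by (metis (no_types, lifting) Int_lower1 openin_Int)
qed

end

text \<open>Clopen subsets of \<open>E\<close> pull back under \<open>h\<close> and under
  \<open>h'\<close>, so both preserve the relation that defines quasicomponents. Continuity and the
  fixed ends take care of the closures.\<close>

lemma essential_image:
  assumes h: "end_homeo h h'" and F: "F \<in> essential"
  shows "h ` F \<in> essential"
proof -
  have h': "end_homeo h' h" by (rule end_homeo_sym[OF h])
  have q: "quasi_component_of (subtopology Q E) x y \<longleftrightarrow> x \<in> E \<and> y \<in> E \<and> (\<forall>T. clop T \<longrightarrow> (x \<in> T \<longleftrightarrow> y \<in> T))" for x y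
    unfolding quasi_component_of_def clop_iff E_top by blast
  obtain x where x: "x \<in> E" "F = Collect (quasi_component_of (subtopology Q E) x)"
    using essential_quasi[OF F] unfolding quasi_components_of_def E_top by blast
  have step: "quasi_component_of (subtopology Q E) (k u) (k v)"
    if k: "end_homeo k k'" and uv: "quasi_component_of (subtopology Q E) u v" for k k' u v
  proof -
    have "u \<in> E" "v \<in> E" using uv q by auto
    moreover have "k u \<in> T \<longleftrightarrow> k v \<in> T" if "clop T" for T
      using clop_preimage[OF k that] uv \<open>u \<in> E\<close> \<open>v \<in> E\<close> unfolding q by blast
    ultimately show ?thesis using end_homeo_E[OF k] unfolding q by blast
  qed
  have ET: "y \<in> E \<Longrightarrow> y \<in> topspace Q" for y by (simp add: E_def)
  have "h ` F = Collect (quasi_component_of (subtopology Q E) (h x))"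
  proof
    show "h ` F \<subseteq> Collect (quasi_component_of (subtopology Q E) (h x))" using step[OF h] x(2) by blast
    show "Collect (quasi_component_of (subtopology Q E) (h x)) \<subseteq> h ` F"
    proof
      fix y assume "y \<in> Collect (quasi_component_of (subtopology Q E) (h x))"
      then have y: "quasi_component_of (subtopology Q E) (h x) y" by simp
      then have "quasi_component_of (subtopology Q E) (h' (h x)) (h' y)" by (rule step[OF h'])
      then have "h' y \<in> F" using x end_homeo_inv(1)[OF h ET[OF x(1)]] by simp
      moreover have "y \<in> E" using y q by blast
      then have "y = h (h' y)" using end_homeo_inv(2)[OF h ET] by metis
      ultimately show "y \<in> h ` F" by blast
    qed
  qed
  then have "h ` F \<in> quasi_components_of (subtopology Q E)"
    using end_homeo_E[OF h x(1)] unfolding quasi_components_of_def E_top by blast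
  moreover have "h ` (Q closure_of F) \<subseteq> Q closure_of (h ` F)"
    using end_homeo_continuous[OF h] by (rule continuous_map_image_closure_subset)
  then have "a \<in> Q closure_of (h ` F)" "b \<in> Q closure_of (h ` F)"
    using F end_homeo_ends[OF h] unfolding essential_def by (metis (mono_tags, lifting) image_eqI mem_Collect_eq subsetD)+
  ultimately show ?thesis by (simp add: essential_def)
qed

text \<open>The kernel of the restriction to the closures of the essential quasicomponents, on the
  level of cocycles.\<close>

definition vanishing :: "nat \<Rightarrow> ('z list \<Rightarrow> 'k::field) set" where
  "vanishing q = {\<phi> \<in> Zc Q {} q. \<forall>F\<in>essential. \<phi> \<in> Bd (subtopology Q (F \<union> {a, b})) {} q}"

lemma subspace_vanishing: "fvs.subspace (vanishing q :: ('z list \<Rightarrow> 'k::field) set)"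
proof (rule fvs.subspaceI)
  show "0 \<in> vanishing q"
    unfolding vanishing_def using fvs.subspace_0[OF subspace_Zc] fvs.subspace_0[OF subspace_Bd] by blast
  show "x + y \<in> vanishing q" if "x \<in> vanishing q" "y \<in> vanishing q" for x y :: "'z list \<Rightarrow> 'k"
    using that unfolding vanishing_def using fvs.subspace_add[OF subspace_Zc] fvs.subspace_add[OF subspace_Bd] by blast
  show "c *s x \<in> vanishing q" if "x \<in> vanishing q" for c and x :: "'z list \<Rightarrow> 'k"
    using that unfolding vanishing_def using fvs.subspace_scale[OF subspace_Zc] fvs.subspace_scale[OF subspace_Bd] by blast
qed

lemma vanishing_map:
  assumes h: "end_homeo h h'" and \<phi>: "\<phi> \<in> vanishing q"
  shows "(\<lambda>xs. \<phi> (map h xs)) \<in> vanishing q"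
  unfolding vanishing_def
proof (intro CollectI conjI ballI)
  show "(\<lambda>xs. \<phi> (map h xs)) \<in> Zc Q {} q"
    using \<phi> by (intro Zc_map[OF end_homeo_continuous[OF h]]) (auto simp: vanishing_def)
  fix F assume F: "F \<in> essential"
  have "\<phi> \<in> Bd (subtopology Q (h ` F \<union> {a, b})) {} q"
    using \<phi> essential_image[OF h F] by (simp add: vanishing_def)
  moreover have "continuous_map (subtopology Q (F \<union> {a, b})) (subtopology Q (h ` F \<union> {a, b})) h"
    using end_homeo_continuous[OF h] end_homeo_ends[OF h]
    by (intro continuous_map_into_subtopology continuous_map_from_subtopology) auto
  ultimately show "(\<lambda>xs. \<phi> (map h xs)) \<in> Bd (subtopology Q (F \<union> {a, b})) {} q"
    by (intro Bd_map) auto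
qed

lemma vanishing_funpow:
  assumes h: "end_homeo h h'" and \<phi>: "\<phi> \<in> vanishing q"
  shows "(\<lambda>xs. \<phi> (map (h ^^ n) xs)) \<in> vanishing q"
proof (induction n)
  case (Suc n)
  have "(\<lambda>xs. \<phi> (map (h ^^ Suc n) xs)) = (\<lambda>xs. \<phi> (map (h ^^ n) (map h xs)))"
    by (simp only: funpow_Suc_right map_map)
  then show ?case using vanishing_map[OF h Suc] by (simp only:)
qed (simp add: \<phi>)

text \<open>If the iterates of \<open>h'\<close> shrink \<open>P\<close> into any neighbourhood of a fixed point \<open>c\<close>, then the finitely
  many classes spanning the \<open>h\<close>-invariant space of vanishing classes die simultaneously on some
  iterate of \<open>P\<close>, hence on \<open>P\<close>.\<close>

lemma vanishing_on_shrinking: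
  fixes u :: "'z list \<Rightarrow> 'k::field" and S :: "('z list \<Rightarrow> 'k) set"
  assumes h: "end_homeo h h'" and P: "closedin Q P" and c: "c \<in> topspace Q"
    and shrink: "\<And>V. openin Q V \<Longrightarrow> c \<in> V \<Longrightarrow> \<exists>n. (h' ^^ n) ` P \<subseteq> V"
    and S: "finite S" "S \<subseteq> Zc Q {} (Suc p)" "vanishing (Suc p) \<subseteq> fvs.span (S \<union> Bd Q {} (Suc p))"
    and u: "u \<in> vanishing (Suc p)"
  shows "u \<in> Bd (subtopology Q P) {} (Suc p)"
proof -
  have "\<exists>V. openin Q V \<and> c \<in> V \<and>
      (\<forall>xs. set xs \<subseteq> V \<longrightarrow> length xs = Suc (Suc p) \<longrightarrow> s xs = cob (\<lambda>ys. s (c # ys)) xs)" if s: "s \<in> S" for s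
  proof -
    have "eventually (\<lambda>xs. length xs = Suc (Suc (Suc p)) \<longrightarrow> cob s xs = 0) (smalls Q)"
      using S(2) s by (auto simp: Zc_def)
    then show ?thesis using c by (rule cone_at_point) blast
  qed
  then obtain V where V: "\<And>s. s \<in> S \<Longrightarrow> openin Q (V s) \<and> c \<in> V s"
    "\<And>s xs. s \<in> S \<Longrightarrow> set xs \<subseteq> V s \<Longrightarrow> length xs = Suc (Suc p) \<Longrightarrow> s xs = cob (\<lambda>ys. s (c # ys)) xs"
    by metis
  let ?V = "topspace Q \<inter> (\<Inter>s\<in>S. V s)"
  have "openin Q ?V" using S(1) V(1) by (cases "S = {}") (auto intro!: openin_Int openin_INT2)
  moreover have "c \<in> ?V" using V(1) c by auto
  ultimately have "\<exists>n. (h' ^^ n) ` P \<subseteq> ?V" by (rule shrink)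
  then obtain n where n: "(h' ^^ n) ` P \<subseteq> ?V" by (elim exE)
  define C where "C = (h' ^^ n) ` P"
  have cont: "continuous_map Q Q (h' ^^ n)"
    by (induction n) (use end_homeo_continuous[OF end_homeo_sym[OF h]] in
        \<open>auto intro: continuous_map_compose[unfolded comp_def]\<close>)
  have C: "closedin Q C"
    using continuous_imp_closed_map[OF cont compact Hausdorff] P unfolding C_def closed_map_def by blast
  have SC: "S \<subseteq> Bd (subtopology Q C) {} (Suc p)"
  proof
    fix s assume s: "s \<in> S"
    show "s \<in> Bd (subtopology Q C) {} (Suc p)"
      unfolding Bd_subtopology[OF C]
    proof (intro exI[of _ "\<lambda>ys. s (c # ys)"] conjI impI)
      show "eventually (\<lambda>xs. set xs \<subseteq> C \<longrightarrow> length xs = Suc p \<longrightarrow> set xs \<subseteq> {} \<longrightarrow> s (c # xs) = 0) (smalls Q)"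
        using eventually_smalls_topspace[of Q] by (rule eventually_mono) auto
      have "C \<subseteq> V s" using n s unfolding C_def by blast
      then show "eventually (\<lambda>xs. set xs \<subseteq> C \<longrightarrow> length xs = Suc (Suc p) \<longrightarrow> s xs = cob (\<lambda>ys. s (c # ys)) xs) (smalls Q)"
        using V(2)[OF s] by (intro always_eventually) blast
    qed simp
  qed
  have "S \<union> Bd Q {} (Suc p) \<subseteq> Bd (subtopology Q C) {} (Suc p)" using SC Bd_restrict by blast
  then have "fvs.span (S \<union> Bd Q {} (Suc p)) \<subseteq> Bd (subtopology Q C) {} (Suc p)"
    by (intro fvs.span_minimal subspace_Bd)
  \<comment> \<open>The pull-back of \<open>u\<close> under \<open>h ^^ n\<close> is again
    vanishing, hence a combination of the generators, all of which bound on \<open>C\<close>.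
    Pulling back once more along the map from \<open>P\<close> to \<open>C\<close> recovers
    \<open>u\<close>.\<close>
  then have v: "(\<lambda>xs. u (map (h ^^ n) xs)) \<in> Bd (subtopology Q C) {} (Suc p)"
    by (rule subsetD[OF _ subsetD[OF S(3) vanishing_funpow[OF h u]]])
  have "continuous_map (subtopology Q P) (subtopology Q C) (h' ^^ n)"
    using cont by (intro continuous_map_into_subtopology continuous_map_from_subtopology) (auto simp: C_def)
  then have 1: "(\<lambda>xs. u (map (h ^^ n) (map (h' ^^ n) xs))) \<in> Bd (subtopology Q P) {} (Suc p)"
    using Bd_map[OF _ _ v, of "subtopology Q P" "h' ^^ n" "{}"] by auto
  have "eventually (\<lambda>xs. length xs = Suc (Suc p) \<longrightarrow> u xs = u (map (h ^^ n) (map (h' ^^ n) xs))) (smalls (subtopology Q P))"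
    using eventually_smalls_topspace
  proof (rule eventually_mono, intro impI)
    fix xs assume "xs \<noteq> [] \<and> set xs \<subseteq> topspace (subtopology Q P)"
    then have "map (h ^^ n) (map (h' ^^ n) xs) = map (\<lambda>x. x) xs"
      unfolding map_map comp_def
      using funpow_inverse(1)[of "topspace Q" h' h] end_homeo_top[OF end_homeo_sym[OF h]] end_homeo_inv(2)[OF h]
      by (intro map_cong) auto
    then show "u xs = u (map (h ^^ n) (map (h' ^^ n) xs))" by simp
  qed
  then have 2: "u - (\<lambda>xs. u (map (h ^^ n) (map (h' ^^ n) xs))) \<in> Bd (subtopology Q P) {} (Suc p)"
    by (rule small_eq_imp_Bd)
  show ?thesis using fvs.subspace_add[OF subspace_Bd 2 1] by simp
qed

lemma vanishing_is_trivial: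
  fixes u :: "'z list \<Rightarrow> 'k::field"
  assumes g: "end_homeo g g'"
    and attract: "\<And>K V. closedin Q K \<Longrightarrow> a \<notin> K \<Longrightarrow> openin Q V \<Longrightarrow> b \<in> V \<Longrightarrow> \<exists>n. (g ^^ n) ` K \<subseteq> V"
    and repel: "\<And>K V. closedin Q K \<Longrightarrow> b \<notin> K \<Longrightarrow> openin Q V \<Longrightarrow> a \<in> V \<Longrightarrow> \<exists>n. (g' ^^ n) ` K \<subseteq> V"
    and fin: "finite essential"
    and fd: "finite_over (Bd Q {} (Suc (Suc p))) (Zc Q {} (Suc (Suc p)) :: ('z list \<Rightarrow> 'k) set)"
    and u: "u \<in> vanishing (Suc (Suc p))"
  shows "u \<in> Bd Q {} (Suc (Suc p))"
proof -
  let ?q = "Suc (Suc p)"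
  have KZ: "(vanishing ?q :: ('z list \<Rightarrow> 'k) set) \<subseteq> Zc Q {} ?q" by (auto simp: vanishing_def)
  have "finite_over (Bd Q {} ?q) (vanishing ?q :: ('z list \<Rightarrow> 'k) set)"
    using fd by (rule finite_over_mono) (use KZ in auto)
  then obtain S where S: "finite S" "S \<subseteq> vanishing ?q" "vanishing ?q \<subseteq> fvs.span (S \<union> Bd Q {} ?q :: ('z list \<Rightarrow> 'k) set)"
    by (rule finite_over_basis[OF _ subspace_vanishing])
  have SZ: "S \<subseteq> Zc Q {} ?q" using S(2) KZ by blast
  have "\<exists>V. openin Q V \<and> F \<union> {a, b} \<subseteq> V \<and> (\<forall>C. closedin Q C \<longrightarrow> C \<subseteq> V \<longrightarrow> s \<in> Bd (subtopology Q C) {} ?q)"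
    if "F \<in> essential" "s \<in> S" for F s
    by (rule Bd_near[OF compact Hausdorff quasi_closed[OF essential_quasi[OF that(1)]], of s ?q])
      (use S(2) that in \<open>auto simp: vanishing_def\<close>)
  then obtain V where V: "\<And>F s. F \<in> essential \<Longrightarrow> s \<in> S \<Longrightarrow> openin Q (V F s) \<and> F \<union> {a, b} \<subseteq> V F s"
    "\<And>F s C. F \<in> essential \<Longrightarrow> s \<in> S \<Longrightarrow> closedin Q C \<Longrightarrow> C \<subseteq> V F s \<Longrightarrow> s \<in> Bd (subtopology Q C) {} ?q"
    by metis
  \<comment> \<open>One neighbourhood of \<open>F\<close> for all generators; intersecting with the
    space covers the case that there are none.\<close>
  define VF where "VF = (\<lambda>F. topspace Q \<inter> (\<Inter>s\<in>S. V F s))"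
  have FT: "F \<union> {a, b} \<subseteq> topspace Q" if "F \<in> essential" for F
    using quasi_sub[OF essential_quasi[OF that]] a b by (auto simp: E_def)
  have VF: "openin Q (VF F)" "F \<union> {a, b} \<subseteq> VF F" if F: "F \<in> essential" for F
  proof -
    show "openin Q (VF F)" unfolding VF_def using S(1) V(1)[OF F] by (cases "S = {}") (auto intro!: openin_Int openin_INT2)
    show "F \<union> {a, b} \<subseteq> VF F" unfolding VF_def using V(1)[OF F] FT[OF F] by blast
  qed
  obtain C where C: "\<And>F. F \<in> essential \<Longrightarrow> clop (C F)" "\<And>F. F \<in> essential \<Longrightarrow> F \<subseteq> C F"
    "\<And>F. F \<in> essential \<Longrightarrow> C F \<subseteq> VF F"
    "\<And>F F'. F \<in> essential \<Longrightarrow> F' \<in> essential \<Longrightarrow> F \<noteq> F' \<Longrightarrow> C F \<inter> C F' = {}"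
    by (rule disjoint_clop_nbhds[OF fin order.refl, of VF]) (use VF in auto)
  have uC: "u \<in> Bd (subtopology Q (C F \<union> {a, b})) {} ?q" if F: "F \<in> essential" for F
  proof -
    have cl: "closedin Q (C F \<union> {a, b})" by (rule clop_closure[OF C(1)[OF F]])
    have "C F \<union> {a, b} \<subseteq> V F s" if "s \<in> S" for s
      using C(3)[OF F] VF(2)[OF F] that unfolding VF_def by blast
    then have "S \<subseteq> Bd (subtopology Q (C F \<union> {a, b})) {} ?q" using V(2)[OF F _ cl] by blast
    then have "S \<union> Bd Q {} ?q \<subseteq> Bd (subtopology Q (C F \<union> {a, b})) {} ?q" using Bd_restrict by blast
    then have "fvs.span (S \<union> Bd Q {} ?q) \<subseteq> Bd (subtopology Q (C F \<union> {a, b})) {} ?q"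
      by (intro fvs.span_minimal subspace_Bd)
    then show ?thesis using S(3) u by blast
  qed
  define D where "D = E - (\<Union>F\<in>essential. C F)"
  have D: "clop D" unfolding D_def using fin C(1) by (intro clop_Diff clop_E clop_UN) auto
  have "F \<inter> D = {}" if "F \<in> essential" for F using C(2)[OF that] that unfolding D_def by blast
  then obtain Da Db where Dab: "D = Da \<union> Db" "Da \<inter> Db = {}" "closedin Q (Da \<union> {a})" "closedin Q (Db \<union> {b})"
    by (rule split_inessential[OF D])
  have ends: "a \<notin> Db" "b \<notin> Da" using Dab(1) D by (auto simp: clop_def E_def)
  \<comment> \<open>\<open>Da\<close> with \<open>a\<close> misses \<open>b\<close>, so iterates of
    \<open>g'\<close> shrink it to \<open>a\<close>. For \<open>Db\<close> the roles of
    \<open>g\<close> and \<open>g'\<close> are exchanged.\<close>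
  have uDa: "u \<in> Bd (subtopology Q (Da \<union> {a})) {} ?q"
    by (rule vanishing_on_shrinking[OF g Dab(3) a _ S(1) SZ S(3) u])
      (rule repel[OF Dab(3)], use ends ab in auto)
  have uDb: "u \<in> Bd (subtopology Q (Db \<union> {b})) {} ?q"
    by (rule vanishing_on_shrinking[OF end_homeo_sym[OF g] Dab(4) b _ S(1) SZ S(3) u])
      (rule attract[OF Dab(4)], use ends ab in auto)
  obtain \<psi>a where \<psi>a: "eventually (\<lambda>xs. set xs \<subseteq> Da \<union> {a} \<longrightarrow> length xs = Suc ?q \<longrightarrow> u xs = cob \<psi>a xs) (smalls Q)"
    using uDa unfolding Bd_subtopology[OF Dab(3)] by blast
  obtain \<psi>b where \<psi>b: "eventually (\<lambda>xs. set xs \<subseteq> Db \<union> {b} \<longrightarrow> length xs = Suc ?q \<longrightarrow> u xs = cob \<psi>b xs) (smalls Q)"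
    using uDb unfolding Bd_subtopology[OF Dab(4)] by blast
  have Dcl: "closedin Q (D \<union> {a, b})" by (rule clop_closure[OF D])
  \<comment> \<open>The two closed parts are disjoint, so a small list in their union lies in one of
    them and the two primitives combine without correction.\<close>
  have "open_cover Q {topspace Q - (Da \<union> {a}), topspace Q - (Db \<union> {b})}"
    using Dab(2-4) ends ab by (auto simp: open_cover_def)
  then have "eventually (\<lambda>xs. set xs \<inter> (Da \<union> {a}) = {} \<or> set xs \<inter> (Db \<union> {b}) = {}) (smalls Q)"
    unfolding eventually_smalls by (intro exI[of _ "{topspace Q - (Da \<union> {a}), topspace Q - (Db \<union> {b})}"]) auto
  then have side: "eventually (\<lambda>xs. xs \<noteq> [] \<and> (set xs \<subseteq> D \<union> {a, b} \<longrightarrow> set xs \<subseteq> Da \<union> {a} \<or> set xs \<subseteq> Db \<union> {b})) (smalls Q)"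
    using eventually_smalls_topspace by (rule eventually_elim2) (use Dab(1) in auto)
  define \<psi> where "\<psi> = (\<lambda>xs. if set xs \<subseteq> Da \<union> {a} then \<psi>a xs else \<psi>b xs)"
  have "eventually (\<lambda>xs. set xs \<subseteq> D \<union> {a, b} \<longrightarrow> length xs = Suc ?q \<longrightarrow> u xs = cob \<psi> xs) (smalls Q)"
    using eventually_conj[OF side eventually_conj[OF \<psi>a \<psi>b]]
  proof (rule eventually_mono, intro impI, elim conjE)
    fix xs assume side: "set xs \<subseteq> D \<union> {a, b} \<longrightarrow> set xs \<subseteq> Da \<union> {a} \<or> set xs \<subseteq> Db \<union> {b}"
      and e: "set xs \<subseteq> Da \<union> {a} \<longrightarrow> length xs = Suc ?q \<longrightarrow> u xs = cob \<psi>a xs"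
      "set xs \<subseteq> Db \<union> {b} \<longrightarrow> length xs = Suc ?q \<longrightarrow> u xs = cob \<psi>b xs"
      and xs: "set xs \<subseteq> D \<union> {a, b}" "length xs = Suc ?q"
    show "u xs = cob \<psi> xs"
    proof (cases "set xs \<subseteq> Da \<union> {a}")
      case True
      have "cob \<psi> xs = cob \<psi>a xs" by (rule cob_cong) (use True in \<open>auto simp: \<psi>_def\<close>)
      then show ?thesis using e(1) True xs(2) by simp
    next
      case False
      then have b: "set xs \<subseteq> Db \<union> {b}" using side xs(1) by blast
      have "cob \<psi> xs = cob \<psi>b xs"
      proof (rule cob_cong)
        fix ys assume ys: "set ys \<subseteq> set xs" "length xs = Suc (length ys)"
        then have "ys \<noteq> []" using xs(2) by auto
        then have "\<not> set ys \<subseteq> Da \<union> {a}" using ys(1) b Dab(2) ends ab by (cases ys) auto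
        then show "\<psi> ys = \<psi>b ys" by (simp add: \<psi>_def)
      qed
      then show ?thesis using e(2) b xs(2) by simp
    qed
  qed
  moreover have "eventually (\<lambda>xs. set xs \<subseteq> D \<union> {a, b} \<longrightarrow> length xs = ?q \<longrightarrow> set xs \<subseteq> {} \<longrightarrow> \<psi> xs = 0) (smalls Q)"
    using eventually_smalls_topspace[of Q] by (rule eventually_mono) auto
  ultimately have uD: "u \<in> Bd (subtopology Q (D \<union> {a, b})) {} ?q"
    unfolding Bd_subtopology[OF Dcl] by (intro exI[of _ \<psi>]) simp
  \<comment> \<open>The index \<open>None\<close> stands for the inessential rest.\<close>
  define CC where "CC = (\<lambda>i. case i of None \<Rightarrow> D | Some F \<Rightarrow> C F)"
  show ?thesis
  proof (rule Bd_glue[of u p "insert None (Some ` essential)" CC])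
    show "u \<in> Zc Q {} ?q" using u KZ by blast
    show "finite (insert None (Some ` essential))" using fin by simp
    show "clop (CC i)" if "i \<in> insert None (Some ` essential)" for i
      using that D C(1) by (auto simp: CC_def)
    show "CC i \<inter> CC j = {}" if "i \<in> insert None (Some ` essential)" "j \<in> insert None (Some ` essential)" "i \<noteq> j" for i j
    proof -
      have DC: "D \<inter> C F = {}" if "F \<in> essential" for F using that by (auto simp: D_def)
      show ?thesis using that DC C(4) by (cases i; cases j) (simp_all add: CC_def Int_commute image_iff)
    qed
    have "(\<Union>F\<in>essential. C F) \<subseteq> E" using C(1) by (auto simp: clop_def)
    then show "(\<Union>i\<in>insert None (Some ` essential). CC i) = E" by (auto simp: CC_def D_def)
    show "u \<in> Bd (subtopology Q (CC i \<union> {a, b})) {} ?q" if "i \<in> insert None (Some ` essential)" for i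
      using that uD uC by (auto simp: CC_def)
  qed
qed

end

section \<open>Dynamics on the compactified unstable manifold\<close>

text \<open>Compactness of the space of two-sided sequences: finitely many orbit equations around
  index 0 are solved by a long enough orbit segment.\<close>

lemma full_orbit_exists:
  assumes M: "Hausdorff_space M" and K: "compactin M K" and f: "continuous_map (subtopology M K) M f"
    and orb: "\<And>n. \<exists>q\<in>K. \<forall>i\<le>n. (f ^^ i) q \<in> K"
  shows "inv_part f K \<noteq> {}"
proof -
  let ?P = "product_topology (\<lambda>_::int. subtopology M K) UNIV"
  have KM: "K \<subseteq> topspace M" by (rule compactin_subset_topspace[OF K])
  have cP: "compact_space ?P" using K by (simp add: compact_space_product_topology compact_space_subtopology)
  have pr: "continuous_map ?P (subtopology M K) (\<lambda>p. p k)" for k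
    by (rule continuous_map_product_projection) simp
  have pr': "continuous_map ?P M (\<lambda>p. p k)" for k
    using pr[of k] by (simp add: continuous_map_in_subtopology)
  have eq: "closedin ?P {p \<in> topspace ?P. f (p i) = p (i + 1)}" for i
    by (rule closedin_continuous_maps_eq[OF M continuous_map_compose[OF pr f, unfolded comp_def] pr'])
  define S where "S = (\<lambda>m::nat. {p \<in> topspace ?P. \<forall>i\<in>{- int m..<int m}. f (p i) = p (i + 1)})"
  have cl: "closedin ?P {p \<in> topspace ?P. \<forall>i\<in>J. f (p i) = p (i + 1)}" if "finite J" for J
    using that
  proof (induction J rule: finite_induct)
    case (insert j J)
    have "{p \<in> topspace ?P. \<forall>i\<in>insert j J. f (p i) = p (i + 1)} =
      {p \<in> topspace ?P. \<forall>i\<in>J. f (p i) = p (i + 1)} \<inter> {p \<in> topspace ?P. f (p j) = p (j + 1)}" by blast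
    then show ?case using insert.IH eq[of j] by (simp only: closedin_Int)
  next
    case empty
    have "{p \<in> topspace ?P. \<forall>i\<in>{}. f (p i) = p (i + 1)} = topspace ?P" by blast
    then show ?case by (simp only: closedin_topspace)
  qed
  have ne: "S m \<noteq> {}" for m
  proof -
    obtain q where q: "q \<in> K" "\<forall>i\<le>2 * m. (f ^^ i) q \<in> K" using orb by blast
    \<comment> \<open>A segment of length 2m is recentred at 0. Outside the window the constant
      \<open>q\<close> is a filler, as no equation is imposed there.\<close>
    define p where "p = (\<lambda>i::int. if - int m \<le> i \<and> i \<le> int m then (f ^^ nat (i + int m)) q else q)"
    have "p i \<in> K" for i using q by (auto simp: p_def nat_le_iff)
    moreover have "f (p i) = p (i + 1)" if "i \<in> {- int m..<int m}" for i
    proof -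
      have "nat (i + 1 + int m) = Suc (nat (i + int m))" using that by auto
      then show ?thesis using that by (simp add: p_def)
    qed
    ultimately have "p \<in> S m" using KM by (auto simp: S_def PiE_iff)
    then show ?thesis by blast
  qed
  have "decseq S"
    unfolding decseq_def S_def by (intro allI impI subsetI CollectI conjI) auto
  then have "(\<Inter>m. S m) \<noteq> {}"
    using compact_space_imp_nest[OF cP] cl ne unfolding S_def by simp
  then obtain p where p: "\<And>m. p \<in> S m" by blast
  have "p i \<in> K" for i using p[of 0] by (auto simp: S_def PiE_iff)
  moreover have "f (p i) = p (i + 1)" for i
  proof -
    have "i \<in> {- int (Suc (nat \<bar>i\<bar>))..<int (Suc (nat \<bar>i\<bar>))}" by auto
    then show ?thesis using p[of "Suc (nat \<bar>i\<bar>)"] unfolding S_def by blast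
  qed
  ultimately have "p 0 \<in> inv_part f K" unfolding inv_part_def by blast
  then show ?thesis by blast
qed

locale index_system =
  fixes M :: "'a topology" and D :: "'a set" and f :: "'a \<Rightarrow> 'a" and X N L :: "'a set"
  assumes Hausdorff_M: "Hausdorff_space M" and map: "openin M D" "continuous_map (subtopology M D) M f"
    and X: "isolated_invariant_set M D f X" and pair: "index_pair M D f X N L"
begin

definition "A = M closure_of (N - L)"
definition "TN = subtopology M N"
definition "Y = index_space M N L"
definition "h = index_map f N L"
definition "W = unstable_space M f N L"
definition "\<sigma> = unstable_shift f N L"
definition "X' = unstable_core M f N L X"
text \<open>Forgetting the first coordinate inverts the shift.\<close>

definition "\<tau> \<xi> = (\<lambda>i::nat. (\<xi> (Suc i) :: 'a option))"

abbreviation "infty \<equiv> unstable_infinity :: nat \<Rightarrow> 'a option"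

lemma N: "compactin M N" "closedin M N" "N \<subseteq> D" "N \<subseteq> topspace M"
  and L: "compactin M L" "closedin M L" "L \<subseteq> N"
  using pair compactin_imp_closedin[OF Hausdorff_M] compactin_subset_topspace unfolding index_pair_def by auto

lemma fNL: "x \<in> N - L \<Longrightarrow> f x \<in> N" and fL: "x \<in> L \<Longrightarrow> f x \<in> N \<Longrightarrow> f x \<in> L"
  using pair unfolding index_pair_def by auto

lemma A: "compactin M A" "A \<subseteq> N" "X = inv_part f A" "N - L \<subseteq> A" "closedin M A"
proof -
  show "compactin M A" "X = inv_part f A" using pair unfolding index_pair_def isolating_neighbourhood_def A_def by auto
  show "A \<subseteq> N" unfolding A_def by (rule closure_of_minimal) (use N in auto)
  show "N - L \<subseteq> A" unfolding A_def by (rule closure_of_subset) (use N in auto)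
  show "closedin M A" by (simp add: A_def)
qed

lemma X_facts: "compactin M X" "f ` X = X" "X \<inter> L = {}" "X \<subseteq> N" "X \<subseteq> M interior_of A"
proof -
  show "compactin M X" "f ` X = X" using X unfolding isolated_invariant_set_def by auto
  show "X \<inter> L = {}" "X \<subseteq> M interior_of A"
    using pair unfolding index_pair_def isolating_neighbourhood_def A_def by auto
  have "X \<subseteq> A" unfolding A(3) inv_part_def by blast
  then show "X \<subseteq> N" using A(2) by blast
qed

lemma core_nbhd: "openin M (M interior_of A - L)" "X \<subseteq> M interior_of A - L" "M interior_of A - L \<subseteq> N - L"
  using L(2) X_facts(3,5) interior_of_subset[of M A] A(2) by (auto intro: openin_diff)

lemma TN: "topspace TN = N" "compact_space TN" "Hausdorff_space TN" "closedin TN L"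
  using N L Hausdorff_M by (auto simp: TN_def compact_space_subtopology Hausdorff_space_subtopology closedin_subset_topspace)

lemma Y_eq: "Y = collapse_topology TN L" by (simp add: Y_def index_space_def TN_def)

lemma compact_Y: "compact_space Y" and Hausdorff_Y: "Hausdorff_space Y"
  unfolding Y_eq using compact_space_collapse[OF TN(2)] Hausdorff_space_collapse[OF TN(2,3,4)] by auto

lemma topspace_Y: "topspace Y = insert None (Some ` (N - L))"
  unfolding Y_eq topspace_collapse_topology TN by simp

lemma f_continuous: "S \<subseteq> N \<Longrightarrow> continuous_map (subtopology M S) M f"
  using map(2) N(3) continuous_map_from_subtopology_mono by blast

lemma h_None [simp]: "h None = None" by (simp add: h_def index_map_def)

lemma h_Some: "h (Some x) = (if x \<in> N - L \<and> f x \<in> N - L then Some (f x) else None)"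
  by (simp add: h_def index_map_def)

lemma h_funpow_None [simp]: "(h ^^ n) None = None" by (induction n) auto

text \<open>Away from the base point, a preimage is cut out by an open condition on
  \<open>f x\<close> together with \<open>x\<close> outside \<open>L\<close>, where
  \<open>f x\<close> is automatically in \<open>N\<close>. For a set containing the base point the
  complement is the preimage of a closed \<open>K\<close> disjoint from \<open>L\<close>; a point of
  \<open>L\<close> cannot be mapped into \<open>K\<close>, because its image in \<open>N\<close>
  would lie in \<open>L\<close>.\<close>

lemma h_continuous: "continuous_map Y Y h"
  unfolding Y_eq
proof (rule continuous_from_collapse)
  show "h None \<in> topspace (collapse_topology TN L)" by (simp add: topspace_collapse_topology)
  let ?k = "\<lambda>x. h (collapse_proj L x)"
  have k: "?k x = (if x \<in> N - L \<and> f x \<in> N - L then Some (f x) else None)" for x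
    by (auto simp: collapse_proj_def h_Some)
  have fN: "continuous_map TN M f" unfolding TN_def using f_continuous by blast
  show "continuous_map TN (collapse_topology TN L) ?k"
    unfolding continuous_map_def
  proof (intro conjI allI impI)
    show "?k \<in> topspace TN \<rightarrow> topspace (collapse_topology TN L)"
      by (auto simp: k topspace_collapse_topology TN)
    fix U assume U: "openin (collapse_topology TN L) U"
    have U': "openin TN {x \<in> topspace TN. collapse_proj L x \<in> U}" using U by (simp add: openin_collapse_topology)
    show "openin TN {x \<in> topspace TN. ?k x \<in> U}"
    proof (cases "None \<in> U")
      case False
      obtain G where G: "openin M G" "{x \<in> topspace TN. collapse_proj L x \<in> U} = G \<inter> N"
        using U' unfolding TN_def openin_subtopology by blast
      have "{x \<in> topspace TN. ?k x \<in> U} = (topspace TN - L) \<inter> {x \<in> topspace TN. f x \<in> G}"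
      proof (intro equalityI subsetI)
        fix x assume "x \<in> {x \<in> topspace TN. ?k x \<in> U}"
        then have x: "x \<in> N - L" "f x \<in> N - L" "Some (f x) \<in> U" using False by (auto simp: k TN split: if_splits)
        then have "f x \<in> {x \<in> topspace TN. collapse_proj L x \<in> U}" by (auto simp: TN collapse_proj_def)
        then show "x \<in> (topspace TN - L) \<inter> {x \<in> topspace TN. f x \<in> G}" using x G(2) by (auto simp: TN)
      next
        fix x assume x: "x \<in> (topspace TN - L) \<inter> {x \<in> topspace TN. f x \<in> G}"
        then have "f x \<in> N" using fNL by (auto simp: TN)
        then have "f x \<in> {x \<in> topspace TN. collapse_proj L x \<in> U}" using x G(2) by auto
        then have "f x \<notin> L" "Some (f x) \<in> U" using False by (auto simp: collapse_proj_def split: if_splits)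
        then show "x \<in> {x \<in> topspace TN. ?k x \<in> U}" using x \<open>f x \<in> N\<close> by (auto simp: k TN)
      qed
      moreover have "openin TN {x \<in> topspace TN. f x \<in> G}" using fN G(1) by (simp add: continuous_map_def)
      ultimately show ?thesis using TN(4) by (simp add: openin_Int closedin_def)
    next
      case True
      define K where "K = N - {x \<in> topspace TN. collapse_proj L x \<in> U}"
      have KL: "K \<inter> L = {}" using True by (auto simp: K_def collapse_proj_def TN subset_iff L(3)[THEN subsetD])
      have "closedin TN K" unfolding K_def using U' closedin_diff[OF closedin_topspace U'] by (simp add: TN)
      then have "closedin M K" unfolding TN_def using N(2) closedin_trans_full by blast
      then have "closedin TN {x \<in> topspace TN. f x \<in> K}" by (rule closedin_continuous_map_preimage[OF fN])
      moreover have "{x \<in> topspace TN. ?k x \<in> U} = topspace TN - {x \<in> topspace TN. f x \<in> K}"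
      proof (intro equalityI subsetI)
        fix x assume x: "x \<in> {x \<in> topspace TN. ?k x \<in> U}"
        have "f x \<notin> K"
        proof
          assume fK: "f x \<in> K"
          then have "f x \<in> N - L" using KL by (auto simp: K_def)
          moreover have "x \<notin> L" using fL[of x] \<open>f x \<in> N - L\<close> by blast
          ultimately have "Some (f x) \<in> U" using x by (auto simp: k TN)
          then show False using fK \<open>f x \<in> N - L\<close> by (auto simp: K_def collapse_proj_def TN)
        qed
        then show "x \<in> topspace TN - {x \<in> topspace TN. f x \<in> K}" using x by blast
      next
        fix x assume x: "x \<in> topspace TN - {x \<in> topspace TN. f x \<in> K}"
        show "x \<in> {x \<in> topspace TN. ?k x \<in> U}"
        proof (cases "x \<in> N - L \<and> f x \<in> N - L")
          case True
          then have "f x \<notin> K" using x by blast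
          then have "collapse_proj L (f x) \<in> U" using True by (auto simp: K_def TN)
          moreover have "?k x = Some (f x)" unfolding k using True by simp
          ultimately show ?thesis using True x by (auto simp: collapse_proj_def)
        next
          case F: False
          then have "?k x = None" unfolding k by simp
          then show ?thesis using x \<open>None \<in> U\<close> by simp
        qed
      qed
      ultimately show ?thesis by (metis openin_diff openin_topspace)
    qed
  qed
qed

lemma W_eq: "W = subtopology (product_topology (\<lambda>_. Y) UNIV) {\<xi>. \<forall>i. h (\<xi> (Suc i)) = \<xi> i}"
  by (simp add: W_def unstable_space_def Y_def h_def)

lemma topspace_W: "topspace W = {\<xi>. (\<forall>i. \<xi> i \<in> topspace Y) \<and> (\<forall>i. h (\<xi> (Suc i)) = \<xi> i)}"
  unfolding W_eq topspace_subtopology topspace_product_topology by (auto simp: PiE_iff)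

lemma W_D: "\<xi> \<in> topspace W \<Longrightarrow> \<xi> i \<in> topspace Y" "\<xi> \<in> topspace W \<Longrightarrow> h (\<xi> (Suc i)) = \<xi> i"
  by (auto simp: topspace_W)

lemma coordinate: "continuous_map W Y (\<lambda>\<xi>. \<xi> i)"
  unfolding W_eq by (intro continuous_map_from_subtopology continuous_map_product_projection) simp

lemma continuous_into_W:
  assumes "\<And>i. continuous_map T Y (\<lambda>x. g x i)" "\<And>x. x \<in> topspace T \<Longrightarrow> g x \<in> topspace W"
  shows "continuous_map T W g"
  unfolding W_eq continuous_map_in_subtopology
  using assms by (auto simp: continuous_map_componentwise_UNIV topspace_W)

lemma Hausdorff_W: "Hausdorff_space W"
  unfolding W_eq using Hausdorff_Y by (intro Hausdorff_space_subtopology) (simp add: Hausdorff_space_product_topology)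

lemma compact_W: "compact_space W"
proof -
  let ?P = "product_topology (\<lambda>_::nat. Y) UNIV"
  have pr: "continuous_map ?P Y (\<lambda>y. y k)" for k by (rule continuous_map_product_projection) simp
  have "closedin ?P {\<xi> \<in> topspace ?P. h (\<xi> (Suc i)) = \<xi> i}" for i
    by (rule closedin_continuous_maps_eq[OF Hausdorff_Y continuous_map_compose[OF pr h_continuous, unfolded comp_def] pr])
  then have "closedin ?P (\<Inter>i. {\<xi> \<in> topspace ?P. h (\<xi> (Suc i)) = \<xi> i})" by (intro closedin_INT) auto
  moreover have "topspace W = (\<Inter>i. {\<xi> \<in> topspace ?P. h (\<xi> (Suc i)) = \<xi> i})"
    by (auto simp: topspace_W PiE_iff)
  ultimately have "closedin ?P (topspace W)" by (simp only:)
  moreover have "compact_space ?P" using compact_Y by (simp add: compact_space_product_topology)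
  ultimately have "compactin ?P (topspace W)" by (intro closedin_compact_space)
  then have "compact_space (subtopology ?P (topspace W))" by (rule compact_space_subtopology)
  moreover have "subtopology ?P (topspace W) = W"
    unfolding W_eq topspace_subtopology by (rule subtopology_restrict)
  ultimately show ?thesis by simp
qed

lemma W_funpow: "\<xi> \<in> topspace W \<Longrightarrow> (h ^^ n) (\<xi> (i + n)) = \<xi> i"
  by (induction n) (simp_all add: W_D funpow_swap1)

lemma inf_W: "infty \<in> topspace W"
  by (simp add: topspace_W unstable_infinity_def topspace_Y)

lemma X'_eq: "X' = {\<xi> \<in> topspace W. \<forall>i. \<xi> i \<in> Some ` X}"
  by (simp add: X'_def unstable_core_def W_def)

lemma closedin_SomeX: "closedin Y (Some ` X)"
proof -
  have "closedin M X" using compactin_imp_closedin[OF Hausdorff_M X_facts(1)] .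
  then have "openin TN (N - X)" unfolding TN_def using N(4) by (auto simp: openin_subtopology intro!: exI[of _ "topspace M - X"])
  then have "openin Y (insert None (Some ` (N - X - L)))"
    unfolding Y_eq using X_facts(3) L(3) by (intro openin_collapse_around) (auto simp: TN)
  moreover have "topspace Y - Some ` X = insert None (Some ` (N - X - L))"
    by (auto simp: topspace_Y)
  moreover have "Some ` X \<subseteq> topspace Y" using X_facts(3,4) by (auto simp: topspace_Y)
  ultimately show ?thesis by (simp add: closedin_def)
qed

lemma closedin_X': "closedin W X'"
proof -
  have "X' = (\<Inter>i. {\<xi> \<in> topspace W. \<xi> i \<in> Some ` X})" by (auto simp: X'_eq)
  moreover have "closedin W {\<xi> \<in> topspace W. \<xi> i \<in> Some ` X}" for i
    by (rule closedin_continuous_map_preimage[OF coordinate closedin_SomeX])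
  ultimately show ?thesis by (metis (no_types, lifting) closedin_INT UNIV_not_empty)
qed

lemma inf_X': "infty \<notin> X'" by (auto simp: X'_eq unstable_infinity_def)

lemma h_X: "z \<in> Some ` X \<Longrightarrow> h z \<in> Some ` X"
proof -
  assume "z \<in> Some ` X"
  then obtain x where x: "x \<in> X" "z = Some x" by blast
  then have "f x \<in> X" using X_facts(2) by blast
  then show ?thesis using x X_facts(3,4) unfolding x(2) h_Some by auto
qed

text \<open>On threads \<open>h (\<xi> (Suc i)) = \<xi> i\<close>, so prepending
  \<open>h (\<xi> 0)\<close> amounts to applying \<open>h\<close> in every coordinate.\<close>

lemma \<sigma>_coordinates: "\<xi> \<in> topspace W \<Longrightarrow> \<sigma> \<xi> = (\<lambda>i. h (\<xi> i))"
  by (rule ext) (auto simp: \<sigma>_def unstable_shift_def W_D h_def[symmetric] split: nat.split)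

lemma h_top: "z \<in> topspace Y \<Longrightarrow> h z \<in> topspace Y"
  using h_continuous by (auto simp: continuous_map_def Pi_iff)

lemma \<sigma>_W: "\<xi> \<in> topspace W \<Longrightarrow> \<sigma> \<xi> \<in> topspace W"
  unfolding \<sigma>_coordinates using h_top by (auto simp: topspace_W)

lemma \<tau>_W: "\<xi> \<in> topspace W \<Longrightarrow> \<tau> \<xi> \<in> topspace W"
  by (auto simp: topspace_W \<tau>_def)

lemma \<sigma>_continuous: "continuous_map W W \<sigma>"
proof (rule continuous_into_W)
  fix i
  have "continuous_map W Y (\<lambda>\<xi>. h (\<xi> i))"
    using continuous_map_compose[OF coordinate h_continuous] by (simp add: comp_def)
  then show "continuous_map W Y (\<lambda>\<xi>. \<sigma> \<xi> i)"
    by (rule continuous_map_eq) (simp add: \<sigma>_coordinates)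
qed (rule \<sigma>_W)

lemma \<tau>_continuous: "continuous_map W W \<tau>"
  by (rule continuous_into_W) (use coordinate \<tau>_W in \<open>auto simp: \<tau>_def\<close>)

lemma \<sigma>_\<tau>: "\<xi> \<in> topspace W \<Longrightarrow> \<sigma> (\<tau> \<xi>) = \<xi>" "\<xi> \<in> topspace W \<Longrightarrow> \<tau> (\<sigma> \<xi>) = \<xi>"
proof -
  assume \<xi>: "\<xi> \<in> topspace W"
  show "\<sigma> (\<tau> \<xi>) = \<xi>" unfolding \<sigma>_coordinates[OF \<tau>_W[OF \<xi>]] using \<xi> by (simp add: \<tau>_def W_D)
  show "\<tau> (\<sigma> \<xi>) = \<xi>" unfolding \<sigma>_coordinates[OF \<xi>] using \<xi> by (simp add: \<tau>_def W_D)
qed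

lemma \<sigma>_inf: "\<sigma> infty = infty" "\<tau> infty = infty"
  using inf_W by (auto simp: \<sigma>_coordinates \<tau>_def) (auto simp: unstable_infinity_def)

lemma \<sigma>_X': "\<xi> \<in> X' \<Longrightarrow> \<sigma> \<xi> \<in> X'" "\<xi> \<in> X' \<Longrightarrow> \<tau> \<xi> \<in> X'"
  using \<sigma>_W \<tau>_W h_X by (auto simp: X'_eq \<sigma>_coordinates) (auto simp: \<tau>_def)

lemma \<sigma>_funpow:
  assumes "\<xi> \<in> topspace W"
  shows "(\<sigma> ^^ n) \<xi> \<in> topspace W" "(\<sigma> ^^ n) \<xi> = (\<lambda>i. (h ^^ n) (\<xi> i))"
proof -
  have "(\<sigma> ^^ n) \<xi> \<in> topspace W \<and> (\<sigma> ^^ n) \<xi> = (\<lambda>i. (h ^^ n) (\<xi> i))"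
    by (induction n) (use assms \<sigma>_W \<sigma>_coordinates in auto)
  then show "(\<sigma> ^^ n) \<xi> \<in> topspace W" "(\<sigma> ^^ n) \<xi> = (\<lambda>i. (h ^^ n) (\<xi> i))" by auto
qed

lemma \<tau>_funpow: "(\<tau> ^^ n) \<xi> = (\<lambda>i. \<xi> (i + n))"
  by (induction n arbitrary: \<xi>) (auto simp: \<tau>_def)

lemma h_orbit:
  assumes "p \<in> N - L" "(h ^^ k) (Some p) \<noteq> None"
  shows "\<forall>i\<le>k. (f ^^ i) p \<in> N - L" "(h ^^ k) (Some p) = Some ((f ^^ k) p)"
proof -
  have "(\<forall>i\<le>k. (f ^^ i) p \<in> N - L) \<and> (h ^^ k) (Some p) = Some ((f ^^ k) p)"
    using assms(2)
  proof (induction k)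
    case (Suc k)
    have "(h ^^ k) (Some p) \<noteq> None" using Suc.prems by (metis funpow.simps(2) comp_apply h_None)
    then have IH: "\<forall>i\<le>k. (f ^^ i) p \<in> N - L" "(h ^^ k) (Some p) = Some ((f ^^ k) p)" using Suc.IH by auto
    then have "h (Some ((f ^^ k) p)) \<noteq> None" using Suc.prems by simp
    then have "f ((f ^^ k) p) \<in> N - L" "h (Some ((f ^^ k) p)) = Some (f ((f ^^ k) p))"
      unfolding h_Some by (auto split: if_splits)
    then show ?case using IH by (auto simp: le_Suc_eq)
  qed (use assms(1) in auto)
  then show "\<forall>i\<le>k. (f ^^ i) p \<in> N - L" "(h ^^ k) (Some p) = Some ((f ^^ k) p)" by auto
qed

text \<open>Points of \<open>L\<close> cannot follow \<open>cl (N - L)\<close> for ever, since a full orbit in \<open>L \<inter> cl (N - L)\<close>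
  would lie in \<open>X\<close>; by compactness the base point attracts a neighbourhood in finite time.\<close>

lemma base_point_attracts:
  obtains k V where "openin Y V" "None \<in> V" "\<And>z. z \<in> V \<Longrightarrow> (h ^^ k) z = None"
proof -
  \<comment> \<open>The points that follow \<open>A\<close> for \<open>k\<close> steps; they
    decrease with \<open>k\<close> and are closed.\<close>
  define R where "R = (\<lambda>k. {q \<in> A. \<forall>i\<le>k. (f ^^ i) q \<in> A})"
  have fA: "continuous_map (subtopology M A) M f" using A(2) by (rule f_continuous)
  have Rcl: "closedin M (R k)" for k
  proof (induction k)
    case 0
    then show ?case using A(5) by (simp add: R_def)
  next
    case (Suc k)
    have "R (Suc k) = {q \<in> topspace (subtopology M A). f q \<in> R k}"
    proof (intro equalityI subsetI)
      fix q assume q: "q \<in> R (Suc k)"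
      have "(f ^^ i) (f q) \<in> A" if "i \<le> k" for i
        using q that by (auto simp: R_def funpow_swap1 dest!: spec[of _ "Suc i"])
      moreover have "f q \<in> A" using q by (auto simp: R_def dest!: spec[of _ 1])
      ultimately show "q \<in> {q \<in> topspace (subtopology M A). f q \<in> R k}"
        using q closedin_subset[OF A(5)] by (auto simp: R_def)
    next
      fix q assume q: "q \<in> {q \<in> topspace (subtopology M A). f q \<in> R k}"
      have "(f ^^ i) q \<in> A" if "i \<le> Suc k" for i
        using q that by (cases i) (auto simp: R_def funpow_swap1)
      then show "q \<in> R (Suc k)" using q by (auto simp: R_def)
    qed
    then have "closedin (subtopology M A) (R (Suc k))"
      using closedin_continuous_map_preimage[OF fA Suc] by simp
    then show ?case using A(5) closedin_trans_full by blast
  qed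
  have "\<exists>k. R k \<inter> L = {}"
  proof (rule ccontr)
    assume no: "\<nexists>k. R k \<inter> L = {}"
    have "inv_part f (A \<inter> L) \<noteq> {}"
    proof (rule full_orbit_exists[OF Hausdorff_M])
      show "compactin M (A \<inter> L)" using A(1) L(2) by (simp add: compact_Int_closedin)
      show "continuous_map (subtopology M (A \<inter> L)) M f" using A(2) by (intro f_continuous) blast
      fix n
      obtain q where q: "q \<in> R n" "q \<in> L" using no by blast
      \<comment> \<open>An orbit that starts in \<open>L\<close> remains in \<open>L\<close> as long
        as it remains in \<open>N\<close>.\<close>
      have "(f ^^ i) q \<in> A \<inter> L" if "i \<le> n" for i
        using that
      proof (induction i)
        case (Suc i)
        have "(f ^^ Suc i) q \<in> A" using q(1) Suc.prems unfolding R_def by blast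
        then show ?case using fL[of "(f ^^ i) q"] Suc A(2) by auto
      qed (use q in \<open>auto simp: R_def\<close>)
      then show "\<exists>q\<in>A \<inter> L. \<forall>i\<le>n. (f ^^ i) q \<in> A \<inter> L" using q by (intro bexI[of _ q]) (auto simp: R_def)
    qed
    then obtain x p where p: "\<forall>i::int. p i \<in> A \<inter> L" "p 0 = x" "\<forall>i. f (p i) = p (i + 1)"
      unfolding inv_part_def by blast
    have "\<forall>i. p i \<in> A" "x \<in> L" using p(1) p(2)[symmetric] by auto
    then have "x \<in> X" unfolding A(3) inv_part_def using p(2,3) by (intro CollectI exI[of _ p] conjI)
    then show False using \<open>x \<in> L\<close> X_facts(3) by blast
  qed
  then obtain k where k: "R k \<inter> L = {}" by blast
  have "openin TN (N - R k)"
    unfolding TN_def openin_subtopology using Rcl[of k] N(4) by (intro exI[of _ "topspace M - R k"]) auto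
  then have o: "openin Y (insert None (Some ` (N - R k - L)))"
    unfolding Y_eq using k L(3) by (intro openin_collapse_around) auto
  show thesis
  proof (rule that[OF o])
    fix z assume z: "z \<in> insert None (Some ` (N - R k - L))"
    show "(h ^^ k) z = None"
    proof (cases z)
      case (Some p)
      then have p: "p \<in> N - L" "p \<notin> R k" using z by auto
      show ?thesis
      proof (rule ccontr)
        assume "(h ^^ k) z \<noteq> None"
        then have "\<forall>i\<le>k. (f ^^ i) p \<in> N - L" using h_orbit(1)[OF p(1)] Some by blast
        then show False using p A(4) by (auto simp: R_def)
      qed
    qed simp
  qed simp
qed

text \<open>The coordinates form a backward orbit and the iterates of \<open>\<xi> 0\<close> a
  forward orbit. If the base point is never reached, they join to a full orbit of \<open>f\<close>
  in \<open>A\<close>, which lies in \<open>X\<close> by isolation.\<close>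

lemma never_leaves:
  assumes \<xi>: "\<xi> \<in> topspace W" and nn: "\<And>n. (h ^^ n) (\<xi> 0) \<noteq> None"
  shows "\<xi> \<in> X'"
proof -
  \<comment> \<open>Nonnegative indices continue forwards by \<open>h\<close>, negative ones read
    off the coordinates.\<close>
  define ob where "ob = (\<lambda>i::int. if 0 \<le> i then (h ^^ nat i) (\<xi> 0) else \<xi> (nat (- i)))"
  have ob_step: "h (ob i) = ob (i + 1)" for i
  proof -
    consider "0 \<le> i" | "i = - 1" | "i < - 1" by linarith
    then show ?thesis
    proof cases
      case 1
      then have "nat (i + 1) = Suc (nat i)" by simp
      then show ?thesis using 1 by (simp add: ob_def)
    next
      case 2
      then show ?thesis using W_D(2)[OF \<xi>, of 0] by (simp add: ob_def)
    next
      case 3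
      then have "nat (- i) = Suc (nat (- (i + 1)))" by simp
      then show ?thesis using 3 W_D(2)[OF \<xi>] by (simp add: ob_def)
    qed
  qed
  have \<xi>n: "\<xi> i \<noteq> None" for i
    using nn[of 0] W_funpow[OF \<xi>, of i 0] by (metis add_0 funpow_0 h_funpow_None)
  have obn: "ob i \<noteq> None" for i using nn \<xi>n by (auto simp: ob_def)
  have htop: "(h ^^ n) z \<in> topspace Y" if "z \<in> topspace Y" for n z
    using that h_top by (induction n) auto
  have obY: "ob i \<in> topspace Y" for i using W_D(1)[OF \<xi>] htop by (auto simp: ob_def)
  define p where "p = (\<lambda>i. the (ob i))"
  have pob: "ob i = Some (p i)" for i using obn[of i] by (auto simp: p_def)
  have pN: "p i \<in> N - L" for i using obY[of i] pob[of i] by (auto simp: topspace_Y)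
  have pf: "f (p i) = p (i + 1)" for i
    using ob_step[of i] unfolding pob h_Some by (simp split: if_splits)
  have "p j \<in> X" for j
  proof -
    have "\<forall>i. p (i + j) \<in> A" "\<forall>i. f (p (i + j)) = p (i + 1 + j)" using pN A(4) pf by (auto simp: add.commute add.left_commute)
    then show ?thesis unfolding A(3) inv_part_def by (intro CollectI exI[of _ "\<lambda>i. p (i + j)"]) auto
  qed
  moreover have "\<xi> i = Some (p (- int i))" for i
    using pob[of "- int i"] by (cases "i = 0") (auto simp: ob_def)
  ultimately show ?thesis using \<xi> by (auto simp: X'_eq)
qed

text \<open>By compactness the initial coordinates of all points of \<open>K\<close> reach the base
  point within a uniform time. The \<open>j\<close>-th coordinate follows \<open>j\<close> steps
  later, and a neighbourhood of infinity contains all threads with one suitable coordinate at the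
  base point.\<close>

lemma attract:
  assumes K: "closedin W K" "K \<inter> X' = {}" and U: "openin W U" "infty \<in> U"
  obtains m where "\<And>n. m \<le> n \<Longrightarrow> (\<sigma> ^^ n) ` K \<subseteq> U"
proof -
  obtain k V where V: "openin Y V" "None \<in> V" "\<And>z. z \<in> V \<Longrightarrow> (h ^^ k) z = None"
    by (rule base_point_attracts) (rule that)
  have hn: "continuous_map Y Y (h ^^ m)" for m
    by (induction m) (auto intro: continuous_map_compose[OF _ h_continuous, unfolded comp_def])
  define G where "G = (\<lambda>m. {\<xi> \<in> topspace W. (h ^^ m) (\<xi> 0) \<in> V})"
  have G: "openin W (G m)" for m
  proof -
    have "continuous_map W Y (\<lambda>\<xi>. (h ^^ m) (\<xi> 0))"
      using continuous_map_compose[OF coordinate hn] by (simp add: comp_def)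
    then show ?thesis using V(1) by (simp add: G_def continuous_map_def)
  qed
  have KW: "K \<subseteq> topspace W" by (rule closedin_subset[OF K(1)])
  have "compactin W K" by (rule closedin_compact_space[OF compact_W K(1)])
  moreover have "K \<subseteq> \<Union>(range G)"
  proof
    fix \<xi> assume \<xi>: "\<xi> \<in> K"
    then obtain m where "(h ^^ m) (\<xi> 0) = None" using never_leaves[of \<xi>] K(2) KW by blast
    then have "\<xi> \<in> G m" using V(2) \<xi> KW by (auto simp: G_def)
    then show "\<xi> \<in> \<Union>(range G)" by blast
  qed
  moreover have "\<And>S. S \<in> range G \<Longrightarrow> openin W S" using G by blast
  ultimately obtain \<F> where "finite \<F>" "\<F> \<subseteq> range G" "K \<subseteq> \<Union>\<F>"
    unfolding compactin_def by meson
  then obtain I where I: "finite I" "K \<subseteq> (\<Union>m\<in>I. G m)" by (metis finite_subset_image)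
  \<comment> \<open>The time to enter the neighbourhood \<open>V\<close> of the base point plus the
    \<open>k\<close> steps after which \<open>V\<close> is absorbed.\<close>
  define m0 where "m0 = Max (insert 0 I) + k"
  have none: "(h ^^ n) (\<xi> 0) = None" if \<xi>K: "\<xi> \<in> K" and n: "m0 \<le> n" for \<xi> n
  proof -
    obtain m where m: "m \<in> I" "\<xi> \<in> G m" using I(2) \<open>\<xi> \<in> K\<close> by blast
    have "m \<le> Max (insert 0 I)" using I(1) m(1) by simp
    then have r: "n = (n - (k + m)) + (k + m)" using n unfolding m0_def by simp
    have "(h ^^ k) ((h ^^ m) (\<xi> 0)) = None" using m(2) V(3) by (auto simp: G_def)
    then show ?thesis by (subst r) (simp only: funpow_add comp_def h_funpow_None)
  qed
  \<comment> \<open>Threads outside \<open>U\<close> with \<open>j\<close>-th coordinate at the base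
    point. They decrease with \<open>j\<close>, as \<open>h\<close> fixes the base point, and only
    infinity could lie in all of them.\<close>
  define B where "B = (\<lambda>j. {\<eta> \<in> topspace W. \<eta> j \<in> {None}} - U)"
  have Bcl: "closedin W (B j)" for j
  proof -
    have "closedin Y {None}" using Hausdorff_Y by (simp add: closedin_Hausdorff_sing_eq topspace_Y)
    then have "closedin W {\<eta> \<in> topspace W. \<eta> j \<in> {None}}"
      by (rule closedin_continuous_map_preimage[OF coordinate])
    then show ?thesis unfolding B_def using U(1) by (rule closedin_diff)
  qed
  have Bdec: "decseq B"
    unfolding decseq_Suc_iff
  proof
    fix j
    have "\<eta> j = None" if "\<eta> \<in> topspace W" "\<eta> (Suc j) = None" for \<eta>
      using W_D(2)[OF that(1), of j] that(2) by simp
    then show "B (Suc j) \<subseteq> B j" by (auto simp: B_def)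
  qed
  have "\<exists>j. B j = {}"
  proof (rule ccontr)
    assume "\<nexists>j. B j = {}"
    then have "B j \<noteq> {}" for j by simp
    then have "(\<Inter>j. B j) \<noteq> {}" by (rule compact_space_imp_nest[where C = B, OF compact_W Bcl _ Bdec])
    then obtain \<eta> where \<eta>: "\<And>j. \<eta> \<in> B j" by blast
    then have "\<eta> = infty" by (auto simp: B_def unstable_infinity_def fun_eq_iff)
    then show False using \<eta>[of 0] U(2) by (auto simp: B_def)
  qed
  then obtain j where j: "B j = {}" by blast
  show thesis
  proof (rule that[of "m0 + j"], rule image_subsetI)
    fix n \<xi> assume n: "m0 + j \<le> n" and \<xi>: "\<xi> \<in> K"
    have \<xi>W: "\<xi> \<in> topspace W" using \<xi> KW by blast
    have "(h ^^ n) (\<xi> j) = (h ^^ (n - j)) ((h ^^ j) (\<xi> j))"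
      using n by (simp add: funpow_add[symmetric, unfolded comp_def fun_eq_iff])
    also have "(h ^^ j) (\<xi> j) = \<xi> 0" using W_funpow[OF \<xi>W, of j 0] by simp
    also have "(h ^^ (n - j)) (\<xi> 0) = None" using n by (intro none[OF \<xi>]) simp
    finally have "(\<sigma> ^^ n) \<xi> j = None" using \<sigma>_funpow(2)[OF \<xi>W] by simp
    then show "(\<sigma> ^^ n) \<xi> \<in> U" using j \<sigma>_funpow(1)[OF \<xi>W, of n] by (auto simp: B_def)
  qed
qed

text \<open>Attraction read backwards: a point of \<open>K\<close> whose \<open>n\<close>-th
  preimage were outside \<open>U\<close> would be carried by \<open>\<sigma> ^^ n\<close> off
  \<open>K\<close>.\<close>

lemma repel:
  assumes K: "closedin W K" "infty \<notin> K" and U: "openin W U" "X' \<subseteq> U"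
  obtains m where "\<And>n. m \<le> n \<Longrightarrow> (\<tau> ^^ n) ` K \<subseteq> U"
proof -
  have 1: "closedin W (topspace W - U)" "(topspace W - U) \<inter> X' = {}" using U by auto
  have 2: "openin W (topspace W - K)" "infty \<in> topspace W - K" using K inf_W by auto
  obtain m where m: "\<And>n. m \<le> n \<Longrightarrow> (\<sigma> ^^ n) ` (topspace W - U) \<subseteq> topspace W - K"
    by (rule attract[OF 1 2]) (rule that)
  show thesis
  proof (rule that[of m], rule image_subsetI, rule ccontr)
    fix n \<xi> assume n: "m \<le> n" and \<xi>: "\<xi> \<in> K" and no: "(\<tau> ^^ n) \<xi> \<notin> U"
    have \<xi>W: "\<xi> \<in> topspace W" using \<xi> closedin_subset[OF K(1)] by blast
    have "(\<sigma> ^^ n) ((\<tau> ^^ n) \<xi>) = \<xi>" "(\<tau> ^^ n) \<xi> \<in> topspace W"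
      using funpow_inverse[of "topspace W" \<tau> \<sigma> \<xi> n] \<tau>_W \<sigma>_\<tau>(1) \<xi>W by auto
    then show False using m[OF n] no \<xi> by (metis DiffD2 DiffI image_subset_iff)
  qed
qed

lemma X'_W: "X' \<subseteq> topspace W" by (auto simp: X'_eq)

end

sublocale index_system \<subseteq> P: collapsed_pair W X'
  by unfold_locales (rule compact_W Hausdorff_W closedin_X')+

sublocale index_system \<subseteq> T: two_ends P.Q None "Some (unstable_infinity :: nat \<Rightarrow> 'a option)"
proof
  show "compact_space P.Q" "Hausdorff_space P.Q" "None \<in> topspace P.Q"
    by (rule P.compact_Q P.Hausdorff_Q P.None_Q)+
  show "Some infty \<in> topspace P.Q" using inf_W inf_X' by (simp add: P.Q_def topspace_collapse_topology)
qed simp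

section \<open>The quotient by the core as a space with two ends\<close>

context index_system
begin

definition "W' = topspace W - (X' \<union> {infty})"
definition "gQ = collapse_map X' \<sigma>"
definition "gQ' = collapse_map X' \<tau>"

lemma topspace_Q: "topspace P.Q = insert None (Some ` (topspace W - X'))"
  by (simp add: P.Q_def topspace_collapse_topology)

lemma E_eq: "T.E = Some ` W'"
  unfolding T.E_def topspace_Q W'_def by auto

lemma gQ_proj: "\<xi> \<in> topspace W \<Longrightarrow> gQ (P.proj \<xi>) = P.proj (\<sigma> \<xi>)"
  and gQ'_proj: "\<xi> \<in> topspace W \<Longrightarrow> gQ' (P.proj \<xi>) = P.proj (\<tau> \<xi>)"
  using \<sigma>_X' by (auto simp: gQ_def gQ'_def collapse_map_def collapse_proj_def)

lemma topspace_Q_cases: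
  assumes "z \<in> topspace P.Q"
  obtains "z = None" | \<xi> where "\<xi> \<in> topspace W" "z = P.proj \<xi>"
  using assms by (auto simp: topspace_Q collapse_proj_def)

lemma gQ_None: "gQ None = None" "gQ' None = None" by (auto simp: gQ_def gQ'_def collapse_map_def)

lemma end_homeo_gQ: "T.end_homeo gQ gQ'"
  unfolding T.end_homeo_def
proof (intro conjI ballI)
  have "continuous_map W P.Q (\<lambda>\<xi>. P.proj (\<sigma> \<xi>))" "continuous_map W P.Q (\<lambda>\<xi>. P.proj (\<tau> \<xi>))"
    using continuous_map_compose[OF \<sigma>_continuous P.proj_Q] continuous_map_compose[OF \<tau>_continuous P.proj_Q]
    by (auto simp: comp_def)
  note proj = this
  have 1: "continuous_map W P.Q (\<lambda>\<xi>. gQ (P.proj \<xi>))" "continuous_map W P.Q (\<lambda>\<xi>. gQ' (P.proj \<xi>))"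
    by (rule continuous_map_eq[OF proj(1)], simp add: gQ_proj)
      (rule continuous_map_eq[OF proj(2)], simp add: gQ'_proj)
  show "continuous_map P.Q P.Q gQ"
    by (subst (1) P.Q_def, rule continuous_from_collapse) (use 1 gQ_None P.None_Q in auto)
  show "continuous_map P.Q P.Q gQ'"
    by (subst (1) P.Q_def, rule continuous_from_collapse) (use 1 gQ_None P.None_Q in auto)
  fix z assume "z \<in> topspace P.Q"
  then show "gQ' (gQ z) = z" "gQ (gQ' z) = z"
    by (cases rule: topspace_Q_cases; simp add: gQ_None gQ_proj gQ'_proj \<sigma>_W \<tau>_W \<sigma>_\<tau>)+
next
  show "gQ None = None" by (rule gQ_None)
  have "P.proj infty = Some infty" using inf_X' by (simp add: collapse_proj_def)
  then show "gQ (Some infty) = Some infty" using gQ_proj[OF inf_W] \<sigma>_inf by simp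
qed

lemma gQ_funpow: "\<xi> \<in> topspace W \<Longrightarrow> (gQ ^^ n) (P.proj \<xi>) = P.proj ((\<sigma> ^^ n) \<xi>)"
  by (induction n) (use \<sigma>_funpow(1) gQ_proj in auto)

lemma \<tau>_funpow_W: "\<xi> \<in> topspace W \<Longrightarrow> (\<tau> ^^ n) \<xi> \<in> topspace W"
  by (induction n) (use \<tau>_W in auto)

lemma gQ'_funpow: "\<xi> \<in> topspace W \<Longrightarrow> (gQ' ^^ n) (P.proj \<xi>) = P.proj ((\<tau> ^^ n) \<xi>)"
  by (induction n) (use \<tau>_funpow_W gQ'_proj in auto)

lemma preimage_proj:
  "closedin P.Q K \<Longrightarrow> closedin W {\<xi> \<in> topspace W. P.proj \<xi> \<in> K}"
  "openin P.Q V \<Longrightarrow> openin W {\<xi> \<in> topspace W. P.proj \<xi> \<in> V}"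
  using P.proj_Q closedin_continuous_map_preimage by (auto simp: continuous_map_def)

lemma attract_Q:
  assumes "closedin P.Q K" "None \<notin> K" "openin P.Q V" "Some infty \<in> V"
  shows "\<exists>n. (gQ ^^ n) ` K \<subseteq> V"
proof -
  have "{\<xi> \<in> topspace W. P.proj \<xi> \<in> K} \<inter> X' = {}" using assms(2) by (auto simp: collapse_proj_def)
  moreover have "infty \<in> {\<xi> \<in> topspace W. P.proj \<xi> \<in> V}" using assms(4) inf_W inf_X' by (simp add: collapse_proj_def)
  ultimately obtain m where m: "\<And>n. m \<le> n \<Longrightarrow> (\<sigma> ^^ n) ` {\<xi> \<in> topspace W. P.proj \<xi> \<in> K} \<subseteq> {\<xi> \<in> topspace W. P.proj \<xi> \<in> V}"
    by (rule attract[OF preimage_proj(1)[OF assms(1)] _ preimage_proj(2)[OF assms(3)]]) (rule that)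
  have "(gQ ^^ m) z \<in> V" if "z \<in> K" for z
  proof -
    have "z \<in> topspace P.Q" using that closedin_subset[OF assms(1)] by blast
    moreover have "z \<noteq> None" using that assms(2) by (cases z) auto
    ultimately obtain \<xi> where "z = Some \<xi>" "\<xi> \<in> topspace W - X'" unfolding topspace_Q by blast
    then have \<xi>: "\<xi> \<in> topspace W" "z = P.proj \<xi>" by (auto simp: collapse_proj_def)
    then show ?thesis using m[of m] that by (auto simp: gQ_funpow)
  qed
  then show ?thesis by blast
qed

lemma repel_Q:
  assumes "closedin P.Q K" "Some infty \<notin> K" "openin P.Q V" "None \<in> V"
  shows "\<exists>n. (gQ' ^^ n) ` K \<subseteq> V"
proof -
  have "infty \<notin> {\<xi> \<in> topspace W. P.proj \<xi> \<in> K}" using assms(2) inf_X' by (auto simp: collapse_proj_def)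
  moreover have "X' \<subseteq> {\<xi> \<in> topspace W. P.proj \<xi> \<in> V}" using assms(4) X'_W by (auto simp: collapse_proj_def)
  ultimately obtain m where m: "\<And>n. m \<le> n \<Longrightarrow> (\<tau> ^^ n) ` {\<xi> \<in> topspace W. P.proj \<xi> \<in> K} \<subseteq> {\<xi> \<in> topspace W. P.proj \<xi> \<in> V}"
    by (rule repel[OF preimage_proj(1)[OF assms(1)] _ preimage_proj(2)[OF assms(3)]]) (rule that)
  have None: "(gQ' ^^ m) None = None" by (induction m) (auto simp: gQ_None)
  have "(gQ' ^^ m) z \<in> V" if "z \<in> K" for z
  proof -
    have "z \<in> topspace P.Q" using that closedin_subset[OF assms(1)] by auto
    then show ?thesis
    proof (cases rule: topspace_Q_cases)
      case 1
      then show ?thesis using None assms(4) by simp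
    next
      case (2 \<xi>)
      then show ?thesis using m[of m] that by (auto simp: gQ'_funpow)
    qed
  qed
  then show ?thesis by blast
qed

abbreviation "Ess \<equiv> essential_quasicomponents M f N L X"

lemma Ess_eq: "Ess = {F \<in> quasi_components_of (subtopology W W'). infty \<in> W closure_of F \<and> W closure_of F \<inter> X' \<noteq> {}}"
  by (simp add: essential_quasicomponents_def Let_def W_def X'_def W'_def)

lemma openin_W': "openin W W'"
proof -
  have "closedin W {infty}" using Hausdorff_W inf_W by (simp add: closedin_Hausdorff_sing_eq)
  then show ?thesis unfolding W'_def using closedin_X' by (intro openin_diff closedin_Un) auto
qed

lemma openin_Some: "U \<subseteq> W' \<Longrightarrow> openin P.Q (Some ` U) \<longleftrightarrow> openin W U"
proof -
  assume U: "U \<subseteq> W'"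
  have "{\<xi> \<in> topspace W. P.proj \<xi> \<in> Some ` U} = U"
    using U by (auto simp: W'_def collapse_proj_def split: if_splits)
  then show ?thesis using U by (auto simp: P.Q_def openin_collapse_topology W'_def)
qed

lemma clop_Some: "T.clop (Some ` C) \<longleftrightarrow> C \<subseteq> W' \<and> openin W C \<and> openin W (W' - C)"
proof -
  have *: "Some ` W' - Some ` C = Some ` (W' - C)" "Some ` C \<subseteq> Some ` W' \<longleftrightarrow> C \<subseteq> W'" by auto
  show ?thesis unfolding T.clop_def E_eq * using openin_Some[of C] openin_Some[of "W' - C"] by auto
qed

lemma quasi_W: "quasi_component_of (subtopology W W') x y \<longleftrightarrow>
    x \<in> W' \<and> y \<in> W' \<and> (\<forall>C. C \<subseteq> W' \<and> openin W C \<and> openin W (W' - C) \<longrightarrow> (x \<in> C \<longleftrightarrow> y \<in> C))"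
proof -
  have t: "topspace (subtopology W W') = W'" using openin_subset[OF openin_W'] by auto
  have o: "openin (subtopology W W') S \<longleftrightarrow> openin W S \<and> S \<subseteq> W'" for S by (rule openin_open_subtopology[OF openin_W'])
  show ?thesis unfolding quasi_component_of_def t closedin_def o by auto
qed

lemma quasi_Q: "quasi_component_of (subtopology P.Q T.E) x y \<longleftrightarrow>
    x \<in> T.E \<and> y \<in> T.E \<and> (\<forall>C. T.clop C \<longrightarrow> (x \<in> C \<longleftrightarrow> y \<in> C))"
  unfolding quasi_component_of_def T.clop_iff T.E_top by blast

text \<open>\<open>W'\<close> is open and disjoint from the collapsed set, so \<open>Some\<close>
  maps it homeomorphically onto \<open>E\<close> and clopen subsets correspond.\<close>

lemma quasi_Some: "quasi_component_of (subtopology P.Q T.E) (Some x) z \<longleftrightarrow>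
    (\<exists>y. z = Some y \<and> quasi_component_of (subtopology W W') x y)"
proof -
  have c: "(\<forall>C. T.clop C \<longrightarrow> R C) \<longleftrightarrow> (\<forall>C. T.clop (Some ` C) \<longrightarrow> R (Some ` C))" for R
  proof
    assume r: "\<forall>C. T.clop (Some ` C) \<longrightarrow> R (Some ` C)"
    show "\<forall>C. T.clop C \<longrightarrow> R C"
    proof (intro allI impI)
      fix C assume C: "T.clop C"
      then have "C \<subseteq> Some ` W'" unfolding T.clop_def E_eq by blast
      then obtain C' where "C = Some ` C'" by (metis subset_imageE)
      then show "R C" using r C by simp
    qed
  qed simp
  show ?thesis
    unfolding quasi_Q quasi_W c unfolding clop_Some E_eq
  proof (cases z)
    case (Some y)
    show "(Some x \<in> Some ` W' \<and> z \<in> Some ` W' \<and>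
        (\<forall>C. C \<subseteq> W' \<and> openin W C \<and> openin W (W' - C) \<longrightarrow> (Some x \<in> Some ` C) = (z \<in> Some ` C))) =
      (\<exists>y. z = Some y \<and> x \<in> W' \<and> y \<in> W' \<and>
        (\<forall>C. C \<subseteq> W' \<and> openin W C \<and> openin W (W' - C) \<longrightarrow> (x \<in> C) = (y \<in> C)))"
      unfolding Some by (simp add: inj_image_mem_iff)
  qed auto
qed

text \<open>Neighbourhoods of \<open>None\<close> pull back to neighbourhoods of the core.
  Conversely, if the closure of \<open>F\<close> misses the core, then its complement descends to a
  neighbourhood of \<open>None\<close>.\<close>

lemma closure_None:
  assumes F: "F \<subseteq> W'"
  shows "None \<in> P.Q closure_of (Some ` F) \<longleftrightarrow> W closure_of F \<inter> X' \<noteq> {}"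
proof
  assume "W closure_of F \<inter> X' \<noteq> {}"
  then obtain x where x: "x \<in> W closure_of F" "x \<in> X'" by blast
  show "None \<in> P.Q closure_of (Some ` F)"
    unfolding in_closure_of
  proof (intro conjI allI impI P.None_Q)
    fix U assume U: "None \<in> U \<and> openin P.Q U"
    have "x \<in> {\<xi> \<in> topspace W. P.proj \<xi> \<in> U}" using x(2) X'_W U by (auto simp: collapse_proj_def)
    then obtain y where "y \<in> F" "P.proj y \<in> U"
      using x(1)[unfolded in_closure_of, THEN conjunct2, rule_format, of "{\<xi> \<in> topspace W. P.proj \<xi> \<in> U}"] preimage_proj(2)[of U] U by auto
    moreover have "P.proj y = Some y" using \<open>y \<in> F\<close> F by (auto simp: W'_def collapse_proj_def)
    ultimately show "\<exists>y. y \<in> Some ` F \<and> y \<in> U" by auto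
  qed
next
  assume n: "None \<in> P.Q closure_of (Some ` F)"
  show "W closure_of F \<inter> X' \<noteq> {}"
  proof
    assume e: "W closure_of F \<inter> X' = {}"
    have "openin W (topspace W - W closure_of F)" by (simp add: openin_diff)
    then have "openin P.Q (insert None (Some ` (topspace W - W closure_of F - X')))"
      unfolding P.Q_def using e by (intro openin_collapse_around) auto
    then obtain y where "y \<in> F" "y \<notin> W closure_of F"
      using n[unfolded in_closure_of, THEN conjunct2, rule_format, of "insert None (Some ` (topspace W - W closure_of F - X'))"] by auto
    then show False using closure_of_subset[of F W] F by (auto simp: W'_def)
  qed
qed

lemma closure_infinity:
  assumes F: "F \<subseteq> W'"
  shows "Some infty \<in> P.Q closure_of (Some ` F) \<longleftrightarrow> infty \<in> W closure_of F"
proof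
  assume x: "infty \<in> W closure_of F"
  show "Some infty \<in> P.Q closure_of (Some ` F)"
    unfolding in_closure_of
  proof (intro conjI allI impI T.b)
    fix U assume U: "Some infty \<in> U \<and> openin P.Q U"
    have "infty \<in> {\<xi> \<in> topspace W. P.proj \<xi> \<in> U}" using inf_W inf_X' U by (auto simp: collapse_proj_def)
    then obtain y where "y \<in> F" "P.proj y \<in> U"
      using x[unfolded in_closure_of, THEN conjunct2, rule_format, of "{\<xi> \<in> topspace W. P.proj \<xi> \<in> U}"] preimage_proj(2)[of U] U by auto
    moreover have "P.proj y = Some y" using \<open>y \<in> F\<close> F by (auto simp: W'_def collapse_proj_def)
    ultimately show "\<exists>y. y \<in> Some ` F \<and> y \<in> U" by auto
  qed
next
  assume n: "Some infty \<in> P.Q closure_of (Some ` F)"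
  show "infty \<in> W closure_of F"
    unfolding in_closure_of
  proof (intro conjI allI impI inf_W)
    fix U assume U: "infty \<in> U \<and> openin W U"
    then have "openin P.Q (Some ` (U - X'))" unfolding P.Q_def using closedin_X' by (intro openin_collapse_off) auto
    moreover have "Some infty \<in> Some ` (U - X')" using U inf_X' by blast
    ultimately show "\<exists>y. y \<in> F \<and> y \<in> U" 
      using n[unfolded in_closure_of, THEN conjunct2, rule_format, of "Some ` (U - X')"] by auto
  qed
qed

lemma Ess_sub: "F \<in> Ess \<Longrightarrow> F \<subseteq> W'"
  using quasi_components_of_subset unfolding Ess_eq by fastforce

lemma essential_iff: "F \<subseteq> W' \<Longrightarrow> Some ` F \<in> T.essential \<longleftrightarrow> F \<in> Ess"
proof -
  assume F: "F \<subseteq> W'"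
  have tW: "topspace (subtopology W W') = W'" using openin_subset[OF openin_W'] by auto
  have img: "Collect (quasi_component_of (subtopology P.Q T.E) (Some x)) = Some ` Collect (quasi_component_of (subtopology W W') x)" for x
    using quasi_Some by auto
  have "quasi_components_of (subtopology P.Q T.E) = (`) Some ` quasi_components_of (subtopology W W')"
    unfolding quasi_components_of_def T.E_top tW arg_cong[OF E_eq, of "image (quasi_component_of_set (subtopology P.Q T.E))"]
      image_image img by (rule refl)
  then have "Some ` F \<in> quasi_components_of (subtopology P.Q T.E) \<longleftrightarrow> F \<in> quasi_components_of (subtopology W W')"
    by (auto simp: inj_image_eq_iff)
  then show ?thesis unfolding T.essential_def Ess_eq using closure_None[OF F] closure_infinity[OF F] by auto
qed

lemma essential_eq: "T.essential = (`) Some ` Ess"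
proof
  show "T.essential \<subseteq> (`) Some ` Ess"
  proof
    fix F assume F: "F \<in> T.essential"
    then have "F \<subseteq> Some ` W'" using T.quasi_sub[OF T.essential_quasi[OF F]] E_eq by simp
    then obtain F' where "F' \<subseteq> W'" "F = Some ` F'" by (metis subset_imageE)
    then show "F \<in> (`) Some ` Ess" using F essential_iff by blast
  qed
  show "(`) Some ` Ess \<subseteq> T.essential" using essential_iff Ess_sub by blast
qed

lemma collapsed_closure_eq:
  assumes "F \<in> Ess"
  shows "collapsed_closure M f N L X F = subtopology P.Q (Some ` F \<union> {None, Some infty})"
proof -
  have "P.proj ` F = Some ` F" using Ess_sub[OF assms] by (auto simp: W'_def collapse_proj_def image_iff)
  moreover have "Some ` F \<in> T.essential" using essential_eq assms by blast
  ultimately show ?thesis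
    unfolding collapsed_closure_def Let_def W_def[symmetric] X'_def[symmetric] P.Q_def[symmetric]
    by (simp add: T.essential_closure)
qed

lemma compact_pair_closure:
  assumes "F \<in> Ess"
  shows "compact_pair (collapsed_closure M f N L X F) {}"
proof -
  have "Some ` F \<in> T.essential" using essential_eq assms by blast
  then have "closedin P.Q (Some ` F \<union> {None, Some infty})" by (rule T.quasi_closed[OF T.essential_quasi])
  then show ?thesis unfolding collapsed_closure_eq[OF assms]
    using P.compact_Q P.Hausdorff_Q
    by unfold_locales (auto simp: compact_space_subtopology closedin_compact_space Hausdorff_space_subtopology)
qed

section \<open>The unstable manifold and its core as inverse limits\<close>

lemma inverse_sequence_W: "inverse_sequence W Y h (\<lambda>i \<xi>. \<xi> i)"
proof
  show "\<exists>x\<in>topspace W. \<forall>i. x i = y i" if "\<And>i. y i \<in> topspace Y" "\<And>i. h (y (Suc i)) = y i" for y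
    using that by (intro bexI[of _ y]) (auto simp: topspace_W)
qed (use compact_W Hausdorff_W compact_Y Hausdorff_Y h_continuous coordinate W_D in auto)

lemma the_continuous: "continuous_map (subtopology Y (Some ` (N - L))) (subtopology M (N - L)) the"
proof -
  have "continuous_map (subtopology Y (Some ` (N - L))) M the"
    unfolding continuous_map_def
  proof (intro conjI allI impI)
    have t: "topspace (subtopology Y (Some ` (N - L))) = Some ` (N - L)" by (auto simp: topspace_Y)
    show "the \<in> topspace (subtopology Y (Some ` (N - L))) \<rightarrow> topspace M" unfolding t using N(4) by auto
    fix U assume U: "openin M U"
    have "openin TN (U \<inter> N)" unfolding TN_def openin_subtopology using U by blast
    then have "openin Y (Some ` (U \<inter> N - L))" unfolding Y_eq using TN(4) by (rule openin_collapse_off)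
    moreover have "{x \<in> topspace (subtopology Y (Some ` (N - L))). the x \<in> U} = Some ` (U \<inter> N - L) \<inter> Some ` (N - L)"
      unfolding t by auto
    ultimately show "openin (subtopology Y (Some ` (N - L))) {x \<in> topspace (subtopology Y (Some ` (N - L))). the x \<in> U}"
      unfolding openin_subtopology by blast
  qed
  then show ?thesis by (auto simp: continuous_map_in_subtopology)
qed

lemma Some_continuous: "continuous_map (subtopology M (N - L)) Y Some"
proof -
  have "continuous_map (subtopology TN (N - L)) Y (collapse_proj L)"
    unfolding Y_eq by (intro continuous_map_from_subtopology continuous_collapse_proj)
  then have "continuous_map (subtopology M (N - L)) Y (collapse_proj L)"
    by (simp add: TN_def subtopology_subtopology Int_absorb1 Diff_subset)
  then show ?thesis by (rule continuous_map_eq) (auto simp: collapse_proj_def)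
qed

text \<open>The core consists of the backward orbits of \<open>f\<close> in \<open>X\<close>, so
  finite dimension passes from \<open>X\<close> to the core in the same degree.\<close>

lemma inverse_sequence_X: "inverse_sequence (subtopology W X') (subtopology M X) f (\<lambda>i \<xi>. the (\<xi> i))"
proof
  show "compact_space (subtopology W X')" "Hausdorff_space (subtopology W X')"
    using closedin_compact_space[OF compact_W closedin_X'] Hausdorff_W
    by (auto simp: compact_space_subtopology Hausdorff_space_subtopology)
  show "compact_space (subtopology M X)" "Hausdorff_space (subtopology M X)"
    using X_facts(1) Hausdorff_M by (auto simp: compact_space_subtopology Hausdorff_space_subtopology)
  show "continuous_map (subtopology M X) (subtopology M X) f"
    using f_continuous[OF X_facts(4)] X_facts(2) by (auto simp: continuous_map_in_subtopology)
  have XNL: "X \<subseteq> N - L" using X_facts(3,4) by blast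
  have tX: "topspace (subtopology W X') = X'" using X'_W by auto
  have val: "\<xi> i \<in> Some ` (N - L)" if "\<xi> \<in> X'" for \<xi> i
    using that image_mono[OF XNL, of Some] by (auto simp: X'_eq)
  show "continuous_map (subtopology W X') (subtopology M X) (\<lambda>\<xi>. the (\<xi> i))" for i
  proof -
    have "continuous_map (subtopology W X') (subtopology Y (Some ` (N - L))) (\<lambda>\<xi>. \<xi> i)"
      using continuous_map_from_subtopology[OF coordinate] val tX
      by (auto simp: continuous_map_in_subtopology)
    from continuous_map_compose[OF this the_continuous]
    have "continuous_map (subtopology W X') M (\<lambda>\<xi>. the (\<xi> i))"
      by (simp add: comp_def continuous_map_in_subtopology)
    moreover have "the (\<xi> i) \<in> X" if "\<xi> \<in> X'" for \<xi>
    proof -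
      have "\<xi> i \<in> Some ` X" using that unfolding X'_eq by blast
      then show ?thesis by auto
    qed
    ultimately show ?thesis using tX by (auto simp: continuous_map_in_subtopology)
  qed
  show "f (the (\<xi> (Suc i))) = the (\<xi> i)" if "\<xi> \<in> topspace (subtopology W X')" for i \<xi>
  proof -
    have \<xi>: "\<xi> \<in> X'" using that tX by simp
    obtain x y where xy: "\<xi> (Suc i) = Some x" "\<xi> i = Some y" using val[OF \<xi>, of "Suc i"] val[OF \<xi>, of i] by auto
    have "h (\<xi> (Suc i)) = \<xi> i" using \<xi> X'_W W_D by blast
    then show ?thesis unfolding xy h_Some by (simp split: if_splits)
  qed
  show "\<xi> = \<eta>" if "\<xi> \<in> topspace (subtopology W X')" "\<eta> \<in> topspace (subtopology W X')" "\<And>i. the (\<xi> i) = the (\<eta> i)" for \<xi> \<eta>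
  proof
    fix i
    show "\<xi> i = \<eta> i" using val[of \<xi> i] val[of \<eta> i] that(1,2) that(3)[of i] tX by auto
  qed
  show "\<exists>\<xi>\<in>topspace (subtopology W X'). \<forall>i. the (\<xi> i) = y i"
    if y: "\<And>i. y i \<in> topspace (subtopology M X)" "\<And>i. f (y (Suc i)) = y i" for y
  proof -
    have yX: "y i \<in> X" for i using y(1)[of i] by simp
    then have "(\<lambda>i. Some (y i)) \<in> X'"
      using XNL y(2) by (fastforce simp: X'_eq topspace_W topspace_Y h_Some)
    then show ?thesis using tX by (intro bexI[of _ "\<lambda>i. Some (y i)"]) auto
  qed
qed

text \<open>The shift of degree between the hypothesis on \<open>X\<close> and the conclusion on the
  quotient is that of the connecting map.\<close>

lemma finite_over_pair:
  assumes W: "finite_over (Bd W {} (Suc p)) (Zc W {} (Suc p) :: ((nat \<Rightarrow> 'a option) list \<Rightarrow> 'k::field) set)"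
    and X: "finite_over (Bd (subtopology M X) {} p) (Zc (subtopology M X) {} p :: ('a list \<Rightarrow> 'k) set)"
  shows "finite_over (Bd P.Q {} (Suc p)) (Zc P.Q {} (Suc p) :: ((nat \<Rightarrow> 'a option) option list \<Rightarrow> 'k) set)"
  by (rule P.finite_over_quotient[OF finite_over_relative[OF closedin_X' W
        inverse_sequence.finite_over_limit[OF inverse_sequence_X X]]])

end

section \<open>Independence of the index pair\<close>

text \<open>Compares unstable spaces of different index pairs: a thread of one corresponds to the
  thread of the other that eventually agrees with it. Late coordinates determine a thread, so there
  is at most one.\<close>

definition tail_map :: "(nat \<Rightarrow> 'b) topology \<Rightarrow> (nat \<Rightarrow> 'b) \<Rightarrow> (nat \<Rightarrow> 'b)" where
  "tail_map V \<xi> = (SOME \<eta>. \<eta> \<in> topspace V \<and> (\<exists>m. \<forall>i\<ge>m. \<xi> i = \<eta> i))"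

context index_system
begin

lemma tail_unique:
  assumes "\<xi> \<in> topspace W" "\<eta> \<in> topspace W" "\<forall>i\<ge>m. \<xi> i = \<eta> i"
  shows "\<xi> = \<eta>"
proof
  fix i
  show "\<xi> i = \<eta> i" using W_funpow[OF assms(1), of m i] W_funpow[OF assms(2), of m i] assms(3) by simp
qed

lemma tail_map_eq:
  assumes "\<eta> \<in> topspace W" "\<forall>i\<ge>m. \<xi> i = \<eta> i"
  shows "tail_map W \<xi> = \<eta>"
proof -
  have "\<exists>\<eta>. \<eta> \<in> topspace W \<and> (\<exists>m. \<forall>i\<ge>m. \<xi> i = \<eta> i)" using assms by blast
  from someI_ex[OF this] obtain m' where m': "tail_map W \<xi> \<in> topspace W" "\<forall>i\<ge>m'. \<xi> i = tail_map W \<xi> i"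
    unfolding tail_map_def by blast
  show ?thesis by (rule tail_unique[OF m'(1) assms(1), of "max m m'"]) (use m'(2) assms(2) in auto)
qed

lemma tail_map_inf: "tail_map W infty = infty"
  by (rule tail_map_eq[OF inf_W]) simp

end

locale two_pairs = S1: index_system M D f X N1 L1 + S2: index_system M D f X N2 L2
  for M :: "'a topology" and D f X N1 L1 N2 L2
begin

text \<open>A common neighbourhood of \<open>X\<close> on which both index maps follow
  \<open>f\<close>, as long as the image stays in it.\<close>

definition "G = (M interior_of S1.A - L1) \<inter> (M interior_of S2.A - L2)"

lemma G: "openin M G" "X \<subseteq> G" "G \<subseteq> N1 - L1" "G \<subseteq> N2 - L2"
  unfolding G_def using S1.core_nbhd S2.core_nbhd by (auto intro: openin_Int)

lemma openin_SomeG: "openin S1.Y (Some ` G)"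
proof -
  have "openin S1.TN G" unfolding S1.TN_def openin_subtopology using G(1,3) by (intro exI[of _ G]) auto
  then have "openin S1.Y (Some ` (G - L1))" unfolding S1.Y_eq using S1.TN(4) by (rule openin_collapse_off)
  moreover have "G - L1 = G" using G(3) by blast
  ultimately show ?thesis by simp
qed

text \<open>Away from infinity all coordinates from some uniform \<open>m\<close> on lie in
  \<open>G\<close>, since \<open>\<tau>\<close> repels towards the core. There the thread obeys both
  index maps, and the missing first coordinates are regenerated by iterating the second one.\<close>

lemma local_form:
  assumes K: "closedin S1.W K" "S1.infty \<notin> K"
  obtains m where "\<And>\<xi> i. \<xi> \<in> K \<Longrightarrow> \<xi> (i + m) \<in> Some ` G"
    "\<And>\<xi>. \<xi> \<in> K \<Longrightarrow> tail_map S2.W \<xi> = (\<lambda>i. (S2.h ^^ m) (\<xi> (i + m)))"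
    "\<And>\<xi>. \<xi> \<in> K \<Longrightarrow> (\<lambda>i. (S2.h ^^ m) (\<xi> (i + m))) \<in> topspace S2.W"
    "\<And>\<xi> i. \<xi> \<in> K \<Longrightarrow> m \<le> i \<Longrightarrow> (S2.h ^^ m) (\<xi> (i + m)) = \<xi> i"
proof -
  have "openin S1.W {\<xi> \<in> topspace S1.W. \<xi> 0 \<in> Some ` G}"
    using S1.coordinate[of 0] openin_SomeG by (simp add: continuous_map_def)
  moreover have "S1.X' \<subseteq> {\<xi> \<in> topspace S1.W. \<xi> 0 \<in> Some ` G}"
    using image_mono[OF G(2), of Some] by (auto simp: S1.X'_eq)
  ultimately obtain m where m: "\<And>n. m \<le> n \<Longrightarrow> (S1.\<tau> ^^ n) ` K \<subseteq> {\<xi> \<in> topspace S1.W. \<xi> 0 \<in> Some ` G}"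
    by (rule S1.repel[OF K]) (rule that)
  have inG: "\<xi> n \<in> Some ` G" if "\<xi> \<in> K" "m \<le> n" for \<xi> n
    using m[OF that(2)] that(1) unfolding S1.\<tau>_funpow by force
  have KW: "K \<subseteq> topspace S1.W" by (rule closedin_subset[OF K(1)])
  have step: "S2.h (\<xi> (Suc n)) = \<xi> n" if \<xi>: "\<xi> \<in> K" and n: "m \<le> n" for \<xi> n
  proof -
    obtain x y where xy: "\<xi> (Suc n) = Some x" "\<xi> n = Some y" "x \<in> G" "y \<in> G"
      using inG[OF \<xi> n] inG[OF \<xi>, of "Suc n"] n by auto
    have "S1.h (\<xi> (Suc n)) = \<xi> n" using \<xi> KW S1.W_D by blast
    then have "f x = y" unfolding xy S1.h_Some by (simp split: if_splits)
    then show ?thesis using xy(3,4) G(4) unfolding xy(1,2) S2.h_Some by auto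
  qed
  have iter: "(S2.h ^^ k) (\<xi> (i + k)) = \<xi> i" if "\<xi> \<in> K" "m \<le> i" for \<xi> i k
  proof (induction k)
    case (Suc k)
    have "S2.h (\<xi> (i + Suc k)) = \<xi> (i + k)" using step[OF that(1), of "i + k"] that(2) by simp
    then show ?case using Suc by (simp only: funpow_Suc_right comp_def)
  qed simp
  have top: "(\<lambda>i. (S2.h ^^ m) (\<xi> (i + m))) \<in> topspace S2.W" if \<xi>: "\<xi> \<in> K" for \<xi>
    unfolding S2.topspace_W
  proof (intro CollectI conjI allI)
    fix i
    have "\<xi> (i + m) \<in> topspace S2.Y" using inG[OF \<xi>, of "i + m"] G(4) by (auto simp: S2.topspace_Y)
    moreover have "(S2.h ^^ k) z \<in> topspace S2.Y" if "z \<in> topspace S2.Y" for k z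
      by (induction k) (use that S2.h_top in auto)
    ultimately show "(S2.h ^^ m) (\<xi> (i + m)) \<in> topspace S2.Y" by blast
    have "S2.h (\<xi> (Suc i + m)) = \<xi> (i + m)" using step[OF \<xi>, of "i + m"] by simp
    then show "S2.h ((S2.h ^^ m) (\<xi> (Suc i + m))) = (S2.h ^^ m) (\<xi> (i + m))" by (metis funpow_swap1)
  qed
  show thesis
  proof (rule that[of m])
    show "\<xi> (i + m) \<in> Some ` G" if "\<xi> \<in> K" for \<xi> i using inG[OF that] by simp
    show "(S2.h ^^ m) (\<xi> (i + m)) = \<xi> i" if "\<xi> \<in> K" "m \<le> i" for \<xi> i by (rule iter[OF that])
    show "tail_map S2.W \<xi> = (\<lambda>i. (S2.h ^^ m) (\<xi> (i + m)))" if "\<xi> \<in> K" for \<xi>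
      by (rule S2.tail_map_eq[OF top[OF that], of m]) (use iter[OF that] in auto)
  qed (rule top)
qed

lemma closed_nbhd:
  assumes "\<xi> \<in> topspace S1.W" "\<xi> \<noteq> S1.infty"
  obtains U K where "openin S1.W U" "closedin S1.W K" "\<xi> \<in> U" "U \<subseteq> K" "S1.infty \<notin> K"
proof -
  have reg: "regular_space S1.W" using S1.compact_W S1.Hausdorff_W by (simp add: compact_Hausdorff_or_regular_imp_normal_space
        normal_t1_imp_regular_space Hausdorff_imp_t1_space)
  have "closedin S1.W {S1.infty}" using S1.Hausdorff_W S1.inf_W by (simp add: closedin_Hausdorff_sing_eq)
  then have "openin S1.W (topspace S1.W - {S1.infty})" by blast
  moreover have "\<xi> \<in> topspace S1.W - {S1.infty}" using assms by blast
  ultimately obtain U K where "openin S1.W U" "closedin S1.W K" "\<xi> \<in> U" "U \<subseteq> K" "K \<subseteq> topspace S1.W - {S1.infty}"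
    using reg unfolding neighbourhood_base_of_closedin[symmetric] neighbourhood_base_of by meson
  then show thesis using that[of U K] by blast
qed

lemma tail_map_props:
  assumes "\<xi> \<in> topspace S1.W"
  shows "tail_map S2.W \<xi> \<in> topspace S2.W" "\<exists>m. \<forall>i\<ge>m. \<xi> i = tail_map S2.W \<xi> i"
proof -
  have "tail_map S2.W \<xi> \<in> topspace S2.W \<and> (\<exists>m. \<forall>i\<ge>m. \<xi> i = tail_map S2.W \<xi> i)"
  proof (cases "\<xi> = S1.infty")
    case True
    then show ?thesis using S2.tail_map_inf S2.inf_W by simp
  next
    case False
    obtain U K where K: "closedin S1.W K" "S1.infty \<notin> K" "\<xi> \<in> K" using closed_nbhd[OF assms False] by blast
    obtain m where m: "tail_map S2.W \<xi> = (\<lambda>i. (S2.h ^^ m) (\<xi> (i + m)))"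
      "(\<lambda>i. (S2.h ^^ m) (\<xi> (i + m))) \<in> topspace S2.W" "\<And>i. m \<le> i \<Longrightarrow> (S2.h ^^ m) (\<xi> (i + m)) = \<xi> i"
      using local_form[OF K(1,2)] K(3) by metis
    then show ?thesis by (metis (no_types, lifting))
  qed
  then show "tail_map S2.W \<xi> \<in> topspace S2.W" "\<exists>m. \<forall>i\<ge>m. \<xi> i = tail_map S2.W \<xi> i" by auto
qed

lemma tail_map_inverse:
  assumes "\<xi> \<in> topspace S1.W"
  shows "tail_map S1.W (tail_map S2.W \<xi>) = \<xi>"
proof -
  obtain m where "\<forall>i\<ge>m. \<xi> i = tail_map S2.W \<xi> i" using tail_map_props(2)[OF assms] by blast
  then show ?thesis by (intro S1.tail_map_eq[OF assms, of m]) simp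
qed

text \<open>Near a point other than infinity one \<open>m\<close> works throughout, so each
  coordinate of the tail map is a fixed iterate of the second index map applied to a fixed
  coordinate, read through \<open>M\<close>.\<close>

lemma tail_map_local:
  assumes \<xi>: "\<xi> \<in> topspace S1.W" "\<xi> \<noteq> S1.infty" and V: "openin S2.W V" "tail_map S2.W \<xi> \<in> V"
  obtains U where "openin S1.W U" "\<xi> \<in> U" "tail_map S2.W ` U \<subseteq> V"
proof -
  obtain U K where UK: "openin S1.W U" "closedin S1.W K" "\<xi> \<in> U" "U \<subseteq> K" "S1.infty \<notin> K"
    by (rule closed_nbhd[OF \<xi>])
  obtain m where m: "\<And>\<xi> i. \<xi> \<in> K \<Longrightarrow> \<xi> (i + m) \<in> Some ` G"
    "\<And>\<xi>. \<xi> \<in> K \<Longrightarrow> tail_map S2.W \<xi> = (\<lambda>i. (S2.h ^^ m) (\<xi> (i + m)))"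
    "\<And>\<xi>. \<xi> \<in> K \<Longrightarrow> (\<lambda>i. (S2.h ^^ m) (\<xi> (i + m))) \<in> topspace S2.W"
    by (rule local_form[OF UK(2,5)]) (rule that)
  have tU: "topspace (subtopology S1.W U) = U" using openin_subset[OF UK(1)] by auto
  have "continuous_map (subtopology S1.W U) S2.W (tail_map S2.W)"
  proof (rule S2.continuous_into_W)
    fix i
    have hm: "continuous_map S2.Y S2.Y (S2.h ^^ m)"
      by (induction m) (auto intro: continuous_map_compose[OF _ S2.h_continuous, unfolded comp_def])
    have "\<xi> (i + m) \<in> Some ` (N1 - L1)" if "\<xi> \<in> U" for \<xi>
      using m(1)[of \<xi> i] that UK(4) image_mono[OF G(3), of Some] by blast
    then have "continuous_map (subtopology S1.W U) (subtopology S1.Y (Some ` (N1 - L1))) (\<lambda>\<xi>. \<xi> (i + m))"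
      using continuous_map_from_subtopology[OF S1.coordinate] tU
      by (auto simp: continuous_map_in_subtopology)
    from continuous_map_compose[OF this S1.the_continuous]
    have "continuous_map (subtopology S1.W U) M (\<lambda>\<xi>. the (\<xi> (i + m)))"
      by (simp add: comp_def continuous_map_in_subtopology)
    moreover have "the (\<xi> (i + m)) \<in> N2 - L2" if "\<xi> \<in> U" for \<xi>
    proof -
      have "\<xi> (i + m) \<in> Some ` (N2 - L2)"
        using m(1)[of \<xi> i] that UK(4) image_mono[OF G(4), of Some] by blast
      then show ?thesis by auto
    qed
    ultimately have "continuous_map (subtopology S1.W U) (subtopology M (N2 - L2)) (\<lambda>\<xi>. the (\<xi> (i + m)))"
      using tU by (auto simp: continuous_map_in_subtopology)
    from continuous_map_compose[OF continuous_map_compose[OF this S2.Some_continuous] hm]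
    have "continuous_map (subtopology S1.W U) S2.Y (\<lambda>\<xi>. (S2.h ^^ m) (Some (the (\<xi> (i + m)))))"
      by (simp add: comp_def)
    then show "continuous_map (subtopology S1.W U) S2.Y (\<lambda>\<xi>. tail_map S2.W \<xi> i)"
    proof (rule continuous_map_eq)
      fix \<xi> assume "\<xi> \<in> topspace (subtopology S1.W U)"
      then have \<xi>K: "\<xi> \<in> K" using tU UK(4) by auto
      obtain x where "\<xi> (i + m) = Some x" using m(1)[OF \<xi>K, of i] by auto
      then show "(S2.h ^^ m) (Some (the (\<xi> (i + m)))) = tail_map S2.W \<xi> i" using m(2)[OF \<xi>K] by simp
    qed
  qed (use m(2,3) UK(4) tU in auto)
  from openin_continuous_map_preimage[OF this V(1)]
  have "openin (subtopology S1.W U) {\<zeta> \<in> U. tail_map S2.W \<zeta> \<in> V}" unfolding tU .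
  then have "openin S1.W {\<zeta> \<in> U. tail_map S2.W \<zeta> \<in> V}" by (rule openin_trans_full[OF _ UK(1)])
  then show thesis using that[of "{\<zeta> \<in> U. tail_map S2.W \<zeta> \<in> V}"] UK(3) V(2) by auto
qed

lemma tail_map_off_infinity:
  "continuous_map (subtopology S1.W (topspace S1.W - {S1.infty})) S2.W (tail_map S2.W)"
proof -
  have o: "openin S1.W (topspace S1.W - {S1.infty})"
    using S1.Hausdorff_W S1.inf_W by (intro openin_diff) (auto simp: closedin_Hausdorff_sing_eq)
  have t: "topspace (subtopology S1.W (topspace S1.W - {S1.infty})) = topspace S1.W - {S1.infty}" by auto
  show ?thesis
    unfolding continuous_map_def t
  proof (intro conjI allI impI)
    show "tail_map S2.W \<in> topspace S1.W - {S1.infty} \<rightarrow> topspace S2.W" using tail_map_props(1) by auto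
    fix V assume V: "openin S2.W V"
    have "openin S1.W {x \<in> topspace S1.W - {S1.infty}. tail_map S2.W x \<in> V}"
    proof (subst openin_subopen, intro ballI)
      fix \<xi> assume \<xi>: "\<xi> \<in> {x \<in> topspace S1.W - {S1.infty}. tail_map S2.W x \<in> V}"
      then obtain U where U: "openin S1.W U" "\<xi> \<in> U" "tail_map S2.W ` U \<subseteq> V"
        using tail_map_local[OF _ _ V] by blast
      then show "\<exists>T. openin S1.W T \<and> \<xi> \<in> T \<and> T \<subseteq> {x \<in> topspace S1.W - {S1.infty}. tail_map S2.W x \<in> V}"
        using o \<xi> openin_subset[OF U(1)] by (intro exI[of _ "U \<inter> (topspace S1.W - {S1.infty})"]) (auto intro: openin_Int)
    qed
    then show "openin (subtopology S1.W (topspace S1.W - {S1.infty})) {x \<in> topspace S1.W - {S1.infty}. tail_map S2.W x \<in> V}"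
      using openin_open_subtopology[OF o] by blast
  qed
qed

end

text \<open>At infinity no uniform \<open>m\<close> exists. A closed set avoiding infinity is
  compact, and its preimage is its image under the inverse tail map, which is continuous there; so
  the preimage is compact and closed. For closed sets through infinity the local form
  suffices.\<close>

lemma tail_map_continuous:
  assumes "two_pairs M D f X N1 L1 N2 L2"
  shows "continuous_map (unstable_space M f N1 L1) (unstable_space M f N2 L2) (tail_map (unstable_space M f N2 L2))"
proof -
  interpret two_pairs M D f X N1 L1 N2 L2 by fact
  interpret swap: two_pairs M D f X N2 L2 N1 L1 by unfold_locales
  have "continuous_map S1.W S2.W (tail_map S2.W)"
    unfolding continuous_map_closedin
  proof (intro conjI allI impI)
    show "tail_map S2.W \<in> topspace S1.W \<rightarrow> topspace S2.W" using tail_map_props(1) by auto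
    fix K assume K: "closedin S2.W K"
    have KW: "K \<subseteq> topspace S2.W" by (rule closedin_subset[OF K])
    show "closedin S1.W {x \<in> topspace S1.W. tail_map S2.W x \<in> K}"
    proof (cases "S1.infty \<in> K")
      case True
      have "openin S1.W {x \<in> topspace S1.W. tail_map S2.W x \<notin> K}"
      proof (subst openin_subopen, intro ballI)
        fix \<xi> assume \<xi>: "\<xi> \<in> {x \<in> topspace S1.W. tail_map S2.W x \<notin> K}"
        then have \<xi>': "\<xi> \<in> topspace S1.W" "\<xi> \<noteq> S1.infty" using S2.tail_map_inf True by auto
        have "openin S2.W (topspace S2.W - K)" using K by blast
        moreover have "tail_map S2.W \<xi> \<in> topspace S2.W - K" using \<xi> tail_map_props(1) by auto
        ultimately obtain U where "openin S1.W U" "\<xi> \<in> U" "tail_map S2.W ` U \<subseteq> topspace S2.W - K"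
          by (rule tail_map_local[OF \<xi>'])
        then show "\<exists>T. openin S1.W T \<and> \<xi> \<in> T \<and> T \<subseteq> {x \<in> topspace S1.W. tail_map S2.W x \<notin> K}"
          using openin_subset by (intro exI[of _ U]) auto
      qed
      then have "closedin S1.W (topspace S1.W - {x \<in> topspace S1.W. tail_map S2.W x \<notin> K})"
        by (rule closedin_diff[OF closedin_topspace])
      moreover have "topspace S1.W - {x \<in> topspace S1.W. tail_map S2.W x \<notin> K} = {x \<in> topspace S1.W. tail_map S2.W x \<in> K}"
        by blast
      ultimately show ?thesis by (rule back_subst)
    next
      case False
      have "compactin S2.W K" by (rule closedin_compact_space[OF S2.compact_W K])
      then have "compactin (subtopology S2.W (topspace S2.W - {S1.infty})) K"
        using KW False by (simp add: compactin_subtopology subset_Diff_insert)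
      then have "compactin S1.W (tail_map S1.W ` K)" by (rule image_compactin[OF _ swap.tail_map_off_infinity])
      then have "closedin S1.W (tail_map S1.W ` K)" by (rule compactin_imp_closedin[OF S1.Hausdorff_W])
      moreover have "{x \<in> topspace S1.W. tail_map S2.W x \<in> K} = tail_map S1.W ` K"
      proof (intro equalityI subsetI)
        fix x assume "x \<in> {x \<in> topspace S1.W. tail_map S2.W x \<in> K}"
        then show "x \<in> tail_map S1.W ` K" using tail_map_inverse by (metis (mono_tags, lifting) imageI mem_Collect_eq)
      next
        fix x assume "x \<in> tail_map S1.W ` K"
        then obtain y where "y \<in> K" "x = tail_map S1.W y" by blast
        then show "x \<in> {x \<in> topspace S1.W. tail_map S2.W x \<in> K}"
          using swap.tail_map_inverse swap.tail_map_props(1) KW by auto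
      qed
      ultimately show ?thesis by simp
    qed
  qed
  then show ?thesis by (simp add: S1.W_def S2.W_def)
qed

text \<open>The tail maps are mutually inverse and continuous, so every cocycle on the first
  unstable space is, up to a coboundary, pulled back from the second.\<close>

lemma finite_over_unstable_space:
  assumes tp: "two_pairs M D f X N1 L1 N2 L2"
    and fd: "finite_over (Bd (index_space M N2 L2) {} q) (Zc (index_space M N2 L2) {} q :: ('a option list \<Rightarrow> 'k::field) set)"
  shows "finite_over (Bd (unstable_space M f N1 L1) {} q)
     (Zc (unstable_space M f N1 L1) {} q :: ((nat \<Rightarrow> 'a option) list \<Rightarrow> 'k) set)"
proof -
  interpret two_pairs M D f X N1 L1 N2 L2 by fact
  interpret swap: two_pairs M D f X N2 L2 N1 L1 by unfold_locales
  have c1: "continuous_map S1.W S2.W (tail_map S2.W)" and c2: "continuous_map S2.W S1.W (tail_map S1.W)"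
    using tail_map_continuous[OF tp] tail_map_continuous[OF swap.two_pairs_axioms] by (auto simp: S1.W_def S2.W_def)
  have "finite_over (Bd S2.W {} q) (Zc S2.W {} q :: ((nat \<Rightarrow> 'a option) list \<Rightarrow> 'k) set)"
    by (rule inverse_sequence.finite_over_limit[OF S2.inverse_sequence_W fd[folded S2.Y_def]])
  then have "finite_over (Bd S1.W {} q) (Zc S1.W {} q :: ((nat \<Rightarrow> 'a option) list \<Rightarrow> 'k) set)"
  proof (rule finite_over_image[of "\<lambda>\<phi> xs. \<phi> (map (tail_map S2.W) xs)", rotated 2])
    show "(\<lambda>\<phi> xs. \<phi> (map (tail_map S2.W) xs)) ` Bd S2.W {} q \<subseteq> (Bd S1.W {} q :: ((nat \<Rightarrow> 'a option) list \<Rightarrow> 'k) set)"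
      using Bd_map[OF c1] by blast
    show "Zc S1.W {} q \<subseteq> fvs.span ((\<lambda>\<phi> xs. \<phi> (map (tail_map S2.W) xs)) ` Zc S2.W {} q \<union> Bd S1.W {} q :: ((nat \<Rightarrow> 'a option) list \<Rightarrow> 'k) set)"
      (is "_ \<subseteq> ?R")
    proof
      fix u :: "(nat \<Rightarrow> 'a option) list \<Rightarrow> 'k" assume u: "u \<in> Zc S1.W {} q"
      have v: "(\<lambda>xs. u (map (tail_map S1.W) xs)) \<in> Zc S2.W {} q" by (rule Zc_map[OF c2 _ u]) auto
      have 1: "(\<lambda>xs. u (map (tail_map S1.W) (map (tail_map S2.W) xs))) \<in> ?R"
        by (rule fvs.span_base, rule UnI1, rule image_eqI[OF _ v]) (rule refl)
      have "eventually (\<lambda>xs. length xs = Suc q \<longrightarrow> u xs = u (map (tail_map S1.W) (map (tail_map S2.W) xs))) (smalls S1.W)"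
        using eventually_smalls_topspace
      proof (rule eventually_mono, intro impI)
        fix xs assume "xs \<noteq> [] \<and> set xs \<subseteq> topspace S1.W"
        then have "map (tail_map S1.W) (map (tail_map S2.W) xs) = map (\<lambda>x. x) xs"
          unfolding map_map comp_def using tail_map_inverse by (intro map_cong) auto
        then show "u xs = u (map (tail_map S1.W) (map (tail_map S2.W) xs))" by simp
      qed
      then have "u - (\<lambda>xs. u (map (tail_map S1.W) (map (tail_map S2.W) xs))) \<in> Bd S1.W {} q"
        by (rule small_eq_imp_Bd)
      then have 2: "u - (\<lambda>xs. u (map (tail_map S1.W) (map (tail_map S2.W) xs))) \<in> ?R"
        by (intro fvs.span_base) blast
      show "u \<in> ?R" using fvs.span_add[OF 2 1] by simp
    qed
  qed (auto simp: plus_fun_def fscale_def)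
  then show ?thesis by (simp add: S1.W_def)
qed

section \<open>The isomorphism\<close>

context index_system
begin

text \<open>Restriction to the closures, after transport of the class to the quotient by excision. A
  representative on the quotient is chosen; \<open>class_map_eval\<close> shows that the choice is
  immaterial.\<close>

definition class_map :: "nat \<Rightarrow> (nat \<Rightarrow> 'a option, 'k::field) cech_class \<Rightarrow>
    (nat \<Rightarrow> 'a option) set \<Rightarrow> ((nat \<Rightarrow> 'a option) option, 'k) cech_class" where
  "class_map q x = (\<lambda>F\<in>Ess. compact_pair.cclass (collapsed_closure M f N L X F) {} q
     (SOME \<phi>. \<phi> \<in> Zc P.Q {None} q \<and> x = P.cclass q (\<lambda>xs. \<phi> (map P.proj xs))))"

lemma pulled: "\<phi> \<in> Zc P.Q {None} q \<Longrightarrow> (\<lambda>xs. \<phi> (map P.proj xs)) \<in> Zc W X' q"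
  by (rule Zc_map[OF P.proj_Q P.proj_A])

lemma restricted: "\<phi> \<in> Zc P.Q B q \<Longrightarrow> F \<in> Ess \<Longrightarrow> \<phi> \<in> Zc (collapsed_closure M f N L X F) {} q"
  unfolding collapsed_closure_eq by (rule Zc_restrict) auto

lemma carrier_H:
  assumes "x \<in> carrier (cech W X' q)"
  obtains \<phi> where "\<phi> \<in> Zc P.Q {None} q" "x = P.cclass q (\<lambda>xs. \<phi> (map P.proj xs))"
proof -
  obtain u where u: "u \<in> Zc W X' q" "x = P.cclass q u" using assms unfolding P.carrier_cech by blast
  obtain \<phi> where \<phi>: "\<phi> \<in> Zc P.Q {None} q" "u - (\<lambda>xs. \<phi> (map P.proj xs)) \<in> Bd W X' q"
    by (rule P.excision_surj[OF u(1)])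
  then have "x = P.cclass q (\<lambda>xs. \<phi> (map P.proj xs))" using P.cclass_eq_iff[OF u(1) pulled[OF \<phi>(1)]] u(2) by simp
  with \<phi>(1) show thesis by (rule that)
qed

text \<open>Two representatives of one class differ by an absolute coboundary on the quotient, by
  \<open>excision_inj\<close>, and this restricts to every closure.\<close>

lemma class_map_eval:
  assumes \<phi>: "\<phi> \<in> Zc P.Q {None} (Suc p)"
  shows "class_map (Suc p) (P.cclass (Suc p) (\<lambda>xs. \<phi> (map P.proj xs))) =
    (\<lambda>F\<in>Ess. compact_pair.cclass (collapsed_closure M f N L X F) {} (Suc p) \<phi>)"
proof -
  let ?x = "P.cclass (Suc p) (\<lambda>xs. \<phi> (map P.proj xs))"
  define \<psi> where "\<psi> = (SOME \<psi>. \<psi> \<in> Zc P.Q {None} (Suc p) \<and> ?x = P.cclass (Suc p) (\<lambda>xs. \<psi> (map P.proj xs)))"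
  have "\<exists>\<psi>. \<psi> \<in> Zc P.Q {None} (Suc p) \<and> ?x = P.cclass (Suc p) (\<lambda>xs. \<psi> (map P.proj xs))" using \<phi> by blast
  from someI_ex[OF this] have \<psi>: "\<psi> \<in> Zc P.Q {None} (Suc p)" "?x = P.cclass (Suc p) (\<lambda>xs. \<psi> (map P.proj xs))"
    unfolding \<psi>_def by auto
  have "(\<lambda>xs. \<phi> (map P.proj xs)) - (\<lambda>xs. \<psi> (map P.proj xs)) \<in> Bd W X' (Suc p)"
    using P.cclass_eq_iff[OF pulled[OF \<phi>] pulled[OF \<psi>(1)]] \<psi>(2) by simp
  then have "(\<lambda>xs. (\<phi> - \<psi>) (map P.proj xs)) \<in> Bd W X' (Suc p)" by (simp add: fun_diff_def)
  then have d: "\<phi> - \<psi> \<in> Bd P.Q {} (Suc p)"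
    using fvs.subspace_diff[OF subspace_Zc \<phi> \<psi>(1)] by (intro P.excision_inj)
  have "compact_pair.cclass (collapsed_closure M f N L X F) {} (Suc p) \<phi> =
      compact_pair.cclass (collapsed_closure M f N L X F) {} (Suc p) \<psi>" if F: "F \<in> Ess" for F
  proof -
    have "\<phi> - \<psi> \<in> Bd (collapsed_closure M f N L X F) {} (Suc p)"
      unfolding collapsed_closure_eq[OF F] using d by (rule Bd_restrict) auto
    then show ?thesis
      using compact_pair.cclass_eq_iff[OF compact_pair_closure[OF F] restricted[OF \<phi> F] restricted[OF \<psi>(1) F]] by simp
  qed
  then show ?thesis unfolding class_map_def \<psi>_def[symmetric] by (intro restrict_ext) simp
qed

lemma shift_Ess:
  assumes "F \<in> Ess"
  shows "\<sigma> ` F \<in> Ess" "gQ ` Some ` F = Some ` \<sigma> ` F"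
proof -
  have FW: "F \<subseteq> W'" by (rule Ess_sub[OF assms])
  have FX: "\<xi> \<in> topspace W" "\<xi> \<notin> X'" if "\<xi> \<in> F" for \<xi> using FW that by (auto simp: W'_def)
  have SF: "Some ` F \<in> T.essential" using essential_eq assms by blast
  have e: "gQ ` Some ` F \<in> T.essential" by (rule T.essential_image[OF end_homeo_gQ SF])
  have gs: "gQ (Some \<xi>) = P.proj (\<sigma> \<xi>)" if "\<xi> \<in> F" for \<xi>
    using gQ_proj[OF FX(1)[OF that]] FX(2)[OF that] by (simp add: collapse_proj_def)
  have "gQ (Some \<xi>) = Some (\<sigma> \<xi>)" if "\<xi> \<in> F" for \<xi>
  proof -
    have "gQ (Some \<xi>) \<in> T.E" using T.quasi_sub[OF T.essential_quasi[OF e]] that by blast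
    then show ?thesis using gs[OF that] by (auto simp: E_eq collapse_proj_def split: if_splits)
  qed
  then show eq: "gQ ` Some ` F = Some ` \<sigma> ` F" by (force simp: image_image)
  obtain F' where "F' \<in> Ess" "Some ` \<sigma> ` F = Some ` F'" using e unfolding eq essential_eq by blast
  then show "\<sigma> ` F \<in> Ess" by (simp add: inj_image_eq_iff)
qed

text \<open>Both sides are represented by the pull-back of \<open>\<phi>\<close> under
  \<open>gQ\<close>, the map that the shift induces on the quotient.\<close>

lemma class_map_shift:
  fixes x :: "(nat \<Rightarrow> 'a option, 'k::field) cech_class"
  assumes "x \<in> carrier (cech W X' (Suc p))"
  shows "class_map (Suc p) (cech_map W X' (Suc p) \<sigma> x) = quasicomponent_sum_map M f N L X (Suc p) (class_map (Suc p) x)"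
proof -
  obtain \<phi> where \<phi>: "\<phi> \<in> Zc P.Q {None} (Suc p)" "x = P.cclass (Suc p) (\<lambda>xs. \<phi> (map P.proj xs))"
    by (rule carrier_H[OF assms])
  have gc: "continuous_map P.Q P.Q gQ" by (rule T.end_homeo_continuous[OF end_homeo_gQ])
  have g\<phi>: "(\<lambda>xs. \<phi> (map gQ xs)) \<in> Zc P.Q {None} (Suc p)"
    by (rule Zc_map[OF gc _ \<phi>(1)]) (auto simp: gQ_None)
  have \<sigma>X: "\<sigma> ` X' \<subseteq> X'" using \<sigma>_X' by blast
  have "cech_map W X' (Suc p) \<sigma> x = P.cclass (Suc p) (\<lambda>xs. \<phi> (map P.proj (map \<sigma> xs)))"
    unfolding \<phi>(2) by (rule cech_map_cclass[OF P.compact_pair_axioms P.compact_pair_axioms \<sigma>_continuous \<sigma>X pulled[OF \<phi>(1)]])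
  also have "\<dots> = P.cclass (Suc p) (\<lambda>xs. \<phi> (map gQ (map P.proj xs)))"
  proof (subst P.cclass_eq_iff)
    show "(\<lambda>xs. \<phi> (map P.proj (map \<sigma> xs))) \<in> Zc W X' (Suc p)"
      by (rule Zc_map[OF \<sigma>_continuous _ pulled[OF \<phi>(1)]]) (use \<sigma>X in auto)
    show "(\<lambda>xs. \<phi> (map gQ (map P.proj xs))) \<in> Zc W X' (Suc p)" by (rule pulled[OF g\<phi>])
    have "eventually (\<lambda>xs. length xs = Suc (Suc p) \<longrightarrow> \<phi> (map P.proj (map \<sigma> xs)) = \<phi> (map gQ (map P.proj xs))) (smalls W)"
      using eventually_smalls_topspace
    proof (rule eventually_mono, intro impI)
      fix xs assume "xs \<noteq> [] \<and> set xs \<subseteq> topspace W"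
      then have "map P.proj (map \<sigma> xs) = map gQ (map P.proj xs)"
        unfolding map_map comp_def using gQ_proj by (intro map_cong) auto
      then show "\<phi> (map P.proj (map \<sigma> xs)) = \<phi> (map gQ (map P.proj xs))" by (rule arg_cong)
    qed
    then show "(\<lambda>xs. \<phi> (map P.proj (map \<sigma> xs))) - (\<lambda>xs. \<phi> (map gQ (map P.proj xs))) \<in> Bd W X' (Suc p)"
      by (rule small_eq_imp_Bd)
  qed
  finally have 1: "class_map (Suc p) (cech_map W X' (Suc p) \<sigma> x) =
      (\<lambda>F\<in>Ess. compact_pair.cclass (collapsed_closure M f N L X F) {} (Suc p) (\<lambda>xs. \<phi> (map gQ xs)))"
    using class_map_eval[OF g\<phi>] by simp
  have *: "cech_map (collapsed_closure M f N L X F) {} (Suc p) gQ (class_map (Suc p) x (\<sigma> ` F)) =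
      compact_pair.cclass (collapsed_closure M f N L X F) {} (Suc p) (\<lambda>xs. \<phi> (map gQ xs))" if F: "F \<in> Ess" for F
  proof -
    have \<sigma>F: "\<sigma> ` F \<in> Ess" by (rule shift_Ess(1)[OF F])
    have "class_map (Suc p) x (\<sigma> ` F) = compact_pair.cclass (collapsed_closure M f N L X (\<sigma> ` F)) {} (Suc p) \<phi>"
      unfolding \<phi>(2) class_map_eval[OF \<phi>(1)] using \<sigma>F by simp
    moreover have "continuous_map (collapsed_closure M f N L X F) (collapsed_closure M f N L X (\<sigma> ` F)) gQ"
      unfolding collapsed_closure_eq[OF F] collapsed_closure_eq[OF \<sigma>F]
    proof (intro continuous_map_into_subtopology continuous_map_from_subtopology gc)
      have s: "gQ ` (Some ` F \<union> {None, Some infty}) \<subseteq> Some ` \<sigma> ` F \<union> {None, Some infty}"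
        unfolding image_Un shift_Ess(2)[OF F] using T.end_homeo_ends[OF end_homeo_gQ] by auto
      show "gQ \<in> topspace (subtopology P.Q (Some ` F \<union> {None, Some infty})) \<rightarrow> Some ` \<sigma> ` F \<union> {None, Some infty}"
        unfolding topspace_subtopology by (rule Pi_I, drule IntD2) (rule subsetD[OF s imageI])
    qed
    ultimately show ?thesis
      using cech_map_cclass[OF compact_pair_closure[OF F] compact_pair_closure[OF \<sigma>F] _ _ restricted[OF \<phi>(1) \<sigma>F]] by simp
  qed
  show ?thesis
    unfolding quasicomponent_sum_map_def \<sigma>_def[symmetric] X'_def[symmetric] gQ_def[symmetric] 1
    by (rule restrict_ext) (simp add: *)
qed

lemma class_map_iso:
  fixes p :: nat and S :: "('k::field, (nat \<Rightarrow> 'a option) set \<Rightarrow> ((nat \<Rightarrow> 'a option) option, 'k) cech_class) module"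
  defines "S \<equiv> quasicomponent_sum M f N L X (Suc (Suc p))"
  assumes fin: "finite Ess"
    and fd: "finite_over (Bd P.Q {} (Suc (Suc p))) (Zc P.Q {} (Suc (Suc p)) :: ((nat \<Rightarrow> 'a option) option list \<Rightarrow> 'k) set)"
  shows "class_map (Suc (Suc p)) \<in> LinearCombinations.module_hom class_ring (cech W X' (Suc (Suc p))) S"
    and "bij_betw (class_map (Suc (Suc p))) (carrier (cech W X' (Suc (Suc p)))) (carrier S)"
proof -
  let ?q = "Suc (Suc p)"
  let ?H = "cech W X' ?q :: ('k, (nat \<Rightarrow> 'a option, 'k) cech_class) module"
  let ?C = "\<lambda>F. collapsed_closure M f N L X F"
  let ?c = "\<lambda>F. compact_pair.cclass (?C F) {} ?q"
  have S_carrier: "carrier S = (\<Pi>\<^sub>E F\<in>Ess. carrier (cech (?C F) {} ?q))"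
    using fin by (auto simp: S_def quasicomponent_sum_def module_direct_sum_def)
  have S_add: "c \<oplus>\<^bsub>S\<^esub> d = (\<lambda>F\<in>Ess. c F \<oplus>\<^bsub>cech (?C F) {} ?q\<^esub> d F)" for c d
    by (simp add: S_def quasicomponent_sum_def module_direct_sum_def)
  have S_smult: "k \<odot>\<^bsub>S\<^esub> c = (\<lambda>F\<in>Ess. k \<odot>\<^bsub>cech (?C F) {} ?q\<^esub> c F)" for k c
    by (simp add: S_def quasicomponent_sum_def module_direct_sum_def)
  have finT: "finite T.essential" using fin essential_eq by simp
  have closed: "class_map ?q x \<in> carrier S" if x: "x \<in> carrier ?H" for x
  proof -
    obtain \<phi> where \<phi>: "\<phi> \<in> Zc P.Q {None} ?q" "x = P.cclass ?q (\<lambda>xs. \<phi> (map P.proj xs))"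
      by (rule carrier_H[OF x])
    show ?thesis
      unfolding \<phi>(2) class_map_eval[OF \<phi>(1)] S_carrier
      using compact_pair.cclass_carrier[OF compact_pair_closure restricted[OF \<phi>(1)]] by auto
  qed
  have add: "class_map ?q (x \<oplus>\<^bsub>?H\<^esub> y) = class_map ?q x \<oplus>\<^bsub>S\<^esub> class_map ?q y"
    if xy: "x \<in> carrier ?H" "y \<in> carrier ?H" for x y
  proof -
    obtain \<phi> where \<phi>: "\<phi> \<in> Zc P.Q {None} ?q" "x = P.cclass ?q (\<lambda>xs. \<phi> (map P.proj xs))"
      by (rule carrier_H[OF xy(1)])
    obtain \<psi> where \<psi>: "\<psi> \<in> Zc P.Q {None} ?q" "y = P.cclass ?q (\<lambda>xs. \<psi> (map P.proj xs))"
      by (rule carrier_H[OF xy(2)])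
    have s: "\<phi> + \<psi> \<in> Zc P.Q {None} ?q" by (rule fvs.subspace_add[OF subspace_Zc \<phi>(1) \<psi>(1)])
    have "x \<oplus>\<^bsub>?H\<^esub> y = P.cclass ?q (\<lambda>xs. (\<phi> + \<psi>) (map P.proj xs))"
      unfolding \<phi>(2) \<psi>(2) P.cech_add[OF pulled[OF \<phi>(1)] pulled[OF \<psi>(1)]] by (simp add: plus_fun_def)
    then have "class_map ?q (x \<oplus>\<^bsub>?H\<^esub> y) = (\<lambda>F\<in>Ess. ?c F (\<phi> + \<psi>))" using class_map_eval[OF s] by simp
    also have "\<dots> = class_map ?q x \<oplus>\<^bsub>S\<^esub> class_map ?q y"
      unfolding S_add \<phi>(2) \<psi>(2) class_map_eval[OF \<phi>(1)] class_map_eval[OF \<psi>(1)]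
      using compact_pair.cech_add[OF compact_pair_closure restricted[OF \<phi>(1)] restricted[OF \<psi>(1)]]
      by (intro restrict_ext) simp
    finally show ?thesis .
  qed
  have smult: "class_map ?q (k \<odot>\<^bsub>?H\<^esub> x) = k \<odot>\<^bsub>S\<^esub> class_map ?q x" if x: "x \<in> carrier ?H" for k x
  proof -
    obtain \<phi> where \<phi>: "\<phi> \<in> Zc P.Q {None} ?q" "x = P.cclass ?q (\<lambda>xs. \<phi> (map P.proj xs))"
      by (rule carrier_H[OF x])
    have s: "k *s \<phi> \<in> Zc P.Q {None} ?q" by (rule fvs.subspace_scale[OF subspace_Zc \<phi>(1)])
    have "k \<odot>\<^bsub>?H\<^esub> x = P.cclass ?q (\<lambda>xs. (k *s \<phi>) (map P.proj xs))"
      unfolding \<phi>(2) P.cech_smult[OF pulled[OF \<phi>(1)]] by (simp add: fscale_def)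
    then have "class_map ?q (k \<odot>\<^bsub>?H\<^esub> x) = (\<lambda>F\<in>Ess. ?c F (k *s \<phi>))" using class_map_eval[OF s] by simp
    also have "\<dots> = k \<odot>\<^bsub>S\<^esub> class_map ?q x"
      unfolding S_smult \<phi>(2) class_map_eval[OF \<phi>(1)]
      using compact_pair.cech_smult[OF compact_pair_closure restricted[OF \<phi>(1)]]
      by (intro restrict_ext) simp
    finally show ?thesis .
  qed
  show "class_map ?q \<in> LinearCombinations.module_hom class_ring ?H S"
    unfolding module_hom_def using closed add smult by auto
  show "bij_betw (class_map ?q) (carrier ?H) (carrier S)"
    unfolding bij_betw_def
  proof
    show "inj_on (class_map ?q) (carrier ?H)"
    proof (rule inj_onI)
      fix x y assume xy: "x \<in> carrier ?H" "y \<in> carrier ?H" "class_map ?q x = class_map ?q y"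
      obtain \<phi> where \<phi>: "\<phi> \<in> Zc P.Q {None} ?q" "x = P.cclass ?q (\<lambda>xs. \<phi> (map P.proj xs))"
        by (rule carrier_H[OF xy(1)])
      obtain \<psi> where \<psi>: "\<psi> \<in> Zc P.Q {None} ?q" "y = P.cclass ?q (\<lambda>xs. \<psi> (map P.proj xs))"
        by (rule carrier_H[OF xy(2)])
      have dZ: "\<phi> - \<psi> \<in> Zc P.Q {None} ?q" by (rule fvs.subspace_diff[OF subspace_Zc \<phi>(1) \<psi>(1)])
      have "\<phi> - \<psi> \<in> Bd (subtopology P.Q (F \<union> {None, Some infty})) {} ?q" if F: "F \<in> T.essential" for F
      proof -
        obtain F' where F': "F' \<in> Ess" "F = Some ` F'" using F essential_eq by blast
        have "?c F' \<phi> = ?c F' \<psi>"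
          using fun_cong[OF xy(3), of F'] F'(1)
          unfolding \<phi>(2) \<psi>(2) class_map_eval[OF \<phi>(1)] class_map_eval[OF \<psi>(1)] by simp
        then show ?thesis
          using compact_pair.cclass_eq_iff[OF compact_pair_closure[OF F'(1)] restricted[OF \<phi>(1) F'(1)] restricted[OF \<psi>(1) F'(1)]]
          unfolding collapsed_closure_eq[OF F'(1)] F'(2) by simp
      qed
      moreover have "\<phi> - \<psi> \<in> Zc P.Q {} ?q" using dZ Zc_mono[of "{}" "{None}" P.Q ?q] by blast
      ultimately have v: "\<phi> - \<psi> \<in> T.vanishing ?q" unfolding T.vanishing_def by blast
      \<comment> \<open>Attraction to infinity and repulsion towards the collapsed core are what the
        triviality of vanishing classes requires.\<close>
      have "\<phi> - \<psi> \<in> Bd P.Q {} ?q"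
        by (rule T.vanishing_is_trivial[OF end_homeo_gQ _ _ finT fd v]) (rule attract_Q repel_Q; assumption)+
      then have "(\<lambda>xs. (\<phi> - \<psi>) (map P.proj xs)) \<in> Bd W X' ?q" by (rule P.excision_Bd[OF dZ])
      then show "x = y"
        unfolding \<phi>(2) \<psi>(2) P.cclass_eq_iff[OF pulled[OF \<phi>(1)] pulled[OF \<psi>(1)]] by (simp add: fun_diff_def)
    qed
    show "class_map ?q ` carrier ?H = carrier S"
    proof
      show "class_map ?q ` carrier ?H \<subseteq> carrier S" using closed by blast
      show "carrier S \<subseteq> class_map ?q ` carrier ?H"
      proof
        fix c assume c: "c \<in> carrier S"
        have "\<exists>\<phi>\<in>Zc (?C F) {} ?q. c F = ?c F \<phi>" if "F \<in> Ess" for F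
        proof -
          have "c F \<in> carrier (cech (?C F) {} ?q)" using c that unfolding S_carrier by (rule PiE_mem)
          then show ?thesis unfolding compact_pair.carrier_cech[OF compact_pair_closure[OF that]] by blast
        qed
        then obtain \<phi> where \<phi>: "\<And>F. F \<in> Ess \<Longrightarrow> \<phi> F \<in> Zc (?C F) {} ?q \<and> c F = ?c F (\<phi> F)" by metis
        \<comment> \<open>Essential sets of the quotient are images under \<open>Some\<close>, which
          \<open>the\<close> undoes.\<close>
        define \<phi>' where "\<phi>' = (\<lambda>F. \<phi> (the ` F))"
        have th: "the ` Some ` F = F" for F :: "(nat \<Rightarrow> 'a option) set" by (simp add: image_image)
        have "\<phi>' F \<in> Zc (subtopology P.Q (F \<union> {None, Some infty})) {} ?q" if F: "F \<in> T.essential" for F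
        proof -
          obtain F' where F': "F' \<in> Ess" "F = Some ` F'" using F essential_eq by blast
          show ?thesis
            using conjunct1[OF \<phi>[OF F'(1)]] unfolding collapsed_closure_eq[OF F'(1)] \<phi>'_def F'(2) th .
        qed
        then obtain \<eta> where \<eta>: "\<eta> \<in> Zc P.Q {} ?q"
          "\<And>F. F \<in> T.essential \<Longrightarrow> \<eta> - \<phi>' F \<in> Bd (subtopology P.Q (F \<union> {None, Some infty})) {} ?q"
          by (rule T.extend_from_essential[OF finT, of \<phi>' "Suc p"]) (assumption, rule that)
        \<comment> \<open>A coboundary is spent to make the extension vanish at the collapsed point,
          so that it defines a class relative to the core.\<close>
        obtain \<theta> where \<theta>: "\<theta> \<in> Zc P.Q {None} ?q" "\<eta> - \<theta> \<in> Bd P.Q {} ?q" by (rule P.Zc_normalize[OF \<eta>(1)])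
        have "?c F \<theta> = c F" if F: "F \<in> Ess" for F
        proof -
          have SF: "Some ` F \<in> T.essential" using essential_eq F by blast
          have "\<eta> - \<phi> F \<in> Bd (?C F) {} ?q" using \<eta>(2)[OF SF] unfolding collapsed_closure_eq[OF F] \<phi>'_def th .
          moreover have "\<eta> - \<theta> \<in> Bd (?C F) {} ?q"
            unfolding collapsed_closure_eq[OF F] using \<theta>(2) by (rule Bd_restrict) auto
          ultimately have "(\<eta> - \<phi> F) - (\<eta> - \<theta>) \<in> Bd (?C F) {} ?q" by (rule fvs.subspace_diff[OF subspace_Bd])
          then have "\<theta> - \<phi> F \<in> Bd (?C F) {} ?q" by simp
          then show ?thesis
            using compact_pair.cclass_eq_iff[OF compact_pair_closure[OF F] restricted[OF \<theta>(1) F], of "\<phi> F"] \<phi>[OF F] by simp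
        qed
        then have "class_map ?q (P.cclass ?q (\<lambda>xs. \<theta> (map P.proj xs))) = c"
          unfolding class_map_eval[OF \<theta>(1)] using c unfolding S_carrier
          by (auto simp: fun_eq_iff PiE_iff extensional_def restrict_def)
        moreover have "P.cclass ?q (\<lambda>xs. \<theta> (map P.proj xs)) \<in> carrier ?H"
          by (rule P.cclass_carrier[OF pulled[OF \<theta>(1)]])
        ultimately show "c \<in> class_map ?q ` carrier ?H" by blast
      qed
    qed
  qed
qed

end

theorem theorem2:
  fixes M :: "'a topology" and f :: "'a \<Rightarrow> 'a" and D X N L :: "'a set"
  assumes coefficients:
      "is_ring_iso (class_ring :: 'k::field ring) (class_ring :: rat ring) \<or>
       is_ring_iso (class_ring :: 'k ring) (class_ring :: complex ring)"
    and space: "locally_compact_space M" "paracompact_space M" "Hausdorff_space M"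
    and map: "openin M D" "continuous_map (subtopology M D) M f"
    and X: "isolated_invariant_set M D f X"
    and components: "finite (connected_components_of (subtopology M X))"
    and pair: "index_pair M D f X N L"
    and standing: "\<exists>N' L'. index_pair M D f X N' L' \<and>
      (\<forall>q. vectorspace.fin_dim class_ring
         (cech (index_space M N' L') {} q :: ('k, ('a option, 'k) cech_class) module))"
  shows "finite (essential_quasicomponents M f N L X) \<and>
    (\<forall>q\<ge>1. vectorspace.fin_dim class_ring
         (cech (subtopology M X) {} q :: ('k, ('a, 'k) cech_class) module) \<longrightarrow>
       (let W = unstable_space M f N L;
            X' = unstable_core M f N L X;
            H = (cech W X' (q + 1) :: ('k, (nat \<Rightarrow> 'a option, 'k) cech_class) module);
            S = quasicomponent_sum M f N L X (q + 1)
        in \<exists>\<Phi> \<in> LinearCombinations.module_hom class_ring H S.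
             bij_betw \<Phi> (carrier H) (carrier S) \<and>
             (\<forall>x \<in> carrier H. \<Phi> (cech_map W X' (q + 1) (unstable_shift f N L) x) =
                quasicomponent_sum_map M f N L X (q + 1) (\<Phi> x))))"
proof -
  obtain N' L' where N': "index_pair M D f X N' L'"
    and fin: "\<And>q. vectorspace.fin_dim class_ring
         (cech (index_space M N' L') {} q :: ('k, ('a option, 'k) cech_class) module)"
    using standing by blast
  interpret S: index_system M D f X N L by unfold_locales (fact space map X pair)+
  interpret S': index_system M D f X N' L' by unfold_locales (fact space map X N')+
  \<comment> \<open>The pair with finite dimensional cohomology may differ from \<open>N\<close> and
    \<open>L\<close>; the tail maps transfer finite dimension to the given unstable space.\<close>
  have tp: "two_pairs M D f X N L N' L'" by unfold_locales
  have cpY: "compact_pair (index_space M N' L') {}"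
    using S'.compact_Y S'.Hausdorff_Y by unfold_locales (auto simp: S'.Y_def)
  have fdW: "finite_over (Bd S.W {} q) (Zc S.W {} q :: ((nat \<Rightarrow> 'a option) list \<Rightarrow> 'k) set)" for q
    using finite_over_unstable_space[OF tp compact_pair.fin_dim_imp_finite_over[OF cpY fin]] by (simp add: S.W_def)
  have cpX: "compact_pair (subtopology M X) {}"
    using S.X_facts(1) space(3) by unfold_locales (auto simp: compact_space_subtopology Hausdorff_space_subtopology)
  \<comment> \<open>Degree 1 of the quotient rests on degree 0 of \<open>X\<close>, which is finite
    dimensional because \<open>X\<close> has finitely many components.\<close>
  have "finite_over (Bd S.P.Q {} 1) (Zc S.P.Q {} 1 :: ((nat \<Rightarrow> 'a option) option list \<Rightarrow> 'k) set)"
    using S.finite_over_pair[OF fdW finite_over_components[OF components]] by simp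
  then have "finite S.T.essential" by (rule S.T.finite_essential)
  moreover have "inj_on ((`) Some) S.Ess" by (rule inj_onI) (simp add: inj_image_eq_iff)
  ultimately have finE: "finite S.Ess" unfolding S.essential_eq by (simp add: finite_image_iff)
  moreover have "\<exists>\<Phi>\<in>LinearCombinations.module_hom class_ring (cech S.W S.X' (q + 1) :: ('k, (nat \<Rightarrow> 'a option, 'k) cech_class) module)
        (quasicomponent_sum M f N L X (q + 1)).
      bij_betw \<Phi> (carrier (cech S.W S.X' (q + 1))) (carrier (quasicomponent_sum M f N L X (q + 1))) \<and>
      (\<forall>x\<in>carrier (cech S.W S.X' (q + 1)). \<Phi> (cech_map S.W S.X' (q + 1) S.\<sigma> x) =
         quasicomponent_sum_map M f N L X (q + 1) (\<Phi> x))"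
    if q: "1 \<le> q" and fd: "vectorspace.fin_dim class_ring (cech (subtopology M X) {} q :: ('k, ('a, 'k) cech_class) module)" for q
  proof -
    obtain p where p: "q = Suc p" using q by (cases q) auto
    have "finite_over (Bd (subtopology M X) {} (Suc p)) (Zc (subtopology M X) {} (Suc p) :: ('a list \<Rightarrow> 'k) set)"
      using compact_pair.fin_dim_imp_finite_over[OF cpX fd] p by simp
    then have fdQ: "finite_over (Bd S.P.Q {} (Suc (Suc p))) (Zc S.P.Q {} (Suc (Suc p)) :: ((nat \<Rightarrow> 'a option) option list \<Rightarrow> 'k) set)"
      by (rule S.finite_over_pair[OF fdW])
    have q1: "q + 1 = Suc (Suc p)" using p by simp
    show ?thesis
      unfolding q1
      by (rule bexI[OF _ S.class_map_iso(1)[OF finE fdQ]], intro conjI ballI S.class_map_iso(2)[OF finE fdQ] S.class_map_shift)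
  qed
  ultimately show ?thesis
    unfolding Let_def S.W_def S.X'_def S.\<sigma>_def by blast
qed

end
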